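(* Let $P(X)=X^4+mX^3+nX^2+aX+b\in\mathbb Z[X]$ be an irreducible polynomial such that for every prime $q$, $v_q(m)=0$ or $v_q(n)\le 1$ or $v_q(a)\le 2$ or $v_q(b)\le 3$. Let $\alpha$ be a complex root of $P$, $K=\mathbb Q(\alpha)$ and $\mathbb Z_K$ its ring of integers. Let $p$ be a prime integer. If $P(X)$ is a $p$-regular polynomial (the polynomials $\phi$, resp. $\phi_1,\phi_2$, below being the monic lifts to $\mathbb Z[X]$ of the irreducible factors of $\bar P=P\bmod p$ with respect to which $P$ is regular), then: 1. If $\bar P(X)$ is square free, then $(1,\alpha,\alpha^2,\alpha^3)$ is a $p$-integral basis of $\mathbb Z_K$. 2. If $\bar P(X)=\bar\phi(X)^4$, where $\deg\phi=1$, then $\left(1,\alpha,\frac{\alpha^2+a_3\alpha}{p^{h_2}},\frac{\alpha^3+a_3\alpha^2+a_2\alpha}{p^{h_3}}\right)$ is a $p$-integral basis of $\mathbb Z_K$, where $P(X)=\sum_{i=0}^4a_i\phi^i$ is the $\phi$-adic development of $P(X)$. 3. If $\bar P(X)=\bar\phi(X)^3\bar P_2(X)$, where $\deg\phi=1$ and $\bar\phi$ does not divide $\bar P_2$, then $\left(1,\alpha,\frac{\alpha^2+a_3\alpha}{p^{h_2}},\frac{\alpha^3+a_3\alpha^2+a_2\alpha}{p^{h_3}}\right)$ is a $p$-integral basis of $\mathbb Z_K$, where $P(X)=\sum_{i=0}^4a_i\phi^i$ is the $\phi$-adic development of $P(X)$. 4. If $\bar P(X)=\bar\phi(X)^2\bar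 P_2(X)$, where $\deg\phi=1$, $\bar\phi$ does not divide $\bar P_2$ and $\bar P_2$ is square free, then $\left(1,\alpha,\frac{\alpha^2+a_3\alpha}{p^{h_2}},\frac{\alpha^3+a_3\alpha^2+a_2\alpha}{p^{h_3}}\right)$ is a $p$-integral basis of $\mathbb Z_K$, where $P(X)=\sum_{i=0}^4a_i\phi^i$ is the $\phi$-adic development of $P(X)$. 5. If $\bar P(X)=\bar\phi_1(X)^2\bar\phi_2(X)^2$, where $\deg\phi_1=\deg\phi_2=1$ and $\bar\phi_1$ does not divide $\bar\phi_2$, then for $k=1,2$ let $P(X)=\sum_{l=0}^4a_{k,l}\phi_k^l$ be the $\phi_k$-adic development of $P(X)$, let $h_3^k$ be the number $h_3$ attached to $\phi_k$, let $w_k=\frac{\alpha^3+a_{k,3}\alpha^2+a_{k,2}\alpha}{p^{h_3^k}}$, and let $\{i,j\}=\{1,2\}$ with $h_3^i\le h_3^j$. Then: (a) if $h_3^i=0$, then $(1,\alpha,\alpha^2,w_j)$ is a $p$-integral basis of $\mathbb Z_K$; (b) if $h_3^i\ge 1$, then $(1,\alpha,w_i-p^{h_3^j-h_3^i}w_j,w_j)$ is a $p$-integral basis of $\mathbb Z_K$. 6. If $\bar P(X)=\bar\phi(X)^2$, where $\phi(X)$ is of degree $2$ and irreducible modulo $p$, then $\left(1,\alpha,\frac{\phi(\alpha)}{p^h},\frac{\alpha\phi(\alpha)}{p^h}\right)$ is a $p$-integral basis of $\mathbb Z_K$, where $P(X)=\phi^2+A(X)\phi+B(X)$ is the $\phi$-adic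 development of $P(X)$ and $h=\min\left(v_p(A(X)),\lfloor v_p(B(X))/2\rfloor\right)$.
   Context: $v_p$ is the $p$-adic valuation ($v_p(0)=\infty$); for $a(X)\in\mathbb Z[X]$, $v_p(a(X))$ is the minimum of the valuations of its coefficients. Bars denote reduction modulo $p$. A $p$-integral basis of $K$ (or of $\mathbb Z_K$) is a family $(w_1,\dots,w_4)$ of elements of $\mathbb Z_K$ such that $p$ does not divide the index $[\mathbb Z_K:\Lambda]$, where $\Lambda=\sum_{i=1}^4\mathbb Z w_i$. $\phi$-adic development and Newton polygon: let $\phi\in\mathbb Z[X]$ be monic of degree $d_\phi$, irreducible modulo $p$, with $\bar\phi\mid\bar P$. The $\phi$-adic development of $P$ is the unique expression $P=\sum_{i=0}^{r}a_i\phi^i$ with $a_i\in\mathbb Z[X]$, $\deg a_i<d_\phi$, $r=\lfloor 4/d_\phi\rfloor$. Let $u_i=v_p(a_{r-i})$ for $0\le i\le r$ (the leading coefficient has abscissa $0$, the constant term abscissa $r$). The $\phi$-Newton polygon of $P$ is the lower convex envelope of the points $P_i=(i,u_i)$ with $u_i<\infty$. Its principal part is the union of its sides of positive slope. For $1\le j\le r$, $h_j$ is the integral part of the ordinate of the polygon at abscissa $j$. Residual polynomials and regularity: for a side $S$ of the principal part, with horizontal length $\ell(S)$, height $h(S)$ and initial abscissa $i$, let $d=\gcd(\ell(S),h(S))$ and $e=\ell(S)/d$. Let $\mathbb F_\phi=\mathbb F_p[X]/(\bar\phi)$. For each integer abscissa $j$ in the projection of $S$, let $t_j\in\mathbb F_\phi$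 be $0$ if $P_j\notin S$, and the class of $a_{r-j}(X)/p^{u_j}$ if $P_j\in S$. The residual polynomial of $S$ is $P_S(Y)=t_iY^d+t_{i+e}Y^{d-1}+\cdots+t_{i+de}\in\mathbb F_\phi[Y]$. $P$ is $\phi$-regular if $P_S(Y)$ is square free for every side $S$ of the principal part of its $\phi$-Newton polygon. $P$ is $p$-regular if there exist monic $\phi_1,\dots,\phi_k\in\mathbb Z[X]$ such that $\bar P=\prod_i\bar\phi_i^{l_i}$ is the factorization of $\bar P$ into powers of distinct irreducible polynomials modulo $p$ and $P$ is $\phi_i$-regular for every $i$.
   Formalization: In items 2–5 the numerators use φ(α) (resp. φ_k(α)) in place of α; in item 2 the second member α is asserted only if v_p(a_3)=0 or v_p(a_2)≤1 or v_p(a_1)≤2 or v_p(a_0)≤3, and in general φ(α)/p^{h_1} replaces it. *)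

theory Defs
  imports
    "HOL-Analysis.Analysis"
    "HOL-Library.Extended_Nat"
    "HOL-Computational_Algebra.Squarefree"
    "Berlekamp_Zassenhaus.Poly_Mod"
begin

section \<open>Number fields inside the complex numbers and p-integral bases\<close>

text \<open>The field generated by \<open>\<alpha>\<close> over the rationals: the least subfield of the complex
  numbers containing \<open>\<alpha>\<close>.\<close>

definition simple_ext :: "complex \<Rightarrow> complex set" where
  "simple_ext \<alpha> = \<Inter>{F. \<alpha> \<in> F \<and> 1 \<in> F \<and>
     (\<forall>x\<in>F. \<forall>y\<in>F. x - y \<in> F \<and> x * y \<in> F) \<and> (\<forall>x\<in>F. inverse x \<in> F)}"

definition ring_of_ints :: "complex \<Rightarrow> complex set" where
  "ring_of_ints \<alpha> = {x \<in> simple_ext \<alpha>. algebraic_int x}"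

definition int_span :: "complex list \<Rightarrow> complex set" where
  "int_span ws = {\<Sum>i<length ws. of_int (c i) * ws ! i | c :: nat \<Rightarrow> int. True}"

text \<open>The number of cosets of \<open>B\<close> in \<open>A\<close>.  It is \<open>0\<close> when the index is infinite, so
  that non-divisibility of the index by \<open>p\<close> includes its finiteness.\<close>

definition add_index :: "complex set \<Rightarrow> complex set \<Rightarrow> nat" where
  "add_index A B = card ((\<lambda>x. (\<lambda>y. x + y) ` B) ` A)"

definition p_integral_basis :: "int \<Rightarrow> complex \<Rightarrow> complex list \<Rightarrow> bool" where
  "p_integral_basis p \<alpha> ws \<longleftrightarrow> length ws = 4 \<and> set ws \<subseteq> ring_of_ints \<alpha> \<and>
     \<not> p dvd int (add_index (ring_of_ints \<alpha>) (int_span ws))"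

section \<open>Valuations\<close>

definition vp :: "int \<Rightarrow> int \<Rightarrow> enat" where
  "vp p x = (if x = 0 then \<infinity> else enat (multiplicity p x))"

text \<open>Coefficients beyond the degree contribute \<open>\<infinity>\<close>, hence do not affect the minimum.\<close>

definition vp_poly :: "int \<Rightarrow> int poly \<Rightarrow> enat" where
  "vp_poly p f = (INF i. vp p (coeff f i))"

section \<open>Developments and Newton polygons\<close>

definition is_phi_dev :: "int poly \<Rightarrow> int poly \<Rightarrow> (nat \<Rightarrow> int poly) \<Rightarrow> bool" where
  "is_phi_dev \<phi> P a \<longleftrightarrow> (\<forall>i. degree (a i) < degree \<phi>) \<and>
     (\<forall>i > degree P div degree \<phi>. a i = 0) \<and>
     P = (\<Sum>i\<le>degree P div degree \<phi>. a i * \<phi> ^ i)"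

lemma phi_expansion_exists:
  fixes \<phi> f :: "int poly"
  assumes "lead_coeff \<phi> = 1" "degree \<phi> > 0"
  shows "degree f < n * degree \<phi> \<Longrightarrow> \<exists>a. (\<forall>i. degree (a i) < degree \<phi>) \<and>
     (\<forall>i\<ge>n. a i = 0) \<and> f = (\<Sum>i<n. a i * \<phi> ^ i)"
proof (induction n arbitrary: f)
  case 0
  then show ?case by simp
next
  case (Suc n)
  have nz: "\<phi> \<noteq> 0" using assms by auto
  obtain q r where qr: "pseudo_divmod f \<phi> = (q, r)" by force
  have f: "f = \<phi> * q + r" and r: "degree r < degree \<phi>"
    using pseudo_divmod[OF nz qr] assms by auto
  have q: "n = 0 \<and> q = 0 \<or> degree q < n * degree \<phi>"
  proof (cases "q = 0")
    case True
    then show ?thesis using assms by (cases n) auto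
  next
    case False
    have "degree (\<phi> * q) = degree \<phi> + degree q"
      using nz False by (rule degree_mult_eq)
    then have "degree f = degree \<phi> + degree q"
      unfolding f using r by (subst degree_add_eq_left) simp_all
    then show ?thesis using Suc.prems by auto
  qed
  obtain a where a: "\<forall>i. degree (a i) < degree \<phi>" "\<forall>i\<ge>n. a i = 0"
    "q = (\<Sum>i<n. a i * \<phi> ^ i)"
  proof (cases "n = 0 \<and> q = 0")
    case True
    show thesis by (rule that[of "\<lambda>_. 0"]) (use True assms in simp_all)
  next
    case False
    then have "degree q < n * degree \<phi>" using q by blast
    from Suc.IH[OF this] show thesis by (elim exE conjE) (rule that)
  qed
  have "f = (\<Sum>i<Suc n. case_nat r a i * \<phi> ^ i)"
    unfolding sum.lessThan_Suc_shift
    by (subst f, subst a(3)) (simp add: sum_distrib_left mult_ac)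
  moreover have "\<forall>i. degree (case_nat r a i) < degree \<phi>"
    using a(1) r by (simp split: nat.split)
  moreover have "\<forall>i\<ge>Suc n. case_nat r a i = 0"
    using a(2) by (simp split: nat.split)
  ultimately show ?case by (intro exI[of _ "case_nat r a"] conjI)
qed

lemma phi_expansion_zero:
  fixes \<phi> :: "int poly"
  assumes "degree \<phi> > 0"
  shows "(\<forall>i. degree (c i) < degree \<phi>) \<Longrightarrow> (\<Sum>i<n. c i * \<phi> ^ i) = 0 \<Longrightarrow>
     i < n \<Longrightarrow> c i = 0"
proof (induction n arbitrary: c i)
  case 0
  then show ?case by simp
next
  case (Suc n)
  define s where "s = (\<Sum>i<n. c (Suc i) * \<phi> ^ i)"
  have e: "c 0 + \<phi> * s = 0"
    using Suc.prems(2) unfolding sum.lessThan_Suc_shift s_def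
    by (simp add: sum_distrib_left mult_ac)
  have "s = 0"
  proof (rule ccontr)
    assume s: "s \<noteq> 0"
    have "degree (\<phi> * s) = degree \<phi> + degree s"
      using assms s by (intro degree_mult_eq) auto
    moreover have "c 0 = - (\<phi> * s)" using e by (simp add: eq_neg_iff_add_eq_0)
    ultimately have "degree (c 0) = degree \<phi> + degree s" by simp
    moreover have "degree (c 0) < degree \<phi>" using Suc.prems(1) by simp
    ultimately show False by simp
  qed
  have "c 0 = 0" using e \<open>s = 0\<close> by simp
  moreover have "c (Suc j) = 0" if "j < n" for j
    by (rule Suc.IH[of "\<lambda>i. c (Suc i)"])
      (use Suc.prems(1) \<open>s = 0\<close> s_def that in simp_all)
  ultimately show ?case using Suc.prems(3) by (cases i) simp_all
qed

lemma is_phi_dev_unique: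
  assumes "lead_coeff \<phi> = 1" "degree \<phi> > 0"
  shows "\<exists>!a. is_phi_dev \<phi> P a"
proof -
  define r where "r = degree P div degree \<phi>"
  have "degree P < Suc r * degree \<phi>"
    unfolding r_def using assms(2) dividend_less_div_times[of "degree \<phi>" "degree P"] by simp
  then obtain a where "(\<forall>i. degree (a i) < degree \<phi>) \<and>
     (\<forall>i\<ge>Suc r. a i = 0) \<and> P = (\<Sum>i<Suc r. a i * \<phi> ^ i)"
    using phi_expansion_exists[OF assms] by blast
  then have a: "is_phi_dev \<phi> P a"
    unfolding is_phi_dev_def r_def[symmetric] lessThan_Suc_atMost by (simp add: Suc_le_eq)
  have "b = c" if "is_phi_dev \<phi> P b" "is_phi_dev \<phi> P c" for b c
  proof
    fix i
    have b: "\<forall>i. degree (b i) < degree \<phi>" "\<forall>i>r. b i = 0" "P = (\<Sum>i\<le>r. b i * \<phi> ^ i)"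
      and c: "\<forall>i. degree (c i) < degree \<phi>" "\<forall>i>r. c i = 0" "P = (\<Sum>i\<le>r. c i * \<phi> ^ i)"
      using that unfolding is_phi_dev_def r_def[symmetric] by blast+
    have "(\<Sum>i<Suc r. (b i - c i) * \<phi> ^ i) = 0"
      unfolding lessThan_Suc_atMost left_diff_distrib sum_subtractf
        b(3)[symmetric] c(3)[symmetric] by simp
    moreover have "\<forall>i. degree (b i - c i) < degree \<phi>"
      using b(1) c(1) by (simp add: degree_diff_less)
    ultimately have "i < Suc r \<Longrightarrow> b i - c i = 0"
      using phi_expansion_zero[OF assms(2), of "\<lambda>i. b i - c i" "Suc r" i] by simp
    then show "b i = c i" using b(2) c(2) by (cases "i < Suc r") simp_all
  qed
  with a show ?thesis by blast
qed

text \<open>\<open>phi_dev \<phi> P i\<close> is the coefficient of \<open>\<phi> ^ i\<close>.\<close>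

definition phi_dev :: "int poly \<Rightarrow> int poly \<Rightarrow> nat \<Rightarrow> int poly" where
  "phi_dev \<phi> P = (THE a. is_phi_dev \<phi> P a)"

definition newton_len :: "int poly \<Rightarrow> int poly \<Rightarrow> nat" where
  "newton_len \<phi> P = degree P div degree \<phi>"

definition newton_u :: "int \<Rightarrow> int poly \<Rightarrow> int poly \<Rightarrow> nat \<Rightarrow> enat" where
  "newton_u p \<phi> P i = vp_poly p (phi_dev \<phi> P (newton_len \<phi> P - i))"

definition newton_points :: "int \<Rightarrow> int poly \<Rightarrow> int poly \<Rightarrow> (real \<times> real) set" where
  "newton_points p \<phi> P =
     {(real i, real k) | i k. i \<le> newton_len \<phi> P \<and> newton_u p \<phi> P i = enat k}"

definition newton_polygon :: "int \<Rightarrow> int poly \<Rightarrow> int poly \<Rightarrow> real \<Rightarrow> real" where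
  "newton_polygon p \<phi> P x = Inf {y. (x, y) \<in> convex hull (newton_points p \<phi> P)}"

text \<open>The number \<open>h\<^sub>j\<close>.\<close>

definition newton_h :: "int \<Rightarrow> int poly \<Rightarrow> int poly \<Rightarrow> nat \<Rightarrow> nat" where
  "newton_h p \<phi> P j = nat \<lfloor>newton_polygon p \<phi> P (real j)\<rfloor>"

text \<open>The ordinate at \<open>j\<close> of the line through the points of abscissas \<open>i\<close> and \<open>k\<close>.\<close>

definition newton_line :: "int \<Rightarrow> int poly \<Rightarrow> int poly \<Rightarrow> nat \<Rightarrow> nat \<Rightarrow> nat \<Rightarrow> real" where
  "newton_line p \<phi> P i k j =
     (let ui = real (the_enat (newton_u p \<phi> P i)); uk = real (the_enat (newton_u p \<phi> P k))
      in ui + (uk - ui) / (real k - real i) * (real j - real i))"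

text \<open>The points of abscissas \<open>i < k\<close> are the end points of a side of the principal part:
  the line through them has positive slope, no point lies below it, and the points on it have
  abscissas between \<open>i\<close> and \<open>k\<close>, so that the side is not a proper part of a longer one.\<close>

definition principal_side :: "int \<Rightarrow> int poly \<Rightarrow> int poly \<Rightarrow> nat \<Rightarrow> nat \<Rightarrow> bool" where
  "principal_side p \<phi> P i k \<longleftrightarrow> i < k \<and> k \<le> newton_len \<phi> P \<and>
     newton_u p \<phi> P i < newton_u p \<phi> P k \<and> newton_u p \<phi> P k < \<infinity> \<and>
     (\<forall>j v. j \<le> newton_len \<phi> P \<longrightarrow> newton_u p \<phi> P j = enat v \<longrightarrow>
        newton_line p \<phi> P i k j \<le> real v \<and>
        (newton_line p \<phi> P i k j = real v \<longrightarrow> i \<le> j \<and> j \<le> k))"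

section \<open>Residual polynomials and regularity\<close>

text \<open>Elements of \<open>\<F>\<^sub>\<phi> = \<F>\<^sub>p[X]/(\<phi>)\<close> are represented by integer polynomials, and
  polynomials in \<open>Y\<close> over it by polynomials with such coefficients (an \<^typ>\<open>int poly poly\<close>
  has outer variable \<open>Y\<close> and inner variable \<open>X\<close>).  The division below is exact.\<close>

definition residual_coeff ::
    "int \<Rightarrow> int poly \<Rightarrow> int poly \<Rightarrow> nat \<Rightarrow> nat \<Rightarrow> nat \<Rightarrow> int poly" where
  "residual_coeff p \<phi> P i k j =
     (case newton_u p \<phi> P j of
        enat v \<Rightarrow> if newton_line p \<phi> P i k j = real v
                  then phi_dev \<phi> P (newton_len \<phi> P - j) div [:p ^ v:] else 0
      | \<infinity> \<Rightarrow> 0)"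

definition residual_poly :: "int \<Rightarrow> int poly \<Rightarrow> int poly \<Rightarrow> nat \<Rightarrow> nat \<Rightarrow> int poly poly" where
  "residual_poly p \<phi> P i k =
     (let l = k - i;
          h = the_enat (newton_u p \<phi> P k) - the_enat (newton_u p \<phi> P i);
          d = gcd l h;
          e = l div d
      in \<Sum>s\<le>d. monom (residual_coeff p \<phi> P i k (i + s * e)) (d - s))"

text \<open>Equality in \<open>\<F>\<^sub>\<phi>[Y]\<close> of the classes of \<open>F\<close> and \<open>G\<close>: all coefficients of the difference
  are divisible by \<open>\<phi>\<close> modulo \<open>p\<close>.\<close>

definition res_eq :: "int \<Rightarrow> int poly \<Rightarrow> int poly poly \<Rightarrow> int poly poly \<Rightarrow> bool" where
  "res_eq p \<phi> F G \<longleftrightarrow> (\<forall>n. poly_mod.dvdm p \<phi> (coeff F n - coeff G n))"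

text \<open>The definition of \<^const>\<open>squarefree\<close>, read in \<open>\<F>\<^sub>\<phi>[Y]\<close>.\<close>

definition res_squarefree :: "int \<Rightarrow> int poly \<Rightarrow> int poly poly \<Rightarrow> bool" where
  "res_squarefree p \<phi> F \<longleftrightarrow>
     (\<forall>G. (\<exists>H. res_eq p \<phi> F (G\<^sup>2 * H)) \<longrightarrow> (\<exists>H. res_eq p \<phi> 1 (G * H)))"

definition phi_regular :: "int \<Rightarrow> int poly \<Rightarrow> int poly \<Rightarrow> bool" where
  "phi_regular p \<phi> P \<longleftrightarrow>
     (\<forall>i k. principal_side p \<phi> P i k \<longrightarrow> res_squarefree p \<phi> (residual_poly p \<phi> P i k))"

text \<open>\<open>P\<close> is \<open>p\<close>-regular if this holds for some \<open>\<Phi>\<close>.  The set \<open>\<Phi>\<close> of lifts is kept as a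
  parameter because the bases are expressed by means of its elements.\<close>

definition p_regular_wrt :: "int \<Rightarrow> int poly \<Rightarrow> int poly set \<Rightarrow> bool" where
  "p_regular_wrt p P \<Phi> \<longleftrightarrow> finite \<Phi> \<and>
     (\<forall>\<phi>\<in>\<Phi>. lead_coeff \<phi> = 1 \<and> poly_mod.irreducible_m p \<phi>) \<and>
     inj_on (poly_mod.Mp p) \<Phi> \<and>
     (\<exists>l :: int poly \<Rightarrow> nat. (\<forall>\<phi>\<in>\<Phi>. l \<phi> > 0) \<and>
        poly_mod.eq_m p P (\<Prod>\<phi>\<in>\<Phi>. \<phi> ^ l \<phi>)) \<and>
     (\<forall>\<phi>\<in>\<Phi>. phi_regular p \<phi> P)"

section \<open>The elements entering the bases\<close>

definition eval_at :: "complex \<Rightarrow> int poly \<Rightarrow> complex" where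
  "eval_at \<alpha> f = poly (map_poly of_int f) \<alpha>"

text \<open>The next two elements are written in terms of \<open>\<phi>(\<alpha>)\<close>, which is \<open>\<alpha>\<close> itself for
  \<open>\<phi> = X\<close>.  With \<open>\<alpha>\<close> in its place they need not be integral: consider
  \<open>P = (X - 1)\<^sup>4 + 81\<close>, \<open>\<phi> = X - 1\<close> and \<open>p = 3\<close>.\<close>

definition quot2 :: "int \<Rightarrow> int poly \<Rightarrow> int poly \<Rightarrow> complex \<Rightarrow> complex" where
  "quot2 p P \<phi> \<alpha> =
     (let a = (\<lambda>i. eval_at \<alpha> (phi_dev \<phi> P i)); x = eval_at \<alpha> \<phi>
      in (x\<^sup>2 + a 3 * x) / of_int p ^ newton_h p \<phi> P 2)"

definition quot3 :: "int \<Rightarrow> int poly \<Rightarrow> int poly \<Rightarrow> complex \<Rightarrow> complex" where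
  "quot3 p P \<phi> \<alpha> =
     (let a = (\<lambda>i. eval_at \<alpha> (phi_dev \<phi> P i)); x = eval_at \<alpha> \<phi>
      in (x ^ 3 + a 3 * x\<^sup>2 + a 2 * x) / of_int p ^ newton_h p \<phi> P 3)"

text \<open>The number \<open>h\<close> attached to \<open>\<phi>\<^sup>2 + A \<phi> + B\<close>.\<close>

definition quad_h :: "int \<Rightarrow> int poly \<Rightarrow> int poly \<Rightarrow> nat" where
  "quad_h p A B = the_enat (min (vp_poly p A)
     (case vp_poly p B of enat k \<Rightarrow> enat (k div 2) | \<infinity> \<Rightarrow> \<infinity>))"

end

(* Let N be an ultrametric norm on the algebraic numbers with N p < 1.  An element G(alpha) / p^v of K is
   integral at p iff N (G beta) <= N p ^ v for all such N and all roots beta of P, so a family of p-integral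
   elements is a p-integral basis as soon as this bound forces the coordinates of G(alpha) / p^v to be
   p-integral.  Write P in terms of phi and let b_j be the j-th Horner partial sum of this development.
   Over the roots whose norm is given by a side S of the Newton polygon, b_j is approximated by a monomial of
   norm q^(ordinate of S at j) times a partial sum of the residual polynomial P_S.  If the coordinates of
   sum c_j b_j were too large, the leading parts would form a nonzero polynomial of degree less than deg P_S
   vanishing at every root of P_S, which is impossible when P_S is squarefree. *)

theory Submission
  imports Defs "HOL-Algebra.Algebraic_Closure_Type" "HOL-Algebra.Sylow"
begin

text \<open>The norms live on an algebraic closure of the rationals and not on the complex numbers:
  on algebraic elements a valuation ring without 1/p has rank one and so carries a real norm, and
  Zorn's lemma supplies enough of these rings to detect every failure of integrality. Letting beta
  run over all roots of P makes a single norm above p see all places of K above p. So the basis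
  elements are bounded for all norms, while spanning is proved with one. Neither completions nor
  residue fields are built. Equality over a residue field is smallness of a difference, and a
  factorisation of P over the p-adic numbers is replaced by a root of P close to a prescribed
  algebraic number, found by comparing the value of P there with its Gauss norm. The passage from
  local coordinates to the index also needs finiteness of the index, which comes from a common
  denominator for all integers of K. With two double factors, or with a quadratic phi, the roots
  fall into two residue classes. The estimates are therefore localised: only the roots in one class
  and the abscissas beyond the horizontal part of the polygon enter.\<close>

hide_const (open) UnivPoly.coeff
  Divisibility.prime
  Divisibility.irreducible
  Henstock_Kurzweil_Integration.content
  up_ring.monom
  module.smult
  Polynomials.degree
  Polynomials.lead_coeff

section \<open>Subrings of a field as sets, and adjunction of one element\<close>

definition unital_subring :: "'a::comm_ring_1 set \<Rightarrow> bool" where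
  "unital_subring A \<longleftrightarrow> 1 \<in> A \<and> (\<forall>x\<in>A. \<forall>y\<in>A. x - y \<in> A \<and> x * y \<in> A)"

definition poly_over :: "'a::zero set \<Rightarrow> 'a poly \<Rightarrow> bool" where
  "poly_over A f \<longleftrightarrow> (\<forall>i. coeff f i \<in> A)"

context
  fixes A :: "'a::comm_ring_1 set"
  assumes A: "unital_subring A"
begin

lemma unital_subring_1: "1 \<in> A"
  and unital_subring_diff: "x \<in> A \<Longrightarrow> y \<in> A \<Longrightarrow> x - y \<in> A"
  and unital_subring_mult: "x \<in> A \<Longrightarrow> y \<in> A \<Longrightarrow> x * y \<in> A"
  using A unfolding unital_subring_def by auto

lemma unital_subring_0: "0 \<in> A"
  using unital_subring_diff[OF unital_subring_1 unital_subring_1] by simp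

lemma unital_subring_uminus: "x \<in> A \<Longrightarrow> - x \<in> A"
  using unital_subring_diff[OF unital_subring_0] by simp

lemma unital_subring_add: "x \<in> A \<Longrightarrow> y \<in> A \<Longrightarrow> x + y \<in> A"
  using unital_subring_diff[of x "- y"] unital_subring_uminus[of y] by simp

lemma unital_subring_power: "x \<in> A \<Longrightarrow> x ^ n \<in> A"
  by (induction n) (simp_all add: unital_subring_1 unital_subring_mult)

lemma unital_subring_sum: "(\<And>i. i \<in> I \<Longrightarrow> f i \<in> A) \<Longrightarrow> sum f I \<in> A"
  by (induction I rule: infinite_finite_induct) (simp_all add: unital_subring_0 unital_subring_add)

lemma unital_subring_of_nat: "of_nat k \<in> A"
  by (induction k) (simp_all add: unital_subring_0 unital_subring_1 unital_subring_add)

lemma unital_subring_of_int: "of_int k \<in> A"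
  by (cases k rule: int_cases2) (simp_all add: unital_subring_of_nat unital_subring_uminus)

lemma unital_subring_poly: "poly_over A f \<Longrightarrow> x \<in> A \<Longrightarrow> poly f x \<in> A"
  unfolding poly_over_def poly_altdef
  by (intro unital_subring_sum unital_subring_mult unital_subring_power) auto

lemma poly_over_1: "poly_over A 1" and poly_over_0: "poly_over A 0"
  and poly_over_const: "x \<in> A \<Longrightarrow> poly_over A [:x:]"
  by (auto simp: poly_over_def unital_subring_0 unital_subring_1 coeff_pCons split: nat.split)

lemma poly_over_monom: "x \<in> A \<Longrightarrow> poly_over A (monom x n)"
  by (auto simp: poly_over_def unital_subring_0)

lemma poly_over_diff: "poly_over A f \<Longrightarrow> poly_over A g \<Longrightarrow> poly_over A (f - g)"
  and poly_over_add: "poly_over A f \<Longrightarrow> poly_over A g \<Longrightarrow> poly_over A (f + g)"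
  and poly_over_mult: "poly_over A f \<Longrightarrow> poly_over A g \<Longrightarrow> poly_over A (f * g)"
  and poly_over_smult: "c \<in> A \<Longrightarrow> poly_over A g \<Longrightarrow> poly_over A (smult c g)"
  by (auto simp: poly_over_def coeff_mult unital_subring_diff unital_subring_add unital_subring_mult
        intro!: unital_subring_sum)

lemma poly_over_sum: "(\<And>i. i \<in> I \<Longrightarrow> poly_over A (f i)) \<Longrightarrow> poly_over A (sum f I)"
  by (induction I rule: infinite_finite_induct) (simp_all add: poly_over_0 poly_over_add)

lemma poly_over_power: "poly_over A f \<Longrightarrow> poly_over A (f ^ n)"
  by (induction n) (simp_all add: poly_over_1 poly_over_mult)

lemma adjoin_unital_subring: "unital_subring {poly f z | f. poly_over A f}"
  unfolding unital_subring_def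
proof (intro conjI ballI)
  show "1 \<in> {poly f z | f. poly_over A f}"
    using poly_over_1 by (auto intro!: exI[of _ 1])
next
  fix x y assume "x \<in> {poly f z | f. poly_over A f}" "y \<in> {poly f z | f. poly_over A f}"
  then obtain f g where fg: "x = poly f z" "y = poly g z" "poly_over A f" "poly_over A g" by auto
  show "x - y \<in> {poly f z | f. poly_over A f}"
    using fg poly_over_diff by (auto intro!: exI[of _ "f - g"])
  show "x * y \<in> {poly f z | f. poly_over A f}"
    using fg poly_over_mult by (auto intro!: exI[of _ "f * g"])
qed

lemma adjoin_supset: "A \<subseteq> {poly f z | f. poly_over A f}"
  using poly_over_const by (auto intro!: exI[of _ "[:_:]"])

lemma adjoin_mem: "z \<in> {poly f z | f. poly_over A f}"
  by (auto intro!: exI[of _ "[:0, 1:]"] simp: poly_over_def coeff_pCons unital_subring_0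
     unital_subring_1 split: nat.split)

end

section \<open>Valuation rings avoiding a given element that is not integral\<close>

definition valuation_subring :: "'a::field set \<Rightarrow> bool" where
  "valuation_subring A \<longleftrightarrow> unital_subring A \<and> (\<forall>z. z \<notin> A \<longrightarrow> inverse z \<in> A)"

lemma valuation_subring_imp_subring: "valuation_subring A \<Longrightarrow> unital_subring A"
  by (simp add: valuation_subring_def)

text \<open>A subring that is maximal with respect to not containing \<open>x\<close>, but contains \<open>inverse x\<close>,
  is a valuation ring.\<close>

locale maximal_avoiding =
  fixes A :: "'a::field set" and x :: 'a
  assumes subring: "unital_subring A" and inv_mem: "inverse x \<in> A" and not_mem: "x \<notin> A"
    and maximal: "\<And>B. unital_subring B \<Longrightarrow> A \<subseteq> B \<Longrightarrow> x \<notin> B \<Longrightarrow> B = A"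
begin

lemma x_nz: "x \<noteq> 0"
  using not_mem unital_subring_0[OF subring] by auto

text \<open>\<open>A[z]\<close> is strictly larger than \<open>A\<close>, so by maximality it
  contains \<open>x\<close>.\<close>

lemma adjoin_represents:
  assumes "z \<notin> A"
  shows "\<exists>f. poly_over A f \<and> x = poly f z"
proof (rule ccontr)
  assume "\<not> ?thesis"
  then have "x \<notin> {poly f z | f. poly_over A f}" by auto
  from maximal[OF adjoin_unital_subring[OF subring] adjoin_supset[OF subring] this]
  show False using adjoin_mem[OF subring, of z] assms by auto
qed

text \<open>\<open>inverse x\<close> behaves like an element of the Jacobson radical. If the inverse
  of \<open>?c\<close> were missing, \<open>x\<close> would be a polynomial in it of degree
  \<open>?n\<close>. Multiplying by \<open>?c ^ ?n\<close>, which is 1 minus a multiple of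
  \<open>inverse x\<close>, would put \<open>x\<close> minus an element of \<open>A\<close> into
  \<open>A\<close>.\<close>

lemma unit_one_minus:
  assumes a: "a \<in> A"
  shows "1 - inverse x * a \<noteq> 0" "inverse (1 - inverse x * a) \<in> A"
proof -
  let ?c = "1 - inverse x * a"
  show nz: "?c \<noteq> 0"
  proof
    assume "?c = 0"
    then have "x = a" using x_nz by (simp add: field_simps)
    then show False using a not_mem by simp
  qed
  show "inverse ?c \<in> A"
  proof (rule ccontr)
    assume "inverse ?c \<notin> A"
    from adjoin_represents[OF this] obtain f where f: "poly_over A f" "x = poly f (inverse ?c)"
      by auto
    have cA: "?c \<in> A"
      using a inv_mem subring by (intro unital_subring_diff unital_subring_mult unital_subring_1)
    let ?n = "degree f"
    have "x * ?c ^ ?n = poly (reflect_poly f) ?c"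
      using nz f(2) by (simp add: poly_reflect_poly_nz)
    moreover have "poly (reflect_poly f) ?c \<in> A"
      using f(1) cA subring
      by (intro unital_subring_poly) (auto simp: poly_over_def coeff_reflect_poly unital_subring_0)
    moreover have "\<exists>b\<in>A. ?c ^ k = 1 - inverse x * b" for k
    proof (induction k)
      case 0
      then show ?case using unital_subring_0[OF subring] by (intro bexI[of _ 0]) auto
    next
      case (Suc k)
      then obtain b where b: "b \<in> A" "?c ^ k = 1 - inverse x * b" by auto
      have "?c ^ Suc k = 1 - inverse x * (b + a - inverse x * a * b)"
        unfolding power_Suc b(2) by (simp add: algebra_simps)
      then show ?case
        using a b(1) inv_mem subring
        by (intro bexI[of _ "b + a - inverse x * a * b"])
           (auto intro!: unital_subring_diff unital_subring_mult unital_subring_add)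
    qed
    ultimately obtain b d where bd: "b \<in> A" "d \<in> A" "x * (1 - inverse x * b) = d" by metis
    have "x * (1 - inverse x * b) = x - x * inverse x * b"
      by (simp only: right_diff_distrib mult_1_right mult.assoc)
    also have "\<dots> = x - b" using x_nz by simp
    finally have "x = d + b" unfolding bd(3) by (simp only: eq_diff_eq)
    then show False using bd(1,2) not_mem unital_subring_add[OF subring] by auto
  qed
qed

text \<open>Multiplying \<open>x = poly g (inverse z)\<close> by \<open>inverse x * z ^ m\<close>
  and moving the constant term of \<open>g\<close> to the left expresses \<open>z ^ m\<close> by
  lower powers of \<open>z\<close>, because \<open>c\<close> is a unit. This replaces the top power
  of \<open>z\<close> in \<open>f\<close>.\<close>

lemma reduce_representation:
  assumes f: "poly_over A f" "x = poly f z" "degree f \<le> n"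
    and g: "poly_over A g" "x = poly g (inverse z)" "degree g \<le> m"
    and mn: "m \<le> n" and z: "z \<noteq> 0"
  shows "\<exists>f. poly_over A f \<and> x = poly f z \<and> degree f < n"
proof -
  define c where "c = 1 - inverse x * coeff g 0"
  have g0: "coeff g i \<in> A" and f0: "coeff f i \<in> A" for i using f g by (auto simp: poly_over_def)
  note c = unit_one_minus[OF g0[of 0], folded c_def]
  have m0: "m \<noteq> 0"
  proof
    assume "m = 0"
    then have "degree g = 0" using g by simp
    then have "x = coeff g 0" using g(2) by (metis degree_eq_zeroE coeff_pCons_0 mult_zero_right poly_0 poly_pCons add.right_neutral)
    then show False using g0 not_mem by auto
  qed
  define r where "r = (\<Sum>j\<in>{1..m}. monom (coeff g j) (m - j))"
  have gsum: "poly g w = (\<Sum>j\<le>m. coeff g j * w ^ j)" for w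
    using g(3) by (subst poly_altdef, intro sum.mono_neutral_left) (auto simp: coeff_eq_0)
  have "z ^ m * poly g (inverse z) = (\<Sum>j\<le>m. coeff g j * z ^ (m - j))"
    unfolding gsum sum_distrib_left
    by (rule sum.cong) (use z in \<open>auto simp: power_diff field_simps\<close>)
  also have "\<dots> = coeff g 0 * z ^ m + poly r z"
    by (simp add: r_def poly_sum poly_monom atMost_atLeast0 sum.atLeast_Suc_atMost)
  finally have zm: "z ^ m * c = inverse x * poly r z"
    using x_nz g(2) by (simp add: c_def field_simps)
  have zm': "z ^ m = inverse x * inverse c * poly r z"
  proof -
    have "z ^ m = z ^ m * c * inverse c" using c(1) by simp
    also have "\<dots> = inverse x * inverse c * poly r z" unfolding zm by (simp add: mult_ac)
    finally show ?thesis .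
  qed
  define h where "h = f - monom (coeff f n) n
     + smult (inverse x * inverse c * coeff f n) (monom 1 (n - m) * r)"
  have zn: "z ^ (n - m) * z ^ m = z ^ n" using mn by (simp flip: power_add)
  have "poly (smult (inverse x * inverse c * coeff f n) (monom 1 (n - m) * r)) z
      = coeff f n * (z ^ (n - m) * (inverse x * inverse c * poly r z))"
    by (simp add: poly_monom mult_ac)
  also have "\<dots> = coeff f n * z ^ n"
    unfolding zm'[symmetric] zn ..
  finally have "poly h z = poly f z" by (simp add: h_def poly_monom)
  moreover have "poly_over A h"
    unfolding h_def r_def using c inv_mem f f0 g0 unital_subring_1[OF subring] subring
    by (intro poly_over_add poly_over_diff poly_over_smult poly_over_mult poly_over_monom
          poly_over_sum unital_subring_mult) auto
  moreover have "degree h < n"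
  proof -
    have n0: "n > 0" using m0 mn by simp
    have "degree (f - monom (coeff f n) n) < n"
    proof -
      have "coeff (f - monom (coeff f n) n) i = 0" if "i > n - 1" for i
        using that f(3) by (cases "i = n") (auto simp: coeff_eq_0)
      then have "degree (f - monom (coeff f n) n) \<le> n - 1"
        by (intro degree_le allI impI)
      then show ?thesis using n0 by simp
    qed
    moreover have "degree (smult (inverse x * inverse c * coeff f n) (monom 1 (n - m) * r)) < n"
    proof -
      have "degree r \<le> m - 1"
        unfolding r_def
        by (intro degree_sum_le finite_atLeastAtMost order.trans[OF degree_monom_le]) auto
      then have "degree (monom 1 (n - m) * r) \<le> (n - m) + (m - 1)"
        by (intro order.trans[OF degree_mult_le] add_mono degree_monom_le)
      then show ?thesis
        using m0 mn n0 by (intro le_less_trans[OF degree_smult_le]) simp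
    qed
    ultimately show ?thesis unfolding h_def by (intro degree_add_less)
  qed
  ultimately show ?thesis using f(2) by (intro exI[of _ h]) auto
qed

text \<open>Descent on the sum of the degrees: the representation of larger degree can always be
  shortened by means of the other one.\<close>

lemma not_both_represented:
  assumes "z \<noteq> 0" "poly_over A f" "x = poly f z" "poly_over A g" "x = poly g (inverse z)"
  shows False
  using assms
proof (induction "degree f + degree g" arbitrary: f g z rule: less_induct)
  case less
  show ?case
  proof (cases "degree g \<le> degree f")
    case True
    from reduce_representation[OF less.prems(2,3) order.refl less.prems(4,5) order.refl True less.prems(1)]
    obtain f' where "poly_over A f'" "x = poly f' z" "degree f' < degree f" by auto
    then show False using less.hyps[of f' g z] less.prems by auto
  next
    case False
    have "poly_over A f \<and> x = poly f (inverse (inverse z))" using less.prems by simp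
    with reduce_representation[OF less.prems(4,5) order.refl _ _ order.refl, of f] False less.prems(1)
    obtain g' where "poly_over A g'" "x = poly g' (inverse z)" "degree g' < degree g" by auto
    then show False using less.hyps[of f g' z] less.prems by auto
  qed
qed

lemma valuation_subring: "valuation_subring A"
  unfolding valuation_subring_def
proof (intro conjI subring allI impI)
  fix z assume z: "z \<notin> A"
  then have "z \<noteq> 0" using unital_subring_0[OF subring] by auto
  then show "inverse z \<in> A"
    using adjoin_represents[OF z] adjoin_represents[of "inverse z"] not_both_represented by blast
qed

end

text \<open>Zorn's lemma starts at \<open>\<int>[inverse x]\<close>. This ring avoids
  \<open>x\<close>, since \<open>x = poly f (inverse x)\<close> times a power of \<open>x\<close>
  would be a monic integral equation for \<open>x\<close>.\<close>

lemma ex_valuation_subring_avoiding: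
  fixes x :: "'a::field_char_0"
  assumes "\<not> algebraic_int x"
  shows "\<exists>A. valuation_subring A \<and> x \<notin> A"
proof -
  let ?S = "{A. unital_subring A \<and> inverse x \<in> A \<and> x \<notin> A}"
  have x0: "x \<noteq> 0" using assms by auto
  have Z: "unital_subring (\<int> :: 'a set)" by (auto simp: unital_subring_def)
  let ?A0 = "{poly f (inverse x) | f. poly_over \<int> f}"
  have "x \<notin> ?A0"
  proof
    assume "x \<in> ?A0"
    then obtain f where f: "poly_over \<int> f" "x = poly f (inverse x)" by auto
    let ?n = "degree f"
    \<comment> \<open>At \<open>x\<close> this is
      \<open>x ^ Suc ?n - x ^ ?n * poly f (inverse x)\<close>.\<close>
    define g where "g = monom 1 (Suc ?n) - reflect_poly f"
    have dr: "degree (reflect_poly f) \<le> ?n" by (rule degree_reflect_poly_le)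
    have "degree g = Suc ?n" "lead_coeff g = 1"
    proof -
      have "degree (reflect_poly f) < degree (monom (1::'a) (Suc ?n))"
        using dr by (simp add: degree_monom_eq)
      then show d: "degree g = Suc ?n"
        unfolding g_def using degree_monom_eq[of "1::'a" "Suc ?n"]
        by (metis degree_add_eq_left diff_conv_add_uminus degree_minus zero_neq_one)
      show "lead_coeff g = 1"
        unfolding d unfolding g_def using dr by (simp add: coeff_eq_0)
    qed
    moreover have "\<forall>i. coeff g i \<in> \<int>"
      using f(1) by (auto simp: g_def poly_over_def coeff_reflect_poly)
    moreover have "poly g x = 0"
      using poly_reflect_poly_nz[OF x0, of f] f(2) by (simp add: g_def poly_monom field_simps)
    ultimately show False using assms algebraic_int.intros by blast
  qed
  then have mem: "?A0 \<in> ?S"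
    using adjoin_unital_subring[OF Z] adjoin_mem[OF Z, of "inverse x"] by auto
  have ne: "?S \<noteq> {}"
  proof
    assume "?S = {}"
    with mem show False by (simp only: empty_iff)
  qed
  have "\<exists>M\<in>?S. \<forall>B\<in>?S. M \<subseteq> B \<longrightarrow> B = M"
  proof (rule subset_Zorn_nonempty[OF ne])
    fix C assume C: "C \<noteq> {}" "subset.chain ?S C"
    then have sub: "\<And>B. B \<in> C \<Longrightarrow> B \<in> ?S"
      and tot: "\<And>B D. B \<in> C \<Longrightarrow> D \<in> C \<Longrightarrow> B \<subseteq> D \<or> D \<subseteq> B"
      by (auto simp: subset.chain_def)
    have "unital_subring (\<Union>C)"
      unfolding unital_subring_def
    proof (intro conjI ballI)
      show "1 \<in> \<Union>C" using C(1) sub unital_subring_1 by blast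
      fix a b assume "a \<in> \<Union>C" "b \<in> \<Union>C"
      then obtain B D where BD: "B \<in> C" "D \<in> C" "a \<in> B" "b \<in> D" by auto
      then obtain E where E: "E \<in> C" "a \<in> E" "b \<in> E" using tot[OF BD(1,2)] by auto
      then have "a - b \<in> E" "a * b \<in> E"
        using sub[OF E(1)] by (auto intro: unital_subring_diff unital_subring_mult)
      then show "a - b \<in> \<Union>C" "a * b \<in> \<Union>C" using E(1) by auto
    qed
    then show "\<Union>C \<in> ?S" using C(1) sub by auto
  qed
  then obtain M where M: "M \<in> ?S" "\<And>B. B \<in> ?S \<Longrightarrow> M \<subseteq> B \<Longrightarrow> B = M" by auto
  interpret maximal_avoiding M x
    using M by unfold_locales auto
  show ?thesis using valuation_subring not_mem by auto
qed

section \<open>Real norms attached to valuation rings of algebraic elements\<close>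

locale padic_norm =
  fixes N :: "'a::field_char_0 \<Rightarrow> real" and p :: int
  assumes prime_p: "prime p"
    and N_nonneg: "N x \<ge> 0"
    and N_eq_0_iff [simp]: "N x = 0 \<longleftrightarrow> x = 0"
    and N_mult: "N (x * y) = N x * N y"
    and N_add: "N (x + y) \<le> max (N x) (N y)"
    and N_p_less_1: "N (of_int p) < 1"

text \<open>The ring is assumed to consist of algebraic elements, since otherwise a valuation ring may
  have rank above one and no real valued norm.\<close>

locale algebraic_valuation_ring =
  fixes A :: "'a::field_char_0 set" and p :: int
  assumes val: "valuation_subring A" and prime_p: "prime p" and inv_p: "inverse (of_int p) \<notin> A"
    and alg: "\<And>z::'a. algebraic z"
begin

lemmas sub = valuation_subring_imp_subring[OF val]

lemma inverse_mem: "z \<notin> A \<Longrightarrow> inverse z \<in> A"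
  using val by (simp add: valuation_subring_def)

abbreviation P where "P \<equiv> (of_int p :: 'a)"

lemma P_nz: "P \<noteq> 0" using prime_p by auto

lemma P_mem: "P \<in> A" by (rule unital_subring_of_int[OF sub])

text \<open>If \<open>z\<close> is outside \<open>A\<close> then \<open>inverse z\<close> is inside,
  and \<open>z = inverse z ^ (s - 1) * z ^ s\<close>.\<close>

lemma root_closed: assumes "z ^ s \<in> A" "s > 0" shows "z \<in> A"
proof (rule ccontr)
  assume z: "z \<notin> A"
  then have z0: "z \<noteq> 0" using unital_subring_0[OF sub] by auto
  have "inverse z ^ (s - 1) * z ^ s \<in> A"
    using unital_subring_mult[OF sub unital_subring_power[OF sub inverse_mem[OF z]] assms(1)] .
  moreover have "inverse z ^ (s - 1) * z ^ s = z"
    using z0 assms(2) by (cases s) (simp_all add: field_simps)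
  ultimately show False using z by simp
qed

text \<open>Of \<open>w = z * a\<close> and \<open>c = 1 - w\<close> one quotient lies in
  \<open>A\<close>. Adding 1 to it puts the inverse of \<open>c\<close> or of \<open>w\<close> into
  \<open>A\<close>, and a unit \<open>w\<close> would make \<open>z\<close> a unit.\<close>

lemma unit_1_minus_nonunit:
  assumes z: "z \<in> A" "inverse z \<notin> A \<or> z = 0" and a: "a \<in> A"
  shows "1 - z * a \<noteq> 0" "inverse (1 - z * a) \<in> A"
proof -
  show nz: "1 - z * a \<noteq> 0"
  proof
    assume "1 - z * a = 0"
    then have "z * a = 1" by simp
    then have "inverse z = a" "z \<noteq> 0" by (auto simp: inverse_unique)
    then show False using z a by auto
  qed
  show "inverse (1 - z * a) \<in> A"
  proof (rule ccontr)
    assume *: "inverse (1 - z * a) \<notin> A"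
    have z0: "z \<noteq> 0" using * unital_subring_1[OF sub] by auto
    show False
    proof (cases "a = 0 \<or> inverse (z * a) \<in> A")
      case True
      moreover have "a \<noteq> 0" using * unital_subring_1[OF sub] by auto
      ultimately have "inverse (z * a) * a \<in> A" using a sub by (auto intro!: unital_subring_mult)
      then show False using z \<open>a \<noteq> 0\<close> z0 by (simp add: field_simps)
    next
      case False
      define c where "c = 1 - z * a"
      define w where "w = z * a"
      have w0: "w \<noteq> 0" using False z0 by (auto simp: w_def)
      have "w / c \<in> A \<or> c / w \<in> A"
        using inverse_mem[of "w / c"] by (auto simp: field_simps)
      then show False
      proof
        assume "w / c \<in> A"
        then have "w / c + 1 \<in> A" using sub unital_subring_1 by (intro unital_subring_add) auto
        moreover have "w / c + 1 = inverse c" using nz by (simp add: c_def w_def field_simps)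
        ultimately show False using * by (simp add: c_def)
      next
        assume "c / w \<in> A"
        then have "c / w + 1 \<in> A" using sub unital_subring_1 by (intro unital_subring_add) auto
        moreover have "c / w + 1 = inverse w" using w0 by (simp add: c_def w_def field_simps)
        ultimately show False using False by (simp add: w_def)
      qed
    qed
  qed
qed

lemma int_unit:
  assumes "\<not> p dvd k"
  shows "inverse (of_int k :: 'a) \<in> A"
proof -
  have "gcd p k = 1" using prime_imp_coprime[OF prime_p assms] by simp
  then obtain u v where uv: "u * p + v * k = 1" using bezout_int by metis
  have "1 - P * of_int u = of_int v * of_int k"
  proof -
    have "(of_int (u * p + v * k) :: 'a) = 1" using uv by simp
    then show ?thesis by (simp add: algebra_simps)
  qed
  moreover have "1 - P * of_int u \<noteq> 0" "inverse (1 - P * of_int u) \<in> A"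
    using unit_1_minus_nonunit[OF P_mem _ unital_subring_of_int[OF sub, of u]] inv_p by auto
  ultimately have "of_int v * inverse (of_int v * of_int k) \<in> A" "of_int v * of_int k \<noteq> (0 :: 'a)"
    using unital_subring_mult[OF sub unital_subring_of_int[OF sub]] by metis+
  then show ?thesis by (simp add: field_simps)
qed

lemma primitive_poly:
  obtains f :: "int poly" where "poly (map_poly of_int f) z = (0::'a)" "\<exists>i. \<not> p dvd coeff f i"
proof -
  obtain g :: "int poly" where g: "poly (map_poly of_int g) z = 0" "g \<noteq> 0"
    using algebraicE'[OF alg[of z]] by blast
  define f where "f = primitive_part g"
  have "g = smult (content g) f" by (simp add: f_def)
  then have "map_poly of_int g = smult (of_int (content g)) (map_poly of_int f :: 'a poly)"
    by (metis of_int_hom.map_poly_hom_smult)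
  then have "poly (map_poly of_int f) z = 0" using g by simp
  moreover have "\<exists>i. \<not> p dvd coeff f i"
  proof (rule ccontr)
    assume "\<not> ?thesis"
    then have "p dvd content f"
      by (simp add: const_poly_dvd_iff const_poly_dvd_iff_dvd_content[symmetric])
    moreover have "content f = 1" using g(2) by (simp add: f_def)
    ultimately have "p dvd 1" by simp
    then show False using prime_p not_prime_unit by blast
  qed
  ultimately show thesis using that by blast
qed

text \<open>One half of rank one. In a primitive integral equation for \<open>z\<close> let
  \<open>n\<close> be the first index whose coefficient is prime to \<open>p\<close>. The terms from
  \<open>n\<close> on add up to \<open>z ^ n\<close> times a unit, and the earlier ones are
  divisible by \<open>p\<close>.\<close>

lemma nonunit_power:
  assumes z: "z \<in> A" "inverse z \<notin> A"
  shows "\<exists>n>0. z ^ n / P \<in> A"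
proof -
  obtain f where f: "poly (map_poly of_int f) z = (0::'a)" "\<exists>i. \<not> p dvd coeff f i"
    using primitive_poly by blast
  define n where "n = (LEAST i. \<not> p dvd coeff f i)"
  have n: "\<not> p dvd coeff f n"
    unfolding n_def by (rule LeastI_ex[OF f(2)])
  have lt: "p dvd coeff f i" if "i < n" for i
    using not_less_Least[OF that[unfolded n_def]] by simp
  let ?c = "\<lambda>i. of_int (coeff f i) :: 'a"
  have nd: "n \<le> degree f" using n by (intro le_degree) auto
  have "0 = (\<Sum>i\<le>degree f. ?c i * z ^ i)"
    using f(1) by (simp add: poly_altdef degree_map_poly coeff_map_poly)
  also have "\<dots> = (\<Sum>i<n. ?c i * z ^ i) + (\<Sum>i=n..degree f. ?c i * z ^ i)"
    using nd by (subst sum.union_disjoint[symmetric]) (auto intro!: sum.cong)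
  also have "(\<Sum>i=n..degree f. ?c i * z ^ i) = ?c n * z ^ n + (\<Sum>i=Suc n..degree f. ?c i * z ^ i)"
    using nd by (simp add: sum.atLeast_Suc_atMost)
  also have "(\<Sum>i=Suc n..degree f. ?c i * z ^ i) = z ^ n * (z * (\<Sum>i=Suc n..degree f. ?c i * z ^ (i - Suc n)))"
    unfolding sum_distrib_left
  proof (rule sum.cong)
    fix i assume "i \<in> {Suc n..degree f}"
    then have "z ^ i = z ^ n * (z * z ^ (i - Suc n))"
      by (metis atLeastAtMost_iff le_add_diff_inverse power_Suc power_add add_Suc_right mult.commute mult.assoc)
    then show "?c i * z ^ i = z ^ n * (z * (?c i * z ^ (i - Suc n)))" by (simp add: mult_ac)
  qed simp
  finally have eq: "z ^ n * (?c n + z * (\<Sum>i=Suc n..degree f. ?c i * z ^ (i - Suc n))) = - (\<Sum>i<n. ?c i * z ^ i)"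
    (is "z ^ n * (_ + z * ?t) = _") by (simp add: algebra_simps eq_neg_iff_add_eq_0)
  have t: "?t \<in> A"
    using sub z by (intro unital_subring_sum unital_subring_mult unital_subring_power unital_subring_of_int)
  have cn: "?c n \<noteq> 0" using n by auto
  define u where "u = 1 - z * (- inverse (?c n) * ?t)"
  have u: "u \<noteq> 0" "inverse u \<in> A"
    unfolding u_def using unit_1_minus_nonunit[OF z(1), of "- inverse (?c n) * ?t"] z t int_unit[OF n] sub
    by (auto intro!: unital_subring_mult unital_subring_uminus)
  have cu: "?c n + z * ?t = ?c n * u" using cn by (simp add: u_def field_simps)
  have "(\<Sum>i<n. ?c i * z ^ i) / P = (\<Sum>i<n. of_int (coeff f i div p) * z ^ i)"
    unfolding sum_divide_distrib
  proof (rule sum.cong)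
    fix i assume "i \<in> {..<n}"
    then have "coeff f i = p * (coeff f i div p)" using lt by auto
    then have "?c i = P * of_int (coeff f i div p)" by (metis of_int_mult)
    then show "?c i * z ^ i / P = of_int (coeff f i div p) * z ^ i" using P_nz by simp
  qed simp
  then have S: "(\<Sum>i<n. ?c i * z ^ i) / P \<in> A"
    using sub z by (auto intro!: unital_subring_sum unital_subring_mult unital_subring_power unital_subring_of_int)
  have "z ^ n / P = - ((\<Sum>i<n. ?c i * z ^ i) / P) * inverse (?c n) * inverse u"
  proof -
    have "z ^ n * (?c n * u) = - (\<Sum>i<n. ?c i * z ^ i)" using eq cu by simp
    then have "z ^ n = - (\<Sum>i<n. ?c i * z ^ i) / (?c n * u)"
      using cn u(1) by (subst nonzero_eq_divide_eq) auto
    then show ?thesis by (simp add: divide_inverse mult_ac)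
  qed
  then have mem: "z ^ n / P \<in> A"
    using unital_subring_mult[OF sub unital_subring_mult[OF sub unital_subring_uminus[OF sub S] int_unit[OF n]] u(2)]
    by simp
  moreover have "n > 0"
    using mem inv_p by (cases n) (simp_all add: field_simps)
  ultimately show ?thesis by blast
qed

text \<open>The other half of rank one: \<open>z\<close> divides the constant term of an integral
  equation, which can be taken nonzero and is then a power of \<open>p\<close> times a unit of
  \<open>A\<close>.\<close>

lemma nonzero_divides_power:
  assumes z: "z \<in> A" "z \<noteq> 0"
  shows "\<exists>n. P ^ n / z \<in> A"
proof (cases "inverse z \<in> A")
  case True
  then show ?thesis by (intro exI[of _ 0]) (simp add: field_simps)
next
  case False
  obtain g :: "int poly" where g: "poly (map_poly of_int g) z = (0::'a)" "coeff g 0 \<noteq> 0"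
    using algebraicE'_nonzero[OF alg[of z] z(2)] by blast
  let ?k = "multiplicity p (coeff g 0)"
  have "\<not> p dvd coeff g 0 div p ^ ?k"
    using g(2) prime_p not_prime_unit by (intro multiplicity_decompose) blast+
  from int_unit[OF this] have u: "inverse (of_int (coeff g 0 div p ^ ?k)) \<in> A" .
  let ?u = "of_int (coeff g 0 div p ^ ?k) :: 'a"
  have c0: "of_int (coeff g 0) = P ^ ?k * ?u"
    by (metis dvd_mult_div_cancel multiplicity_dvd of_int_mult of_int_power)
  have u0: "?u \<noteq> 0" using c0 g(2) by auto
  obtain c h where gh: "g = pCons c h" by (cases g)
  have "0 = of_int c + z * poly (map_poly of_int h) z"
    using g(1) gh by (simp add: of_int_hom.map_poly_pCons_hom)
  then have "P ^ ?k * ?u = - z * poly (map_poly of_int h) z"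
    using c0 gh by (simp add: eq_neg_iff_add_eq_0)
  then have "P ^ ?k / z = - poly (map_poly of_int h) z * inverse ?u"
    using u0 z(2) by (simp add: field_simps)
  moreover have "poly (map_poly of_int h) z \<in> A"
    using sub z by (intro unital_subring_poly) (auto simp: poly_over_def coeff_map_poly unital_subring_of_int)
  ultimately show ?thesis using u sub by (auto intro!: unital_subring_mult unital_subring_uminus exI[of _ ?k])
qed

text \<open>A Dedekind cut: \<open>r / s\<close> is a slope when \<open>p ^ r\<close> divides
  \<open>z ^ s\<close> in \<open>A\<close>, that is, when it does not exceed the value of
  \<open>z\<close> measured in units of the value of \<open>p\<close>.\<close>

definition slopes :: "'a \<Rightarrow> real set" where
  "slopes z = {real_of_int r / real s | r s. s > 0 \<and> z ^ s * P powi (- r) \<in> A}"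

lemma P_powi_mem: "r \<ge> 0 \<Longrightarrow> P powi r \<in> A"
  using unital_subring_power[OF sub P_mem] by (simp add: power_int_def)

lemma P_powi_mem_iff: "P powi r \<in> A \<longleftrightarrow> r \<ge> 0"
proof
  assume mem: "P powi r \<in> A"
  show "r \<ge> 0"
  proof (rule ccontr)
    assume "\<not> r \<ge> 0"
    then have "P powi r * P powi (- r - 1) \<in> A"
      using mem P_powi_mem[of "- r - 1"] by (intro unital_subring_mult[OF sub]) auto
    moreover have "P powi r * P powi (- r - 1) = P powi (-1)"
      using P_nz by (simp flip: power_int_add)
    ultimately show False using inv_p by (simp add: power_int_minus)
  qed
qed (rule P_powi_mem)

lemma slopes_memI:
  assumes "z ^ s * P powi (- r) \<in> A" "s > 0"
  shows "real_of_int r / real s \<in> slopes z"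
  using assms unfolding slopes_def by blast

lemma powi_power: "(P powi r) ^ t = P powi (r * int t)"
  by (simp add: power_int_mult)

lemma power_powi_mem:
  assumes "z ^ s * P powi (- r) \<in> A"
  shows "z ^ (s * t) * P powi (- (r * int t)) \<in> A"
proof -
  have "(z ^ s * P powi (- r)) ^ t \<in> A" by (rule unital_subring_power[OF sub assms])
  then show ?thesis
    by (simp only: power_mult_distrib power_mult powi_power mult_minus_left)
qed

text \<open>Membership of a slope does not depend on the fraction representing it, and the slopes are
  closed downwards.\<close>

lemma slopes_memD:
  assumes z: "z \<noteq> 0" and x: "x \<in> slopes z" and le: "real_of_int r / real s \<le> x" and s: "s > 0"
  shows "z ^ s * P powi (- r) \<in> A"
proof -
  obtain r' s' where x': "x = real_of_int r' / real s'" "s' > 0" "z ^ s' * P powi (- r') \<in> A"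
    using x unfolding slopes_def by blast
  have "real_of_int (r * int s') \<le> real_of_int (r' * int s)"
    using le s x' by (simp add: field_simps)
  then have *: "r * int s' \<le> r' * int s" by linarith
  have "z ^ (s' * s) * P powi (- (r' * int s)) * P powi (r' * int s - r * int s') \<in> A"
    using * by (intro unital_subring_mult[OF sub] power_powi_mem[OF x'(3)] P_powi_mem) auto
  also have "z ^ (s' * s) * P powi (- (r' * int s)) * P powi (r' * int s - r * int s')
      = z ^ (s' * s) * P powi (- (r * int s'))"
    using P_nz by (simp add: mult.assoc flip: power_int_add)
  also have "\<dots> = (z ^ s * P powi (- r)) ^ s'"
    by (simp only: power_mult_distrib power_mult powi_power mult_minus_left mult.commute[of s' s])
  finally show ?thesis by (rule root_closed) (use x' in simp)
qed

lemma slopes_nonempty_bounded: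
  assumes "z \<noteq> 0"
  shows "slopes z \<noteq> {}" "bdd_above (slopes z)"
proof -
  have lower: "\<exists>n. w * P ^ n \<in> A" if "w \<noteq> 0" for w
  proof (cases "w \<in> A")
    case True
    then show ?thesis by (intro exI[of _ 0]) simp
  next
    case False
    from nonzero_divides_power[OF inverse_mem[OF False]] that
    show ?thesis by (auto simp: field_simps)
  qed
  obtain n where n: "z * P ^ n \<in> A" using lower[OF assms] by blast
  have "real_of_int (- int n) / real 1 \<in> slopes z"
    using n by (intro slopes_memI) (auto simp: power_int_def)
  then show "slopes z \<noteq> {}" by blast
  obtain m where m: "inverse z * P ^ m \<in> A" using lower[of "inverse z"] assms by auto
  show "bdd_above (slopes z)"
  proof (intro bdd_aboveI)
    fix x assume "x \<in> slopes z"
    then obtain r s where x: "x = real_of_int r / real s" "s > 0" "z ^ s * P powi (- r) \<in> A"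
      unfolding slopes_def by blast
    have "(inverse z * P ^ m) ^ s * (z ^ s * P powi (- r)) \<in> A"
      by (intro unital_subring_mult[OF sub] unital_subring_power[OF sub] m x)
    also have "(inverse z * P ^ m) ^ s * (z ^ s * P powi (- r)) = P powi (int (m * s) - r)"
    proof -
      have "(inverse z * P ^ m) ^ s * (z ^ s * P powi (- r))
          = (inverse z * z) ^ s * (P powi (int (m * s)) * P powi (- r))"
        by (simp only: power_mult_distrib power_mult mult_ac power_int_of_nat)
      also have "\<dots> = P powi (int (m * s) - r)"
        using assms P_nz by (simp flip: power_int_add)
      finally show ?thesis .
    qed
    finally have "r \<le> int (m * s)" by (simp add: P_powi_mem_iff)
    then have "real_of_int r \<le> real_of_int (int (m * s))" by linarith
    then show "x \<le> real m" using x by (simp add: pos_divide_le_eq)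
  qed
qed

definition val_of :: "'a \<Rightarrow> real" where "val_of z = Sup (slopes z)"

lemma val_ge: "z \<noteq> 0 \<Longrightarrow> z ^ s * P powi (- r) \<in> A \<Longrightarrow> s > 0 \<Longrightarrow> real_of_int r / real s \<le> val_of z"
  unfolding val_of_def using slopes_nonempty_bounded by (intro cSup_upper slopes_memI) auto

lemma less_val_memD:
  assumes "z \<noteq> 0" "real_of_int r / real s < val_of z" "s > 0"
  shows "z ^ s * P powi (- r) \<in> A"
proof -
  obtain x where "x \<in> slopes z" "real_of_int r / real s < x"
    using assms slopes_nonempty_bounded unfolding val_of_def by (auto simp: less_cSup_iff)
  then show ?thesis using slopes_memD assms by auto
qed

lemma rat_between:
  assumes "a < (b::real)" obtains r s where "a < real_of_int r / real s" "real_of_int r / real s < b" "s > 0"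
proof -
  obtain q where q: "a < of_rat q" "of_rat q < b" using of_rat_dense[OF assms] by blast
  obtain r s where rs: "quotient_of q = (r, s)" by force
  then have "q = of_int r / of_int s" "s > 0" by (auto simp: quotient_of_div quotient_of_denom_pos)
  then have "of_rat q = real_of_int r / real (nat s)" by (simp add: of_rat_divide)
  with q that \<open>s > 0\<close> show thesis by (metis zero_less_nat_eq)
qed

text \<open>For the lower bound, memberships for slopes close to the two suprema are multiplied. For
  the upper bound, a rational above the supremum makes the inverse available; combined with a slope
  of the product, these inverses would put a negative power of \<open>p\<close> into
  \<open>A\<close>.\<close>

lemma val_mult:
  assumes z: "z \<noteq> 0" and w: "w \<noteq> 0"
  shows "val_of (z * w) = val_of z + val_of w"
proof (rule antisym)
  have split: "(z * w) ^ (s * t) * P powi (- (r * int t + q * int s))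
     = z ^ (s * t) * P powi (- (r * int t)) * (w ^ (t * s) * P powi (- (q * int s)))" for s t r q
  proof -
    have "P powi (- (r * int t + q * int s)) = P powi (- (r * int t)) * P powi (- (q * int s))"
      using P_nz by (simp flip: power_int_add)
    then show ?thesis by (simp add: power_mult_distrib mult_ac)
  qed
  have lower: "val_of x + val_of y \<le> val_of (x * y)" if x: "x \<noteq> 0" and y: "y \<noteq> 0"
    and split: "\<And>s t r q. (x * y) ^ (s * t) * P powi (- (r * int t + q * int s))
     = x ^ (s * t) * P powi (- (r * int t)) * (y ^ (t * s) * P powi (- (q * int s)))" for x y
  proof (rule ccontr)
    assume "\<not> ?thesis"
    then have d: "0 < (val_of x + val_of y - val_of (x * y)) / 2" by simp
    let ?d = "(val_of x + val_of y - val_of (x * y)) / 2"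
    from d obtain r s where rs: "val_of x - ?d < real_of_int r / real s" "real_of_int r / real s < val_of x" "s > 0"
      by (metis rat_between diff_less_eq less_add_same_cancel1)
    from d obtain q t where qt: "val_of y - ?d < real_of_int q / real t" "real_of_int q / real t < val_of y" "t > 0"
      by (metis rat_between diff_less_eq less_add_same_cancel1)
    have mem: "(x * y) ^ (s * t) * P powi (- (r * int t + q * int s)) \<in> A"
      unfolding split using power_powi_mem[OF less_val_memD[OF x rs(2,3)], of t]
        power_powi_mem[OF less_val_memD[OF y qt(2,3)], of s] by (rule unital_subring_mult[OF sub])
    have "real_of_int (r * int t + q * int s) / real (s * t) \<le> val_of (x * y)"
      by (rule val_ge[OF _ mem]) (use x y rs(3) qt(3) in auto)
    also have "real_of_int (r * int t + q * int s) / real (s * t) = real_of_int r / real s + real_of_int q / real t"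
      using rs(3) qt(3) by (simp add: add_divide_distrib)
    finally show False using rs(1) qt(1) by argo
  qed
  show "val_of z + val_of w \<le> val_of (z * w)" by (rule lower[OF z w split])
  show "val_of (z * w) \<le> val_of z + val_of w"
  proof (rule ccontr)
    assume "\<not> ?thesis"
    then have d: "0 < (val_of (z * w) - val_of z - val_of w) / 3" by simp
    let ?d = "(val_of (z * w) - val_of z - val_of w) / 3"
    from d obtain r s where rs: "val_of z < real_of_int r / real s" "real_of_int r / real s < val_of z + ?d" "s > 0"
      by (metis rat_between less_add_same_cancel1)
    from d obtain q t where qt: "val_of w < real_of_int q / real t" "real_of_int q / real t < val_of w + ?d" "t > 0"
      by (metis rat_between less_add_same_cancel1)
    from d obtain k l where kl: "val_of (z * w) - ?d < real_of_int k / real l" "real_of_int k / real l < val_of (z * w)" "l > 0"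
      by (metis rat_between diff_less_eq less_add_same_cancel1)
    have inv: "inverse (x ^ j * P powi (- i)) \<in> A" if "x \<noteq> 0" "val_of x < real_of_int i / real j" "j > 0" for x i j
    proof (rule inverse_mem, rule notI)
      assume "x ^ j * P powi (- i) \<in> A"
      from val_ge[OF that(1) this that(3)] that(2) show False by simp
    qed
    have inv_powi: "inverse (P powi (- r)) = P powi r" for r by (simp add: power_int_minus)
    have 1: "inverse (z ^ s * P powi (- r)) ^ (t * l) \<in> A" "inverse (w ^ t * P powi (- q)) ^ (s * l) \<in> A"
      using inv[OF z rs(1,3)] inv[OF w qt(1,3)] by (auto intro: unital_subring_power[OF sub])
    have 2: "((z * w) ^ l * P powi (- k)) ^ (s * t) \<in> A"
      using less_val_memD[OF _ kl(2,3)] z w by (auto intro: unital_subring_power[OF sub])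
    have e1: "inverse (z ^ s * P powi (- r)) ^ (t * l) = inverse z ^ (s * t * l) * P powi (r * int (t * l))"
      by (simp add: power_mult_distrib powi_power inv_powi flip: power_mult power_inverse)
        (simp add: power_inverse mult_ac)
    have e2: "inverse (w ^ t * P powi (- q)) ^ (s * l) = inverse w ^ (s * t * l) * P powi (q * int (s * l))"
      by (simp add: power_mult_distrib powi_power inv_powi flip: power_mult power_inverse)
        (simp add: power_inverse mult_ac)
    have e3: "((z * w) ^ l * P powi (- k)) ^ (s * t) = z ^ (s * t * l) * w ^ (s * t * l) * P powi (- k * int (s * t))"
      by (simp add: power_mult_distrib powi_power mult_ac flip: power_mult)
    let ?e = "r * int (t * l) + q * int (s * l) - k * int (s * t)"
    have "inverse (z ^ s * P powi (- r)) ^ (t * l) * inverse (w ^ t * P powi (- q)) ^ (s * l)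
        * ((z * w) ^ l * P powi (- k)) ^ (s * t)
      = (inverse z * z) ^ (s * t * l) * (inverse w * w) ^ (s * t * l)
        * (P powi (r * int (t * l)) * P powi (q * int (s * l)) * P powi (- k * int (s * t)))"
      unfolding e1 e2 e3 by (simp only: power_mult_distrib mult_ac)
    also have "\<dots> = P powi ?e"
      using z w P_nz by (simp flip: power_int_add)
    finally have "P powi ?e \<in> A" using 1 2 by (metis unital_subring_mult[OF sub])
    then have "0 \<le> ?e" by (simp add: P_powi_mem_iff)
    then have "0 \<le> real_of_int ?e" by linarith
    moreover have "real_of_int ?e / real (s * t * l)
       = real_of_int r / real s + real_of_int q / real t - real_of_int k / real l"
      using rs(3) qt(3) kl(3) by (simp add: add_divide_distrib diff_divide_distrib)
    ultimately have "0 \<le> real_of_int r / real s + real_of_int q / real t - real_of_int k / real l"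
      by (metis divide_nonneg_nonneg of_nat_0_le_iff)
    then show False using rs qt kl d by argo
  qed
qed

lemma val_nonneg: assumes "z \<in> A" "z \<noteq> 0" shows "val_of z \<ge> 0"
  using val_ge[OF assms(2), of 1 0] assms by simp

lemma val_1: "val_of 1 = 0"
  using val_mult[of 1 1] by simp

lemma val_P_pos: "val_of P > 0"
  using val_ge[OF P_nz, of 1 1] P_nz unital_subring_1[OF sub] by (simp add: power_int_minus)

lemma val_inverse: "z \<noteq> 0 \<Longrightarrow> val_of (inverse z) = - val_of z"
  using val_mult[of z "inverse z"] val_1 by simp

text \<open>One of the two quotients lies in \<open>A\<close>; the sum is the denominator times 1
  plus that quotient, and the second factor has nonnegative value.\<close>

lemma val_add:
  assumes "z \<noteq> 0" "w \<noteq> 0" "z + w \<noteq> 0"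
  shows "min (val_of z) (val_of w) \<le> val_of (z + w)"
proof -
  have *: "val_of y \<le> val_of (x + y)" if "x / y \<in> A" "y \<noteq> 0" "x + y \<noteq> 0" for x y
  proof -
    have "x + y = y * (1 + x / y)" using that by (simp add: field_simps)
    moreover have "1 + x / y \<in> A" by (intro unital_subring_add[OF sub] unital_subring_1[OF sub] that)
    moreover have "1 + x / y \<noteq> 0" using that calculation(1) by auto
    ultimately show ?thesis using val_mult[of y "1 + x / y"] val_nonneg[of "1 + x / y"] that by simp
  qed
  have "z / w \<in> A \<or> w / z \<in> A" using inverse_mem[of "z / w"] by (auto simp: field_simps)
  then show ?thesis using *[of z w] *[of w z] assms by (auto simp: add.commute min_def)
qed

definition norm_of :: "'a \<Rightarrow> real" where "norm_of z = (if z = 0 then 0 else 2 powr (- val_of z))"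

lemma padic_norm: "padic_norm norm_of p"
proof
  show "prime p" by (rule prime_p)
  show "norm_of x \<ge> 0" "norm_of x = 0 \<longleftrightarrow> x = 0" for x by (auto simp: norm_of_def)
  show "norm_of (x * y) = norm_of x * norm_of y" for x y
    by (auto simp: norm_of_def val_mult powr_diff powr_minus powr_add field_simps)
  show "norm_of P < 1" using val_P_pos P_nz by (simp add: norm_of_def powr_less_one)
  show "norm_of (x + y) \<le> max (norm_of x) (norm_of y)" for x y
    using val_add[of x y] by (auto simp: norm_of_def max_def min_def split: if_splits)
qed

text \<open>Strictness uses rank one: a power of the non-unit \<open>inverse z\<close> is divisible
  by \<open>p\<close>, which keeps its value away from 0.\<close>

lemma norm_gt_1:
  assumes "z \<notin> A"
  shows "norm_of z > 1"
proof -
  have z: "z \<noteq> 0" using assms unital_subring_0[OF sub] by auto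
  obtain n where n: "n > 0" "inverse z ^ n / P \<in> A"
    using nonunit_power[OF inverse_mem[OF assms]] assms by auto
  have "real_of_int 1 / real n \<le> val_of (inverse z)"
    using n z by (intro val_ge) (auto simp: power_int_minus field_simps)
  then have "val_of (inverse z) > 0" using n by (auto intro: less_le_trans[rotated])
  then have "val_of z < 0" using val_inverse[OF z] by simp
  then show ?thesis using z by (simp add: norm_of_def)
qed

end

text \<open>Some prime is not invertible in \<open>A\<close>. Otherwise the leading coefficient of
  an integral equation for \<open>x\<close> would be a unit, and dividing the equation by
  \<open>x ^ (?n - 1)\<close> would express \<open>x\<close> by powers of \<open>inverse x\<close>,
  which lie in \<open>A\<close>.\<close>

theorem ex_padic_norm_gt_1:
  fixes x :: "'a::field_char_0"
  assumes alg: "\<And>z::'a. algebraic z" and x: "\<not> algebraic_int x"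
  shows "\<exists>p N. padic_norm N p \<and> N x > 1"
proof -
  obtain A where A: "valuation_subring A" "x \<notin> A" using ex_valuation_subring_avoiding[OF x] by blast
  note sub = valuation_subring_imp_subring[OF A(1)]
  have "\<exists>p::int. prime p \<and> inverse (of_int p) \<notin> A"
  proof (rule ccontr)
    assume "\<not> ?thesis"
    then have pr: "\<And>p::int. prime p \<Longrightarrow> inverse (of_int p) \<in> A" by blast
    have inv: "inverse (of_int k :: 'a) \<in> A" if "k \<noteq> 0" for k
      using that
    proof (induction k rule: prime_divisors_induct)
      case zero then show ?case by simp
    next
      case (unit k)
      then have "k = 1 \<or> k = -1" by auto
      then show ?case using unital_subring_1[OF sub] unital_subring_uminus[OF sub] by auto
    next
      case (factor p k)
      then show ?case using pr[of p] unital_subring_mult[OF sub] by (auto simp: inverse_mult_distrib)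
    qed
    obtain g :: "int poly" where g: "g \<noteq> 0" "poly (map_poly of_int g) x = 0"
      using algebraicE'[OF alg[of x]] by blast
    let ?c = "\<lambda>i. of_int (coeff g i) :: 'a" and ?n = "degree g"
    have x0: "x \<noteq> 0" using A(2) unital_subring_0[OF sub] by auto
    have ix: "inverse x \<in> A" using A unfolding valuation_subring_def by blast
    have n0: "?n > 0"
    proof (rule ccontr)
      assume "\<not> ?n > 0"
      then obtain c where "g = [:c:]" using degree_eq_zeroE by blast
      then show False using g by (simp add: of_int_hom.map_poly_pCons_hom)
    qed
    have "0 = (\<Sum>i\<le>?n. ?c i * x ^ i)"
      using g(2) by (simp add: poly_altdef degree_map_poly coeff_map_poly)
    also have "\<dots> = ?c ?n * x ^ ?n + (\<Sum>i<?n. ?c i * x ^ i)"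
      by (simp add: lessThan_Suc_atMost[symmetric] add.commute)
    finally have "?c ?n * x ^ ?n = - (\<Sum>i<?n. ?c i * x ^ i)"
      by (simp add: eq_neg_iff_add_eq_0)
    then have "?c ?n * x ^ ?n * inverse x ^ (?n - 1) = - (\<Sum>i<?n. ?c i * x ^ i) * inverse x ^ (?n - 1)"
      by simp
    moreover have "x ^ ?n * inverse x ^ (?n - 1) = x"
      using n0 x0 by (cases ?n) (auto simp: field_simps)
    moreover have "(\<Sum>i<?n. ?c i * x ^ i) * inverse x ^ (?n - 1) = (\<Sum>i<?n. ?c i * inverse x ^ (?n - 1 - i))"
      unfolding sum_distrib_right
    proof (rule sum.cong)
      fix i assume "i \<in> {..<?n}"
      then have "?n - 1 = i + (?n - 1 - i)" by auto
      then have e: "inverse x ^ (?n - 1) = inverse x ^ i * inverse x ^ (?n - 1 - i)" by (metis power_add)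
      have one: "x ^ i * inverse x ^ i = 1" using x0 by (simp add: power_inverse)
      have "?c i * x ^ i * inverse x ^ (?n - 1) = ?c i * (x ^ i * inverse x ^ i) * inverse x ^ (?n - 1 - i)"
        unfolding e by (simp only: mult.assoc)
      then show "?c i * x ^ i * inverse x ^ (?n - 1) = ?c i * inverse x ^ (?n - 1 - i)"
        unfolding one by simp
    qed simp
    ultimately have "?c ?n * x = - (\<Sum>i<?n. ?c i * inverse x ^ (?n - 1 - i))"
      by (simp add: mult.assoc)
    then have "x = inverse (?c ?n) * (- (\<Sum>i<?n. ?c i * inverse x ^ (?n - 1 - i)))"
    proof -
      have "?c ?n \<noteq> 0" using g(1) by simp
      then have "x = inverse (?c ?n) * (?c ?n * x)" by (simp add: mult.assoc[symmetric] del: of_int_eq_0_iff)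
      with \<open>?c ?n * x = _\<close> show ?thesis by simp
    qed
    moreover have "\<dots> \<in> A"
      using inv[of "lead_coeff g"] g(1) ix
      by (intro unital_subring_mult[OF sub] unital_subring_uminus[OF sub] unital_subring_sum[OF sub]
            unital_subring_power[OF sub] unital_subring_of_int[OF sub]) auto
    ultimately show False using A(2) by simp
  qed
  then obtain p :: int where p: "prime p" "inverse (of_int p) \<notin> A" by blast
  interpret algebraic_valuation_ring A p
    using A(1) p alg by unfold_locales
  show ?thesis using padic_norm norm_gt_1[OF A(2)] by blast
qed

section \<open>Ultrametric estimates and reduction modulo the maximal ideal\<close>

context padic_norm
begin

lemma N_0 [simp]: "N 0 = 0" by simp

lemma N_1 [simp]: "N 1 = 1"
  using N_mult[of 1 1] by (metis N_eq_0_iff mult_cancel_left1 mult_1_left zero_neq_one)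

lemma N_minus [simp]: "N (- x) = N x"
proof -
  have "N (-1) * N (-1) = 1" using N_mult[of "-1" "-1"] by simp
  then have "N (-1) = 1" using N_nonneg[of "-1"] by (metis abs_of_nonneg abs_1 real_sqrt_abs2 real_sqrt_one)
  then show ?thesis using N_mult[of "-1" x] by simp
qed

lemma N_diff: "N (x - y) \<le> max (N x) (N y)"
  using N_add[of x "- y"] by simp

lemma N_diff_commute: "N (x - y) = N (y - x)"
  using N_minus[of "x - y"] by simp

lemma N_power: "N (x ^ n) = N x ^ n"
  by (induction n) (simp_all add: N_mult)

lemma N_prod: "N (prod f I) = (\<Prod>i\<in>I. N (f i))"
  by (induction I rule: infinite_finite_induct) (simp_all add: N_mult)

lemma N_inverse: "N (inverse x) = inverse (N x)"
proof (cases "x = 0")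
  case False
  then have "N x * N (inverse x) = 1" using N_mult[of x "inverse x"] by simp
  then show ?thesis by (metis inverse_unique)
qed simp

lemma N_divide: "N (x / y) = N x / N y"
  by (simp add: divide_inverse N_mult N_inverse)

lemma N_add_le: "N x \<le> C \<Longrightarrow> N y \<le> C \<Longrightarrow> N (x + y) \<le> C"
  using N_add[of x y] by simp

lemma N_diff_le: "N x \<le> C \<Longrightarrow> N y \<le> C \<Longrightarrow> N (x - y) \<le> C"
  using N_diff[of x y] by simp

lemma N_add_less: "N x < C \<Longrightarrow> N y < C \<Longrightarrow> N (x + y) < C"
  using N_add[of x y] by simp

lemma N_diff_less: "N x < C \<Longrightarrow> N y < C \<Longrightarrow> N (x - y) < C"
  using N_diff[of x y] by simp

lemma N_sum_le: "C \<ge> 0 \<Longrightarrow> (\<And>i. i \<in> I \<Longrightarrow> N (f i) \<le> C) \<Longrightarrow> N (sum f I) \<le> C"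
  by (induction I rule: infinite_finite_induct) (auto intro!: N_add_le)

lemma N_sum_less: "C > 0 \<Longrightarrow> (\<And>i. i \<in> I \<Longrightarrow> N (f i) < C) \<Longrightarrow> N (sum f I) < C"
  by (induction I rule: infinite_finite_induct) (auto intro!: N_add_less)

lemma N_add_eq: "N x < N y \<Longrightarrow> N (x + y) = N y"
proof (rule antisym)
  assume *: "N x < N y"
  then show "N (x + y) \<le> N y" using N_add[of x y] by simp
  show "N y \<le> N (x + y)" using N_diff[of "x + y" x] * by (auto simp: max_def split: if_splits)
qed

lemma N_eq_of_close: "N (x - y) < N y \<Longrightarrow> N x = N y"
  using N_add_eq[of "x - y" y] by simp

lemma N_of_int_le_1: "N (of_int k) \<le> 1"
proof -
  have "N (of_nat m) \<le> 1" for m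
    by (induction m) (auto intro!: N_add_le)
  then show ?thesis by (cases k rule: int_cases2) auto
qed

text \<open>The norm is not normalised at \<open>p\<close>. With bounds written as powers of this
  base, the exponents are ordinary \<open>p\<close>-adic valuations.\<close>

definition q :: real where "q = N (of_int p)"

lemma q_pos: "0 < q" and q_less_1: "q < 1"
  using N_nonneg[of "of_int p"] N_p_less_1 prime_p by (auto simp: q_def less_le)

lemma N_of_int_eq_1:
  assumes "\<not> p dvd k"
  shows "N (of_int k) = 1"
proof -
  have "gcd p k = 1" using prime_imp_coprime[OF prime_p assms] by simp
  then obtain u v where uv: "u * p + v * k = 1" using bezout_int by metis
  then have e: "of_int u * of_int p + of_int v * of_int k = (1::'a)"
    by (metis of_int_1 of_int_add of_int_mult)
  show ?thesis
  proof (rule ccontr)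
    assume "N (of_int k) \<noteq> 1"
    then have k: "N (of_int k) < 1" using N_of_int_le_1[of k] by simp
    have "N (of_int u * of_int p) < 1" "N (of_int v * of_int k) < 1"
      using N_p_less_1 k N_of_int_le_1[of u] N_of_int_le_1[of v] N_nonneg[of "of_int p"] N_nonneg[of "of_int k"]
      by (auto simp: N_mult intro: le_less_trans[OF mult_left_le_one_le])
        (auto simp: N_mult N_nonneg intro: le_less_trans[OF mult_left_le_one_le])
    then have "N (1::'a) < 1" unfolding e[symmetric] by (rule N_add_less)
    then show False by simp
  qed
qed

lemma N_of_int_less_1_iff: "N (of_int k) < 1 \<longleftrightarrow> p dvd k"
proof
  assume "p dvd k"
  then obtain l where "k = p * l" by auto
  then have "N (of_int k) = N (of_int p) * N (of_int l)" by (simp add: N_mult)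
  also have "\<dots> \<le> N (of_int p)" using N_of_int_le_1[of l] N_nonneg[of "of_int p"] by (simp add: mult_left_le)
  finally show "N (of_int k) < 1" using N_p_less_1 by simp
next
  show "N (of_int k) < 1 \<Longrightarrow> p dvd k" using N_of_int_eq_1[of k] by fastforce
qed

text \<open>Vanishing over the residue field, which is not constructed: \<open>small (f - g)\<close>
  is congruence of \<open>f\<close> and \<open>g\<close>.\<close>

definition small :: "'a poly \<Rightarrow> bool" where "small f \<longleftrightarrow> (\<forall>i. N (coeff f i) < 1)"

lemma small_0 [simp]: "small 0" by (simp add: small_def)

lemma small_add: "small f \<Longrightarrow> small g \<Longrightarrow> small (f + g)"
  by (auto simp: small_def intro: N_add_less)

lemma small_diff: "small f \<Longrightarrow> small g \<Longrightarrow> small (f - g)"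
  by (auto simp: small_def intro: N_diff_less)

lemma small_uminus: "small f \<Longrightarrow> small (- f)"
  by (auto simp: small_def)

lemma small_mult:
  assumes f: "\<And>i. N (coeff f i) \<le> 1" and g: "small g"
  shows "small (f * g)"
  unfolding small_def coeff_mult
proof (intro allI N_sum_less)
  fix i k
  have "N (coeff f k * coeff g (i - k)) \<le> N (coeff g (i - k))"
    using f[of k] N_nonneg by (simp add: N_mult mult_left_le_one_le)
  then show "N (coeff f k * coeff g (i - k)) < 1" using g by (auto simp: small_def intro: le_less_trans)
qed simp

lemma N_poly_less_1:
  assumes "small f" "N x \<le> 1" shows "N (poly f x) < 1"
  unfolding poly_altdef
proof (intro N_sum_less)
  fix i
  have "N (coeff f i * x ^ i) \<le> N (coeff f i)"
    using assms(2) N_nonneg by (simp add: N_mult N_power mult_left_le power_le_one)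
  then show "N (coeff f i * x ^ i) < 1" using assms(1) by (auto simp: small_def intro: le_less_trans)
qed simp

lemma N_poly_le_1:
  assumes "\<And>i. N (coeff f i) \<le> 1" "N x \<le> 1" shows "N (poly f x) \<le> 1"
  unfolding poly_altdef
proof (intro N_sum_le)
  fix i
  have "N (coeff f i * x ^ i) \<le> N (coeff f i)"
    using assms(2) N_nonneg by (simp add: N_mult N_power mult_left_le power_le_one)
  then show "N (coeff f i * x ^ i) \<le> 1" using assms(1)[of i] by linarith
qed simp

lemma N_mult_le_1: "N x \<le> 1 \<Longrightarrow> N y \<le> 1 \<Longrightarrow> N (x * y) \<le> 1"
  by (simp add: N_mult N_nonneg mult_le_one)

lemma N_mult_less_1: "N x \<le> 1 \<Longrightarrow> N y < 1 \<Longrightarrow> N (x * y) < 1"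
  using mult_left_le_one_le[of "N y" "N x"] N_nonneg by (simp add: N_mult)

lemma N_root_le_1:
  assumes f: "\<And>i. N (coeff f i) \<le> 1" and lead: "N (lead_coeff f) = 1" and root: "poly f x = 0"
  shows "N x \<le> 1"
proof (rule ccontr)
  assume x: "\<not> N x \<le> 1"
  let ?n = "degree f"
  have n0: "?n > 0"
  proof (rule ccontr)
    assume "\<not> ?n > 0"
    then obtain c where "f = [:c:]" using degree_eq_zeroE by blast
    then show False using lead root by auto
  qed
  have "(\<Sum>i<?n. coeff f i * x ^ i) + lead_coeff f * x ^ ?n = 0"
    using root by (simp add: poly_altdef lessThan_Suc_atMost[symmetric])
  then have "lead_coeff f * x ^ ?n = - (\<Sum>i<?n. coeff f i * x ^ i)" by (simp add: eq_neg_iff_add_eq_0 add.commute)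
  then have "N (lead_coeff f * x ^ ?n) = N (\<Sum>i<?n. coeff f i * x ^ i)" by simp
  also have "\<dots> \<le> N x ^ (?n - 1)"
  proof (intro N_sum_le)
    fix i assume "i \<in> {..<?n}"
    then have "N x ^ i \<le> N x ^ (?n - 1)" using x by (intro power_increasing) auto
    moreover have "N (coeff f i * x ^ i) \<le> N x ^ i"
      using f[of i] N_nonneg by (simp add: N_mult N_power mult_left_le_one_le)
    ultimately show "N (coeff f i * x ^ i) \<le> N x ^ (?n - 1)" by linarith
  qed (simp add: N_nonneg)
  also have "N (lead_coeff f * x ^ ?n) = N x ^ ?n" using lead by (simp add: N_mult N_power)
  finally have "N x ^ ?n \<le> N x ^ (?n - 1)" .
  moreover have "N x ^ (?n - 1) < N x ^ ?n" using x n0 by (intro power_strict_increasing) auto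
  ultimately show False by simp
qed

end

section \<open>Polynomials over the residue field of Z, in terms of lifts\<close>

text \<open>\<open>Z\<close> plays the role of a discrete valuation ring with uniformiser \<open>p\<close>, up to
  localisation; its image modulo the maximal ideal is a subfield of the residue field.\<close>

locale coeff_ring = padic_norm N p
  for N :: "'a::{alg_closed_field,field_char_0} \<Rightarrow> real" and p :: int +
  fixes Z :: "'a set"
  assumes Z_subring: "unital_subring Z"
    and Z_le_1: "z \<in> Z \<Longrightarrow> N z \<le> 1"
    and Z_inverse: "z \<in> Z \<Longrightarrow> N z = 1 \<Longrightarrow> \<exists>w\<in>Z. N (z * w - 1) < 1"
    and Z_divide: "z \<in> Z \<Longrightarrow> N z < 1 \<Longrightarrow> \<exists>w\<in>Z. z = of_int p * w"
begin

lemmas Z_closed = unital_subring_1[OF Z_subring] unital_subring_0[OF Z_subring]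
  unital_subring_of_int[OF Z_subring] unital_subring_mult[OF Z_subring]
  unital_subring_add[OF Z_subring] unital_subring_diff[OF Z_subring]
  unital_subring_uminus[OF Z_subring] unital_subring_power[OF Z_subring]
  unital_subring_sum[OF Z_subring]
lemmas over_Z = poly_over_1[OF Z_subring] poly_over_0[OF Z_subring] poly_over_const[OF Z_subring]
  poly_over_monom[OF Z_subring] poly_over_diff[OF Z_subring] poly_over_add[OF Z_subring]
  poly_over_mult[OF Z_subring] poly_over_smult[OF Z_subring] poly_over_sum[OF Z_subring]

lemma coeff_le_1: "poly_over Z f \<Longrightarrow> N (coeff f i) \<le> 1"
  by (simp add: poly_over_def Z_le_1)

lemma small_mult_over: "poly_over Z f \<Longrightarrow> small g \<Longrightarrow> small (f * g)" "poly_over Z f \<Longrightarrow> small g \<Longrightarrow> small (g * f)"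
  using small_mult[of f g] coeff_le_1 by (auto simp: mult.commute)

lemma small_cong_mult:
  assumes "poly_over Z f" "poly_over Z g'" "small (f - f')" "small (g - g')"
  shows "small (f * g - f' * g')"
proof -
  have "f * g - f' * g' = f * (g - g') + (f - f') * g'" by (simp add: algebra_simps)
  then show ?thesis using assms by (simp add: small_add small_mult_over)
qed

lemma small_trans: "small (f - g) \<Longrightarrow> small (g - h) \<Longrightarrow> small (f - h)"
  using small_add[of "f - g" "g - h"] by simp

lemma small_sym: "small (f - g) \<Longrightarrow> small (g - f)"
  using small_uminus[of "f - g"] by simp

lemma N_poly_cong:
  assumes "small (f - g)" "N x \<le> 1" "N (poly g x) < 1"
  shows "N (poly f x) < 1"
  using N_add_less[OF N_poly_less_1[OF assms(1,2)] assms(3)] by simp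

lemma top_unit_coeff:
  assumes "poly_over Z f" "\<not> small f"
  obtains d where "d \<le> degree f" "N (coeff f d) = 1" "\<And>i. i > d \<Longrightarrow> N (coeff f i) < 1"
proof -
  let ?S = "{i. N (coeff f i) = 1}"
  have sub: "?S \<subseteq> {..degree f}"
  proof
    fix i assume "i \<in> ?S"
    then have "coeff f i \<noteq> 0" by auto
    then show "i \<in> {..degree f}" by (simp add: le_degree)
  qed
  then have fin: "finite ?S" using finite_subset by blast
  obtain i where "\<not> N (coeff f i) < 1" using assms(2) by (auto simp: small_def)
  then have "?S \<noteq> {}" using coeff_le_1[OF assms(1), of i] by auto
  then have mx: "Max ?S \<in> ?S" using fin by (rule Max_in[rotated])
  show thesis
  proof (rule that[of "Max ?S"])
    show "Max ?S \<le> degree f" "N (coeff f (Max ?S)) = 1" using mx sub by auto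
    fix i assume i: "i > Max ?S"
    then have "i \<notin> ?S" using Max_ge[OF fin, of i] by auto
    then show "N (coeff f i) < 1" using coeff_le_1[OF assms(1), of i] by auto
  qed
qed

text \<open>The lift is cut off at the last coefficient of norm 1 and divided by it up to a small
  error, so that its degree is the degree of the reduction of \<open>f\<close>.\<close>

lemma ex_monic_associate:
  assumes f: "poly_over Z f" "\<not> small f"
  obtains g w where "lead_coeff g = 1" "degree g \<le> degree f" "poly_over Z g" "w \<in> Z" "small (g - smult w f)"
proof -
  obtain d where d: "d \<le> degree f" "N (coeff f d) = 1" "\<And>i. i > d \<Longrightarrow> N (coeff f i) < 1"
    using top_unit_coeff[OF f] by blast
  obtain w where w: "w \<in> Z" "N (coeff f d * w - 1) < 1"
    using Z_inverse[of "coeff f d"] f(1) d(2) by (auto simp: poly_over_def)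
  define g where "g = monom 1 d + (\<Sum>i<d. monom (w * coeff f i) i)"
  have cg: "coeff g i = (if i = d then 1 else if i < d then w * coeff f i else 0)" for i
  proof -
    have "coeff (\<Sum>j<d. monom (w * coeff f j) j) i = (if i < d then w * coeff f i else 0)"
      by (simp add: coeff_sum)
    then show ?thesis by (simp add: g_def)
  qed
  have dg: "degree g = d"
    by (rule antisym) (auto intro!: degree_le le_degree simp: cg)
  show thesis
  proof (rule that[of g w])
    show "lead_coeff g = 1" "degree g \<le> degree f" using dg d(1) by (auto simp: cg)
    show "poly_over Z g" using f(1) w(1) by (auto simp: poly_over_def cg Z_closed)
    show "small (g - smult w f)"
      unfolding small_def
    proof
      fix i
      show "N (coeff (g - smult w f) i) < 1"
        using w(2) N_mult_less_1[OF Z_le_1[OF w(1)] d(3), of i] N_diff_commute[of 1 "coeff f d * w"]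
        by (auto simp: cg mult.commute)
    qed
  qed (rule w)
qed

lemma monic_division:
  assumes g: "poly_over Z g" "lead_coeff g = 1" "degree g > 0"
  shows "poly_over Z f \<Longrightarrow> (\<And>i. i \<ge> n \<Longrightarrow> coeff f i = 0) \<Longrightarrow>
     \<exists>h r. poly_over Z h \<and> poly_over Z r \<and> f = g * h + r \<and> degree r < degree g"
proof (induction n arbitrary: f)
  case 0
  then have "f = 0" by (simp add: poly_eq_iff)
  then show ?case using g(3) over_Z by (intro exI[of _ 0]) auto
next
  case (Suc n)
  show ?case
  proof (cases "n < degree g")
    case True
    have "degree f \<le> n" using Suc.prems(2) by (intro degree_le) auto
    then show ?thesis using True Suc.prems(1) over_Z by (intro exI[of _ 0] exI[of _ f]) auto
  next
    case False
    let ?k = "n - degree g"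
    define f' where "f' = f - monom (coeff f n) ?k * g"
    have cn: "coeff f n \<in> Z" using Suc.prems(1) by (simp add: poly_over_def)
    have over: "poly_over Z f'"
      unfolding f'_def by (intro over_Z Suc.prems(1) g(1) cn)
    have z: "coeff f' i = 0" if "i \<ge> n" for i
    proof (cases "i = n")
      case True
      then show ?thesis using False g(2) by (simp add: f'_def coeff_monom_mult)
    next
      case F: False
      then have "coeff f i = 0" "coeff g (i - ?k) = 0"
        using that False Suc.prems(2)[of i] by (auto intro!: coeff_eq_0)
      then show ?thesis using that by (simp add: f'_def coeff_monom_mult)
    qed
    obtain h r where hr: "poly_over Z h" "poly_over Z r" "f' = g * h + r" "degree r < degree g"
      using Suc.IH[OF over z] by blast
    have "f = g * (h + monom (coeff f n) ?k) + r"
      using hr(3) by (simp add: f'_def algebra_simps)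
    then show ?thesis
      using hr cn by (intro exI[of _ "h + monom (coeff f n) ?k"] exI[of _ r]) (auto intro: over_Z)
  qed
qed

text \<open>\<open>\<psi>\<close> lifts the minimal polynomial of the residue of
  \<open>\<rho>\<close>: it is monic of least degree among those with small value there. A remainder
  that is not small would have a monic associate of lower degree.\<close>

lemma ex_minimal_polynomial:
  assumes f: "poly_over Z f" "\<not> small f" "N (poly f \<rho>) < 1" and rho: "N \<rho> \<le> 1"
  obtains \<psi> where "poly_over Z \<psi>" "lead_coeff \<psi> = 1" "degree \<psi> > 0" "N (poly \<psi> \<rho>) < 1"
    "\<And>g. poly_over Z g \<Longrightarrow> N (poly g \<rho>) < 1 \<Longrightarrow>
       \<exists>h r. poly_over Z h \<and> poly_over Z r \<and> g = \<psi> * h + r \<and> degree r < degree \<psi> \<and> small r"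
proof -
  define Q where "Q g \<longleftrightarrow> poly_over Z g \<and> lead_coeff g = 1 \<and> N (poly g \<rho>) < 1" for g
  have mon: "\<exists>g. Q g \<and> degree g \<le> degree f" if f: "poly_over Z f" "\<not> small f" "N (poly f \<rho>) < 1" for f
  proof -
    obtain g w where g: "lead_coeff g = 1" "degree g \<le> degree f" "poly_over Z g" "w \<in> Z" "small (g - smult w f)"
      using ex_monic_associate[OF f(1,2)] by blast
    have "N (poly (smult w f) \<rho>) < 1"
      using N_mult_less_1[OF Z_le_1[OF g(4)] f(3)] by simp
    from N_poly_cong[OF g(5) rho this] show ?thesis using g unfolding Q_def by blast
  qed
  obtain g0 where "Q g0" using mon[OF f] by blast
  define \<psi> where "\<psi> = arg_min degree Q"
  have psi: "Q \<psi>" and least: "\<And>g. Q g \<Longrightarrow> degree \<psi> \<le> degree g"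
    using arg_min_nat_lemma[of Q g0 degree] \<open>Q g0\<close> unfolding \<psi>_def by auto
  have deg: "degree \<psi> > 0"
  proof (rule ccontr)
    assume "\<not> degree \<psi> > 0"
    then obtain c where "\<psi> = [:c:]" using degree_eq_zeroE by blast
    then show False using psi unfolding Q_def by auto
  qed
  have "\<exists>h r. poly_over Z h \<and> poly_over Z r \<and> g = \<psi> * h + r \<and> degree r < degree \<psi> \<and> small r"
    if g: "poly_over Z g" "N (poly g \<rho>) < 1" for g
  proof -
    obtain h r where hr: "poly_over Z h" "poly_over Z r" "g = \<psi> * h + r" "degree r < degree \<psi>"
      using monic_division[of \<psi> g "Suc (degree g)"] psi deg g(1) unfolding Q_def
      by (metis Suc_le_eq coeff_eq_0)
    have "N (poly (\<psi> * h) \<rho>) < 1"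
      using N_mult_less_1[of "poly h \<rho>" "poly \<psi> \<rho>"] N_poly_le_1[OF coeff_le_1[OF hr(1)] rho] psi
      unfolding Q_def by (simp add: mult.commute)
    then have "N (poly r \<rho>) < 1"
      using N_diff_less[OF g(2), of "poly (\<psi> * h) \<rho>"] hr(3) by simp
    then have "small r" using mon[OF hr(2)] least hr(4) by fastforce
    then show ?thesis using hr by blast
  qed
  then show thesis using that psi deg unfolding Q_def by blast
qed

text \<open>Squarefreeness of the reduction over the residue field of \<open>Z\<close>. The
  conclusion makes the reduction of \<open>G\<close> a constant, which is a unit as soon as the
  reduction of \<open>R\<close> is nonzero.\<close>

definition residually_squarefree :: "'a poly \<Rightarrow> bool" where
  "residually_squarefree R \<longleftrightarrow> (\<forall>G H. poly_over Z G \<longrightarrow> poly_over Z H \<longrightarrow> small (R - G * G * H) \<longrightarrow>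
     (\<forall>n\<ge>1. N (coeff G n) < 1))"

lemma not_small_lead: "N (lead_coeff f) = 1 \<Longrightarrow> \<not> small f"
  unfolding small_def by (metis less_irrefl)

text \<open>The minimal polynomial \<open>\<psi>\<close> of one root is split off from
  \<open>R\<close> and from \<open>Q\<close>. At a root of the cofactor \<open>R1\<close> it cannot
  be small, since \<open>R\<close> would then have a square factor; so \<open>Q1\<close> inherits
  the vanishing, and induction applies to \<open>R1\<close>.\<close>

lemma divides_of_vanishing:
  assumes "poly_over Z R" "N (lead_coeff R) = 1" "residually_squarefree R" "poly_over Z Q"
    "\<And>\<rho>. N \<rho> \<le> 1 \<Longrightarrow> N (poly R \<rho>) < 1 \<Longrightarrow> N (poly Q \<rho>) < 1"
  shows "\<exists>H. poly_over Z H \<and> small (Q - R * H)"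
  using assms
proof (induction "degree R" arbitrary: R Q rule: less_induct)
  case less
  note R = less.prems(1) note lead = less.prems(2) note sq = less.prems(3) note Q = less.prems(4)
  show ?case
  proof (cases "degree R = 0")
    case True
    then obtain c where c: "R = [:c:]" using degree_eq_zeroE by blast
    then have cZ: "c \<in> Z" "N c = 1" using R lead by (auto simp: poly_over_def coeff_pCons split: nat.splits) 
    obtain w where w: "w \<in> Z" "N (c * w - 1) < 1" using Z_inverse[OF cZ] by blast
    have "Q - R * smult w Q = - (smult (c * w - 1) Q)"
      by (simp add: c algebra_simps smult_diff_left)
    moreover have "small (smult (c * w - 1) Q)"
      using N_mult_less_1[OF coeff_le_1[OF Q] w(2)] by (simp add: small_def mult.commute)
    ultimately show ?thesis using w Q over_Z small_uminus by metis
  next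
    case False
    obtain \<rho> where rho: "poly R \<rho> = 0" using alg_closed_imp_poly_has_root[of R] False by auto
    have r1: "N \<rho> \<le> 1" by (rule N_root_le_1[OF coeff_le_1[OF R] lead rho])
    obtain \<psi> where psi: "poly_over Z \<psi>" "lead_coeff \<psi> = 1" "degree \<psi> > 0" "N (poly \<psi> \<rho>) < 1"
      and min: "\<And>g. poly_over Z g \<Longrightarrow> N (poly g \<rho>) < 1 \<Longrightarrow>
       \<exists>h r. poly_over Z h \<and> poly_over Z r \<and> g = \<psi> * h + r \<and> degree r < degree \<psi> \<and> small r"
      using ex_minimal_polynomial[OF R not_small_lead[OF lead] _ r1] rho by auto
    obtain R1 r where R1: "poly_over Z R1" "poly_over Z r" "R = \<psi> * R1 + r" "degree r < degree \<psi>" "small r"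
      using min[OF R] rho by auto
    have "N (poly Q \<rho>) < 1" using less.prems(5)[OF r1] rho by simp
    from min[OF Q this] obtain Q1 s
      where Q1: "poly_over Z Q1" "poly_over Z s" "Q = \<psi> * Q1 + s" "small s" by auto
    have R1nz: "R1 \<noteq> 0" using R1(3,5) not_small_lead[OF lead] by auto
    have dm: "degree (\<psi> * R1) = degree \<psi> + degree R1" using R1nz psi(3) by (intro degree_mult_eq) auto
    then have dlt: "degree r < degree (\<psi> * R1)" using R1(4) by simp
    have dR: "degree R = degree \<psi> + degree R1"
      unfolding R1(3) using degree_add_eq_left[OF dlt] dm by simp
    have lR1: "N (lead_coeff R1) = 1"
    proof -
      have "lead_coeff R = lead_coeff (\<psi> * R1)"
        unfolding R1(3) using lead_coeff_add_le[OF dlt] dlt by (metis add.commute lead_coeff_add_le)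
      then show ?thesis using lead psi(2) by (simp add: lead_coeff_mult)
    qed
    have sR: "small (R - \<psi> * R1)" using R1 by simp
    have sq1: "residually_squarefree R1"
      unfolding residually_squarefree_def
    proof (intro allI impI)
      fix G H n assume G: "poly_over Z G" "poly_over Z H" "small (R1 - G * G * H)" "1 \<le> (n::nat)"
      have "\<psi> * R1 - G * G * (\<psi> * H) = \<psi> * (R1 - G * G * H)" by (simp add: algebra_simps)
      then have "small (\<psi> * R1 - G * G * (\<psi> * H))" using G psi(1) by (simp add: small_mult_over)
      then have "small (R - G * G * (\<psi> * H))" by (rule small_trans[OF sR])
      moreover have "poly_over Z (\<psi> * H)" using psi(1) G(2) over_Z by blast
      ultimately show "N (coeff G n) < 1" using sq G(1,4) unfolding residually_squarefree_def by blast
    qed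
    have van: "N (poly Q1 \<sigma>) < 1" if s: "N \<sigma> \<le> 1" "N (poly R1 \<sigma>) < 1" for \<sigma>
    proof -
      have "N (poly (\<psi> * R1) \<sigma>) < 1"
        using N_mult_less_1[OF N_poly_le_1[OF coeff_le_1[OF psi(1)] s(1)] s(2)] by simp
      from N_poly_cong[OF sR s(1) this] have "N (poly Q \<sigma>) < 1" by (rule less.prems(5)[OF s(1)])
      moreover have "small (\<psi> * Q1 - Q)" using Q1 small_uminus by simp
      ultimately have "N (poly (\<psi> * Q1) \<sigma>) < 1" using N_poly_cong s(1) by blast
      then have prod: "N (poly \<psi> \<sigma>) * N (poly Q1 \<sigma>) < 1" by (simp add: N_mult)
      show ?thesis
      proof (cases "N (poly \<psi> \<sigma>) < 1")
        case True
        \<comment> \<open>The minimal polynomial of a common root of \<open>\<psi>\<close> and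
          \<open>R1\<close> divides both of them, so its square divides \<open>R\<close>.\<close>
        obtain \<eta> where chi: "poly_over Z \<eta>" "lead_coeff \<eta> = 1" "degree \<eta> > 0" "N (poly \<eta> \<sigma>) < 1"
          and minc: "\<And>g. poly_over Z g \<Longrightarrow> N (poly g \<sigma>) < 1 \<Longrightarrow>
           \<exists>h r. poly_over Z h \<and> poly_over Z r \<and> g = \<eta> * h + r \<and> degree r < degree \<eta> \<and> small r"
          using ex_minimal_polynomial[OF R1(1) not_small_lead[OF lR1] s(2,1)] by blast
        obtain A a where A: "poly_over Z A" "\<psi> = \<eta> * A + a" "small a" using minc[OF psi(1) True] by blast
        obtain B b where B: "poly_over Z B" "R1 = \<eta> * B + b" "small b" using minc[OF R1(1) s(2)] by blast
        have "small (\<psi> * R1 - (\<eta> * A) * (\<eta> * B))"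
          using A B psi(1) chi(1) over_Z by (intro small_cong_mult) auto
        then have "small (\<psi> * R1 - \<eta> * \<eta> * (A * B))" by (simp add: mult_ac)
        then have "small (R - \<eta> * \<eta> * (A * B))" by (rule small_trans[OF sR])
        moreover have "poly_over Z (A * B)" using A B over_Z by blast
        ultimately have "N (lead_coeff \<eta>) < 1"
          using sq chi(1,3) unfolding residually_squarefree_def by (metis Suc_leI One_nat_def)
        then show ?thesis using chi(2) by simp
      next
        case False
        then have "N (poly \<psi> \<sigma>) = 1"
          using N_poly_le_1[OF coeff_le_1[OF psi(1)] s(1)] by simp
        then show ?thesis using prod by simp
      qed
    qed
    have "degree R1 < degree R" using dR psi(3) by simp
    from less.hyps[OF this R1(1) lR1 sq1 Q1(1) van]
    obtain H where H: "poly_over Z H" "small (Q1 - R1 * H)" by blast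
    have "small (\<psi> * (Q1 - R1 * H) - (R - \<psi> * R1) * H + s)"
      by (rule small_add[OF small_diff[OF small_mult_over(1)[OF psi(1) H(2)] small_mult_over(2)[OF H(1) sR]] Q1(4)])
    moreover have "\<psi> * (Q1 - R1 * H) - (R - \<psi> * R1) * H + s = Q - R * H"
      unfolding Q1(3) by (simp add: algebra_simps)
    ultimately show ?thesis using H(1) by auto
  qed
qed

text \<open>Otherwise \<open>Q\<close> would be congruent to \<open>R * H\<close> with
  \<open>H\<close> not small. The last unit coefficients of \<open>R\<close> and \<open>H\<close>
  then produce one in degree at least \<open>degree R\<close>, beyond the degree of
  \<open>Q\<close>.\<close>

theorem residually_squarefree_root:
  assumes R: "poly_over Z R" "N (lead_coeff R) = 1" "residually_squarefree R"
    and Q: "poly_over Z Q" "degree Q < degree R" "\<not> small Q"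
  obtains \<rho> where "N \<rho> \<le> 1" "N (poly R \<rho>) < 1" "N (poly Q \<rho>) = 1"
proof -
  have "\<exists>\<rho>. N \<rho> \<le> 1 \<and> N (poly R \<rho>) < 1 \<and> \<not> N (poly Q \<rho>) < 1"
  proof (rule ccontr)
    assume "\<not> ?thesis"
    then obtain H where H: "poly_over Z H" "small (Q - R * H)"
      using divides_of_vanishing[OF R Q(1)] by blast
    have "\<not> small H"
    proof
      assume "small H"
      then have "small (Q - R * H + R * H)" by (intro small_add H small_mult_over R)
      then show False using Q(3) by simp
    qed
    then obtain t where t: "N (coeff H t) = 1" "\<And>i. i > t \<Longrightarrow> N (coeff H i) < 1"
      using top_unit_coeff[OF H(1)] by blast
    let ?d = "degree R"
    have "coeff (R * H) (?d + t) = (\<Sum>i\<le>?d + t. coeff R i * coeff H (?d + t - i))"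
      by (simp add: coeff_mult)
    also have "\<dots> = (\<Sum>i\<in>{..?d + t} - {?d}. coeff R i * coeff H (?d + t - i)) + lead_coeff R * coeff H t"
      by (subst sum.remove[of _ ?d]) auto
    finally have e: "coeff (R * H) (?d + t) =
      (\<Sum>i\<in>{..?d + t} - {?d}. coeff R i * coeff H (?d + t - i)) + lead_coeff R * coeff H t" .
    have "N (\<Sum>i\<in>{..?d + t} - {?d}. coeff R i * coeff H (?d + t - i)) < 1"
    proof (intro N_sum_less)
      fix i assume i: "i \<in> {..?d + t} - {?d}"
      show "N (coeff R i * coeff H (?d + t - i)) < 1"
      proof (cases "i < ?d")
        case True
        then show ?thesis using N_mult_less_1[OF coeff_le_1[OF R(1)] t(2), of "?d + t - i" i] by simp
      next
        case False
        then show ?thesis using i by (simp add: coeff_eq_0)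
      qed
    qed simp
    then have "N (coeff (R * H) (?d + t)) = 1"
      unfolding e using N_add_eq[of _ "lead_coeff R * coeff H t"] R(2) t(1) by (simp add: N_mult)
    moreover have "coeff (Q - R * H) (?d + t) = - coeff (R * H) (?d + t)"
      using Q(2) by (simp add: coeff_eq_0)
    ultimately show False using H(2) unfolding small_def by (metis N_minus less_irrefl)
  qed
  then obtain \<rho> where "N \<rho> \<le> 1" "N (poly R \<rho>) < 1" "\<not> N (poly Q \<rho>) < 1" by blast
  moreover have "N (poly Q \<rho>) \<le> 1" by (rule N_poly_le_1[OF coeff_le_1[OF Q(1)]]) fact
  ultimately show thesis using that by force
qed

end

section \<open>Powers of q, the Gauss norm, and division by p in Z\<close>

context padic_norm
begin

lemma q_powr_le: "y \<le> x \<Longrightarrow> q powr x \<le> q powr y"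
  using q_pos q_less_1 by (intro powr_mono') auto

lemma q_powr_less: "y < x \<Longrightarrow> q powr x < q powr y"
  using q_pos q_less_1 by (intro powr_less_mono') auto

lemma q_powr_le_iff: "q powr x \<le> q powr y \<longleftrightarrow> y \<le> x"
  using q_powr_le[of y x] q_powr_less[of x y] by force

lemma q_powr_less_iff: "q powr x < q powr y \<longleftrightarrow> y < x"
  using q_powr_le[of x y] q_powr_less[of y x] by (cases "x \<le> y") auto

lemma q_powr_eq_iff: "q powr x = q powr y \<longleftrightarrow> x = y"
  by (metis order.refl order.antisym q_powr_le_iff)

lemma q_powr_pos: "0 < q powr x" using q_pos by simp

lemma q_powr_real: "q powr real k = q ^ k" using q_pos by (simp add: powr_realpow)

lemma q_powr_power: "(q powr x) ^ k = q powr (x * real k)"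
  using q_pos by (simp add: powr_powr[symmetric] powr_realpow)

lemma N_p_power: "N (of_int p ^ k) = q ^ k" by (simp add: N_power q_def)

lemma N_power_diff:
  assumes "N x = g" "N y = g" "N (x - y) < g" "m > 0"
  shows "N (x ^ m - y ^ m) < g ^ m"
  using assms(4)
proof (induction m)
  case (Suc m)
  have g: "g > 0" using assms(3) N_nonneg[of "x - y"] by linarith
  have e: "x ^ Suc m - y ^ Suc m = x * (x ^ m - y ^ m) + (x - y) * y ^ m" by (simp add: algebra_simps)
  have "N (x * (x ^ m - y ^ m)) < g ^ Suc m"
    using Suc.IH g assms(1) by (cases "m = 0") (auto simp: N_mult)
  moreover have "N ((x - y) * y ^ m) < g ^ Suc m"
    using assms(2,3) g by (simp add: N_mult N_power)
  ultimately show ?case unfolding e by (rule N_add_less)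
qed simp

text \<open>One half of the multiplicativity of the Gauss norm of radius \<open>g\<close>, by
  induction over the linear factors; that of \<open>X - x\<close> is
  \<open>max g (N x)\<close>.\<close>

lemma N_coeff_prod_roots_le:
  assumes g: "g > 0"
  shows "N (coeff (\<Prod>x\<in>#A. [:- x, 1:]) m) * g ^ m \<le> (\<Prod>x\<in>#A. max g (N x))"
proof (induction A arbitrary: m)
  case empty
  then show ?case using g by (cases m) (auto simp: coeff_pCons)
next
  case (add y A)
  let ?Q = "\<Prod>x\<in>#A. [:- x, 1:]" and ?B = "\<Prod>x\<in>#A. max g (N x)"
  have B0: "0 \<le> ?B" using add.IH[of 0] N_nonneg[of "coeff ?Q 0"] by simp
  have e: "coeff (\<Prod>x\<in>#add_mset y A. [:- x, 1:]) m = (if m = 0 then 0 else coeff ?Q (m - 1)) - y * coeff ?Q m"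
    by (cases m) auto
  have 1: "N (y * coeff ?Q m) * g ^ m \<le> max g (N y) * ?B"
  proof -
    have "N y * (N (coeff ?Q m) * g ^ m) \<le> max g (N y) * ?B"
      using add.IH[of m] N_nonneg g B0 by (intro mult_mono) auto
    then show ?thesis by (simp add: N_mult mult.assoc)
  qed
  have 2: "N (if m = 0 then 0 else coeff ?Q (m - 1)) * g ^ m \<le> max g (N y) * ?B"
  proof (cases m)
    case 0
    then show ?thesis using B0 g by simp
  next
    case (Suc k)
    have "g * (N (coeff ?Q k) * g ^ k) \<le> max g (N y) * ?B"
      using add.IH[of k] N_nonneg g B0 by (intro mult_mono) auto
    then show ?thesis using Suc by (simp add: mult_ac)
  qed
  have "N (coeff (\<Prod>x\<in>#add_mset y A. [:- x, 1:]) m) * g ^ m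
     \<le> max (N (if m = 0 then 0 else coeff ?Q (m - 1))) (N (y * coeff ?Q m)) * g ^ m"
    unfolding e using N_diff g by (intro mult_right_mono) auto
  also have "\<dots> \<le> max g (N y) * ?B" using 1 2 by (auto simp: max_def)
  finally show ?case by simp
qed

end

context coeff_ring
begin

text \<open>The exponent \<open>m\<close> with \<open>q ^ m < N z\<close> bounds the number of
  possible divisions by \<open>p\<close>. In particular all nonzero norms on \<open>Z\<close> are
  powers of \<open>q\<close>.\<close>

lemma Z_decompose:
  assumes "z \<in> Z" "z \<noteq> 0"
  obtains k w where "z = of_int p ^ k * w" "w \<in> Z" "N w = 1"
proof -
  have N0: "N z > 0" using assms(2) N_nonneg[of z] by (simp add: less_le)
  then obtain m where "q ^ m < N z" using q_less_1 q_pos real_arch_pow_inv by blast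
  then have "\<exists>k w. z = of_int p ^ k * w \<and> w \<in> Z \<and> N w = 1"
    using assms(1)
  proof (induction m arbitrary: z)
    case 0
    then show ?case using Z_le_1[of z] by simp
  next
    case (Suc m)
    show ?case
    proof (cases "N z = 1")
      case True
      then show ?thesis using Suc.prems by (intro exI[of _ 0] exI[of _ z]) auto
    next
      case False
      then obtain w where w: "w \<in> Z" "z = of_int p * w"
        using Z_divide[of z] Z_le_1[of z] Suc.prems by force
      have "q * q ^ m < q * N w" using Suc.prems(1) w(2) by (simp add: N_mult q_def)
      then have "q ^ m < N w" using q_pos by simp
      from Suc.IH[OF this w(1)] obtain k v where v: "w = of_int p ^ k * v" "v \<in> Z" "N v = 1" by blast
      then show ?thesis using w(2) by (intro exI[of _ "Suc k"] exI[of _ v]) (auto simp: mult_ac)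
    qed
  qed
  then show thesis using that by blast
qed

lemma Z_divide_power:
  assumes "z \<in> Z" "N z \<le> q ^ k"
  shows "\<exists>w\<in>Z. z = of_int p ^ k * w"
  using assms
proof (induction k arbitrary: z)
  case 0
  then show ?case by auto
next
  case (Suc k)
  have "q ^ Suc k < 1" using q_pos q_less_1 by (intro power_Suc_less_one) auto
  then obtain w where w: "w \<in> Z" "z = of_int p * w" using Z_divide[of z] Suc.prems by auto
  have "q * N w \<le> q * q ^ k" using Suc.prems(2) w(2) by (simp add: N_mult q_def)
  then have "N w \<le> q ^ k" using q_pos by simp
  then obtain v where "v \<in> Z" "w = of_int p ^ k * v" using Suc.IH[OF w(1)] by blast
  then show ?case using w(2) by (auto simp: mult_ac)
qed

end

section \<open>Sides of the Newton polygon and Horner partial sums\<close>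

locale newton_data = coeff_ring +
  fixes f :: "'a poly" and n :: nat
  assumes f_over: "poly_over Z f" and f_deg: "degree f = n" and f_monic: "lead_coeff f = 1"
begin

abbreviation \<pi> where "\<pi> \<equiv> (of_int p :: 'a)"

definition a :: "nat \<Rightarrow> 'a" where "a s = coeff f (n - s)"

definition b :: "nat \<Rightarrow> 'a \<Rightarrow> 'a" where "b j x = (\<Sum>s\<le>j. a s * x ^ (j - s))"

definition lin :: "nat \<Rightarrow> nat \<Rightarrow> nat \<Rightarrow> nat \<Rightarrow> nat \<Rightarrow> real" where
  "lin i e h u s = real u + (real s - real i) * (real h / real e)"

definition res_poly :: "nat \<Rightarrow> (nat \<Rightarrow> 'a) \<Rightarrow> 'a poly" where
  "res_poly d t = (\<Sum>r\<le>d. monom (t r) (d - r))"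

text \<open>A side from abscissa \<open>i\<close> to \<open>i + d * e\<close> with initial ordinate \<open>u\<close> and slope \<open>h / e\<close>;
  \<open>t\<close> lists the coefficients of its residual polynomial.\<close>

definition good_side :: "nat \<Rightarrow> nat \<Rightarrow> nat \<Rightarrow> nat \<Rightarrow> nat \<Rightarrow> (nat \<Rightarrow> 'a) \<Rightarrow> bool" where
  "good_side i d e h u t \<longleftrightarrow> 0 < d \<and> 0 < e \<and> i + d * e \<le> n \<and> gcd e h = 1 \<and>
     (\<forall>r\<le>d. t r \<in> Z \<and> a (i + r * e) = \<pi> ^ (u + r * h) * t r) \<and> N (t 0) = 1 \<and> N (t d) = 1 \<and>
     (\<forall>s\<le>n. N (a s) \<le> q powr lin i e h u s) \<and>
     (\<forall>s\<le>n. s < i \<or> i + d * e < s \<longrightarrow> N (a s) < q powr lin i e h u s) \<and>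
     residually_squarefree (res_poly d t)"

lemma a_in_Z: "a s \<in> Z" using f_over by (simp add: a_def poly_over_def)

lemma poly_f: "poly f x = (\<Sum>s\<le>n. a s * x ^ (n - s))"
proof -
  have "poly f x = (\<Sum>m\<le>n. coeff f m * x ^ m)" by (simp add: poly_altdef f_deg)
  also have "\<dots> = (\<Sum>s\<le>n. coeff f (n - s) * x ^ (n - s))"
    by (rule sum.reindex_bij_witness[of _ "\<lambda>s. n - s" "\<lambda>s. n - s"]) auto
  finally show ?thesis by (simp add: a_def)
qed

text \<open>\<open>x ^ (n - j) * b j x\<close> collects the terms of \<open>poly f x\<close> up to
  abscissa \<open>j\<close>, so at a root it cancels against the others. This expression is the
  useful one at roots of large norm.\<close>

lemma b_tail:
  assumes "poly f x = 0" "x \<noteq> 0" "j \<le> n"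
  shows "b j x = - (\<Sum>s\<in>{j<..n}. a s * inverse x ^ (s - j))"
proof -
  have "0 = inverse x ^ (n - j) * (\<Sum>s\<le>n. a s * x ^ (n - s))"
    using assms(1) by (simp add: poly_f)
  also have "\<dots> = (\<Sum>s\<le>n. inverse x ^ (n - j) * (a s * x ^ (n - s)))"
    by (simp add: sum_distrib_left)
  also have "\<dots> = (\<Sum>s\<le>j. inverse x ^ (n - j) * (a s * x ^ (n - s))) +
     (\<Sum>s\<in>{j<..n}. inverse x ^ (n - j) * (a s * x ^ (n - s)))"
    using assms(3) by (subst sum.union_disjoint[symmetric]) (auto intro!: sum.cong)
  also have "(\<Sum>s\<le>j. inverse x ^ (n - j) * (a s * x ^ (n - s))) = b j x"
    unfolding b_def
  proof (rule sum.cong)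
    fix s assume "s \<in> {..j}"
    then have "n - s = (n - j) + (j - s)" using assms(3) by auto
    then have "x ^ (n - s) = x ^ (n - j) * x ^ (j - s)" by (simp add: power_add)
    moreover have "inverse x ^ (n - j) * x ^ (n - j) = 1" using assms(2) by (simp add: power_inverse)
    ultimately show "inverse x ^ (n - j) * (a s * x ^ (n - s)) = a s * x ^ (j - s)"
      by (simp add: mult.left_commute mult.assoc[symmetric])
  qed simp
  also have "(\<Sum>s\<in>{j<..n}. inverse x ^ (n - j) * (a s * x ^ (n - s))) = (\<Sum>s\<in>{j<..n}. a s * inverse x ^ (s - j))"
  proof (rule sum.cong)
    fix s assume "s \<in> {j<..n}"
    then have "n - j = (n - s) + (s - j)" by auto
    then have "inverse x ^ (n - j) = inverse x ^ (n - s) * inverse x ^ (s - j)" by (simp add: power_add)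
    moreover have "inverse x ^ (n - s) * x ^ (n - s) = 1" using assms(2) by (simp add: power_inverse)
    ultimately show "inverse x ^ (n - j) * (a s * x ^ (n - s)) = a s * inverse x ^ (s - j)"
      by (metis (no_types, lifting) mult.assoc mult.commute mult_1_left)
  qed simp
  finally show ?thesis by (simp add: eq_neg_iff_add_eq_0)
qed

text \<open>A line of slope \<open>l\<close> through \<open>(j, A)\<close> that supports the polygon bounds \<open>b j\<close> at every root.\<close>

lemma b_bound_steep:
  assumes supp: "\<And>s. s \<le> n \<Longrightarrow> N (a s) \<le> q powr (A + (real s - real j) * l)"
    and j: "j \<le> n" and x: "N x \<le> q powr m" "l \<le> m"
  shows "N (b j x) \<le> q powr A"
  unfolding b_def
proof (intro N_sum_le)
  fix s assume s: "s \<in> {..j}"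
  have "N (a s * x ^ (j - s)) \<le> q powr (A + (real s - real j) * l) * (q powr m) ^ (j - s)"
    unfolding N_mult N_power using s j x N_nonneg by (intro mult_mono power_mono supp) auto
  also have "\<dots> = q powr (A + (real s - real j) * l + m * real (j - s))"
    by (simp add: q_powr_power powr_add)
  also have "\<dots> \<le> q powr A"
  proof (rule q_powr_le)
    have "0 \<le> (real j - real s) * (m - l)" using s x(2) by (intro mult_nonneg_nonneg) auto
    then show "A \<le> A + (real s - real j) * l + m * real (j - s)" using s by (simp add: of_nat_diff algebra_simps)
  qed
  finally show "N (a s * x ^ (j - s)) \<le> q powr A" .
qed (use q_powr_pos in \<open>auto intro: less_imp_le\<close>)

text \<open>At roots of norm above \<open>q powr l\<close> the defining sum of \<open>b j\<close> is
  too large, but the tail is not. Its exponents \<open>s - j\<close> are at least 1, which gains the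
  factor \<open>q powr (l - m)\<close>.\<close>

lemma b_bound_flat:
  assumes supp: "\<And>s. s \<le> n \<Longrightarrow> N (a s) \<le> q powr (A + (real s - real j) * l)"
    and j: "j \<le> n" and x: "N x = q powr m" "m \<le> l" and root: "poly f x = 0"
  shows "N (b j x) \<le> q powr (A + (l - m))"
proof -
  have x0: "x \<noteq> 0" using x(1) q_powr_pos[of m] by auto
  have "N (\<Sum>s\<in>{j<..n}. a s * inverse x ^ (s - j)) \<le> q powr (A + (l - m))"
  proof (intro N_sum_le)
    fix s assume s: "s \<in> {j<..n}"
    have ix: "N (inverse x) = q powr (- m)" using x(1) by (simp add: N_inverse powr_minus)
    have "N (a s * inverse x ^ (s - j)) \<le> q powr (A + (real s - real j) * l) * (q powr (- m)) ^ (s - j)"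
      unfolding N_mult N_power ix using s j N_nonneg q_pos by (intro mult_mono supp) auto
    also have "\<dots> = q powr (A + (real s - real j) * l + (- m) * real (s - j))"
      by (simp only: q_powr_power powr_add)
    also have "\<dots> \<le> q powr (A + (l - m))"
    proof (rule q_powr_le)
      have "1 * (l - m) \<le> (real s - real j) * (l - m)" using s x(2) by (intro mult_right_mono) auto
      then show "A + (l - m) \<le> A + (real s - real j) * l + (- m) * real (s - j)"
        using s by (simp add: of_nat_diff algebra_simps)
    qed
    finally show "N (a s * inverse x ^ (s - j)) \<le> q powr (A + (l - m))" .
  qed (use q_powr_pos in \<open>auto intro: less_imp_le\<close>)
  then show ?thesis using b_tail[OF root x0 j] by simp
qed

lemma lin_shift: "lin i e h u s = lin i e h u j + (real s - real j) * (real h / real e)"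
proof -
  have "(real s - real i) * c = (real j - real i) * c + (real s - real j) * c" for c
    by (simp add: left_diff_distrib)
  from this[of "real h / real e"] show ?thesis unfolding lin_def by linarith
qed

lemma good_sideD:
  assumes "good_side i d e h u t"
  shows "0 < d" "0 < e" "i + d * e \<le> n" "gcd e h = 1"
    "\<And>r. r \<le> d \<Longrightarrow> t r \<in> Z" "\<And>r. r \<le> d \<Longrightarrow> a (i + r * e) = \<pi> ^ (u + r * h) * t r"
    "N (t 0) = 1" "N (t d) = 1"
    "\<And>s. s \<le> n \<Longrightarrow> N (a s) \<le> q powr lin i e h u s"
    "\<And>s. s \<le> n \<Longrightarrow> s < i \<or> i + d * e < s \<Longrightarrow> N (a s) < q powr lin i e h u s"
    "residually_squarefree (res_poly d t)"
  using assms unfolding good_side_def by auto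

lemma lin_lattice: "0 < e \<Longrightarrow> lin i e h u (i + r * e) = real (u + r * h)"
  by (simp add: lin_def)

lemma good_side_ends:
  assumes "good_side i d e h u t"
  shows "N (a i) = q powr lin i e h u i" "N (a (i + d * e)) = q powr lin i e h u (i + d * e)"
proof -
  note S = good_sideD[OF assms]
  show "N (a i) = q powr lin i e h u i"
    using S(6)[of 0] S(7) by (simp add: N_mult N_p_power lin_def q_powr_real)
  show "N (a (i + d * e)) = q powr lin i e h u (i + d * e)"
    unfolding lin_lattice[OF S(2)] q_powr_real using S(6)[of d] S(8) by (simp add: N_mult N_p_power)
qed

text \<open>Norms on \<open>Z\<close> are powers of \<open>q\<close>, so a point on the line has
  integral ordinate. As \<open>e\<close> and \<open>h\<close> are coprime, \<open>e\<close> then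
  divides \<open>s - i\<close>.\<close>

lemma good_side_off_lattice:
  assumes S: "good_side i d e h u t" and s: "s \<le> n" "\<not> (\<exists>r\<le>d. s = i + r * e)"
  shows "N (a s) < q powr lin i e h u s"
proof (rule ccontr)
  note S' = good_sideD[OF S]
  assume "\<not> ?thesis"
  then have eq: "N (a s) = q powr lin i e h u s" using S'(9)[OF s(1)] by simp
  have rng: "i \<le> s" "s \<le> i + d * e" using S'(10)[OF s(1)] eq by force+
  have "a s \<noteq> 0" using eq q_powr_pos[of "lin i e h u s"] by auto
  then obtain k w where w: "a s = \<pi> ^ k * w" "w \<in> Z" "N w = 1" using Z_decompose[OF a_in_Z] by blast
  then have "q powr real k = q powr lin i e h u s" using eq by (simp add: N_mult N_p_power q_powr_real)
  then have "real k = lin i e h u s" by (simp add: q_powr_eq_iff)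
  then have "real k * real e = real u * real e + real (s - i) * real h"
    using S'(2) rng by (simp add: lin_def of_nat_diff field_simps)
  then have "real (k * e) = real (u * e + (s - i) * h)" by simp
  then have "k * e = u * e + (s - i) * h" by linarith
  then have "e dvd (s - i) * h" by (metis dvd_add_right_iff dvd_triv_right)
  then have "e dvd s - i" using S'(4) by (metis coprime_dvd_mult_left_iff coprime_iff_gcd_eq_1)
  then obtain r where r: "s - i = e * r" by auto
  then have "r \<le> d" using rng S'(2) by (metis le_diff_conv mult.commute nat_mult_le_cancel1 add.commute)
  then show False using s(2) r rng by (metis le_add_diff_inverse mult.commute)
qed

lemma poly_res_poly: "poly (res_poly d t) x = (\<Sum>r\<le>d. t r * x ^ (d - r))"
  by (simp add: res_poly_def poly_sum poly_monom)

lemma coeff_res_poly: "coeff (res_poly d t) m = (if m \<le> d then t (d - m) else 0)"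
proof -
  have "coeff (res_poly d t) m = (\<Sum>r\<le>d. if r = d - m \<and> m \<le> d then t r else 0)"
    unfolding res_poly_def coeff_sum by (rule sum.cong) auto
  then show ?thesis by (cases "m \<le> d") auto
qed

text \<open>Every root \<open>\<rho>\<close> of the residual polynomial is the residue of \<open>\<beta> ^ e / p ^ h\<close> for some
  root \<open>\<beta>\<close>: otherwise \<open>f\<close> could not be small at \<open>y\<close>, by comparison with the Gauss norm of \<open>f\<close>.\<close>

lemma good_side_root:
  assumes S: "good_side i d e h u t" and rho: "N \<rho> \<le> 1" "N (poly (res_poly d t) \<rho>) < 1"
  obtains y \<beta> where "y ^ e = \<pi> ^ h * \<rho>" "N y = q powr (real h / real e)" "poly f \<beta> = 0"
    "N (\<beta> - y) < q powr (real h / real e)" "N \<beta> = q powr (real h / real e)" "N \<rho> = 1"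
proof -
  note S' = good_sideD[OF S]
  let ?l = "real h / real e"
  let ?k = "i + d * e"
  let ?C = "q powr lin i e h u n"
  \<comment> \<open>The constant term \<open>t d\<close> is a unit, so a root of the residual
    polynomial is one too.\<close>
  have rho1: "N \<rho> = 1"
  proof (rule ccontr)
    assume "N \<rho> \<noteq> 1"
    then have lt: "N \<rho> < 1" using rho by simp
    have "poly (res_poly d t) \<rho> = (\<Sum>r<d. t r * \<rho> ^ (d - r)) + t d"
      by (simp add: poly_res_poly lessThan_Suc_atMost[symmetric])
    moreover have "N (\<Sum>r<d. t r * \<rho> ^ (d - r)) < 1"
    proof (intro N_sum_less)
      fix r assume r: "r \<in> {..<d}"
      then have "N \<rho> ^ (d - r) < 1" using lt N_nonneg by (intro power_less_one_iff[THEN iffD2]) auto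
      then show "N (t r * \<rho> ^ (d - r)) < 1"
        using N_mult_less_1[OF Z_le_1[OF S'(5)], of r] r by (simp add: N_power)
    qed simp
    ultimately show False using N_add_eq[of _ "t d"] S'(8) rho(2) by simp
  qed
  \<comment> \<open>The number that \<open>\<beta>\<close> has to be close to:
    \<open>y ^ e / p ^ h\<close> is \<open>\<rho>\<close> itself.\<close>
  obtain y where y: "y ^ e = \<pi> ^ h * \<rho>" using nth_root_exists[OF S'(2)] by blast
  have Ny: "N y = q powr ?l"
  proof -
    have "N y ^ e = q ^ h" using arg_cong[OF y, of N] rho1 by (simp add: N_mult N_power N_p_power q_def)
    also have "q ^ h = (q powr ?l) ^ e" using S'(2) by (simp add: q_powr_power q_powr_real[symmetric])
    finally show ?thesis using S'(2) N_nonneg q_pos by (auto intro: power_eq_imp_eq_base)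
  qed
  \<comment> \<open>With radius \<open>N y\<close> all points of the line contribute equally, and
    \<open>?C\<close> is the Gauss norm of \<open>f\<close>.\<close>
  have gauss: "q powr lin i e h u s * N y ^ (n - s) = ?C" if "s \<le> n" for s
  proof -
    have "q powr lin i e h u s * N y ^ (n - s) = q powr (lin i e h u s + ?l * real (n - s))"
      unfolding Ny q_powr_power powr_add ..
    also have "lin i e h u s + ?l * real (n - s) = lin i e h u n"
      using that by (simp add: lin_shift[of i e h u n s] of_nat_diff algebra_simps)
    finally show ?thesis .
  qed
  have inj: "inj_on (\<lambda>r. i + r * e) {..d}" using S'(2) by (auto simp: inj_on_def)
  let ?L = "(\<lambda>r. i + r * e) ` {..d}"
  have Ln: "?L \<subseteq> {..n}"
  proof -
    have "i + r * e \<le> n" if "r \<le> d" for r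
      using that S'(3) mult_le_mono1[OF that, of e] by linarith
    then show ?thesis by auto
  qed
  have "N (\<Sum>s\<in>{..n} - ?L. a s * y ^ (n - s)) < ?C"
  proof (intro N_sum_less)
    fix s assume s: "s \<in> {..n} - ?L"
    have "N (a s) < q powr lin i e h u s" using s by (intro good_side_off_lattice[OF S]) auto
    then have "N (a s * y ^ (n - s)) < q powr lin i e h u s * N y ^ (n - s)"
      unfolding N_mult N_power using Ny q_pos by (intro mult_strict_right_mono) auto
    then show "N (a s * y ^ (n - s)) < ?C" using gauss s by simp
  qed (rule q_powr_pos)
  moreover have "N (\<Sum>s\<in>?L. a s * y ^ (n - s)) < ?C"
  proof -
    have "(\<Sum>s\<in>?L. a s * y ^ (n - s)) = (\<Sum>r\<le>d. a (i + r * e) * y ^ (n - (i + r * e)))"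
      by (subst sum.reindex[OF inj]) simp
    also have "\<dots> = (\<Sum>r\<le>d. \<pi> ^ (u + d * h) * y ^ (n - ?k) * (t r * \<rho> ^ (d - r)))"
    proof (rule sum.cong)
      fix r assume r: "r \<in> {..d}"
      have "d * e = r * e + (d - r) * e" "d * h = r * h + (d - r) * h"
        using r by (simp_all add: add_mult_distrib[symmetric])
      then have e1: "n - (i + r * e) = (n - ?k) + e * (d - r)" and e2: "u + d * h = u + r * h + h * (d - r)"
        using S'(3) by (simp_all add: mult.commute)
      have "y ^ (n - (i + r * e)) = y ^ (n - ?k) * (\<pi> ^ h * \<rho>) ^ (d - r)"
        unfolding e1 power_add power_mult y ..
      moreover have "a (i + r * e) = \<pi> ^ (u + r * h) * t r" using r S'(6) by simp
      ultimately show "a (i + r * e) * y ^ (n - (i + r * e)) = \<pi> ^ (u + d * h) * y ^ (n - ?k) * (t r * \<rho> ^ (d - r))"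
        unfolding e2 by (simp add: power_mult_distrib power_add power_mult mult_ac)
    qed simp
    also have "\<dots> = \<pi> ^ (u + d * h) * y ^ (n - ?k) * poly (res_poly d t) \<rho>"
      by (simp add: poly_res_poly sum_distrib_left)
    finally have "N (\<Sum>s\<in>?L. a s * y ^ (n - s)) = q ^ (u + d * h) * N y ^ (n - ?k) * N (poly (res_poly d t) \<rho>)"
      by (simp add: N_mult N_power N_p_power q_def)
    also have "q ^ (u + d * h) * N y ^ (n - ?k) = ?C"
      using gauss[OF S'(3)] unfolding lin_lattice[OF S'(2)] q_powr_real .
    also have "?C * N (poly (res_poly d t) \<rho>) < ?C" using rho(2) q_powr_pos[of "lin i e h u n"] by simp
    finally show ?thesis .
  qed
  ultimately have "N ((\<Sum>s\<in>{..n} - ?L. a s * y ^ (n - s)) + (\<Sum>s\<in>?L. a s * y ^ (n - s))) < ?C"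
    by (rule N_add_less)
  then have small_val: "N (poly f y) < ?C"
    unfolding poly_f using sum.subset_diff[OF Ln, of "\<lambda>s. a s * y ^ (n - s)"] by simp
  have f0: "f \<noteq> 0" using f_monic by auto
  obtain B where B: "f = (\<Prod>x\<in>#B. [:- x, 1:])"
    using alg_closed_imp_factorization[OF f0] f_monic by auto
  have pf: "poly f z = (\<Prod>x\<in>#B. z - x)" for z
    unfolding B by (induction B) (auto simp: left_diff_distrib)
  let ?g = "q powr ?l"
  \<comment> \<open>If all roots were far from \<open>y\<close>, each \<open>N (y - x)\<close> would
    be at least \<open>max ?g (N x)\<close>, and \<open>N (poly f y)\<close> would reach the Gauss
    norm \<open>?C\<close>.\<close>
  have "\<exists>x\<in>#B. N (y - x) < ?g"
  proof (rule ccontr)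
    assume "\<not> ?thesis"
    then have far: "\<And>x. x \<in># B \<Longrightarrow> ?g \<le> N (y - x)" by force
    have mx: "max ?g (N x) \<le> N (y - x)" if "x \<in># B" for x
      using far[OF that] N_add_eq[of "y" "- x"] Ny by (cases "N x \<le> ?g") auto
    have "0 \<le> (\<Prod>x\<in>#B'. max ?g (N x)) \<and> (\<Prod>x\<in>#B'. max ?g (N x)) \<le> N (\<Prod>x\<in>#B'. y - x)"
      if "B' \<subseteq># B" for B'
      using that
    proof (induction B')
      case (add x B')
      then have "x \<in># B" "B' \<subseteq># B" by (auto dest: mset_subset_eq_insertD mset_subset_eqD)
      then have IH: "0 \<le> (\<Prod>x\<in>#B'. max ?g (N x))" "(\<Prod>x\<in>#B'. max ?g (N x)) \<le> N (\<Prod>x\<in>#B'. y - x)"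
        and m: "max ?g (N x) \<le> N (y - x)"
        using add.IH mx by auto
      have g0: "0 \<le> max ?g (N x)" using N_nonneg by (simp add: le_max_iff_disj)
      have "max ?g (N x) * (\<Prod>x\<in>#B'. max ?g (N x)) \<le> N (y - x) * N (\<Prod>x\<in>#B'. y - x)"
        using m IH N_nonneg by (intro mult_mono) auto
      then show ?case using mult_nonneg_nonneg[OF g0 IH(1)] by (simp add: N_mult)
    qed simp
    from this[of B] have "(\<Prod>x\<in>#B. max ?g (N x)) \<le> N (poly f y)" by (simp add: pf)
    moreover have "N (coeff f (n - i)) * ?g ^ (n - i) \<le> (\<Prod>x\<in>#B. max ?g (N x))"
      using N_coeff_prod_roots_le[OF q_powr_pos, of B "n - i" ?l] unfolding B[symmetric] .
    moreover have "N (coeff f (n - i)) * ?g ^ (n - i) = ?C"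
      using good_side_ends(1)[OF S] gauss[of i] S'(3) Ny by (simp add: a_def)
    ultimately show False using small_val by linarith
  qed
  then obtain x where x: "x \<in># B" "N (y - x) < ?g" by blast
  have "poly f x = 0" using x(1) unfolding pf by (auto simp: prod_mset_zero_iff)
  moreover have "N (x - y) < ?g" using x(2) N_diff_commute by metis
  moreover have "N x = ?g" using N_eq_of_close[of x y] calculation(2) Ny by simp
  ultimately show thesis using that y Ny rho1 by blast
qed

end

context newton_data
begin

text \<open>Two sides of the polygon agree where they overlap, and slopes increase from left to right.\<close>

lemma good_side_above:
  assumes S: "good_side i d e h u t" and S': "good_side i' d' e' h' u' t'"
    and j: "i' \<le> j" "j \<le> i' + d' * e'"
  shows "lin i e h u j \<le> lin i' e' h' u' j"
proof -
  let ?k = "i' + d' * e'"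
  note D = good_sideD[OF S] and D' = good_sideD[OF S']
  have 1: "lin i e h u i' \<le> lin i' e' h' u' i'"
    using D(9)[of i'] good_side_ends(1)[OF S'] D'(3) by (simp add: q_powr_le_iff)
  have 2: "lin i e h u ?k \<le> lin i' e' h' u' ?k"
    using D(9)[of ?k] good_side_ends(2)[OF S'] D'(3) by (simp add: q_powr_le_iff)
  define c where "c = real h / real e - real h' / real e'"
  have 3: "lin i e h u s - lin i' e' h' u' s = (lin i e h u j - lin i' e' h' u' j) + (real s - real j) * c" for s
    using lin_shift[of i e h u s j] lin_shift[of i' e' h' u' s j] unfolding c_def
    by (simp only: right_diff_distrib)
  show ?thesis
  proof (cases "c \<ge> 0")
    case True
    then have "0 \<le> (real ?k - real j) * c" using j by (intro mult_nonneg_nonneg) linarith+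
    then show ?thesis using 3[of ?k] 2 by linarith
  next
    case False
    then have "0 \<le> (real i' - real j) * c" using j by (intro mult_nonpos_nonpos) linarith+
    then show ?thesis using 3[of i'] 1 by linarith
  qed
qed

lemma good_side_slope_less:
  assumes S: "good_side i d e h u t" and S': "good_side i' d' e' h' u' t'"
    and j: "i + d * e \<le> j" "i' \<le> j" "j < i' + d' * e'"
  shows "real h / real e < real h' / real e'"
proof -
  let ?k = "i' + d' * e'"
  note D = good_sideD[OF S] and D' = good_sideD[OF S']
  let ?i = "i + d * e"
  have 2: "lin i e h u ?k < lin i' e' h' u' ?k"
    using D(10)[of ?k] good_side_ends(2)[OF S'] D'(3) j by (simp add: q_powr_less_iff)
  have 1: "lin i' e' h' u' ?i \<le> lin i e h u ?i"
    using good_side_above[OF S' S, of ?i] by simp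
  have "(real ?k - real ?i) * (real h / real e) < (real ?k - real ?i) * (real h' / real e')"
    using 1 2 lin_shift[of i e h u ?k ?i] lin_shift[of i' e' h' u' ?k ?i] by linarith
  moreover have "0 < real ?k - real ?i" using j by linarith
  ultimately show ?thesis by (simp only: mult_less_cancel_left_pos)
qed

text \<open>The strict bound at roots of smaller slope removes, at the roots belonging to one side,
  all indices on the sides to its right.\<close>

lemma b_bound_good_side:
  assumes S: "good_side i d e h u t" and j: "i \<le> j" "j < i + d * e"
    and x: "poly f x = 0" "N x = q powr m"
  shows "N (b j x) \<le> q powr lin i e h u j"
    and "m < real h / real e \<Longrightarrow> N (b j x) < q powr lin i e h u j"
proof -
  note D = good_sideD[OF S]
  have jn: "j \<le> n" using j D(3) by linarith
  have supp: "N (a s) \<le> q powr (lin i e h u j + (real s - real j) * (real h / real e))" if "s \<le> n" for s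
    using D(9)[OF that] unfolding lin_shift[of i e h u s j] .
  show *: "N (b j x) < q powr lin i e h u j" if "m < real h / real e"
  proof -
    have "N (b j x) \<le> q powr (lin i e h u j + (real h / real e - m))"
      by (rule b_bound_flat[OF supp jn x(2) less_imp_le[OF that] x(1)])
    also have "\<dots> < q powr lin i e h u j" using that by (intro q_powr_less) linarith
    finally show ?thesis .
  qed
  show "N (b j x) \<le> q powr lin i e h u j"
  proof (cases "m < real h / real e")
    case True
    from *[OF this] show ?thesis by simp
  next
    case False
    then show ?thesis using x(2) by (intro b_bound_steep[OF supp jn, of x m]) auto
  qed
qed

lemma good_side_degree_res:
  assumes "good_side i d e h u t"
  shows "poly_over Z (res_poly d t)" "degree (res_poly d t) = d" "N (lead_coeff (res_poly d t)) = 1"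
proof -
  note D = good_sideD[OF assms]
  show "poly_over Z (res_poly d t)"
    using D(5) by (auto simp: poly_over_def coeff_res_poly Z_closed)
  have "t 0 \<noteq> 0" using D(7) by auto
  then show deg: "degree (res_poly d t) = d"
    by (intro antisym degree_le le_degree) (auto simp: coeff_res_poly)
  show "N (lead_coeff (res_poly d t)) = 1" unfolding deg using D(7) by (simp add: coeff_res_poly)
qed

text \<open>The part of \<open>b j\<close> that matters at the roots belonging to the side, with \<open>j = j0 + \<tau> * e\<close>
  and \<open>j0 - i = fr + r0 * e\<close>.\<close>

lemma b_lattice_approx:
  assumes S: "good_side i d e h u t"
    and j: "j = i + fr + R * e" "fr < e" "R < d"
    and y: "y ^ e = \<pi> ^ h * \<rho>" "N y = q powr (real h / real e)" "N \<beta> = q powr (real h / real e)"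
      "N (\<beta> - y) < q powr (real h / real e)"
  shows "N (b j \<beta> - y ^ fr * \<pi> ^ (u + R * h) * (\<Sum>r\<le>R. t r * \<rho> ^ (R - r))) < q powr lin i e h u j"
proof -
  note D = good_sideD[OF S]
  let ?A = "q powr lin i e h u j"
  have "R * e + e \<le> d * e" using j(3) by (metis Suc_leI mult_Suc mult_le_mono1 add.commute)
  then have jk: "i \<le> j" "j < i + d * e" using j(1,2) by linarith+
  then have jn: "j \<le> n" using D(3) by linarith
  have inj: "inj_on (\<lambda>r. i + r * e) {..R}" using D(2) by (auto simp: inj_on_def)
  let ?L = "(\<lambda>r. i + r * e) ` {..R}"
  have Lj: "?L \<subseteq> {..j}"
  proof -
    have "i + r * e \<le> j" if "r \<le> R" for r
      using mult_le_mono1[OF that, of e] j(1) by linarith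
    then show ?thesis by auto
  qed
  have gauss: "q powr lin i e h u s * (q powr (real h / real e)) ^ (j - s) = ?A" if "s \<le> j" for s
  proof -
    have "q powr lin i e h u s * (q powr (real h / real e)) ^ (j - s)
      = q powr (lin i e h u s + (real h / real e) * real (j - s))" unfolding q_powr_power powr_add ..
    also have "lin i e h u s + (real h / real e) * real (j - s) = lin i e h u j"
      using lin_shift[of i e h u j s] that by (simp only: of_nat_diff mult.commute)
    finally show ?thesis .
  qed
  have off: "N (\<Sum>s\<in>{..j} - ?L. a s * \<beta> ^ (j - s)) < ?A"
  proof (intro N_sum_less)
    fix s assume s: "s \<in> {..j} - ?L"
    \<comment> \<open>A lattice point at or before \<open>j\<close> has index at most
      \<open>R\<close>, because the offset \<open>fr\<close> is less than \<open>e\<close>.\<close>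
    have nl: "\<not> (\<exists>r\<le>d. s = i + r * e)"
    proof
      assume "\<exists>r\<le>d. s = i + r * e"
      then obtain r where r: "r \<le> d" "s = i + r * e" by blast
      have "r > R" using r s by (force simp: not_le[symmetric])
      then have "R * e + e \<le> r * e" by (metis Suc_leI mult_Suc mult_le_mono1 add.commute)
      then show False using r s j(1,2) by auto
    qed
    have "N (a s) < q powr lin i e h u s" using s jn by (intro good_side_off_lattice[OF S _ nl]) auto
    then have "N (a s * \<beta> ^ (j - s)) < q powr lin i e h u s * (q powr (real h / real e)) ^ (j - s)"
      unfolding N_mult N_power y(3) using q_pos by (intro mult_strict_right_mono) auto
    then show "N (a s * \<beta> ^ (j - s)) < ?A" using gauss[of s] s by simp
  qed (rule q_powr_pos)
  \<comment> \<open>Replacing \<open>\<beta>\<close> by \<open>y\<close> changes each positive power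
    by less than its norm.\<close>
  have on: "N (\<Sum>s\<in>?L. a s * (\<beta> ^ (j - s) - y ^ (j - s))) < ?A"
  proof (intro N_sum_less)
    fix s assume s: "s \<in> ?L"
    then have sj: "s \<le> j" using Lj by auto
    show "N (a s * (\<beta> ^ (j - s) - y ^ (j - s))) < ?A"
    proof (cases "j - s = 0")
      case True
      then show ?thesis using q_powr_pos by simp
    next
      case False
      then have lt: "N (\<beta> ^ (j - s) - y ^ (j - s)) < (q powr (real h / real e)) ^ (j - s)"
        using N_power_diff[OF y(3,2,4)] by simp
      have "N (a s) * N (\<beta> ^ (j - s) - y ^ (j - s)) \<le> q powr lin i e h u s * N (\<beta> ^ (j - s) - y ^ (j - s))"
        using D(9)[of s] sj jn N_nonneg by (intro mult_right_mono) auto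
      also have "\<dots> < q powr lin i e h u s * (q powr (real h / real e)) ^ (j - s)"
        using lt q_powr_pos by (intro mult_strict_left_mono) auto
      finally show ?thesis unfolding gauss[OF sj] N_mult .
    qed
  qed (rule q_powr_pos)
  have main: "(\<Sum>s\<in>?L. a s * y ^ (j - s)) = y ^ fr * \<pi> ^ (u + R * h) * (\<Sum>r\<le>R. t r * \<rho> ^ (R - r))"
    unfolding sum.reindex[OF inj] o_def sum_distrib_left
  proof (rule sum.cong)
    fix r assume r: "r \<in> {..R}"
    then have rd: "r \<le> d" using j(3) by simp
    have Re: "R * e = r * e + (R - r) * e" "R * h = r * h + (R - r) * h"
      using r by (simp_all add: add_mult_distrib[symmetric])
    have e1: "j - (i + r * e) = fr + e * (R - r)" using Re(1) j(1) by (simp add: mult.commute)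
    have "y ^ (j - (i + r * e)) = y ^ fr * (\<pi> ^ h * \<rho>) ^ (R - r)"
      unfolding e1 power_add power_mult y(1) ..
    moreover have "\<pi> ^ (u + R * h) = \<pi> ^ (u + r * h) * (\<pi> ^ h) ^ (R - r)"
      unfolding Re(2) by (simp add: power_add power_mult mult.commute mult.left_commute)
    ultimately show "a (i + r * e) * y ^ (j - (i + r * e)) = y ^ fr * \<pi> ^ (u + R * h) * (t r * \<rho> ^ (R - r))"
      unfolding D(6)[OF rd] by (simp add: power_mult_distrib mult_ac)
  qed simp
  have "b j \<beta> = (\<Sum>s\<in>{..j} - ?L. a s * \<beta> ^ (j - s)) + (\<Sum>s\<in>?L. a s * \<beta> ^ (j - s))"
    unfolding b_def by (rule sum.subset_diff[OF Lj]) simp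
  also have "(\<Sum>s\<in>?L. a s * \<beta> ^ (j - s)) = (\<Sum>s\<in>?L. a s * (\<beta> ^ (j - s) - y ^ (j - s))) + (\<Sum>s\<in>?L. a s * y ^ (j - s))"
    unfolding sum.distrib[symmetric] by (rule sum.cong) (simp_all add: right_diff_distrib)
  finally have "b j \<beta> - (\<Sum>s\<in>?L. a s * y ^ (j - s)) = (\<Sum>s\<in>{..j} - ?L. a s * \<beta> ^ (j - s)) +
     (\<Sum>s\<in>?L. a s * (\<beta> ^ (j - s) - y ^ (j - s)))" by simp
  then show ?thesis unfolding main[symmetric] using N_add_less[OF off on] by simp
qed

text \<open>The residual polynomial of \<open>\<Sum>j. c j * b j\<close> along a side has degree less than \<open>d\<close>, hence it
  does not vanish at all roots of the residual polynomial of the side.\<close>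

theorem coordinates_less:
  assumes cov: "\<And>j. j1 \<le> j \<Longrightarrow> j < n \<Longrightarrow>
      \<exists>i d e h u t. good_side i d e h u t \<and> i \<le> j \<and> j < i + d * e \<and> A j = lin i e h u j"
    and c: "\<And>j. c j \<in> Z"
    and M: "M > 0" and bound: "\<And>j. j1 \<le> j \<Longrightarrow> j < n \<Longrightarrow> N (c j) \<le> M * q powr (- A j)"
    and near: "\<And>\<beta> i d e h u t. good_side i d e h u t \<Longrightarrow> j1 < i + d * e \<Longrightarrow> poly f \<beta> = 0 \<Longrightarrow>
      N \<beta> = q powr (real h / real e) \<Longrightarrow> N (\<Sum>j\<in>{j1..<n}. c j * b j \<beta>) < M"
    and j: "j1 \<le> j" "j < n"
  shows "N (c j) < M * q powr (- A j)"
proof (rule ccontr)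
  assume neg: "\<not> ?thesis"
  \<comment> \<open>The indices at which the bound is attained. On the side above the least one,
    \<open>j0\<close>, a root will be found at which the sum has norm \<open>M\<close>.\<close>
  let ?T = "{j\<in>{j1..<n}. N (c j) = M * q powr (- A j)}"
  have "j \<in> ?T" using neg bound[OF j] j by auto
  then have Tne: "?T \<noteq> {}" by blast
  define j0 where "j0 = Min ?T"
  have fin: "finite ?T" by simp
  have j0T: "j0 \<in> ?T" unfolding j0_def by (rule Min_in[OF fin Tne])
  have j0min: "N (c j) < M * q powr (- A j)" if "j1 \<le> j" "j < j0" for j
  proof (rule ccontr)
    assume "\<not> ?thesis"
    then have "j \<in> ?T" using bound[of j] that j0T by auto
    then have "j0 \<le> j" unfolding j0_def by (rule Min_le[OF fin])
    then show False using that(2) by simp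
  qed
  have j0: "j1 \<le> j0" "j0 < n" "N (c j0) = M * q powr (- A j0)" using j0T by auto
  obtain i d e h u t where S: "good_side i d e h u t" and ij0: "i \<le> j0" "j0 < i + d * e"
    using cov[OF j0(1,2)] by blast
  note D = good_sideD[OF S]
  have A_eq: "A j = lin i e h u j" if jS: "i \<le> j" "j < i + d * e" "j1 \<le> j" for j
  proof -
    have "j < n" using jS D(3) by linarith
    obtain i' d' e' h' u' t' where S': "good_side i' d' e' h' u' t'" "i' \<le> j" "j < i' + d' * e'"
      "A j = lin i' e' h' u' j" using cov[OF jS(3) \<open>j < n\<close>] by blast
    show ?thesis
      using good_side_above[OF S S'(1), of j] good_side_above[OF S'(1) S, of j] S' jS by auto
  qed
  let ?l = "real h / real e"
  \<comment> \<open>From \<open>j0\<close> on, only indices on the side congruent to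
    \<open>j0\<close> modulo \<open>e\<close> can attain the bound. They are
    \<open>j0 + \<tau> * e\<close> with \<open>\<tau> \<le> m\<close>.\<close>
  define fr where "fr = (j0 - i) mod e"
  define r0 where "r0 = (j0 - i) div e"
  have j0e: "j0 = i + fr + r0 * e" unfolding fr_def r0_def using ij0(1) by simp
  have fr: "fr < e" unfolding fr_def using D(2) by simp
  have r0d: "r0 < d"
  proof (rule ccontr)
    assume "\<not> r0 < d"
    then have "d * e \<le> r0 * e" by (intro mult_le_mono1) simp
    then show False using ij0(2) j0e by linarith
  qed
  define m where "m = d - 1 - r0"
  have rd: "r0 + \<tau> < d \<longleftrightarrow> \<tau> \<le> m" for \<tau> unfolding m_def using r0d by auto
  have jt: "j0 + \<tau> * e = i + fr + (r0 + \<tau>) * e" for \<tau> unfolding j0e by (simp add: add_mult_distrib)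
  have lt_k: "i + fr + r * e < i + d * e \<longleftrightarrow> r < d" for r
  proof
    assume "r < d"
    then have "r * e + e \<le> d * e" by (metis Suc_leI mult_Suc mult_le_mono1 add.commute)
    then show "i + fr + r * e < i + d * e" using fr by linarith
  next
    assume *: "i + fr + r * e < i + d * e"
    show "r < d"
    proof (rule ccontr)
      assume "\<not> r < d"
      then have "d * e \<le> r * e" by (intro mult_le_mono1) simp
      then show False using * by linarith
    qed
  qed
  have in_S: "i \<le> j0 + \<tau> * e" "j0 + \<tau> * e < i + d * e" "j1 \<le> j0 + \<tau> * e" "j0 + \<tau> * e < n" if "\<tau> \<le> m" for \<tau>
    using that lt_k[of "r0 + \<tau>"] rd[of \<tau>] jt[of \<tau>] ij0(1) j0(1) D(3) by auto
  have A_lat: "A (j0 + \<tau> * e) = real (u + (r0 + \<tau>) * h) + real fr * ?l" if "\<tau> \<le> m" for \<tau>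
  proof -
    have "A (j0 + \<tau> * e) = lin i e h u (j0 + \<tau> * e)" using in_S[OF that] by (intro A_eq)
    also have "\<dots> = lin i e h u (i + (r0 + \<tau>) * e) + real fr * ?l"
      unfolding jt using lin_shift[of i e h u "i + fr + (r0 + \<tau>) * e" "i + (r0 + \<tau>) * e"] by simp
    finally show ?thesis unfolding lin_lattice[OF D(2)] .
  qed
  define M' where "M' = M * q powr (- (real fr * ?l))"
  \<comment> \<open>The power of \<open>p\<close> is the one occurring in the approximation of
    \<open>b (j0 + \<tau> * e)\<close>. Once it is absorbed, all coefficients share the bound
    \<open>M'\<close>, which is attained at \<open>\<tau> = 0\<close>.\<close>
  define Dc where "Dc \<tau> = c (j0 + \<tau> * e) * \<pi> ^ (u + (r0 + \<tau>) * h)" for \<tau>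
  have M'_eq: "M * q powr (- A (j0 + \<tau> * e)) * q ^ (u + (r0 + \<tau>) * h) = M'" if "\<tau> \<le> m" for \<tau>
    unfolding A_lat[OF that] M'_def q_powr_real[symmetric] mult.assoc powr_add[symmetric] by simp
  have NDc: "N (Dc \<tau>) = N (c (j0 + \<tau> * e)) * q ^ (u + (r0 + \<tau>) * h)" for \<tau>
    by (simp add: Dc_def N_mult N_p_power)
  have Dc_le: "N (Dc \<tau>) \<le> M'" if "\<tau> \<le> m" for \<tau>
    unfolding NDc M'_eq[OF that, symmetric] using bound in_S[OF that] q_pos
    by (intro mult_right_mono) auto
  have Dc_0: "N (Dc 0) = M'"
    unfolding NDc using M'_eq[of 0] j0(3) by simp
  have M'0: "M' > 0" using M q_powr_pos by (simp add: M'_def)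
  have DcZ: "Dc \<tau> \<in> Z" for \<tau>
    unfolding Dc_def by (intro Z_closed c)
  have "Dc 0 \<noteq> 0" using Dc_0 M'0 by auto
  then obtain z w where zw: "Dc 0 = \<pi> ^ z * w" "w \<in> Z" "N w = 1" using Z_decompose[OF DcZ] by blast
  then have M'z: "M' = q ^ z" using Dc_0 by (simp add: N_mult N_p_power)
  have "\<exists>v\<in>Z. Dc \<tau> = \<pi> ^ z * v" if "\<tau> \<le> m" for \<tau>
    using Z_divide_power[OF DcZ] Dc_le[OF that] M'z by simp
  then obtain \<delta> where \<delta>: "\<And>\<tau>. \<tau> \<le> m \<Longrightarrow> \<delta> \<tau> \<in> Z" "\<And>\<tau>. \<tau> \<le> m \<Longrightarrow> Dc \<tau> = \<pi> ^ z * \<delta> \<tau>"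
    by metis
  have d0: "N (\<delta> 0) = 1"
    using \<delta>(2)[of 0] Dc_0 M'z q_pos by (simp add: N_mult N_p_power)
  \<comment> \<open>What the terms with index \<open>j0 + \<tau> * e\<close> leave after division by
    their common monomial: a combination of partial sums of the residual polynomial. The condition
    \<open>\<tau> \<le> m\<close> keeps the degree below \<open>d\<close>.\<close>
  define Q where "Q = (\<Sum>\<tau>\<le>m. \<Sum>r\<le>r0 + \<tau>. monom (\<delta> \<tau> * t r) (r0 + \<tau> - r))"
  have tZ: "t r \<in> Z" if "r \<le> r0 + \<tau>" "\<tau> \<le> m" for r \<tau>
    using that rd[of \<tau>] by (intro D(5)) linarith
  have Q_over: "poly_over Z Q"
    unfolding Q_def using \<delta>(1) tZ by (intro over_Z Z_closed) auto
  have Q_deg: "degree Q < degree (res_poly d t)"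
  proof -
    have "degree Q \<le> d - 1"
      unfolding Q_def
    proof (intro degree_sum_le finite_atMost)
      fix \<tau> r assume "\<tau> \<in> {..m}" "r \<in> {..r0 + \<tau>}"
      then show "degree (monom (\<delta> \<tau> * t r) (r0 + \<tau> - r)) \<le> d - 1"
        using rd[of \<tau>] by (intro order.trans[OF degree_monom_le]) auto
    qed
    then show ?thesis using good_side_degree_res(2)[OF S] D(1) by simp
  qed
  \<comment> \<open>The partial sums have distinct degrees \<open>r0 + \<tau>\<close> and the unit
    \<open>t 0\<close> as leading coefficient, so the last unit among the
    \<open>\<delta> \<tau>\<close> survives as a unit coefficient of \<open>Q\<close>.\<close>
  have Q_nsmall: "\<not> small Q"
  proof
    assume sm: "small Q"
    let ?U = "{\<tau>\<in>{..m}. N (\<delta> \<tau>) = 1}"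
    have Une: "?U \<noteq> {}" using d0 by auto
    define \<tau>1 where "\<tau>1 = Max ?U"
    have "\<tau>1 \<in> ?U" unfolding \<tau>1_def by (rule Max_in) (use Une in auto)
    then have t1: "\<tau>1 \<le> m" "N (\<delta> \<tau>1) = 1" by auto
    have above: "N (\<delta> \<tau>) < 1" if "\<tau> \<le> m" "\<tau> > \<tau>1" for \<tau>
    proof (rule ccontr)
      assume "\<not> ?thesis"
      then have "\<tau> \<in> ?U" using Z_le_1[OF \<delta>(1)[OF that(1)]] that(1) by auto
      then have "\<tau> \<le> \<tau>1" unfolding \<tau>1_def by (intro Max_ge) auto
      then show False using that(2) by simp
    qed
    let ?c = "\<lambda>\<tau>. (\<Sum>r\<le>r0 + \<tau>. if r0 + \<tau> - r = r0 + \<tau>1 then \<delta> \<tau> * t r else 0)"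
    have "coeff Q (r0 + \<tau>1) = (\<Sum>\<tau>\<le>m. ?c \<tau>)"
      unfolding Q_def coeff_sum by simp
    also have "\<dots> = (\<Sum>\<tau>\<in>{..m} - {\<tau>1}. ?c \<tau>) + ?c \<tau>1"
      using t1(1) by (subst sum.remove[of _ \<tau>1]) auto
    also have "?c \<tau>1 = \<delta> \<tau>1 * t 0"
    proof -
      have "?c \<tau>1 = (\<Sum>r\<le>r0 + \<tau>1. if r = 0 then \<delta> \<tau>1 * t 0 else 0)"
        by (rule sum.cong) auto
      then show ?thesis by simp
    qed
    finally have e: "coeff Q (r0 + \<tau>1) = (\<Sum>\<tau>\<in>{..m} - {\<tau>1}. ?c \<tau>) + \<delta> \<tau>1 * t 0" .
    have "N (\<Sum>\<tau>\<in>{..m} - {\<tau>1}. ?c \<tau>) < 1"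
    proof (intro N_sum_less)
      fix \<tau> r assume tr: "\<tau> \<in> {..m} - {\<tau>1}" "r \<in> {..r0 + \<tau>}"
      show "N (if r0 + \<tau> - r = r0 + \<tau>1 then \<delta> \<tau> * t r else 0) < 1"
      proof (cases "r0 + \<tau> - r = r0 + \<tau>1")
        case True
        then have "\<tau> > \<tau>1" using tr by auto
        then have "N (t r * \<delta> \<tau>) < 1"
          using tr above Z_le_1 tZ by (intro N_mult_less_1) auto
        then show ?thesis using True by (simp add: mult.commute)
      qed simp
    qed simp_all
    then have "N (coeff Q (r0 + \<tau>1)) = 1"
      unfolding e using N_add_eq[of _ "\<delta> \<tau>1 * t 0"] t1(2) D(7) by (simp add: N_mult)
    then show False using sm unfolding small_def by (metis less_irrefl)
  qed
  note R = good_side_degree_res[OF S]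
  obtain \<rho> where rho: "N \<rho> \<le> 1" "N (poly (res_poly d t) \<rho>) < 1" "N (poly Q \<rho>) = 1"
    using residually_squarefree_root[OF R(1,3) D(11) Q_over Q_deg Q_nsmall] by blast
  obtain y \<beta> where y: "y ^ e = \<pi> ^ h * \<rho>" "N y = q powr ?l" "poly f \<beta> = 0"
    "N (\<beta> - y) < q powr ?l" "N \<beta> = q powr ?l" "N \<rho> = 1"
    using good_side_root[OF S rho(1,2)] by blast
  have total: "N (\<Sum>j\<in>{j1..<n}. c j * b j \<beta>) < M"
    using ij0 j0(1) by (intro near[OF S _ y(3,5)]) linarith
  let ?L = "(\<lambda>\<tau>. j0 + \<tau> * e) ` {..m}"
  have Lsub: "?L \<subseteq> {j1..<n}" using in_S by auto
  have inj: "inj_on (\<lambda>\<tau>. j0 + \<tau> * e) {..m}" using D(2) by (auto simp: inj_on_def)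
  have MA: "M * q powr (- A j) * q powr (A j) = M" for j
    using q_pos by (simp add: mult.assoc flip: powr_add)
  have term_le: "N (c j * b j \<beta>) < M"
    if "N (c j) < M * q powr (- A j)" "N (b j \<beta>) \<le> q powr (A j)" for j
  proof -
    have "N (c j) * N (b j \<beta>) \<le> N (c j) * q powr A j" using that(2) N_nonneg by (intro mult_left_mono) auto
    also have "\<dots> < M * q powr (- A j) * q powr A j" using that(1) q_powr_pos by (intro mult_strict_right_mono) auto
    finally show ?thesis unfolding MA N_mult .
  qed
  have term_less: "N (x * w) < M" if "N x \<le> M * q powr (- A j)" "N w < q powr (A j)" for x w j
  proof -
    have "N x * N w \<le> M * q powr (- A j) * N w" using that(1) N_nonneg by (intro mult_right_mono) auto
    also have "\<dots> < M * q powr (- A j) * q powr A j"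
      using that(2) M q_powr_pos by (intro mult_strict_left_mono) auto
    finally show ?thesis unfolding MA N_mult .
  qed
  \<comment> \<open>The other indices are negligible. Beyond the side \<open>b j\<close> is strictly
    smaller at \<open>\<beta>\<close>; before \<open>j0\<close> the coefficient is, by minimality;
    between them, a coefficient attaining the bound would have its index in the class of
    \<open>j0\<close> modulo \<open>e\<close>.\<close>
  have "N (\<Sum>j\<in>{j1..<n} - ?L. c j * b j \<beta>) < M"
  proof (intro N_sum_less M)
    fix j assume jj: "j \<in> {j1..<n} - ?L"
    obtain i' d' e' h' u' t' where S': "good_side i' d' e' h' u' t'" "i' \<le> j" "j < i' + d' * e'"
      "A j = lin i' e' h' u' j" using cov[of j] jj by auto
    note bb = b_bound_good_side[OF S'(1-3) y(3,5)]
    show "N (c j * b j \<beta>) < M"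
    proof (cases "j < i + d * e")
      case False
      then have "N (b j \<beta>) < q powr A j"
        unfolding S'(4) using good_side_slope_less[OF S S'(1) _ S'(2,3)] by (intro bb(2)) auto
      then show ?thesis using bound[of j] jj by (intro term_less) auto
    next
      case True
      have "N (c j) < M * q powr (- A j)"
      proof (cases "j < j0")
        case True
        then show ?thesis using j0min jj by auto
      next
        case False
        show ?thesis
        proof (rule ccontr)
          assume "\<not> ?thesis"
          then have eqj: "N (c j) = M * q powr (- A j)" using bound[of j] jj by auto
          have "c j \<noteq> 0" "c j0 \<noteq> 0" using eqj j0(3) M q_powr_pos by auto
          then obtain k w k' w' where kw: "c j = \<pi> ^ k * w" "N w = 1" "c j0 = \<pi> ^ k' * w'" "N w' = 1"
            using Z_decompose[OF c] by metis
          have "q powr real k = M * q powr (- A j)" "q powr real k' = M * q powr (- A j0)"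
            using eqj j0(3) kw by (simp_all add: N_mult N_p_power q_powr_real)
          then have "q powr real k * q powr A j = q powr real k' * q powr A j0"
            by (simp only: MA)
          then have "q powr (real k + A j) = q powr (real k' + A j0)" by (simp only: powr_add)
          then have "real k + A j = real k' + A j0" by (simp only: q_powr_eq_iff)
          moreover have "A j = A j0 + (real j - real j0) * ?l"
            using A_eq[of j] A_eq[of j0] ij0 j0(1) True False jj lin_shift[of i e h u j j0] by auto
          ultimately have "(real k' - real k) * real e = (real j - real j0) * real h"
            using D(2) by (simp add: field_simps)
          then have "real_of_int ((int k' - int k) * int e) = real_of_int ((int j - int j0) * int h)" by simp
          then have "(int k' - int k) * int e = (int j - int j0) * int h" by (simp only: of_int_eq_iff)
          then have "int e dvd (int j - int j0) * int h" by (metis dvd_triv_right)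
          moreover have "int j - int j0 = int (j - j0)" using False by simp
          ultimately have "e dvd (j - j0) * h" by (metis int_dvd_int_iff of_nat_mult)
          then have "e dvd j - j0" using D(4) by (metis coprime_dvd_mult_left_iff coprime_iff_gcd_eq_1)
          then obtain \<tau> where "j - j0 = e * \<tau>" by auto
          then have jeq: "j = j0 + \<tau> * e" using False by (simp add: mult.commute)
          then have "r0 + \<tau> < d" using True lt_k[of "r0 + \<tau>"] jt[of \<tau>] by simp
          then show False using jj jeq rd by auto
        qed
      qed
      then show ?thesis using bb(1) unfolding S'(4)[symmetric] by (rule term_le)
    qed
  qed
  moreover have "(\<Sum>j\<in>{j1..<n}. c j * b j \<beta>) = (\<Sum>j\<in>{j1..<n} - ?L. c j * b j \<beta>) + (\<Sum>j\<in>?L. c j * b j \<beta>)"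
    by (rule sum.subset_diff[OF Lsub]) simp
  ultimately have "N (\<Sum>j\<in>?L. c j * b j \<beta>) < M"
    using N_diff_less[OF total, of "\<Sum>j\<in>{j1..<n} - ?L. c j * b j \<beta>"] by simp
  then have lat: "N (\<Sum>\<tau>\<le>m. c (j0 + \<tau> * e) * b (j0 + \<tau> * e) \<beta>) < M"
    unfolding sum.reindex[OF inj] o_def .
  let ?B = "\<lambda>\<tau>. y ^ fr * \<pi> ^ (u + (r0 + \<tau>) * h) * (\<Sum>r\<le>r0 + \<tau>. t r * \<rho> ^ (r0 + \<tau> - r))"
  have "N (\<Sum>\<tau>\<le>m. c (j0 + \<tau> * e) * (b (j0 + \<tau> * e) \<beta> - ?B \<tau>)) < M"
  proof (intro N_sum_less M)
    fix \<tau> assume "\<tau> \<in> {..m}"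
    then have tm: "\<tau> \<le> m" by simp
    let ?j = "j0 + \<tau> * e"
    have "N (b ?j \<beta> - ?B \<tau>) < q powr lin i e h u ?j"
      using rd[of \<tau>] tm by (intro b_lattice_approx[OF S jt fr _ y(1,2,5,4)]) simp
    then have "N (b ?j \<beta> - ?B \<tau>) < q powr A ?j" using A_eq[of ?j] in_S[OF tm] by simp
    then show "N (c ?j * (b ?j \<beta> - ?B \<tau>)) < M"
      using bound[of ?j] in_S[OF tm] by (intro term_less) auto
  qed
  from N_diff_less[OF lat this]
  have "N (\<Sum>\<tau>\<le>m. c (j0 + \<tau> * e) * ?B \<tau>) < M"
    unfolding sum_subtractf[symmetric] by (simp add: right_diff_distrib)
  also have "(\<Sum>\<tau>\<le>m. c (j0 + \<tau> * e) * ?B \<tau>) = y ^ fr * \<pi> ^ z * poly Q \<rho>"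
  proof -
    have pQ: "poly Q \<rho> = (\<Sum>\<tau>\<le>m. \<delta> \<tau> * (\<Sum>r\<le>r0 + \<tau>. t r * \<rho> ^ (r0 + \<tau> - r)))"
      unfolding Q_def by (simp add: poly_sum poly_monom sum_distrib_left mult.assoc)
    show ?thesis
      unfolding pQ sum_distrib_left[of "y ^ fr * \<pi> ^ z"]
    proof (rule sum.cong)
      fix \<tau> assume "\<tau> \<in> {..m}"
      then have Dt: "Dc \<tau> = \<pi> ^ z * \<delta> \<tau>" using \<delta>(2) by simp
      show "c (j0 + \<tau> * e) * ?B \<tau> = y ^ fr * \<pi> ^ z * (\<delta> \<tau> * (\<Sum>r\<le>r0 + \<tau>. t r * \<rho> ^ (r0 + \<tau> - r)))"
      proof -
        have "x * (v * w * s) = v * (x * w) * s" for x v w s :: 'a by (simp only: mult_ac)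
        then have "c (j0 + \<tau> * e) * ?B \<tau> = y ^ fr * Dc \<tau> * (\<Sum>r\<le>r0 + \<tau>. t r * \<rho> ^ (r0 + \<tau> - r))"
          unfolding Dc_def .
        also have "\<dots> = y ^ fr * \<pi> ^ z * (\<delta> \<tau> * (\<Sum>r\<le>r0 + \<tau>. t r * \<rho> ^ (r0 + \<tau> - r)))"
          unfolding Dt by (simp only: mult.assoc)
        finally show ?thesis .
      qed
    qed simp
  qed
  \<comment> \<open>As \<open>poly Q \<rho>\<close> is a unit, the approximated sum has norm exactly
    \<open>M\<close>, against the estimate just obtained.\<close>
  also have "N (y ^ fr * \<pi> ^ z * poly Q \<rho>) = (q powr ?l) ^ fr * M'"
    using y(2) rho(3) M'z by (simp add: N_mult N_power N_p_power q_def)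
  also have "\<dots> = M"
    using q_pos unfolding M'_def q_powr_power
    by (simp add: mult.left_commute mult.commute[of ?l] flip: powr_add)
  finally show False by simp
qed

end

section \<open>Integer polynomials at a root of P, and the field that it generates\<close>

text \<open>The analogue of \<open>eval_at\<close> over any commutative ring: the same integer
  polynomial is evaluated at the complex root and at roots in the algebraic closure of the
  rationals.\<close>

definition ieval :: "int poly \<Rightarrow> 'a::comm_ring_1 \<Rightarrow> 'a" where
  "ieval G x = poly (map_poly of_int G) x"

lemma eval_at_ieval: "eval_at \<alpha> G = ieval G \<alpha>"
  by (simp add: eval_at_def ieval_def)

lemma ieval_simps [simp]:
  "ieval 0 x = 0" "ieval 1 x = 1" "ieval (f + g) x = ieval f x + ieval g x"
  "ieval (f - g) x = ieval f x - ieval g x" "ieval (f * g) x = ieval f x * ieval g x"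
  "ieval (f ^ n) x = ieval f x ^ n" "ieval (smult c f) x = of_int c * ieval f x"
  "ieval (- f) x = - ieval f x"
  for x :: "'a::comm_ring_1"
  by (simp_all add: ieval_def hom_distribs)

lemma ieval_pCons [simp]: "ieval (pCons c f) x = of_int c + x * ieval f x"
  by (simp add: ieval_def of_int_hom.map_poly_pCons_hom)

lemma ieval_sum: "ieval (sum f I) x = (\<Sum>i\<in>I. ieval (f i) x)"
  by (induction I rule: infinite_finite_induct) simp_all

lemma ieval_altdef: "ieval f x = (\<Sum>i\<le>degree f. of_int (coeff f i) * x ^ i)" for x :: "'a::{comm_ring_1,ring_char_0}"
  by (simp add: ieval_def poly_altdef coeff_map_poly degree_map_poly)

text \<open>\<open>H\<close> is a nonzero element of least degree in the ideal generated by
  \<open>P\<close> and \<open>G\<close>, so pseudo-division of \<open>P\<close> by it leaves no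
  remainder. As \<open>P\<close> is prime and too large to divide \<open>H\<close>, it divides the
  quotient and cancels, and \<open>H\<close> divides a constant.\<close>

lemma irreducible_bezout:
  fixes P G :: "int poly"
  assumes irr: "irreducible P" and G: "G \<noteq> 0" "degree G < degree P"
  obtains U V c where "c \<noteq> 0" "U * P + V * G = [:c:]"
proof -
  define J where "J H \<longleftrightarrow> H \<noteq> 0 \<and> (\<exists>U V. H = U * P + V * G)" for H
  have "J G" unfolding J_def using G(1) by (simp, intro exI[of _ 0] exI[of _ 1]) simp
  define H where "H = arg_min degree J"
  have H: "J H" and least: "\<And>K. J K \<Longrightarrow> degree H \<le> degree K"
    using arg_min_nat_lemma[of J G degree] \<open>J G\<close> unfolding H_def by auto
  obtain U V where UV: "H = U * P + V * G" and H0: "H \<noteq> 0" using H unfolding J_def by blast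
  obtain s r where sr: "pseudo_divmod P H = (s, r)" by force
  let ?c = "coeff H (degree H) ^ (Suc (degree P) - degree H)"
  have div: "smult ?c P = H * s + r" "r = 0 \<or> degree r < degree H"
    using pseudo_divmod[OF H0 sr] by auto
  have "r = 0"
  proof (rule ccontr)
    assume r: "r \<noteq> 0"
    have "r = ([:?c:] - U * s) * P + (- (V * s)) * G"
      using div(1) UV by (simp add: algebra_simps)
    then have "J r" using r unfolding J_def by blast
    then show False using least[of r] div(2) r by simp
  qed
  then have e: "[:?c:] * P = H * s" using div(1) by simp
  have pr: "prime_elem P" using irr by (rule irreducible_imp_prime_elem)
  have P0: "P \<noteq> 0" using pr by auto
  have "P dvd H * s" by (metis e dvd_triv_right)
  then have "P dvd H \<or> P dvd s" by (rule prime_elem_dvd_multD[OF pr])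
  then show thesis
  proof
    assume "P dvd H"
    then have "degree P \<le> degree H" using H0 by (rule dvd_imp_degree_le)
    then show thesis using least[OF \<open>J G\<close>] G by simp
  next
    assume "P dvd s"
    then obtain s' where s': "s = P * s'" by auto
    have "P * [:?c:] = P * (H * s')"
      using e unfolding s' by (simp only: mult.commute mult.left_commute)
    then have "[:?c:] = H * s'" using mult_left_cancel[OF P0] by blast
    then have "H dvd [:?c:]" "[:?c:] \<noteq> 0" using H0 by auto
    then have "degree H \<le> degree [:?c:]" by (rule dvd_imp_degree_le)
    then have "degree H = 0" by simp
    then obtain c where "H = [:c:]" using degree_eq_zeroE by blast
    then show thesis using that[of c U V] UV H0 by auto
  qed
qed

lemma monic_divmod:
  fixes P F :: "int poly"
  assumes "lead_coeff P = 1" "degree P > 0"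
  obtains s r where "F = P * s + r" "degree r < degree P"
proof -
  have P0: "P \<noteq> 0" using assms by auto
  obtain s r where sr: "pseudo_divmod F P = (s, r)" by force
  show thesis using that[of s r] pseudo_divmod[OF P0 sr] assms by auto
qed

locale monic_irreducible =
  fixes P :: "int poly"
  assumes monic: "lead_coeff P = 1" and irr: "irreducible P" and deg_P: "degree P = 4"
begin

text \<open>\<open>P\<close> is the minimal polynomial of each of its roots, in whichever field it
  lies. This carries relations between the complex numbers and the algebraic closure of the
  rationals.\<close>

lemma ieval_transfer:
  fixes x :: "'a::field_char_0" and y :: "'b::field_char_0"
  assumes "ieval P x = 0" "ieval P y = 0" "ieval F x = 0"
  shows "ieval F y = 0"
proof -
  obtain s r where sr: "F = P * s + r" "degree r < degree P"
    using monic_divmod[OF monic, of F] deg_P by auto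
  have "r = 0"
  proof (rule ccontr)
    assume r: "r \<noteq> 0"
    obtain U V c where c: "c \<noteq> 0" "U * P + V * r = [:c:]" by (rule irreducible_bezout[OF irr r sr(2)])
    have "ieval r x = 0" using assms(1,3) sr(1) by simp
    then have "ieval (U * P + V * r) x = 0" using assms(1) by simp
    then show False unfolding c(2) using c(1) by simp
  qed
  then show ?thesis using sr(1) assms(2) by simp
qed

lemma reduce_degree:
  assumes "ieval P (x::'a::field_char_0) = 0"
  obtains r where "degree r < 4" "ieval r x = ieval F x"
proof -
  obtain s r where "F = P * s + r" "degree r < degree P"
    using monic_divmod[OF monic, of F] deg_P by auto
  then show thesis using that[of r] assms deg_P by simp
qed

definition quot_rep :: "complex \<Rightarrow> complex set" where
  "quot_rep \<alpha> = {ieval G \<alpha> / of_int D | G D. degree G < 4 \<and> D \<noteq> 0}"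

lemma quot_repI:
  assumes "ieval P \<alpha> = 0" "D \<noteq> 0" "x = ieval G \<alpha> / of_int D" shows "x \<in> quot_rep \<alpha>"
proof -
  obtain r where r: "degree r < 4" "ieval r \<alpha> = ieval G \<alpha>" by (rule reduce_degree[OF assms(1)])
  show ?thesis
    unfolding quot_rep_def mem_Collect_eq
    by (intro exI[of _ r] exI[of _ D]) (simp add: r assms)
qed

text \<open>The fractions form a subfield containing \<open>\<alpha>\<close>; inverses come from the
  Bezout relation between the numerator and \<open>P\<close>.\<close>

lemma simple_ext_subset_quot_rep:
  assumes root: "ieval P \<alpha> = 0"
  shows "simple_ext \<alpha> \<subseteq> quot_rep \<alpha>"
proof -
  have "\<alpha> \<in> quot_rep \<alpha>" by (rule quot_repI[OF root, of 1 _ "[:0, 1:]"]) simp_all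
  moreover have "1 \<in> quot_rep \<alpha>" by (rule quot_repI[OF root, of 1 _ 1]) simp_all
  moreover have "x - y \<in> quot_rep \<alpha>" "x * y \<in> quot_rep \<alpha>" if "x \<in> quot_rep \<alpha>" "y \<in> quot_rep \<alpha>" for x y
  proof -
    obtain G D G' D' where x: "x = ieval G \<alpha> / of_int D" "D \<noteq> 0" "y = ieval G' \<alpha> / of_int D'" "D' \<noteq> 0"
      using \<open>x \<in> _\<close> \<open>y \<in> _\<close> unfolding quot_rep_def by blast
    show "x - y \<in> quot_rep \<alpha>"
      by (rule quot_repI[OF root, of "D * D'" _ "smult D' G - smult D G'"]) (use x(2,4) in \<open>simp_all add: x(1,3) field_simps\<close>)
    show "x * y \<in> quot_rep \<alpha>"
      by (rule quot_repI[OF root, of "D * D'" _ "G * G'"]) (use x in simp_all)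
  qed
  moreover have "inverse x \<in> quot_rep \<alpha>" if x: "x \<in> quot_rep \<alpha>" for x
  proof (cases "x = 0")
    case True
    then show ?thesis using x by simp
  next
    case False
    obtain G D where G: "x = ieval G \<alpha> / of_int D" "D \<noteq> 0" "degree G < 4" using x unfolding quot_rep_def by blast
    have "G \<noteq> 0" using False G(1) by auto
    moreover have "degree G < degree P" using G(3) deg_P by simp
    ultimately obtain U V c where c: "c \<noteq> 0" "U * P + V * G = [:c:]" by (rule irreducible_bezout[OF irr])
    have "ieval (U * P + V * G) \<alpha> = of_int c" unfolding c(2) by simp
    then have "ieval V \<alpha> * ieval G \<alpha> = of_int c" using root by simp
    moreover have "ieval G \<alpha> = x * of_int D" using G(1,2) by simp
    ultimately have e: "x * (of_int D * ieval V \<alpha>) = of_int c" by (simp add: mult_ac)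
    have "inverse x = ieval (smult D V) \<alpha> / of_int c"
      unfolding e[symmetric] using False c(1) e by (auto simp: field_simps)
    then show ?thesis by (rule quot_repI[OF root c(1)])
  qed
  ultimately show ?thesis unfolding simple_ext_def by (intro Inter_lower) blast
qed

end

lemma simple_ext_closed:
  "\<alpha> \<in> simple_ext \<alpha>" "1 \<in> simple_ext \<alpha>"
  "x \<in> simple_ext \<alpha> \<Longrightarrow> y \<in> simple_ext \<alpha> \<Longrightarrow> x - y \<in> simple_ext \<alpha>"
  "x \<in> simple_ext \<alpha> \<Longrightarrow> y \<in> simple_ext \<alpha> \<Longrightarrow> x * y \<in> simple_ext \<alpha>"
  "x \<in> simple_ext \<alpha> \<Longrightarrow> inverse x \<in> simple_ext \<alpha>"
  unfolding simple_ext_def by auto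

lemma simple_ext_subring: "unital_subring (simple_ext \<alpha>)"
  unfolding unital_subring_def using simple_ext_closed by blast

lemma ieval_in_simple_ext: "ieval G \<alpha> \<in> simple_ext \<alpha>"
  unfolding ieval_def
  by (intro unital_subring_poly[OF simple_ext_subring] simple_ext_closed)
     (simp add: poly_over_def coeff_map_poly unital_subring_of_int[OF simple_ext_subring])

lemma divide_in_simple_ext: "x \<in> simple_ext \<alpha> \<Longrightarrow> y \<in> simple_ext \<alpha> \<Longrightarrow> x / y \<in> simple_ext \<alpha>"
  unfolding divide_inverse by (intro simple_ext_closed)

section \<open>Integrality tested by norms at the roots of P\<close>

type_synonym algebraic_number = "rat alg_closure"

lemma algebraic_alg_closure: "algebraic (x :: algebraic_number)"
proof -
  obtain f :: "rat poly" where f: "f \<noteq> 0" "poly (map_poly to_ac f) x = 0"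
    using alg_closure_algebraic by blast
  have rat: "to_ac r \<in> \<rat>" for r :: rat
  proof -
    obtain a b where ab: "quotient_of r = (a, b)" by force
    have "r = of_int a / of_int b" using quotient_of_div[OF ab] .
    then have "to_ac r = of_int a / of_int b" by simp
    then show ?thesis by simp
  qed
  have "map_poly to_ac f \<noteq> 0" using f(1) by (simp add: poly_eq_iff coeff_map_poly)
  moreover have "coeff (map_poly to_ac f) i \<in> \<rat>" for i using rat by (simp add: coeff_map_poly)
  ultimately show ?thesis using algebraicI' f(2) by blast
qed

lemmas ex_norm_gt_1 = ex_padic_norm_gt_1[OF algebraic_alg_closure]

text \<open>\<open>1 / p\<close> is not integral, so some norm exceeds 1 there. That norm is below 1
  at \<open>p\<close>, hence belongs to \<open>p\<close>.\<close>

lemma ex_padic_norm: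
  assumes p: "prime (p::int)"
  shows "\<exists>N :: algebraic_number \<Rightarrow> real. padic_norm N p"
proof -
  let ?x = "1 / of_int p :: algebraic_number"
  have p0: "p \<noteq> 0" using p by auto
  have "\<not> algebraic_int ?x"
  proof
    assume "algebraic_int ?x"
    then have "?x \<in> \<int>" by (rule rational_algebraic_int_is_int) (auto intro: Rats_divide)
    then obtain k where "?x = of_int k" by (elim Ints_cases)
    then have "of_int (k * p) = (1 :: algebraic_number)" using p0 by (simp add: field_simps)
    then have "k * p = 1" by (metis of_int_eq_1_iff)
    then show False using p by (metis dvd_triv_right not_prime_unit)
  qed
  from ex_norm_gt_1[OF this] obtain p' :: int and N where N: "padic_norm N p'" "N ?x > 1" by blast
  interpret padic_norm N p' by fact
  have "N (of_int p) < 1"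
  proof (rule ccontr)
    assume "\<not> N (of_int p) < 1"
    then show False using N(2) N_of_int_le_1[of p] by (simp add: N_divide)
  qed
  then have "p' dvd p" by (simp add: N_of_int_less_1_iff)
  then have "p' = p" using primes_dvd_imp_eq[OF prime_p p] by simp
  then show ?thesis using N(1) by blast
qed

context monic_irreducible
begin

lemma ex_root: "\<exists>\<beta> :: algebraic_number. ieval P \<beta> = 0"
  unfolding ieval_def using deg_P by (intro alg_closed_imp_poly_has_root) (simp add: degree_map_poly)

lemma (in padic_norm) N_ieval_le_1: "N x \<le> 1 \<Longrightarrow> N (ieval G x) \<le> 1"
  unfolding ieval_def by (intro N_poly_le_1) (simp_all add: coeff_map_poly N_of_int_le_1)

lemma N_le_1_at_root: "padic_norm N p \<Longrightarrow> ieval P \<beta> = 0 \<Longrightarrow> N \<beta> \<le> 1"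
proof -
  assume N: "padic_norm N p" and r: "ieval P \<beta> = 0"
  interpret padic_norm N p by fact
  show ?thesis
    by (rule N_root_le_1[of "map_poly of_int P"])
       (use r monic N_of_int_le_1 in \<open>simp_all add: ieval_def coeff_map_poly degree_map_poly\<close>)
qed

text \<open>A monic equation for \<open>ieval G x / of_int D\<close>, multiplied by a power of
  \<open>D\<close>, is the vanishing of an integer polynomial at \<open>x\<close>, and so holds at
  every root.\<close>

lemma algebraic_int_ieval_transfer:
  fixes x :: "'a::field_char_0" and y :: "'b::field_char_0"
  assumes "ieval P x = 0" "ieval P y = 0" "D \<noteq> 0" "algebraic_int (ieval G x / of_int D)"
  shows "algebraic_int (ieval G y / of_int D)"
proof -
  obtain F where F: "poly (map_poly of_int F) (ieval G x / of_int D) = 0" "lead_coeff F = 1"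
    using assms(4) unfolding algebraic_int_altdef_ipoly by blast
  let ?n = "degree F"
  define H where "H = (\<Sum>i\<le>?n. smult (coeff F i * D ^ (?n - i)) (G ^ i))"
  have H: "ieval H z = of_int D ^ ?n * poly (map_poly of_int F) (ieval G z / of_int D)"
    for z :: "'c::field_char_0"
  proof -
    have e: "poly (map_poly of_int F) (ieval G z / of_int D) = (\<Sum>i\<le>?n. of_int (coeff F i) * (ieval G z / of_int D) ^ i)"
      by (simp add: poly_altdef coeff_map_poly degree_map_poly)
    show ?thesis
      unfolding H_def ieval_sum e sum_distrib_left
    proof (rule sum.cong)
      fix i assume "i \<in> {..?n}"
      then have "(of_int D ^ ?n :: 'c) = of_int D ^ (?n - i) * of_int D ^ i" by (simp flip: power_add)
      then show "ieval (smult (coeff F i * D ^ (?n - i)) (G ^ i)) z =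
          of_int D ^ ?n * (of_int (coeff F i) * (ieval G z / of_int D) ^ i)"
        using assms(3) by (simp add: power_divide)
    qed simp
  qed
  have "ieval H x = 0" using H[of x] F(1) by simp
  then have "ieval H y = 0" using ieval_transfer assms(1,2) by blast
  then have "poly (map_poly of_int F) (ieval G y / of_int D) = 0" using H[of y] assms(3) by simp
  then show ?thesis using F(2) unfolding algebraic_int_altdef_ipoly by blast
qed

text \<open>Norms are at most 1 on integral elements, and an element that is not integral has norm
  above 1 for some prime. The root is first exchanged for an algebraic number, since the norms are
  defined there only.\<close>

lemma algebraic_int_iff_norms:
  fixes \<alpha> :: "'a::field_char_0"
  assumes root: "ieval P \<alpha> = 0" and D: "D \<noteq> 0"
  shows "algebraic_int (ieval G \<alpha> / of_int D) \<longleftrightarrow>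
    (\<forall>p N \<beta>. padic_norm (N :: algebraic_number \<Rightarrow> real) p \<longrightarrow> ieval P \<beta> = 0 \<longrightarrow> N (ieval G \<beta>) \<le> N (of_int D))"
proof
  assume int: "algebraic_int (ieval G \<alpha> / of_int D)"
  show "\<forall>p N \<beta>. padic_norm (N :: algebraic_number \<Rightarrow> real) p \<longrightarrow> ieval P \<beta> = 0 \<longrightarrow> N (ieval G \<beta>) \<le> N (of_int D)"
  proof (intro allI impI)
    fix p and N :: "algebraic_number \<Rightarrow> real" and \<beta> :: algebraic_number
    assume N: "padic_norm N p" and r: "ieval P \<beta> = 0"
    interpret padic_norm N p by fact
    have "algebraic_int (ieval G \<beta> / of_int D)" by (rule algebraic_int_ieval_transfer[OF root r D int])
    then obtain F where F: "poly (map_poly of_int F) (ieval G \<beta> / of_int D) = 0" "lead_coeff F = 1"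
      unfolding algebraic_int_altdef_ipoly by blast
    have "N (ieval G \<beta> / of_int D) \<le> 1"
      by (rule N_root_le_1[OF _ _ F(1)])
         (use F(2) N_of_int_le_1 in \<open>simp_all add: coeff_map_poly degree_map_poly\<close>)
    moreover have "N (of_int D) > 0" using D N_nonneg[of "of_int D"] by (simp add: less_le)
    ultimately show "N (ieval G \<beta>) \<le> N (of_int D)" by (simp add: N_divide)
  qed
next
  assume all: "\<forall>p N \<beta>. padic_norm (N :: algebraic_number \<Rightarrow> real) p \<longrightarrow> ieval P \<beta> = 0 \<longrightarrow> N (ieval G \<beta>) \<le> N (of_int D)"
  obtain \<beta> :: algebraic_number where r: "ieval P \<beta> = 0" using ex_root by blast
  have "algebraic_int (ieval G \<beta> / of_int D)"
  proof (rule ccontr)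
    assume "\<not> ?thesis"
    from ex_norm_gt_1[OF this] obtain p and N :: "algebraic_number \<Rightarrow> real"
      where N: "padic_norm N p" "N (ieval G \<beta> / of_int D) > 1" by blast
    interpret padic_norm N p by fact
    have "N (of_int D) > 0" using D N_nonneg[of "of_int D"] by (simp add: less_le)
    then have "N (ieval G \<beta>) > N (of_int D)" using N(2) by (simp add: N_divide)
    then show False using all N(1) r by force
  qed
  then show "algebraic_int (ieval G \<alpha> / of_int D)" by (rule algebraic_int_ieval_transfer[OF r root D])
qed

lemma ring_of_ints_iff:
  assumes root: "ieval P \<alpha> = 0"
  shows "x \<in> ring_of_ints \<alpha> \<longleftrightarrow> (\<exists>G D. degree G < 4 \<and> D \<noteq> 0 \<and> x = ieval G \<alpha> / of_int D \<and>
    (\<forall>p N \<beta>. padic_norm (N :: algebraic_number \<Rightarrow> real) p \<longrightarrow> ieval P \<beta> = 0 \<longrightarrow> N (ieval G \<beta>) \<le> N (of_int D)))"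
    (is "_ \<longleftrightarrow> (\<exists>G D. ?R G D)")
proof
  assume x: "x \<in> ring_of_ints \<alpha>"
  then have "x \<in> quot_rep \<alpha>" using simple_ext_subset_quot_rep[OF root] by (auto simp: ring_of_ints_def)
  then obtain G D where "x = ieval G \<alpha> / of_int D" "degree G < 4" "D \<noteq> 0" unfolding quot_rep_def by blast
  moreover have "algebraic_int x" using x by (simp add: ring_of_ints_def)
  ultimately show "\<exists>G D. ?R G D" using algebraic_int_iff_norms[OF root] by blast
next
  assume "\<exists>G D. ?R G D"
  then obtain G D where GD: "degree G < 4" "D \<noteq> 0" "x = ieval G \<alpha> / of_int D"
    "\<forall>p N \<beta>. padic_norm (N :: algebraic_number \<Rightarrow> real) p \<longrightarrow> ieval P \<beta> = 0 \<longrightarrow> N (ieval G \<beta>) \<le> N (of_int D)"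
    by blast
  have "algebraic_int x" unfolding GD(3) using algebraic_int_iff_norms[OF root GD(2)] GD(4) by blast
  moreover have "x \<in> simple_ext \<alpha>"
    unfolding GD(3) by (intro divide_in_simple_ext ieval_in_simple_ext unital_subring_of_int[OF simple_ext_subring])
  ultimately show "x \<in> ring_of_ints \<alpha>" by (simp add: ring_of_ints_def)
qed

lemma ring_of_ints_diff:
  assumes root: "ieval P \<alpha> = 0" and x: "x \<in> ring_of_ints \<alpha>" and y: "y \<in> ring_of_ints \<alpha>"
  shows "x - y \<in> ring_of_ints \<alpha>"
proof -
  let ?n = "\<lambda>G D. \<forall>p N \<beta>. padic_norm (N :: algebraic_number \<Rightarrow> real) p \<longrightarrow> ieval P \<beta> = 0 \<longrightarrow> N (ieval G \<beta>) \<le> N (of_int D)"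
  obtain G D where G: "degree G < 4" "D \<noteq> 0" "x = ieval G \<alpha> / of_int D" "?n G D"
    using x unfolding ring_of_ints_iff[OF root] by blast
  obtain G' D' where G': "degree G' < 4" "D' \<noteq> 0" "y = ieval G' \<alpha> / of_int D'" "?n G' D'"
    using y unfolding ring_of_ints_iff[OF root] by blast
  let ?G = "smult D' G - smult D G'"
  have "degree ?G < 4"
    using G(1) G'(1) by (intro degree_diff_less le_less_trans[OF degree_smult_le]) auto
  moreover have "x - y = ieval ?G \<alpha> / of_int (D * D')"
    unfolding G(3) G'(3) using G(2) G'(2) by (simp add: field_simps)
  moreover have "?n ?G (D * D')"
  proof (intro allI impI)
    fix p and N :: "algebraic_number \<Rightarrow> real" and \<beta> :: algebraic_number
    assume N: "padic_norm N p" and r: "ieval P \<beta> = 0"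
    interpret padic_norm N p by fact
    have "N (of_int D' * ieval G \<beta>) \<le> N (of_int (D * D'))"
    proof -
      have "N (ieval G \<beta>) \<le> N (of_int D)" using G(4) N r by blast
      then show ?thesis using N_nonneg by (simp add: N_mult mult.commute[of "N (of_int D)"] mult_left_mono)
    qed
    moreover have "N (of_int D * ieval G' \<beta>) \<le> N (of_int (D * D'))"
    proof -
      have "N (ieval G' \<beta>) \<le> N (of_int D')" using G'(4) N r by blast
      then show ?thesis using N_nonneg by (simp add: N_mult mult_left_mono)
    qed
    ultimately show "N (ieval ?G \<beta>) \<le> N (of_int (D * D'))" by (simp add: N_diff_le)
  qed
  ultimately show ?thesis unfolding ring_of_ints_iff[OF root] using G(2) G'(2) by (metis mult_eq_0_iff)
qed

lemma ieval_in_ring_of_ints: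
  assumes root: "ieval P \<alpha> = 0"
  shows "ieval G \<alpha> \<in> ring_of_ints \<alpha>"
proof -
  obtain r where r: "degree r < 4" "ieval r \<alpha> = ieval G \<alpha>" by (rule reduce_degree[OF root])
  have "N (ieval r \<beta>) \<le> N (of_int 1)" if "padic_norm (N :: algebraic_number \<Rightarrow> real) p" "ieval P \<beta> = 0" for p N \<beta>
  proof -
    interpret padic_norm N p by fact
    show ?thesis using N_ieval_le_1[OF N_le_1_at_root[OF that]] by simp
  qed
  then show ?thesis unfolding ring_of_ints_iff[OF root] using r by (intro exI[of _ r] exI[of _ 1]) auto
qed

end

text \<open>An additive group of complex numbers with \<open>k x\<close> in a subgroup of finite index, \<open>p\<close> not
  dividing \<open>k\<close>, for every \<open>x\<close>: by Sylow's theorem the index is prime to \<open>p\<close>.\<close>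

lemma add_index_not_dvd:
  fixes A B :: "complex set" and p :: int
  assumes A: "0 \<in> A" "\<And>x y. x \<in> A \<Longrightarrow> y \<in> A \<Longrightarrow> x - y \<in> A"
    and B: "0 \<in> B" "\<And>x y. x \<in> B \<Longrightarrow> y \<in> B \<Longrightarrow> x - y \<in> B" and BA: "B \<subseteq> A"
    and p: "prime p" and fin: "finite ((\<lambda>x. (\<lambda>y. x + y) ` B) ` A)"
    and loc: "\<And>x. x \<in> A \<Longrightarrow> \<exists>k. \<not> p dvd k \<and> of_int k * x \<in> B"
  shows "\<not> p dvd int (add_index A B)"
proof
  assume dvd: "p dvd int (add_index A B)"
  have Aneg: "- x \<in> A" if "x \<in> A" for x using A(2)[OF A(1) that] by simp
  have Aadd: "x + y \<in> A" if "x \<in> A" "y \<in> A" for x y using A(2)[OF that(1) Aneg[OF that(2)]] by simp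
  have Bneg: "- x \<in> B" if "x \<in> B" for x using B(2)[OF B(1) that] by simp
  have Badd: "x + y \<in> B" if "x \<in> B" "y \<in> B" for x y using B(2)[OF that(1) Bneg[OF that(2)]] by simp
  have Bmul: "of_int k * x \<in> B" if "x \<in> B" for k x
  proof -
    have n: "of_nat m * x \<in> B" for m by (induction m) (auto simp: B(1) ring_distribs intro: Badd that)
    show ?thesis
    proof (cases "k \<ge> 0")
      case True then show ?thesis using n[of "nat k"] by simp
    next
      case False
      then have "of_int k * x = - (of_nat (nat (- k)) * x)" by simp
      then show ?thesis using Bneg[OF n] by simp
    qed
  qed
  define G where "G = \<lparr>carrier = A, monoid.mult = (+), one = (0::complex)\<rparr>"
  have G: "comm_group G"
    unfolding G_def
    by (rule comm_groupI) (use A Aadd Aneg in \<open>auto simp: add.assoc add.commute intro: exI[of _ "- _"] bexI[of _ "- _"]\<close>)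
  interpret G: comm_group G by (rule G)
  have inv: "inv\<^bsub>G\<^esub> x = - x" if "x \<in> A" for x
    by (rule G.inv_equality) (use that Aneg in \<open>auto simp: G_def\<close>)
  have sub: "subgroup B G"
    by (rule G.subgroupI) (use BA B(1) Bneg Badd inv in \<open>auto simp: G_def\<close>)
  have nB: "B \<lhd> G" by (rule G.subgroup_imp_normal[OF sub])
  interpret Q: group "G Mod B" by (rule normal.factorgroup_is_group[OF nB])
  have rc: "r_coset G B x = (\<lambda>y. x + y) ` B" for x
    by (auto simp: r_coset_def G_def add.commute)
  have car: "carrier (G Mod B) = (\<lambda>x. (\<lambda>y. x + y) ` B) ` A"
    unfolding carrier_FactGroup rc by (simp add: G_def)
  have finQ: "finite (carrier (G Mod B))" using fin car by simp
  have ord: "Coset.order (G Mod B) = add_index A B" by (simp add: Coset.order_def car add_index_def)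
  have np: "prime (nat p)" using p unfolding prime_int_nat_transfer by blast
  have np2: "int (nat p) = p" using prime_gt_0_int[OF p] by simp
  have "nat p dvd add_index A B" using dvd np2 by (metis int_dvd_int_iff)
  \<comment> \<open>Sylow's theorem is used with exponent 1, that is as Cauchy's theorem: the
    quotient has a subgroup of order \<open>p\<close>.\<close>
  then obtain m where "Coset.order (G Mod B) = nat p ^ 1 * m" unfolding ord by auto
  from sylow_thm[OF np Q.group_axioms this finQ]
  obtain H where H: "subgroup H (G Mod B)" "card H = nat p" by auto
  interpret H: group "(G Mod B)\<lparr>carrier := H\<rparr>" by (rule subgroup.subgroup_is_group[OF H(1) Q.group_axioms])
  have "nat p > 1" using prime_gt_1_nat[OF np] .
  then have "card H \<noteq> card {\<one>\<^bsub>G Mod B\<^esub>}" using H(2) by simp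
  then have "H \<noteq> {\<one>\<^bsub>G Mod B\<^esub>}" by blast
  then obtain K where K: "K \<in> H" "K \<noteq> B" using subgroup.one_closed[OF H(1)] by auto
  have "K \<in> carrier (G Mod B)" using K(1) subgroup.subset[OF H(1)] by blast
  then obtain x where x: "x \<in> A" "K = (\<lambda>y. x + y) ` B" unfolding car by blast
  have "K [^]\<^bsub>(G Mod B)\<lparr>carrier := H\<rparr>\<^esub> card H = \<one>\<^bsub>(G Mod B)\<lparr>carrier := H\<rparr>\<^esub>"
    using H.pow_order_eq_1[of K] K(1) by (simp add: Coset.order_def)
  then have Kp: "K [^]\<^bsub>G Mod B\<^esub> nat p = B" using H(2) by (simp add: nat_pow_def)
  have pw: "K [^]\<^bsub>G Mod B\<^esub> (j::nat) = (\<lambda>y. of_nat j * x + y) ` B" for j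
  proof (induction j)
    case 0
    then show ?case by simp
  next
    case (Suc j)
    have "K [^]\<^bsub>G Mod B\<^esub> Suc j = ((\<lambda>y. of_nat j * x + y) ` B) <#>\<^bsub>G\<^esub> ((\<lambda>y. x + y) ` B)"
      using Suc x(2) by simp
    also have "\<dots> = (\<lambda>y. of_nat (Suc j) * x + y) ` B"
    proof
      show "((\<lambda>y. of_nat j * x + y) ` B) <#>\<^bsub>G\<^esub> ((\<lambda>y. x + y) ` B) \<subseteq> (\<lambda>y. of_nat (Suc j) * x + y) ` B"
      proof
        fix z assume "z \<in> ((\<lambda>y. of_nat j * x + y) ` B) <#>\<^bsub>G\<^esub> ((\<lambda>y. x + y) ` B)"
        then obtain y y' where y: "y \<in> B" "y' \<in> B" "z = (of_nat j * x + y) + (x + y')"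
          unfolding set_mult_def G_def by auto
        then have "z = of_nat (Suc j) * x + (y + y')" by (simp add: algebra_simps)
        then show "z \<in> (\<lambda>y. of_nat (Suc j) * x + y) ` B" using Badd y by blast
      qed
      show "(\<lambda>y. of_nat (Suc j) * x + y) ` B \<subseteq> ((\<lambda>y. of_nat j * x + y) ` B) <#>\<^bsub>G\<^esub> ((\<lambda>y. x + y) ` B)"
      proof
        fix z assume "z \<in> (\<lambda>y. of_nat (Suc j) * x + y) ` B"
        then obtain y where y: "y \<in> B" "z = of_nat (Suc j) * x + y" by blast
        then have "z = (of_nat j * x + y) + (x + 0)" by (simp add: algebra_simps)
        then show "z \<in> ((\<lambda>y. of_nat j * x + y) ` B) <#>\<^bsub>G\<^esub> ((\<lambda>y. x + y) ` B)"
          unfolding set_mult_def G_def using y(1) B(1) by force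
      qed
    qed
    finally show ?case .
  qed
  have "of_nat (nat p) * x + 0 \<in> B" using Kp pw[of "nat p"] B(1) by blast
  then have px: "of_int p * x \<in> B" using np2 by (metis add.right_neutral of_int_of_nat_eq)
  \<comment> \<open>Both \<open>p * x\<close> and \<open>k * x\<close> lie in \<open>B\<close>, and
    \<open>p\<close> and \<open>k\<close> are coprime; so \<open>x\<close> lies in \<open>B\<close>
    and its coset is trivial.\<close>
  obtain k where k: "\<not> p dvd k" "of_int k * x \<in> B" using loc[OF x(1)] by blast
  have "gcd p k = 1" using prime_imp_coprime[OF p k(1)] by simp
  then obtain u v where uv: "u * p + v * k = 1" using bezout_int by metis
  have "of_int u * (of_int p * x) + of_int v * (of_int k * x) = of_int (u * p + v * k) * x"
    by (simp add: algebra_simps)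
  then have "x = of_int u * (of_int p * x) + of_int v * (of_int k * x)" unfolding uv by simp
  also have "\<dots> \<in> B" by (intro Badd Bmul px k(2))
  finally have xB: "x \<in> B" .
  have "K = B"
  proof
    show "K \<subseteq> B" using x(2) xB Badd by auto
    show "B \<subseteq> K"
    proof
      fix z assume z: "z \<in> B"
      then have "z = x + (z - x)" "z - x \<in> B" using xB B(2) by auto
      then show "z \<in> K" unfolding x(2) by blast
    qed
  qed
  then show False using K(2) by simp
qed

section \<open>Integral spans and their localisation at p\<close>

lemma int_span_zero: "0 \<in> int_span ws"
  unfolding int_span_def by (auto intro!: exI[of _ "\<lambda>_. 0"])

lemma int_span_diff: "x \<in> int_span ws \<Longrightarrow> y \<in> int_span ws \<Longrightarrow> x - y \<in> int_span ws"
proof -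
  assume "x \<in> int_span ws" "y \<in> int_span ws"
  then obtain c d where "x = (\<Sum>i<length ws. of_int (c i) * ws ! i)" "y = (\<Sum>i<length ws. of_int (d i) * ws ! i)"
    unfolding int_span_def by blast
  then have "x - y = (\<Sum>i<length ws. of_int (c i - d i) * ws ! i)"
    by (simp add: sum_subtractf left_diff_distrib)
  then show ?thesis unfolding int_span_def by (auto intro!: exI[of _ "\<lambda>i. c i - d i"])
qed

lemma int_span_add: "x \<in> int_span ws \<Longrightarrow> y \<in> int_span ws \<Longrightarrow> x + y \<in> int_span ws"
  using int_span_diff[of x ws "0 - y"] int_span_diff[OF int_span_zero, of y] by simp

lemma int_span_mult: "x \<in> int_span ws \<Longrightarrow> of_int k * x \<in> int_span ws"
proof -
  assume "x \<in> int_span ws"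
  then obtain c where "x = (\<Sum>i<length ws. of_int (c i) * ws ! i)" unfolding int_span_def by blast
  then have "of_int k * x = (\<Sum>i<length ws. of_int (k * c i) * ws ! i)" by (simp add: sum_distrib_left mult.assoc)
  then show ?thesis unfolding int_span_def by (auto intro!: exI[of _ "\<lambda>i. k * c i"])
qed

lemma int_span_sum: "(\<And>i. i \<in> I \<Longrightarrow> f i \<in> int_span ws) \<Longrightarrow> sum f I \<in> int_span ws"
  by (induction I rule: infinite_finite_induct) (auto intro: int_span_zero int_span_add)

lemma int_span_base: "i < length ws \<Longrightarrow> ws ! i \<in> int_span ws"
proof -
  assume i: "i < length ws"
  have "(\<Sum>j<length ws. of_int (if j = i then 1 else 0) * ws ! j) = (\<Sum>j<length ws. if j = i then ws ! j else 0)"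
    by (rule sum.cong) auto
  also have "\<dots> = ws ! i" using i by simp
  finally show ?thesis unfolding int_span_def by (auto intro!: exI[of _ "\<lambda>j. if j = i then 1 else 0"])
qed

text \<open>The span of \<open>ws\<close> over the integers localised at \<open>p\<close>, with the
  denominator cleared.\<close>

definition loc_span :: "int \<Rightarrow> complex list \<Rightarrow> complex set" where
  "loc_span p ws = {x. \<exists>k. \<not> p dvd k \<and> of_int k * x \<in> int_span ws}"

context
  fixes p :: int and ws :: "complex list"
  assumes p: "prime p"
begin

lemma loc_span_int_span: "x \<in> int_span ws \<Longrightarrow> x \<in> loc_span p ws"
  unfolding loc_span_def using p by (auto intro!: exI[of _ 1] dest: not_prime_unit)

lemma loc_span_add:
  assumes "x \<in> loc_span p ws" "y \<in> loc_span p ws" shows "x + y \<in> loc_span p ws"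
proof -
  obtain k l where kl: "\<not> p dvd k" "of_int k * x \<in> int_span ws" "\<not> p dvd l" "of_int l * y \<in> int_span ws"
    using assms unfolding loc_span_def by blast
  have "of_int (k * l) * (x + y) = of_int l * (of_int k * x) + of_int k * (of_int l * y)"
    by (simp add: algebra_simps)
  also have "\<dots> \<in> int_span ws" by (rule int_span_add[OF int_span_mult[OF kl(2)] int_span_mult[OF kl(4)]])
  finally have "of_int (k * l) * (x + y) \<in> int_span ws" .
  moreover have "\<not> p dvd k * l" using kl p prime_dvd_mult_iff by blast
  ultimately show ?thesis unfolding loc_span_def by blast
qed

lemma loc_span_mult: "x \<in> loc_span p ws \<Longrightarrow> of_int c * x \<in> loc_span p ws"
proof -
  assume "x \<in> loc_span p ws"
  then obtain k where k: "\<not> p dvd k" "of_int k * x \<in> int_span ws" unfolding loc_span_def by blast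
  have "of_int k * (of_int c * x) = of_int c * (of_int k * x)" by simp
  also have "\<dots> \<in> int_span ws" by (rule int_span_mult[OF k(2)])
  finally show ?thesis using k(1) unfolding loc_span_def by blast
qed

lemma loc_span_uminus: "x \<in> loc_span p ws \<Longrightarrow> - x \<in> loc_span p ws"
  using loc_span_mult[of x "-1"] by simp

lemma loc_span_diff: "x \<in> loc_span p ws \<Longrightarrow> y \<in> loc_span p ws \<Longrightarrow> x - y \<in> loc_span p ws"
  using loc_span_add[of x "- y"] loc_span_uminus[of y] by simp

lemma loc_span_0: "0 \<in> loc_span p ws"
  by (rule loc_span_int_span[OF int_span_zero])

lemma loc_span_sum: "(\<And>i. i \<in> I \<Longrightarrow> f i \<in> loc_span p ws) \<Longrightarrow> sum f I \<in> loc_span p ws"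
  by (induction I rule: infinite_finite_induct) (auto intro: loc_span_0 loc_span_add)

lemma loc_span_cancel:
  assumes "of_int k * x \<in> loc_span p ws" "\<not> p dvd k" shows "x \<in> loc_span p ws"
proof -
  obtain l where l: "\<not> p dvd l" "of_int l * (of_int k * x) \<in> int_span ws"
    using assms(1) unfolding loc_span_def by blast
  have "of_int (l * k) * x \<in> int_span ws" using l(2) by (simp add: mult.assoc)
  moreover have "\<not> p dvd l * k" using l assms(2) p prime_dvd_mult_iff by blast
  ultimately show ?thesis unfolding loc_span_def by blast
qed

lemma loc_span_base: "i < length ws \<Longrightarrow> ws ! i \<in> loc_span p ws"
  by (intro loc_span_int_span int_span_base)

lemma loc_span_mem: "w \<in> set ws \<Longrightarrow> w \<in> loc_span p ws"
  using loc_span_base by (metis in_set_conv_nth)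

end

text \<open>Reducing the coefficients of \<open>E * x\<close> modulo \<open>E\<close> leaves
  finitely many coset representatives.\<close>

lemma finite_cosets:
  assumes E: "(E::int) > 0" and div: "\<And>x. x \<in> A \<Longrightarrow> of_int E * x \<in> int_span ws"
  shows "finite ((\<lambda>x. (\<lambda>y. x + y) ` int_span ws) ` A)"
proof -
  let ?n = "length ws"
  let ?F = "{..<?n} \<rightarrow>\<^sub>E {0..<E}"
  define val where "val c = (\<Sum>i<?n. of_int (c i) * ws ! i) / (of_int E :: complex)" for c :: "nat \<Rightarrow> int"
  have "(\<lambda>x. (\<lambda>y. x + y) ` int_span ws) ` A \<subseteq> (\<lambda>c. (\<lambda>y. val c + y) ` int_span ws) ` ?F"
  proof
    fix K assume "K \<in> (\<lambda>x. (\<lambda>y. x + y) ` int_span ws) ` A"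
    then obtain x where x: "x \<in> A" "K = (\<lambda>y. x + y) ` int_span ws" by blast
    obtain c where c: "of_int E * x = (\<Sum>i<?n. of_int (c i) * ws ! i)"
      using div[OF x(1)] unfolding int_span_def by blast
    define d where "d = (\<lambda>i\<in>{..<?n}. c i mod E)"
    have dF: "d \<in> ?F" using E by (auto simp: d_def)
    define s where "s = (\<Sum>i<?n. of_int (c i div E) * ws ! i)"
    have s: "s \<in> int_span ws"
      unfolding int_span_def s_def by (intro CollectI exI[of _ "\<lambda>i. c i div E"] conjI refl TrueI)
    have "(\<Sum>i<?n. of_int (c i) * ws ! i) = (\<Sum>i<?n. of_int (d i) * ws ! i) + of_int E * s"
      unfolding s_def sum_distrib_left sum.distrib[symmetric]
    proof (rule sum.cong)
      fix i assume "i \<in> {..<?n}"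
      then have "c i = d i + E * (c i div E)" by (simp add: d_def)
      then have "(of_int (c i) :: complex) = of_int (d i) + of_int E * of_int (c i div E)"
        by (metis of_int_add of_int_mult)
      then show "of_int (c i) * ws ! i = of_int (d i) * ws ! i + of_int E * (of_int (c i div E) * ws ! i)"
        by (simp add: algebra_simps)
    qed simp
    then have Ex: "of_int E * x = (\<Sum>i<?n. of_int (d i) * ws ! i) + of_int E * s" using c by simp
    have E': "(of_int E :: complex) \<noteq> 0" using E by simp
    have "x = of_int E * x / of_int E" using E' by simp
    then have xs: "x = val d + s" unfolding val_def Ex using E' by (simp add: add_divide_distrib)
    have "K = (\<lambda>y. val d + y) ` int_span ws"
    proof
      show "K \<subseteq> (\<lambda>y. val d + y) ` int_span ws"
      proof
        fix z assume "z \<in> K"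
        then obtain y where y: "y \<in> int_span ws" "z = x + y" unfolding x(2) by blast
        have "z = val d + (s + y)" unfolding y(2) xs by (simp only: add.assoc)
        then show "z \<in> (\<lambda>y. val d + y) ` int_span ws" using int_span_add[OF s y(1)] by blast
      qed
      show "(\<lambda>y. val d + y) ` int_span ws \<subseteq> K"
      proof
        fix z assume "z \<in> (\<lambda>y. val d + y) ` int_span ws"
        then obtain y where y: "y \<in> int_span ws" "z = val d + y" by blast
        then have "z = x + (y - s)" unfolding xs by simp
        then show "z \<in> K" unfolding x(2) using int_span_diff[OF y(1) s] by blast
      qed
    qed
    then show "K \<in> (\<lambda>c. (\<lambda>y. val c + y) ` int_span ws) ` ?F" using dF by blast
  qed
  moreover have "finite ?F" by (intro finite_PiE) auto
  ultimately show ?thesis by (rule finite_surj[rotated])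
qed

context monic_irreducible
begin

text \<open>Lagrange interpolation at the roots of \<open>P\<close>, with \<open>V\<close> such that \<open>V P'\<close> is the constant \<open>c\<close>
  modulo \<open>P\<close>.\<close>

lemma common_denominator:
  assumes root: "ieval P \<alpha> = 0"
  shows "\<exists>c. c \<noteq> 0 \<and> (\<forall>x\<in>ring_of_ints \<alpha>. \<exists>H. degree H < 4 \<and> of_int c * x = ieval H \<alpha>)"
proof -
  have "pderiv P \<noteq> 0" "degree (pderiv P) < degree P"
    using deg_P by (auto simp: pderiv_eq_0_iff degree_pderiv)
  then obtain U V c where c: "c \<noteq> 0" "U * P + V * pderiv P = [:c:]" by (rule irreducible_bezout[OF irr])
  define Q :: "algebraic_number poly" where "Q = map_poly of_int P"
  have Q: "lead_coeff Q = 1" "degree Q = 4"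
    using monic deg_P by (simp_all add: Q_def degree_map_poly coeff_map_poly)
  have Q0: "Q \<noteq> 0" using Q by auto
  have VQ: "ieval V x * poly (pderiv Q) x = of_int c" if "poly Q x = 0" for x
  proof -
    have "ieval P x = 0" using that by (simp add: ieval_def Q_def)
    moreover have "ieval (U * P + V * pderiv P) x = of_int c" unfolding c(2) by simp
    moreover have "ieval (pderiv P) x = poly (pderiv Q) x"
      by (simp add: ieval_def Q_def of_int_hom.map_poly_pderiv)
    ultimately show ?thesis by simp
  qed
  define R where "R = {x. poly Q x = 0}"
  have finR: "finite R" unfolding R_def by (rule poly_roots_finite[OF Q0])
  \<comment> \<open>At every root \<open>V\<close> times the derivative is the nonzero constant
    \<open>c\<close>, so there are no multiple roots.\<close>
  have cardR: "card R = 4"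
  proof -
    obtain B where B: "size B = degree Q" "Q = smult (lead_coeff Q) (\<Prod>x\<in>#B. [:- x, 1:])"
      using alg_closed_imp_factorization[OF Q0] by blast
    have BQ: "Q = (\<Prod>x\<in>#B. [:- x, 1:])" using B(2) Q(1) by simp
    have "count B x \<le> 1" for x
    proof (rule ccontr)
      assume "\<not> count B x \<le> 1"
      then have "count B x \<ge> 2" by simp
      then have "{#x, x#} \<subseteq># B" by (auto simp: subseteq_mset_def)
      then obtain B' where B': "B = {#x, x#} + B'" by (metis subset_mset.le_iff_add)
      have sq: "(\<Prod>z\<in>#{#x, x#} + B'. h z) = (h x)\<^sup>2 * (\<Prod>z\<in>#B'. h z)"
        for h :: "algebraic_number \<Rightarrow> algebraic_number poly"
        by (simp add: power2_eq_square mult.assoc)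
      have "Q = [:- x, 1:]\<^sup>2 * (\<Prod>x\<in>#B'. [:- x, 1:])" unfolding BQ B' by (rule sq)
      moreover have "poly (l\<^sup>2 * C) x = 0 \<and> poly (pderiv (l\<^sup>2 * C)) x = 0" if "poly l x = 0"
        for l C :: "algebraic_number poly"
        using that by (simp add: pderiv_mult power2_eq_square)
      ultimately have "poly Q x = 0" "poly (pderiv Q) x = 0"
        by (metis poly_pCons poly_0 mult_zero_right add.right_neutral add.left_inverse mult.right_neutral pCons_one poly_1)+
      then show False using VQ[of x] c(1) by simp
    qed
    then have "mset_set (set_mset B) = B"
    proof (intro multiset_eqI)
      fix x assume le: "\<And>x. count B x \<le> 1"
      show "count (mset_set (set_mset B)) x = count B x"
      proof (cases "x \<in># B")
        case True
        then have "count B x \<noteq> 0" by simp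
        then have "count B x = 1" using le[of x] by linarith
        then show ?thesis using True by simp
      next
        case False
        then show ?thesis by (simp add: not_in_iff)
      qed
    qed
    then have "card (set_mset B) = size B" by (metis size_mset_set)
    moreover have "set_mset B = R"
    proof -
      have "poly Q z = (\<Prod>x\<in>#B. z - x)" for z unfolding BQ by (induction B) (auto simp: left_diff_distrib)
      then show ?thesis unfolding R_def by (auto simp: prod_mset_zero_iff)
    qed
    ultimately show ?thesis using B(1) Q(2) by simp
  qed
  define S where "S x = synthetic_div Q x" for x
  have S: "Q = [:- x, 1:] * S x" if "x \<in> R" for x
    using synthetic_div_correct'[of x Q] that unfolding S_def R_def by simp
  have S_deg: "degree (S x) = 3" for x using Q(2) by (simp add: S_def degree_synthetic_div)
  have S_other: "poly (S x) y = 0" if "x \<in> R" "y \<in> R" "x \<noteq> y" for x y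
  proof -
    have "poly Q y = (y - x) * poly (S x) y" by (subst S[OF that(1)]) (simp add: left_diff_distrib)
    then show ?thesis using that unfolding R_def by simp
  qed
  have S_self: "poly (S x) x = poly (pderiv Q) x" if "x \<in> R" for x
  proof -
    have gen: "poly (pderiv (l * C)) x = poly C x" if "poly l x = 0" "pderiv l = 1"
      for l C :: "algebraic_number poly"
      using that by (simp add: pderiv_mult)
    have "poly (pderiv ([:- x, 1:] * S x)) x = poly (S x) x"
      by (rule gen) (simp_all add: pderiv_pCons)
    then show ?thesis unfolding S[OF that, symmetric] by simp
  qed
  have "\<exists>H. degree H < 4 \<and> of_int c * x = ieval H \<alpha>" if x: "x \<in> ring_of_ints \<alpha>" for x
  proof -
    obtain G D where GD: "degree G < 4" "D \<noteq> 0" "x = ieval G \<alpha> / of_int D"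
      "\<And>p N \<beta>. padic_norm (N :: algebraic_number \<Rightarrow> real) p \<Longrightarrow> ieval P \<beta> = 0 \<Longrightarrow> N (ieval G \<beta>) \<le> N (of_int D)"
      using x unfolding ring_of_ints_iff[OF root] by blast
    \<comment> \<open>Lagrange interpolation of \<open>c * G\<close> at the four roots. The usual
      division by the derivative has become multiplication by \<open>V\<close>, at the cost of the
      factor \<open>c\<close>.\<close>
    define L where "L = (\<Sum>x\<in>R. smult (ieval G x * ieval V x) (S x))"
    have L_deg: "degree L \<le> 3"
      unfolding L_def using S_deg by (intro degree_sum_le[OF finR]) (metis degree_smult_le)
    have L_val: "poly L y = of_int c * ieval G y" if y: "y \<in> R" for y
    proof -
      have "poly L y = (\<Sum>x\<in>R. ieval G x * ieval V x * poly (S x) y)" by (simp add: L_def poly_sum)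
      also have "\<dots> = (\<Sum>x\<in>R. if x = y then ieval G y * ieval V y * poly (S y) y else 0)"
        using S_other y by (intro sum.cong) auto
      also have "\<dots> = ieval G y * (ieval V y * poly (pderiv Q) y)"
        using finR y S_self[OF y] by (simp add: mult.assoc)
      finally show ?thesis using VQ y unfolding R_def by (simp add: mult.commute)
    qed
    define G' :: "algebraic_number poly" where "G' = map_poly of_int (smult c G)"
    have "degree (L - G') \<le> 3"
      unfolding G'_def using L_deg GD(1)
      by (intro degree_diff_le) (auto simp: degree_map_poly intro: order.trans[OF degree_smult_le])
    moreover have "R \<subseteq> {y. poly (L - G') y = 0}"
    proof
      fix y assume "y \<in> R"
      moreover have "poly G' y = of_int c * ieval G y" using ieval_simps(7)[of c G y] by (simp add: G'_def ieval_def)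
      ultimately show "y \<in> {y. poly (L - G') y = 0}" using L_val by simp
    qed
    ultimately have "L - G' = 0"
      using card_poly_roots_bound[of "L - G'"] card_mono[OF poly_roots_finite[of "L - G'"], of R] cardR by force
    then have LG: "coeff L i = of_int (c * coeff G i)" for i by (simp add: G'_def coeff_map_poly)
    \<comment> \<open>The quotients \<open>S x\<close> have integral coefficients, so the
      coefficients \<open>c * coeff G i\<close> of \<open>L\<close> have norm at most
      \<open>N (of_int D)\<close> for every norm. Divided by \<open>D\<close> they are rational
      algebraic integers.\<close>
    have dvd: "D dvd c * coeff G i" for i
    proof -
      let ?z = "of_int (c * coeff G i) / of_int D :: algebraic_number"
      have "algebraic_int ?z"
      proof (rule ccontr)
        assume "\<not> ?thesis"
        from ex_norm_gt_1[OF this] obtain p and N :: "algebraic_number \<Rightarrow> real"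
          where N: "padic_norm N p" "N ?z > 1" by blast
        interpret padic_norm N p by fact
        have Dpos: "N (of_int D) > 0" using GD(2) N_nonneg[of "of_int D"] by (simp add: less_le)
        have "N (coeff L i) \<le> N (of_int D)"
          unfolding L_def coeff_sum
        proof (intro N_sum_le N_nonneg)
          fix x assume xR: "x \<in> R"
          then have r: "ieval P x = 0" unfolding R_def Q_def ieval_def by simp
          have Nx: "N x \<le> 1" by (rule N_le_1_at_root[OF N(1) r])
          have NS: "N (coeff (S x) i) \<le> 1"
          proof -
            have "N (coeff (synthetic_div q x) i) \<le> 1" if "\<And>i. N (coeff q i) \<le> 1" for q i
              using that
            proof (induction q arbitrary: i)
              case 0 then show ?case by simp
            next
              case (pCons a q)
              have q: "N (coeff q i) \<le> 1" for i using pCons.prems[of "Suc i"] by simp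
              show ?case using pCons.IH[OF q] N_poly_le_1[OF q Nx] by (cases i) auto
            qed
            from this[of Q i] show ?thesis
              unfolding S_def by (simp add: Q_def coeff_map_poly N_of_int_le_1)
          qed
          have "N (ieval V x * coeff (S x) i) \<le> 1" by (intro N_mult_le_1 N_ieval_le_1 Nx NS)
          then have "N (ieval G x) * N (ieval V x * coeff (S x) i) \<le> N (of_int D) * 1"
            using GD(4)[OF N(1) r] N_nonneg by (intro mult_mono) auto
          then show "N (coeff (smult (ieval G x * ieval V x) (S x)) i) \<le> N (of_int D)"
            by (simp add: N_mult mult.assoc)
        qed
        then show False using N(2) Dpos unfolding LG by (simp add: N_divide)
      qed
      then have "?z \<in> \<int>" by (rule rational_algebraic_int_is_int) (auto intro: Rats_divide)
      then obtain k where "?z = of_int k" by (elim Ints_cases)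
      then have "of_int (c * coeff G i) = (of_int (k * D) :: algebraic_number)"
        using GD(2) by (simp add: field_simps)
      then have "c * coeff G i = k * D" by (simp only: of_int_eq_iff)
      then show ?thesis by simp
    qed
    define H where "H = map_poly (\<lambda>z. z div D) (smult c G)"
    have HG: "smult D H = smult c G"
      using dvd by (auto simp: poly_eq_iff H_def coeff_map_poly)
    then have "degree H < 4" using GD(1,2) c(1) by (metis degree_smult_eq)
    moreover have "of_int D * ieval H \<alpha> = of_int c * ieval G \<alpha>"
      using arg_cong[OF HG, of "\<lambda>f. ieval f \<alpha>"] by simp
    then have "of_int c * x = ieval H \<alpha>" unfolding GD(3) using GD(2) by (simp add: field_simps)
    ultimately show ?thesis by blast
  qed
  then show ?thesis using c(1) by blast
qed

text \<open>All denominators are powers of \<open>p\<close>, so norms above other primes impose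
  nothing. Local spanning gives each integer of the field a multiplier prime to \<open>p\<close>; a
  common denominator makes the index finite, and then \<open>add_index_not_dvd\<close>
  applies.\<close>

theorem p_integral_basisI:
  assumes root: "ieval P \<alpha> = 0" and p: "prime p" and len: "length ws = 4"
    and gen: "\<And>w. w \<in> set ws \<Longrightarrow> \<exists>G e. w = ieval G \<alpha> / of_int p ^ e \<and>
      (\<forall>N \<beta>. padic_norm (N :: algebraic_number \<Rightarrow> real) p \<longrightarrow> ieval P \<beta> = 0 \<longrightarrow> N (ieval G \<beta>) \<le> N (of_int p) ^ e)"
    and span: "\<And>G v. degree G < 4 \<Longrightarrow>
      (\<And>N \<beta>. padic_norm (N :: algebraic_number \<Rightarrow> real) p \<Longrightarrow> ieval P \<beta> = 0 \<Longrightarrow> N (ieval G \<beta>) \<le> N (of_int p) ^ v) \<Longrightarrow>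
      ieval G \<alpha> / of_int p ^ v \<in> loc_span p ws"
  shows "p_integral_basis p \<alpha> ws"
proof -
  have p0: "p \<noteq> 0" using p by auto
  have sub: "w \<in> ring_of_ints \<alpha>" if w: "w \<in> set ws" for w
  proof -
    obtain G e where G: "w = ieval G \<alpha> / of_int p ^ e"
      "\<And>N \<beta>. padic_norm (N :: algebraic_number \<Rightarrow> real) p \<Longrightarrow> ieval P \<beta> = 0 \<Longrightarrow> N (ieval G \<beta>) \<le> N (of_int p) ^ e"
      using gen[OF w] by blast
    have wG: "w = ieval G \<alpha> / of_int (p ^ e)" using G(1) by simp
    have "N (ieval G \<beta>) \<le> N (of_int (p ^ e))"
      if N: "padic_norm (N :: algebraic_number \<Rightarrow> real) p'" and r: "ieval P \<beta> = 0" for p' N \<beta>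
    proof -
      interpret padic_norm N p' by fact
      show ?thesis
      proof (cases "N (of_int p) < 1")
        case True
        then have "p' dvd p" by (simp add: N_of_int_less_1_iff)
        then have "p' = p" using primes_dvd_imp_eq[OF prime_p p] by simp
        then show ?thesis using G(2)[of N \<beta>] N r by (simp add: N_power)
      next
        case False
        then have "N (of_int p) = 1" using N_of_int_le_1[of p] by simp
        then show ?thesis using N_ieval_le_1[OF N_le_1_at_root[OF N r]] by (simp add: N_power)
      qed
    qed
    then have "algebraic_int w" unfolding wG using algebraic_int_iff_norms[OF root, of "p ^ e" G] p0 by simp
    moreover have "w \<in> simple_ext \<alpha>"
      unfolding wG by (intro divide_in_simple_ext ieval_in_simple_ext unital_subring_of_int[OF simple_ext_subring])
    ultimately show ?thesis by (simp add: ring_of_ints_def)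
  qed
  have loc: "x \<in> loc_span p ws" if x: "x \<in> ring_of_ints \<alpha>" for x
  proof -
    obtain G D where GD: "degree G < 4" "D \<noteq> 0" "x = ieval G \<alpha> / of_int D"
      "\<And>p N \<beta>. padic_norm (N :: algebraic_number \<Rightarrow> real) p \<Longrightarrow> ieval P \<beta> = 0 \<Longrightarrow> N (ieval G \<beta>) \<le> N (of_int D)"
      using x unfolding ring_of_ints_iff[OF root] by blast
    define v where "v = multiplicity p D"
    define D0 where "D0 = D div p ^ v"
    have D: "D = p ^ v * D0" unfolding D0_def v_def by (simp add: multiplicity_dvd)
    have nd: "\<not> p dvd D0"
      unfolding D0_def v_def using GD(2) p not_prime_unit by (intro multiplicity_decompose) blast+
    have "N (ieval G \<beta>) \<le> N (of_int p) ^ v"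
      if N: "padic_norm (N :: algebraic_number \<Rightarrow> real) p" and r: "ieval P \<beta> = 0" for N \<beta>
    proof -
      interpret padic_norm N p by fact
      show ?thesis using GD(4)[OF N r] N_of_int_eq_1[OF nd] unfolding D by (simp add: N_mult N_power)
    qed
    from span[OF GD(1) this] have "ieval G \<alpha> / of_int p ^ v \<in> loc_span p ws" .
    moreover have "of_int D0 * x = ieval G \<alpha> / of_int p ^ v"
      unfolding GD(3) D using GD(2) D by (simp add: field_simps)
    ultimately show ?thesis using loc_span_cancel[OF p _ nd] by simp
  qed
  obtain c where c: "c \<noteq> 0" "\<And>x. x \<in> ring_of_ints \<alpha> \<Longrightarrow> \<exists>H. degree H < 4 \<and> of_int c * x = ieval H \<alpha>"
    using common_denominator[OF root] by blast
  have "\<exists>k. k \<noteq> 0 \<and> of_int k * \<alpha> ^ i \<in> int_span ws" for i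
  proof -
    have "ieval (monom 1 i) \<alpha> \<in> loc_span p ws" by (intro loc ieval_in_ring_of_ints root)
    then have "\<alpha> ^ i \<in> loc_span p ws" by (simp add: ieval_def poly_monom of_int_hom.map_poly_hom_monom)
    then obtain k where k: "\<not> p dvd k" "of_int k * \<alpha> ^ i \<in> int_span ws" unfolding loc_span_def by blast
    then have "k \<noteq> 0" by auto
    with k(2) show ?thesis by blast
  qed
  then obtain k where k: "\<And>i. k i \<noteq> 0" "\<And>i. of_int (k i) * \<alpha> ^ i \<in> int_span ws" by metis
  \<comment> \<open>\<open>c\<close> carries all integers of the field into
    \<open>\<int>[\<alpha>]\<close>, and the \<open>k i\<close> carry the four powers of
    \<open>\<alpha>\<close> into the span.\<close>
  define E where "E = \<bar>c * (\<Prod>i<4. k i)\<bar>"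
  have E0: "E > 0" using c(1) k(1) by (simp add: E_def)
  have div: "of_int E * x \<in> int_span ws" if x: "x \<in> ring_of_ints \<alpha>" for x
  proof -
    obtain H where H: "degree H < 4" "of_int c * x = ieval H \<alpha>" using c(2)[OF x] by blast
    have "of_int (\<Prod>i<4. k i) * (of_int c * x) = (\<Sum>i<4. of_int (\<Prod>i<4. k i) * (of_int (coeff H i) * \<alpha> ^ i))"
    proof -
      have "ieval H \<alpha> = (\<Sum>i<4. of_int (coeff H i) * \<alpha> ^ i)"
        unfolding ieval_altdef by (rule sum.mono_neutral_left) (use H(1) in \<open>auto simp: coeff_eq_0\<close>)
      then show ?thesis unfolding H(2) by (simp add: sum_distrib_left)
    qed
    also have "\<dots> \<in> int_span ws"
    proof (rule int_span_sum)
      fix i :: nat assume i: "i \<in> {..<4}"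
      have "(\<Prod>i<4. k i) = k i * (\<Prod>j\<in>{..<4} - {i}. k j)" using i by (simp add: prod.remove)
      then have "of_int (\<Prod>i<4. k i) * (of_int (coeff H i) * \<alpha> ^ i) =
         of_int (coeff H i * (\<Prod>j\<in>{..<4} - {i}. k j)) * (of_int (k i) * \<alpha> ^ i)"
        by simp
      then show "of_int (\<Prod>i<4. k i) * (of_int (coeff H i) * \<alpha> ^ i) \<in> int_span ws"
        using int_span_mult[OF k(2)] by metis
    qed
    finally have m: "of_int (c * (\<Prod>i<4. k i)) * x \<in> int_span ws" by (simp add: mult_ac)
    have "E = c * (\<Prod>i<4. k i) \<or> E = - 1 * (c * (\<Prod>i<4. k i))" unfolding E_def by linarith
    then show ?thesis using m int_span_mult[OF m, of "-1"] by (auto simp: mult.assoc)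
  qed
  have mul: "of_int k * x \<in> ring_of_ints \<alpha>" if x: "x \<in> ring_of_ints \<alpha>" for k x
  proof -
    have O0: "0 \<in> ring_of_ints \<alpha>" using ring_of_ints_diff[OF root x x] by simp
    have add: "y + z \<in> ring_of_ints \<alpha>" if "y \<in> ring_of_ints \<alpha>" "z \<in> ring_of_ints \<alpha>" for y z
      using ring_of_ints_diff[OF root that(1) ring_of_ints_diff[OF root O0 that(2)]] by simp
    have n: "of_nat m * x \<in> ring_of_ints \<alpha>" for m
      by (induction m) (auto simp: O0 ring_distribs intro: add x)
    show ?thesis
    proof (cases "k \<ge> 0")
      case True then show ?thesis using n[of "nat k"] by simp
    next
      case False
      then have "of_int k * x = 0 - of_nat (nat (- k)) * x" by simp
      then show ?thesis using ring_of_ints_diff[OF root O0 n] by simp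
    qed
  qed
  have O0: "0 \<in> ring_of_ints \<alpha>" using ieval_in_ring_of_ints[OF root, of 0] by simp
  have spansub: "int_span ws \<subseteq> ring_of_ints \<alpha>"
  proof
    fix x assume "x \<in> int_span ws"
    then obtain d where d: "x = (\<Sum>i<length ws. of_int (d i) * ws ! i)" unfolding int_span_def by blast
    have add: "y + z \<in> ring_of_ints \<alpha>" if "y \<in> ring_of_ints \<alpha>" "z \<in> ring_of_ints \<alpha>" for y z
      using ring_of_ints_diff[OF root that(1) ring_of_ints_diff[OF root O0 that(2)]] by simp
    have "(\<Sum>i\<in>I. of_int (d i) * ws ! i) \<in> ring_of_ints \<alpha>" if "I \<subseteq> {..<length ws}" for I
      using finite_subset[OF that finite_lessThan] that
      by (induction I rule: finite_induct) (auto intro: O0 add[OF mul[OF sub[OF nth_mem]]])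
    then show "x \<in> ring_of_ints \<alpha>" unfolding d by blast
  qed
  have "\<not> p dvd int (add_index (ring_of_ints \<alpha>) (int_span ws))"
  proof (rule add_index_not_dvd[OF O0 _ int_span_zero int_span_diff spansub p finite_cosets[OF E0 div]])
    show "\<exists>k. \<not> p dvd k \<and> of_int k * x \<in> int_span ws" if "x \<in> ring_of_ints \<alpha>" for x
      using loc[OF that] unfolding loc_span_def by blast
  qed (use ring_of_ints_diff[OF root] in auto)
  then show ?thesis unfolding p_integral_basis_def using len sub by auto
qed

end

section \<open>The residue fields of the integers and of Z[xi]\<close>

context padic_norm
begin

lemma N_ieval_eq_m:
  assumes "poly_mod.eq_m p f g" "N x \<le> 1"
  shows "N (ieval f x - ieval g x) < 1"
proof -
  have "poly_mod.M p (coeff f i) = poly_mod.M p (coeff g i)" for i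
    using assms(1) by (metis poly_mod.Mp_coeff)
  then have d: "p dvd coeff (f - g) i" for i
    unfolding poly_mod.M_def by (simp add: mod_eq_dvd_iff)
  have "N (ieval (f - g) x) < 1"
    unfolding ieval_def
    by (intro N_poly_less_1 assms(2)) (use d in \<open>simp add: small_def coeff_map_poly N_of_int_less_1_iff flip: of_int_diff\<close>)
  then show ?thesis by simp
qed

end

lemma eq_mI: "(\<And>i. p dvd coeff (f - g) i) \<Longrightarrow> poly_mod.eq_m p f g"
  by (intro poly_eqI) (simp add: poly_mod.Mp_coeff poly_mod.M_def mod_eq_dvd_iff)

lemma eq_mD: "poly_mod.eq_m p f g \<Longrightarrow> p dvd coeff (f - g) i"
  by (metis poly_mod.Mp_coeff poly_mod.M_def mod_eq_dvd_iff coeff_diff)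

lemma eq_m_refl_mult: "poly_mod.eq_m p f g \<Longrightarrow> poly_mod.eq_m p (f * h) (g * h)"
  by (metis poly_mod.mult_Mp(1))

locale int_coeff_norm = padic_norm N p
  for N :: "'a::{alg_closed_field,field_char_0} \<Rightarrow> real" and p :: int
begin

sublocale Int: coeff_ring N p "\<int>"
proof
  show "unital_subring (\<int> :: 'a set)" by (auto simp: unital_subring_def)
  show "N z \<le> 1" if "z \<in> \<int>" for z using that by (auto elim!: Ints_cases simp: N_of_int_le_1)
  show "\<exists>w\<in>\<int>. N (z * w - 1) < 1" if z: "z \<in> \<int>" "N z = 1" for z
  proof -
    obtain k where k: "z = of_int k" using z(1) by (elim Ints_cases)
    have "\<not> p dvd k" using z(2) N_of_int_less_1_iff[of k] k by simp
    then have "gcd p k = 1" using prime_imp_coprime[OF prime_p] by simp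
    then obtain u v where uv: "u * p + v * k = 1" using bezout_int by metis
    have "z * of_int v - 1 = of_int (- u * p)"
      unfolding k using arg_cong[OF uv, of "of_int :: int \<Rightarrow> 'a"] by (simp add: algebra_simps)
    then have "N (z * of_int v - 1) < 1" using N_of_int_less_1_iff[of "- u * p"] by simp
    then show ?thesis by auto
  qed
  show "\<exists>w\<in>\<int>. z = of_int p * w" if z: "z \<in> \<int>" "N z < 1" for z
  proof -
    obtain k where k: "z = of_int k" using z(1) by (elim Ints_cases)
    then have "p dvd k" using z(2) N_of_int_less_1_iff by simp
    then obtain l where "k = p * l" by auto
    then show ?thesis using k by (intro bexI[of _ "of_int l"]) auto
  qed
qed

lemma ints_poly_lift: "poly_over \<int> (g :: 'a poly) \<Longrightarrow> \<exists>G. g = map_poly of_int G"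
  by (metis intpolyE poly_over_def)

lemma ints_small_iff: "small (map_poly of_int G) \<longleftrightarrow> (\<forall>i. p dvd coeff G i)"
  by (simp add: small_def coeff_map_poly N_of_int_less_1_iff)

end

text \<open>The residue field of \<open>\<int>[\<xi>]\<close> is \<open>\<F>\<^sub>\<phi>\<close>.\<close>

locale residue_root = int_coeff_norm N p
  for N :: "'a::{alg_closed_field,field_char_0} \<Rightarrow> real" and p :: int +
  fixes \<phi> :: "int poly" and \<xi> :: 'a
  assumes phi_monic: "lead_coeff \<phi> = 1" and phi_irr: "poly_mod.irreducible_m p \<phi>"
    and phi_root: "ieval \<phi> \<xi> = 0" and phi_deg: "degree \<phi> > 0"
begin

lemma N_xi: "N \<xi> \<le> 1"
  by (rule N_root_le_1[of "map_poly of_int \<phi>"])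
     (use phi_root phi_monic N_of_int_le_1 in \<open>simp_all add: ieval_def coeff_map_poly degree_map_poly\<close>)

lemma N_ieval_less_1_of_dvdm:
  assumes "poly_mod.dvdm p \<phi> g" shows "N (ieval g \<xi>) < 1"
proof -
  obtain h where "poly_mod.eq_m p g (\<phi> * h)" using assms by (auto simp: poly_mod.dvdm_def)
  from N_ieval_eq_m[OF this N_xi] show ?thesis using phi_root by simp
qed

text \<open>The minimal polynomial \<open>\<Psi>\<close> of the residue of \<open>\<xi>\<close>
  divides both \<open>\<phi>\<close> and \<open>g\<close> modulo \<open>p\<close>. It is not a unit,
  so its cofactor \<open>h\<close> in the irreducible \<open>\<phi>\<close> is one, and
  \<open>\<phi>\<close> divides \<open>g\<close> too.\<close>

lemma dvdm_of_N_ieval_less_1: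
  assumes g: "N (ieval g \<xi>) < 1"
  shows "poly_mod.dvdm p \<phi> g"
proof -
  have over: "poly_over \<int> (map_poly of_int G :: 'a poly)" for G by (simp add: poly_over_def coeff_map_poly)
  have ns: "\<not> small (map_poly of_int \<phi> :: 'a poly)"
    by (rule Int.not_small_lead) (simp add: degree_map_poly coeff_map_poly phi_monic)
  have small_val: "N (poly (map_poly of_int \<phi>) \<xi>) < 1" using phi_root by (simp add: ieval_def)
  obtain \<psi> where psi: "poly_over \<int> \<psi>" "N (poly \<psi> \<xi>) < 1"
    and min: "\<And>g. poly_over \<int> g \<Longrightarrow> N (poly g \<xi>) < 1 \<Longrightarrow>
       \<exists>h r. poly_over \<int> h \<and> poly_over \<int> r \<and> g = \<psi> * h + r \<and> degree r < degree \<psi> \<and> small r"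
    using Int.ex_minimal_polynomial[OF over ns small_val N_xi] by blast
  obtain \<Psi> where Psi: "\<psi> = map_poly of_int \<Psi>" using ints_poly_lift[OF psi(1)] by blast
  have div: "\<exists>h. poly_mod.eq_m p G (\<Psi> * h)" if G: "N (ieval G \<xi>) < 1" for G
  proof -
    obtain h r where hr: "poly_over \<int> h" "map_poly of_int G = \<psi> * h + r" "small r"
      using min[OF over] G unfolding ieval_def by blast
    obtain H where H: "h = map_poly of_int H" using ints_poly_lift[OF hr(1)] by blast
    have "r = map_poly of_int (G - \<Psi> * H)" using hr(2) by (simp add: Psi H hom_distribs)
    then have "\<forall>i. p dvd coeff (G - \<Psi> * H) i" using hr(3) ints_small_iff by metis
    then show ?thesis using eq_mI by blast
  qed
  obtain h where h: "poly_mod.eq_m p \<phi> (\<Psi> * h)" using div[of \<phi>] phi_root by auto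
  obtain k where k: "poly_mod.eq_m p g (\<Psi> * k)" using div[OF g] by blast
  have "\<not> poly_mod.dvdm p \<Psi> 1"
  proof
    assume "poly_mod.dvdm p \<Psi> 1"
    then obtain l where "poly_mod.eq_m p 1 (\<Psi> * l)" by (auto simp: poly_mod.dvdm_def)
    from N_ieval_eq_m[OF this N_xi] have 1: "N (1 - ieval \<Psi> \<xi> * ieval l \<xi>) < 1" by simp
    have "N (ieval \<Psi> \<xi> * ieval l \<xi>) < 1"
      using N_mult_less_1[OF N_ieval_le_1[OF N_xi, of l], of "ieval \<Psi> \<xi>"] psi(2)
      by (simp add: Psi ieval_def mult.commute)
    from N_add_less[OF 1 this] show False by simp
  qed
  then have "poly_mod.dvdm p h 1" using phi_irr h unfolding poly_mod.irreducible_m_def by blast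
  then obtain l where l: "poly_mod.eq_m p 1 (h * l)" by (auto simp: poly_mod.dvdm_def)
  have "poly_mod.eq_m p (\<phi> * (l * k)) (\<Psi> * h * (l * k))" by (rule eq_m_refl_mult[OF h])
  moreover have "poly_mod.eq_m p (1 * (\<Psi> * k)) (h * l * (\<Psi> * k))" by (rule eq_m_refl_mult[OF l])
  ultimately have "poly_mod.eq_m p g (\<phi> * (l * k))" using k by (simp add: mult_ac)
  then show ?thesis unfolding poly_mod.dvdm_def by blast
qed

definition Zx :: "'a set" where "Zx = range (\<lambda>g. ieval g \<xi>)"

lemma Zx_mem [simp]: "ieval g \<xi> \<in> Zx" by (simp add: Zx_def)

lemma Zx_of_int [simp]: "of_int k \<in> Zx"
  using Zx_mem[of "[:k:]"] by simp

text \<open>Division by \<open>p\<close> comes from divisibility by \<open>\<phi>\<close> modulo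
  \<open>p\<close>. Inverses come from finiteness: two powers of a unit \<open>z\<close> have the
  same coefficients modulo \<open>p\<close>, and cancelling the smaller power leaves a power of
  \<open>z\<close> as inverse.\<close>

sublocale coeff_ring N p Zx
proof
  show "unital_subring Zx"
    unfolding unital_subring_def Zx_def
  proof (intro conjI ballI)
    show "1 \<in> range (\<lambda>g. ieval g \<xi>)" by (metis ieval_simps(2) rangeI)
    fix x y assume "x \<in> range (\<lambda>g. ieval g \<xi>)" "y \<in> range (\<lambda>g. ieval g \<xi>)"
    then obtain g h where "x = ieval g \<xi>" "y = ieval h \<xi>" by blast
    then have "x - y = ieval (g - h) \<xi>" "x * y = ieval (g * h) \<xi>" by simp_all
    then show "x - y \<in> range (\<lambda>g. ieval g \<xi>)" "x * y \<in> range (\<lambda>g. ieval g \<xi>)" by blast+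
  qed
  show "N z \<le> 1" if "z \<in> Zx" for z using that N_ieval_le_1[OF N_xi] by (auto simp: Zx_def)
  show "\<exists>w\<in>Zx. z = of_int p * w" if z: "z \<in> Zx" "N z < 1" for z
  proof -
    obtain g where g: "z = ieval g \<xi>" using z(1) by (auto simp: Zx_def)
    obtain h where h: "poly_mod.eq_m p g (\<phi> * h)"
      using dvdm_of_N_ieval_less_1[of g] z(2) g by (auto simp: poly_mod.dvdm_def)
    define r where "r = map_poly (\<lambda>c. c div p) (g - \<phi> * h)"
    have "g - \<phi> * h = smult p r"
      using eq_mD[OF h] by (auto simp: poly_eq_iff r_def coeff_map_poly)
    from arg_cong[OF this, of "\<lambda>f. ieval f \<xi>"] have "z = of_int p * ieval r \<xi>" using g phi_root by simp
    then show ?thesis by auto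
  qed
  show "\<exists>w\<in>Zx. N (z * w - 1) < 1" if z: "z \<in> Zx" "N z = 1" for z
  proof -
    obtain g where g: "z = ieval g \<xi>" using z(1) by (auto simp: Zx_def)
    have "\<exists>r. degree r < degree \<phi> \<and> ieval r \<xi> = z ^ m" for m
    proof -
      obtain s r where "g ^ m = \<phi> * s + r" "degree r < degree \<phi>"
        by (rule monic_divmod[OF phi_monic phi_deg])
      then show ?thesis using phi_root g ieval_simps(6)[of g m \<xi>] by (intro exI[of _ r]) auto
    qed
    then obtain R where R: "\<And>m. degree (R m) < degree \<phi>" "\<And>m. ieval (R m) \<xi> = z ^ m" by metis
    define code where "code m = map (\<lambda>i. coeff (R m) i mod p) [0..<degree \<phi>]" for m
    have "range code \<subseteq> {xs. set xs \<subseteq> {0..<p} \<and> length xs = degree \<phi>}"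
      using prime_gt_0_int[OF prime_p] by (auto simp: code_def)
    then have "finite (range code)" by (rule finite_subset) (intro finite_lists_length_eq finite_atLeastLessThan_int)
    then have "\<not> inj code" using finite_imageD[of code UNIV] infinite_UNIV_nat by blast
    then obtain m m' where m: "m < m'" "code m = code m'"
      unfolding inj_def by (metis linorder_neqE_nat)
    have "poly_mod.eq_m p (R m') (R m)"
    proof (rule eq_mI)
      fix i
      show "p dvd coeff (R m' - R m) i"
      proof (cases "i < degree \<phi>")
        case True
          then have "code m ! i = code m' ! i" using m(2) by simp
          then have e: "coeff (R m) i mod p = coeff (R m') i mod p" using True by (simp add: code_def)
          then have "coeff (R m') i mod p = coeff (R m) i mod p" by (rule sym)
          then show ?thesis by (simp add: mod_eq_dvd_iff)
      next
        case False
        then show ?thesis using R(1)[of m] R(1)[of m'] by (simp add: coeff_eq_0)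
      qed
    qed
    from N_ieval_eq_m[OF this N_xi] have "N (z ^ m' - z ^ m) < 1" unfolding R(2) .
    moreover have "z ^ m' - z ^ m = z ^ m * (z * z ^ (m' - m - 1) - 1)"
    proof -
      have "m' = m + Suc (m' - m - 1)" using m(1) by simp
      then have "z ^ m' = z ^ m * (z * z ^ (m' - m - 1))" by (metis power_add power_Suc)
      then show ?thesis by (simp add: right_diff_distrib)
    qed
    ultimately have "N (z * z ^ (m' - m - 1) - 1) < 1" using z(2) by (simp add: N_mult N_power)
    moreover have "z ^ (m' - m - 1) \<in> Zx" unfolding g by (simp only: ieval_simps(6)[symmetric] Zx_mem)
    ultimately show ?thesis by blast
  qed
qed

text \<open>Degrees add over the residue field: in the coefficient at \<open>d + t\<close> only the
  product of the two last units has norm 1.\<close>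

lemma top_unit_mult:
  assumes G: "\<And>i. N (coeff G i) \<le> 1" "N (coeff G d) = 1" "\<And>i. i > d \<Longrightarrow> N (coeff G i) < 1"
    and H: "\<And>i. N (coeff H i) \<le> 1" "N (coeff H t) = 1" "\<And>i. i > t \<Longrightarrow> N (coeff H i) < 1"
  shows "N (coeff (G * H) (d + t)) = 1"
proof -
  have "coeff (G * H) (d + t) = (\<Sum>i\<in>{..d + t} - {d}. coeff G i * coeff H (d + t - i)) + coeff G d * coeff H t"
    by (simp add: coeff_mult sum.remove[of _ d])
  moreover have "N (\<Sum>i\<in>{..d + t} - {d}. coeff G i * coeff H (d + t - i)) < 1"
  proof (intro N_sum_less)
    fix i assume i: "i \<in> {..d + t} - {d}"
    show "N (coeff G i * coeff H (d + t - i)) < 1"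
    proof (cases "i < d")
      case True
      then show ?thesis using N_mult_less_1[OF G(1) H(3), of "d + t - i" i] by simp
    next
      case False
      then have "i > d" using i by auto
      then show ?thesis using N_mult_less_1[OF H(1) G(3), of i "d + t - i"] by (simp add: mult.commute)
    qed
  qed simp
  ultimately show ?thesis using N_add_eq[of _ "coeff G d * coeff H t"] G(2) H(2) by (simp add: N_mult)
qed

definition ev_xi :: "int poly poly \<Rightarrow> 'a poly" where "ev_xi F = map_poly (\<lambda>g. ieval g \<xi>) F"

lemma coeff_ev_xi: "coeff (ev_xi F) n = ieval (coeff F n) \<xi>"
  by (simp add: ev_xi_def coeff_map_poly)

lemma ev_xi_simps: "ev_xi (F - G) = ev_xi F - ev_xi G" "ev_xi (F * G) = ev_xi F * ev_xi G" "ev_xi 1 = 1"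
  by (auto simp: poly_eq_iff coeff_ev_xi coeff_mult ieval_sum)

lemma ev_xi_over: "poly_over Zx (ev_xi F)" by (simp add: poly_over_def coeff_ev_xi)

lemma ev_xi_lift:
  assumes "poly_over Zx G" obtains G0 where "G = ev_xi G0"
proof -
  define g0 where "g0 z = (if z = 0 then 0 else (SOME g. ieval g \<xi> = z))" for z
  have "ieval (g0 z) \<xi> = z" if "z \<in> Zx" for z
  proof (cases "z = 0")
    case False
    obtain g where "ieval g \<xi> = z" using \<open>z \<in> Zx\<close> unfolding Zx_def by auto
    then have "ieval (SOME g. ieval g \<xi> = z) \<xi> = z" by (rule someI)
    then show ?thesis using False by (simp add: g0_def)
  qed (simp add: g0_def)
  then have "G = ev_xi (map_poly g0 G)"
    using assms by (auto simp: poly_eq_iff coeff_ev_xi coeff_map_poly g0_def[of 0] poly_over_def)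
  then show thesis by (rule that)
qed

lemma small_ev_xi_iff: "small (ev_xi F - ev_xi G) \<longleftrightarrow> res_eq p \<phi> F G"
  unfolding small_def res_eq_def ev_xi_simps[symmetric] coeff_ev_xi
  using N_ieval_less_1_of_dvdm dvdm_of_N_ieval_less_1 by (auto simp del: ieval_simps)

text \<open>A unit of \<open>\<F>\<^sub>\<phi>[Y]\<close> has degree 0, so the unit provided by
  \<open>res_squarefree\<close> is residually constant.\<close>

lemma residually_squarefree_ev_xi:
  assumes "res_squarefree p \<phi> F"
  shows "residually_squarefree (ev_xi F)"
  unfolding residually_squarefree_def
proof (intro allI impI)
  fix G H and n :: nat assume G: "poly_over Zx G" and H: "poly_over Zx H" and sm: "small (ev_xi F - G * G * H)" and n: "1 \<le> n"
  obtain G0 where G0: "G = ev_xi G0" by (rule ev_xi_lift[OF G])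
  obtain H0 where H0: "H = ev_xi H0" by (rule ev_xi_lift[OF H])
  have "res_eq p \<phi> F (G0\<^sup>2 * H0)"
    using sm unfolding small_ev_xi_iff[symmetric] G0 H0 by (simp add: ev_xi_simps power2_eq_square)
  then obtain H1 where "res_eq p \<phi> 1 (G0 * H1)" using assms unfolding res_squarefree_def by blast
  then have one: "small (1 - G * ev_xi H1)" unfolding small_ev_xi_iff[symmetric] G0 by (simp add: ev_xi_simps)
  let ?K = "ev_xi H1"
  have K: "poly_over Zx ?K" by (rule ev_xi_over)
  have c0: "\<not> small (1 :: 'a poly)" by (auto simp: small_def intro!: exI[of _ 0])
  have nG: "\<not> small G" using one small_add[OF one small_mult_over(2)[OF K, of G]] c0 by auto
  have nK: "\<not> small ?K" using one small_add[OF one small_mult_over(1)[OF G, of ?K]] c0 by auto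
  obtain d where d: "N (coeff G d) = 1" "\<And>i. i > d \<Longrightarrow> N (coeff G i) < 1" using top_unit_coeff[OF G nG] by blast
  obtain t where t: "N (coeff ?K t) = 1" "\<And>i. i > t \<Longrightarrow> N (coeff ?K i) < 1" using top_unit_coeff[OF K nK] by blast
  have u: "N (coeff (G * ?K) (d + t)) = 1"
    by (rule top_unit_mult[OF coeff_le_1[OF G] d coeff_le_1[OF K] t])
  have "d + t = 0"
  proof (rule ccontr)
    assume "d + t \<noteq> 0"
    then have "coeff (1 - G * ?K) (d + t) = - coeff (G * ?K) (d + t)" by simp
    then show False using one u unfolding small_def by (metis N_minus less_irrefl)
  qed
  then show "N (coeff G n) < 1" using d(2)[of n] n by simp
qed

lemma residually_squarefree_cong:
  assumes "residually_squarefree R" "small (R - R')"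
  shows "residually_squarefree R'"
  using assms small_trans unfolding residually_squarefree_def by blast

text \<open>Over the residue field twice the degree of \<open>G\<close> is at most 1.\<close>

lemma residually_squarefree_degree_1:
  assumes R: "poly_over Zx R" "degree R = 1" "N (lead_coeff R) = 1"
  shows "residually_squarefree R"
  unfolding residually_squarefree_def
proof (intro allI impI)
  fix G H and n :: nat assume G: "poly_over Zx G" and H: "poly_over Zx H" and sm: "small (R - G * G * H)" and n: "1 \<le> n"
  have nR: "\<not> small R" by (rule not_small_lead[OF R(3)])
  have nG: "\<not> small G"
  proof
    assume "small G"
    then have "small (G * (G * H))" using G H over_Z by (intro small_mult_over(2)) auto
    then show False using nR small_add[OF sm, of "G * G * H"] by (simp add: mult.assoc)
  qed
  have nH: "\<not> small H"
  proof
    assume "small H"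
    then have "small ((G * G) * H)" using G over_Z by (intro small_mult_over(1)) auto
    then show False using nR small_add[OF sm, of "G * G * H"] by simp
  qed
  obtain d where d: "N (coeff G d) = 1" "\<And>i. i > d \<Longrightarrow> N (coeff G i) < 1" using top_unit_coeff[OF G nG] by blast
  obtain t where t: "N (coeff H t) = 1" "\<And>i. i > t \<Longrightarrow> N (coeff H i) < 1" using top_unit_coeff[OF H nH] by blast
  show "N (coeff G n) < 1"
  proof (cases "d = 0")
    case True
    then show ?thesis using d(2) n by auto
  next
    case False
    have GG: "N (coeff (G * G) (d + d)) = 1" by (rule top_unit_mult[OF coeff_le_1[OF G] d coeff_le_1[OF G] d])
    have over: "poly_over Zx (G * G)" using G over_Z by blast
    have GGs: "N (coeff (G * G) i) < 1" if "i > d + d" for i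
      unfolding coeff_mult
    proof (intro N_sum_less)
      fix k assume "k \<in> {..i}"
      show "N (coeff G k * coeff G (i - k)) < 1"
      proof (cases "k > d")
        case True
        then show ?thesis using N_mult_less_1[OF coeff_le_1[OF G] d(2), of k "i - k"] by (simp add: mult.commute)
      next
        case False
        then have "i - k > d" using that by simp
        then show ?thesis by (intro N_mult_less_1 coeff_le_1[OF G] d(2))
      qed
    qed simp
    have "N (coeff (G * G * H) (d + d + t)) = 1"
      by (rule top_unit_mult[OF coeff_le_1[OF over] GG GGs coeff_le_1[OF H] t])
    moreover have "coeff R (d + d + t) = 0" using R(2) False by (intro coeff_eq_0) auto
    then have "coeff (R - G * G * H) (d + d + t) = - coeff (G * G * H) (d + d + t)" by simp
    ultimately show ?thesis using sm unfolding small_def by (metis N_minus less_irrefl)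
  qed
qed

end

section \<open>Lower convex envelopes and their supporting chords\<close>

lemma affine_interpolate:
  fixes A B :: real
  assumes "s \<noteq> t"
  shows "A + B * y = ((A + B * s) * (t - y) + (A + B * t) * (y - s)) / (t - s)"
proof -
  have "(A + B * y) * (t - s) = (A + B * s) * (t - y) + (A + B * t) * (y - s)" by (simp add: algebra_simps)
  then show ?thesis using assms by (simp add: eq_divide_eq)
qed

definition chord :: "(nat \<Rightarrow> real) \<Rightarrow> nat \<Rightarrow> nat \<Rightarrow> real \<Rightarrow> real" where
  "chord u i k x = u i + (u k - u i) / (real k - real i) * (x - real i)"

lemma chord_ends: "i < k \<Longrightarrow> chord u i k (real i) = u i" "i < k \<Longrightarrow> chord u i k (real k) = u k"
  by (simp_all add: chord_def)

lemma chord_interpolate: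
  assumes "s \<noteq> t"
  shows "chord u i k y = (chord u i k s * (t - y) + chord u i k t * (y - s)) / (t - s)"
proof -
  define B where "B = (u k - u i) / (real k - real i)"
  define A where "A = u i - B * real i"
  have e: "chord u i k x = A + B * x" for x unfolding chord_def A_def B_def[symmetric] by (simp add: algebra_simps)
  show ?thesis unfolding e by (rule affine_interpolate[OF assms])
qed

text \<open>The side covering the unit interval from \<open>j\<close> minimises the height of the chord at its
  midpoint; among the minimisers take one of maximal length.\<close>

lemma ex_supporting_chord:
  fixes u :: "nat \<Rightarrow> real"
  assumes F: "finite F" "s0 \<in> F" "s0 \<le> j" "t0 \<in> F" "j < t0"
  obtains i k where "i \<in> F" "k \<in> F" "i \<le> j" "j < k" "\<And>x. x \<in> F \<Longrightarrow> chord u i k (real x) \<le> u x"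
    "\<And>x. x \<in> F \<Longrightarrow> chord u i k (real x) = u x \<Longrightarrow> i \<le> x \<and> x \<le> k"
proof -
  \<comment> \<open>A half-integral abscissa is never a vertex. So each point lies strictly to the
    left or to the right and can replace the end of the chord on that side.\<close>
  define y where "y = real j + 1 / 2"
  define V where "V z = chord u (fst z) (snd z) y" for z
  let ?P = "{z \<in> F \<times> F. fst z \<le> j \<and> j < snd z}"
  have fin: "finite ?P" using F(1) by simp
  have ne: "?P \<noteq> {}" using F by auto
  define m where "m = Min (V ` ?P)"
  let ?Q = "{z \<in> ?P. V z = m}"
  have "m \<in> V ` ?P" unfolding m_def by (rule Min_in) (use fin ne in auto)
  then obtain z0 where "z0 \<in> ?P" "V z0 = m" by (elim imageE) simp
  then have "z0 \<in> ?Q" by blast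
  then have Qne: "?Q \<noteq> {}" by blast
  have finQ: "finite ?Q" by (rule finite_subset[OF _ fin]) blast
  define M where "M = Max ((\<lambda>z. snd z - fst z) ` ?Q)"
  have "M \<in> (\<lambda>z. snd z - fst z) ` ?Q" unfolding M_def by (rule Max_in) (use finQ Qne in auto)
  then obtain z where z: "z \<in> ?Q" "M = snd z - fst z" by auto
  obtain i k where ik: "z = (i, k)" by force
  have I: "i \<in> F" "k \<in> F" "i \<le> j" "j < k" "chord u i k y = m" using z(1) ik by (auto simp: V_def)
  have low: "m \<le> chord u s t y" if "s \<in> F" "t \<in> F" "s \<le> j" "j < t" for s t
  proof -
    have "(s, t) \<in> ?P" using that by simp
    then have "m \<le> V (s, t)" unfolding m_def by (intro Min_le finite_imageI fin imageI)
    then show ?thesis by (simp add: V_def)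
  qed
  have long: "t - s \<le> k - i" if "s \<in> F" "t \<in> F" "s \<le> j" "j < t" "chord u s t y = m" for s t
  proof -
    have "(s, t) \<in> ?Q" using that by (auto simp: V_def)
    then have "(\<lambda>z. snd z - fst z) (s, t) \<in> (\<lambda>z. snd z - fst z) ` ?Q" by (rule imageI)
    then have "(\<lambda>z. snd z - fst z) (s, t) \<le> M" unfolding M_def by (intro Max_ge finite_imageI finQ)
    then show ?thesis using z(2) ik by simp
  qed
  have weighted: "(a' * w + b * v) / z - (a * w + b * v) / z = (a' - a) * (w / z)" for a a' b v w z :: real
  proof -
    have "(a' * w + b * v) / z - (a * w + b * v) / z = (a' * w + b * v - (a * w + b * v)) / z"
      by (rule diff_divide_distrib[symmetric])
    then show ?thesis by (simp add: left_diff_distrib)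
  qed
  \<comment> \<open>Exchanging an end for \<open>x\<close> raises the chord at \<open>y\<close> by a
    positive multiple of the height of \<open>x\<close> above the old chord. Minimality of
    \<open>m\<close> then gives support, and maximality of the length confines the points on the
    chord.\<close>
  have left: "chord u x k y - m = (u x - chord u i k (real x)) * ((real k - y) / (real k - real x))"
    if "x \<le> j" for x
  proof -
    have ne: "real x \<noteq> real k" using that I by simp
    have "x < k" using that I by simp
    have 1: "m = (chord u i k (real x) * (real k - y) + u k * (y - real x)) / (real k - real x)"
      using chord_interpolate[OF ne, of u i k y] I by (simp add: chord_ends)
    have 2: "chord u x k y = (u x * (real k - y) + u k * (y - real x)) / (real k - real x)"
      using chord_interpolate[OF ne, of u x k y] \<open>x < k\<close> by (simp add: chord_ends)
    show ?thesis unfolding 1 2 by (rule weighted)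
  qed
  have right: "chord u i x y - m = (u x - chord u i k (real x)) * ((y - real i) / (real x - real i))"
    if "x > j" for x
  proof -
    have ne: "real i \<noteq> real x" using that I by simp
    have "i < x" using that I by simp
    have 1: "m = (chord u i k (real x) * (y - real i) + u i * (real x - y)) / (real x - real i)"
      using chord_interpolate[OF ne, of u i k y] I by (simp add: chord_ends add.commute)
    have 2: "chord u i x y = (u x * (y - real i) + u i * (real x - y)) / (real x - real i)"
      using chord_interpolate[OF ne, of u i x y] \<open>i < x\<close> by (simp add: chord_ends add.commute)
    show ?thesis unfolding 1 2 by (rule weighted)
  qed
  have yk: "real k - y > 0" and yi: "y - real i > 0" using I unfolding y_def by linarith+
  show thesis
  proof (rule that[OF I(1-4)])
    fix x assume x: "x \<in> F"
    show "chord u i k (real x) \<le> u x"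
    proof (cases "x \<le> j")
      case True
      have "0 \<le> chord u x k y - m" using low[OF x I(2) True I(4)] by simp
      moreover have "(real k - y) / (real k - real x) > 0" using True I yk by simp
      ultimately show ?thesis unfolding left[OF True] by (simp only: zero_le_mult_iff) linarith
    next
      case False
      then have xj: "x > j" by simp
      have "0 \<le> chord u i x y - m" using low[OF I(1) x I(3) xj] by simp
      moreover have "(y - real i) / (real x - real i) > 0" using xj I yi by simp
      ultimately show ?thesis unfolding right[OF xj] by (simp only: zero_le_mult_iff) linarith
    qed
    assume eq: "chord u i k (real x) = u x"
    show "i \<le> x \<and> x \<le> k"
    proof (cases "x \<le> j")
      case True
      then have "chord u x k y = m" using left[OF True] eq by simp
      from long[OF x I(2) True I(4) this] show ?thesis using True I by auto
    next
      case False
      then have xj: "x > j" by simp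
      then have "chord u i x y = m" using right[OF xj] eq by simp
      from long[OF I(1) x I(3) xj this] show ?thesis using xj I by auto
    qed
  qed
qed

lemma newton_line_chord:
  "newton_line p \<phi> P i k j = chord (\<lambda>i. real (the_enat (newton_u p \<phi> P i))) i k (real j)"
  by (simp add: newton_line_def chord_def Let_def)

lemma newton_points_hull_ge:
  assumes "\<And>s v. s \<le> newton_len \<phi> P \<Longrightarrow> newton_u p \<phi> P s = enat v \<Longrightarrow> A + B * real s \<le> real v"
    and "(x, y) \<in> convex hull (newton_points p \<phi> P)"
  shows "A + B * x \<le> y"
proof -
  have "newton_points p \<phi> P \<subseteq> {z. inner (- B, 1) z \<ge> A}"
    using assms(1) by (fastforce simp: newton_points_def)
  then have "convex hull (newton_points p \<phi> P) \<subseteq> {z. inner (- B, 1) z \<ge> A}"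
    by (rule hull_minimal) (rule convex_halfspace_ge)
  then show ?thesis using assms(2) by auto
qed

lemma newton_polygon_le:
  assumes "(x, y) \<in> convex hull (newton_points p \<phi> P)"
  shows "newton_polygon p \<phi> P x \<le> y"
  unfolding newton_polygon_def
proof (rule cInf_lower)
  show "y \<in> {y. (x, y) \<in> convex hull newton_points p \<phi> P}" using assms by simp
  show "bdd_below {y. (x, y) \<in> convex hull newton_points p \<phi> P}"
    by (rule bdd_belowI[of _ 0]) (use newton_points_hull_ge[of \<phi> P p 0 0 x] in auto)
qed

text \<open>Convexity bounds the polygon by the chord from above; from below, the half plane over
  the chord contains all points and hence their hull.\<close>

lemma newton_polygon_on_chord:
  assumes ik: "i < k" "k \<le> newton_len \<phi> P" "newton_u p \<phi> P i = enat ui" "newton_u p \<phi> P k = enat uk"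
    and supp: "\<And>s v. s \<le> newton_len \<phi> P \<Longrightarrow> newton_u p \<phi> P s = enat v \<Longrightarrow> newton_line p \<phi> P i k s \<le> real v"
    and j: "i \<le> j" "j \<le> k"
  shows "newton_polygon p \<phi> P (real j) = newton_line p \<phi> P i k j"
proof -
  define B where "B = (real uk - real ui) / (real k - real i)"
  define A where "A = real ui - B * real i"
  have line: "newton_line p \<phi> P i k s = A + B * real s" for s
  proof -
    have "newton_line p \<phi> P i k s = real ui + B * (real s - real i)"
      unfolding newton_line_def ik(3,4) Let_def B_def by simp
    then show ?thesis unfolding A_def by (simp add: right_diff_distrib)
  qed
  have "newton_polygon p \<phi> P (real j) = A + B * real j"
    unfolding newton_polygon_def
  proof (rule cInf_eq_minimum)
    define t where "t = (real j - real i) / (real k - real i)"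
    have t: "0 \<le> t" "t \<le> 1" using ik(1) j by (auto simp: t_def)
    have comb: "(1 - t) * x + t * y = x + t * (y - x)" for x y :: real by (simp add: algebra_simps)
    have pts: "(real i, real ui) \<in> convex hull newton_points p \<phi> P" "(real k, real uk) \<in> convex hull newton_points p \<phi> P"
      using ik by (auto intro!: hull_inc simp: newton_points_def)
    have "(1 - t) *\<^sub>R (real i, real ui) + t *\<^sub>R (real k, real uk) \<in> convex hull newton_points p \<phi> P"
      by (rule convexD[OF convex_convex_hull pts]) (use t in auto)
    moreover have "(1 - t) * real i + t * real k = real j"
    proof -
      have "t * (real k - real i) = real j - real i" using ik(1) by (simp add: t_def)
      then show ?thesis unfolding comb by simp
    qed
    moreover have "(1 - t) * real ui + t * real uk = A + B * real j"
    proof -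
      have "t * (real uk - real ui) = B * (real j - real i)" by (simp add: B_def t_def)
      then show ?thesis unfolding comb A_def by (simp add: right_diff_distrib)
    qed
    ultimately show "A + B * real j \<in> {y. (real j, y) \<in> convex hull newton_points p \<phi> P}" by simp
  next
    fix y assume "y \<in> {y. (real j, y) \<in> convex hull newton_points p \<phi> P}"
    then show "A + B * real j \<le> y"
      using newton_points_hull_ge[of \<phi> P p A B "real j" y] supp unfolding line by simp
  qed
  then show ?thesis using line by simp
qed

lemma vp_poly_const: "vp_poly p [:c:] = vp p c"
  unfolding vp_poly_def
proof (rule antisym)
  show "(INF i. vp p (coeff [:c:] i)) \<le> vp p c" by (rule INF_lower2[of 0]) auto
  show "vp p c \<le> (INF i. vp p (coeff [:c:] i))"
    by (rule INF_greatest) (auto simp: coeff_pCons vp_def split: nat.split)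
qed

lemma monic_basis:
  fixes B :: "nat \<Rightarrow> int poly"
  assumes "\<And>j. j < n \<Longrightarrow> degree (B j) = j \<and> lead_coeff (B j) = 1" "degree G < n \<or> G = 0"
  shows "\<exists>d. G = (\<Sum>j<n. smult (d j) (B j))"
  using assms
proof (induction n arbitrary: G)
  case 0
  then show ?case by simp
next
  case (Suc n)
  define G' where "G' = G - smult (coeff G n) (B n)"
  have B: "degree (B n) = n" "coeff (B n) n = 1" using Suc.prems(1)[of n] by auto
  have "coeff G' i = 0" if "i \<ge> n" for i
    using that B Suc.prems(2) by (cases "i = n") (auto simp: G'_def coeff_eq_0)
  then have "degree G' < n \<or> G' = 0"
    by (metis leading_coeff_0_iff not_le)
  moreover have B': "\<And>j. j < n \<Longrightarrow> degree (B j) = j \<and> lead_coeff (B j) = 1" using Suc.prems(1) less_SucI by blast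
  ultimately obtain d where d: "G' = (\<Sum>j<n. smult (d j) (B j))" using Suc.IH[OF B'] by blast
  have "G = (\<Sum>j<Suc n. smult ((d(n := coeff G n)) j) (B j))"
  proof -
    have "(\<Sum>j<n. smult ((d(n := coeff G n)) j) (B j)) = G'" unfolding d by (rule sum.cong) auto
    then show ?thesis by (simp add: G'_def)
  qed
  then show ?case by blast
qed

context newton_data
begin

text \<open>Let \<open>M\<close> be the largest \<open>N (c j) * q powr A j\<close>. If it exceeded
  \<open>C\<close>, the sum would be below \<open>M\<close> at all roots, and
  \<open>coordinates_less\<close> would push the largest term below itself.\<close>

lemma coordinates_le:
  assumes cov: "\<And>j. j < n \<Longrightarrow>
      \<exists>i d e h u t. good_side i d e h u t \<and> i \<le> j \<and> j < i + d * e \<and> A j = lin i e h u j"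
    and c: "\<And>j. c j \<in> Z" and C: "C > 0"
    and all: "\<And>\<beta>. poly f \<beta> = 0 \<Longrightarrow> N (\<Sum>j<n. c j * b j \<beta>) \<le> C"
    and j: "j < n"
  shows "N (c j) \<le> C * q powr (- A j)"
proof (rule ccontr)
  assume neg: "\<not> ?thesis"
  define V where "V j = N (c j) * q powr A j" for j
  have V: "N (c j) = V j * q powr (- A j)" for j using q_pos by (simp add: V_def mult.assoc flip: powr_add)
  define M where "M = Max (V ` {..<n})"
  have ge: "V j \<le> M" if "j < n" for j unfolding M_def using that by (intro Max_ge) auto
  have "M \<in> V ` {..<n}" unfolding M_def by (rule Max_in) (use j in auto)
  then obtain j0 where j0: "j0 < n" "V j0 = M" by auto
  have "C < V j" using neg unfolding V[of j] using q_powr_pos by (simp add: not_le)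
  then have MC: "C < M" using ge[OF j] by simp
  have "N (c j0) < M * q powr (- A j0)"
  proof (rule coordinates_less[where ?j1.0 = 0])
    show "\<exists>i d e h u t. good_side i d e h u t \<and> i \<le> j \<and> j < i + d * e \<and> A j = lin i e h u j" if "j < n" for j
      by (rule cov[OF that])
    show "N (c j) \<le> M * q powr (- A j)" if "j < n" for j
      unfolding V[of j] using ge[OF that] q_pos by (intro mult_right_mono) auto
    show "N (\<Sum>j\<in>{0..<n}. c j * b j \<beta>) < M" if "poly f \<beta> = 0" for \<beta>
      using all[OF that] MC by (simp add: atLeast0LessThan)
  qed (use c C MC j0 in auto)
  then show False unfolding V[of j0] j0(2) by simp
qed

lemma b_bound_all_roots:
  assumes S: "good_side i d e h u t" and j: "i \<le> j" "j < i + d * e"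
    and x: "poly f x = 0" "x \<noteq> 0"
  shows "N (b j x) \<le> q powr lin i e h u j" "N (a j) \<le> q powr lin i e h u j"
proof -
  have "N x > 0" using x(2) N_nonneg[of x] by (simp add: less_le)
  then obtain m where "N x = q powr m"
    using q_pos q_less_1 by (intro that[of "log q (N x)"]) simp
  then show "N (b j x) \<le> q powr lin i e h u j" using b_bound_good_side(1)[OF S j x(1)] by blast
  show "N (a j) \<le> q powr lin i e h u j" using good_sideD(9)[OF S, of j] good_sideD(3)[OF S] j by simp
qed

end

section \<open>Linear phi: the polygon of P(X + c)\<close>

locale linear_lift = monic_irreducible P
  for P :: "int poly" +
  fixes p c :: int and \<phi> :: "int poly"
  assumes prime_p: "prime p" and phi: "\<phi> = [:- c, 1:]" and phi_irr: "poly_mod.irreducible_m p \<phi>"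
    and regular: "phi_regular p \<phi> P"
begin

text \<open>For \<open>\<phi> = X - c\<close> the \<open>\<phi>\<close>-adic development of
  \<open>P\<close> is the expansion of \<open>P(X + c)\<close>, so the \<open>\<phi>\<close>-polygon
  is the ordinary polygon of \<open>Pc\<close>.\<close>

definition Pc :: "int poly" where "Pc = pcompose P [:c, 1:]"

lemma Pc_deg: "degree Pc = 4" "lead_coeff Pc = 1" "coeff Pc 4 = 1"
proof -
  show "degree Pc = 4" using deg_P by (simp add: Pc_def degree_pcompose)
  have "lead_coeff (pcompose P [:c, 1:]) = lead_coeff P * lead_coeff [:c, 1:] ^ degree P"
    by (rule lead_coeff_comp) simp
  then show "lead_coeff Pc = 1" using monic by (simp add: Pc_def)
  then show "coeff Pc 4 = 1" using \<open>degree Pc = 4\<close> by simp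
qed

lemma ieval_Pc: "ieval Pc x = ieval P (x + of_int c)" for x :: "'b::field_char_0"
  by (simp add: Pc_def ieval_def of_int_hom.map_poly_pcompose poly_pcompose hom_distribs add.commute)

lemma phi_dev_eq: "phi_dev \<phi> P = (\<lambda>i. [:coeff Pc i:])"
proof -
  have lp: "lead_coeff \<phi> = 1" "degree \<phi> > 0" "degree \<phi> = 1" using phi by auto
  have "P = pcompose Pc \<phi>"
  proof -
    have "pcompose [:c, 1:] [:- c, 1:] = ([:0, 1:] :: int poly)" by (simp add: pcompose_pCons)
    then show ?thesis unfolding Pc_def pcompose_assoc[symmetric] phi by (simp only: pcompose_idR)
  qed
  also have "\<dots> = (\<Sum>i\<le>4. [:coeff Pc i:] * \<phi> ^ i)"
    unfolding pcompose_altdef poly_altdef using Pc_deg by (simp add: degree_map_poly coeff_map_poly)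
  finally have "is_phi_dev \<phi> P (\<lambda>i. [:coeff Pc i:])"
    unfolding is_phi_dev_def using lp deg_P Pc_deg by (auto simp: coeff_eq_0)
  then show ?thesis
    unfolding phi_dev_def using is_phi_dev_unique[OF lp(1,2), of P] by (intro the1_equality)
qed

lemma len: "newton_len \<phi> P = 4" using deg_P phi by (simp add: newton_len_def)

definition cs :: "nat \<Rightarrow> int" where "cs s = coeff Pc (4 - s)"

lemma newton_u_eq: "newton_u p \<phi> P s = vp p (cs s)"
  by (simp add: newton_u_def phi_dev_eq len vp_poly_const cs_def)

lemma newton_u_enat: "newton_u p \<phi> P s = enat v \<longleftrightarrow> cs s \<noteq> 0 \<and> multiplicity p (cs s) = v"
  by (auto simp: newton_u_eq vp_def)

lemma cs_0: "cs 0 = 1" using Pc_deg by (simp add: cs_def)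

lemma cs_4_nz: "cs 4 \<noteq> 0"
proof
  assume "cs 4 = 0"
  then have "poly Pc 0 = 0" by (simp add: cs_def poly_0_coeff_0)
  then have "poly P c = 0" by (simp add: Pc_def poly_pcompose)
  then have "[:- c, 1:] dvd P" by (simp add: poly_eq_0_iff_dvd)
  then obtain s where s: "P = [:- c, 1:] * s" by auto
  then have "is_unit [:- c, 1:] \<or> is_unit s" using irr irreducibleD by blast
  moreover have "\<not> is_unit [:- c, 1:]" using dvd_imp_degree_le[of "[:- c, 1:]" 1] by auto
  ultimately have "degree s = 0" using dvd_imp_degree_le[of s 1] by auto
  then have "degree P \<le> 1" using degree_mult_le[of "[:- c, 1:]" s] s by simp
  then show False using deg_P by simp
qed

definition NP :: "nat \<Rightarrow> real" where "NP j = newton_polygon p \<phi> P (real j)"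

lemma newton_h_eq: "newton_h p \<phi> P j = nat \<lfloor>NP j\<rfloor>" by (simp add: newton_h_def NP_def)

text \<open>The last hypothesis of \<open>ex_good_side\<close> below: the part of slope zero is harmless when the
  cofactor of the power of \<open>\<phi>\<close> is squarefree modulo \<open>p\<close>.\<close>

definition head_poly :: "nat \<Rightarrow> int poly" where
  "head_poly k = (\<Sum>r\<le>k. monom (cs r) (k - r))"

lemma coeff_head_poly: "coeff (head_poly k) m = (if m \<le> k then cs (k - m) else 0)"
proof -
  have "coeff (head_poly k) m = (\<Sum>r\<le>k. if r = k - m \<and> m \<le> k then cs r else 0)"
    unfolding head_poly_def coeff_sum by (rule sum.cong) auto
  then show ?thesis by (cases "m \<le> k") auto
qed

text \<open>\<open>head_poly k\<close> is the residual polynomial of a horizontal side from abscissa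
  0 to \<open>k\<close>. Regularity speaks of sides of positive slope only, so its squarefreeness
  has to come from elsewhere.\<close>

definition head_squarefree :: "nat \<Rightarrow> bool" where
  "head_squarefree k \<longleftrightarrow> (\<forall>G H. (\<forall>i. p dvd coeff (head_poly k - G * G * H) i) \<longrightarrow> (\<forall>n\<ge>1. p dvd coeff G n))"

end

locale linear_lift_norm = linear_lift P p c \<phi> + padic_norm N p
  for P :: "int poly" and p c :: int and \<phi> :: "int poly" and N :: "algebraic_number \<Rightarrow> real"
begin

sublocale RR: residue_root N p \<phi> "of_int c"
  by unfold_locales (use phi phi_irr in simp_all)

sublocale ND: newton_data N p RR.Zx "map_poly of_int Pc" 4
proof
  show "poly_over RR.Zx (map_poly of_int Pc)" by (simp add: poly_over_def coeff_map_poly)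
  show "degree (map_poly of_int Pc :: algebraic_number poly) = 4" using Pc_deg by (simp add: degree_map_poly)
  show "lead_coeff (map_poly of_int Pc :: algebraic_number poly) = 1"
    using Pc_deg by (simp add: degree_map_poly coeff_map_poly)
qed

lemma a_eq: "ND.a s = of_int (cs s)" by (simp add: ND.a_def cs_def coeff_map_poly)

lemma N_of_int_mult: "k \<noteq> 0 \<Longrightarrow> N (of_int k) = q powr real (multiplicity p k)"
proof -
  assume k: "k \<noteq> 0"
  let ?m = "multiplicity p k"
  have "\<not> p dvd k div p ^ ?m" using k prime_p not_prime_unit by (intro multiplicity_decompose) blast+
  moreover have "k = p ^ ?m * (k div p ^ ?m)" by (simp add: multiplicity_dvd)
  ultimately have "N (of_int k) = q ^ ?m"
    using N_of_int_eq_1[of "k div p ^ ?m"] N_mult[of "of_int p ^ ?m" "of_int (k div p ^ ?m)"]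
    by (metis N_p_power mult.right_neutral of_int_mult of_int_power)
  then show ?thesis by (simp add: q_powr_real)
qed

lemma Zx_ints: "RR.Zx = \<int>"
proof
  have "ieval g (of_int c :: algebraic_number) = of_int (poly g c)" for g
    by (induction g) simp_all
  then show "RR.Zx \<subseteq> \<int>" unfolding RR.Zx_def by auto
  show "\<int> \<subseteq> RR.Zx" by (auto elim: Ints_cases)
qed

lemma head_residually_squarefree:
  "head_squarefree k \<longleftrightarrow> RR.residually_squarefree (map_poly of_int (head_poly k))"
proof
  assume sq: "head_squarefree k"
  show "RR.residually_squarefree (map_poly of_int (head_poly k))"
    unfolding RR.residually_squarefree_def
  proof (intro allI impI)
    fix G H and n :: nat
    assume GH: "poly_over RR.Zx G" "poly_over RR.Zx H" and sm: "small (map_poly of_int (head_poly k) - G * G * H)" and n: "1 \<le> n"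
    obtain G0 where G0: "G = map_poly of_int G0" using RR.ints_poly_lift GH(1) Zx_ints by auto
    obtain H0 where H0: "H = map_poly of_int H0" using RR.ints_poly_lift GH(2) Zx_ints by auto
    have "map_poly of_int (head_poly k) - G * G * H = map_poly of_int (head_poly k - G0 * G0 * H0)"
      unfolding G0 H0 by (simp add: hom_distribs)
    then have "\<forall>i. p dvd coeff (head_poly k - G0 * G0 * H0) i" using sm RR.ints_small_iff by metis
    then have "p dvd coeff G0 n" using sq n unfolding head_squarefree_def by blast
    then show "N (coeff G n) < 1" unfolding G0 by (simp add: coeff_map_poly N_of_int_less_1_iff)
  qed
next
  assume sq: "RR.residually_squarefree (map_poly of_int (head_poly k))"
  show "head_squarefree k"
    unfolding head_squarefree_def
  proof (intro allI impI)
    fix G H and n :: nat assume d: "\<forall>i. p dvd coeff (head_poly k - G * G * H) i" and n: "1 \<le> n"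
    let ?m = "map_poly of_int :: int poly \<Rightarrow> algebraic_number poly"
    have "small (?m (head_poly k - G * G * H))" using d RR.ints_small_iff by blast
    then have "small (?m (head_poly k) - ?m G * ?m G * ?m H)" by (simp add: hom_distribs)
    moreover have "poly_over RR.Zx (?m K)" for K by (simp add: poly_over_def coeff_map_poly)
    ultimately have "N (coeff (?m G) n) < 1" using sq n unfolding RR.residually_squarefree_def by blast
    then show "p dvd coeff G n" by (simp add: coeff_map_poly N_of_int_less_1_iff)
  qed
qed

text \<open>The supporting chord over the interval from \<open>j\<close> to \<open>j + 1\<close> is
  a side. With positive slope it is a \<open>principal_side\<close>, and regularity makes its
  residual polynomial squarefree; with slope 0 the hypothesis \<open>zero\<close> does.\<close>

lemma ex_good_side:
  assumes j: "j < 4"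
    and zero: "\<And>k. j < k \<Longrightarrow> k \<le> 4 \<Longrightarrow> \<not> p dvd cs k \<Longrightarrow> (\<And>s. k < s \<Longrightarrow> s \<le> 4 \<Longrightarrow> p dvd cs s) \<Longrightarrow> head_squarefree k"
  shows "\<exists>i d e h u t. ND.good_side i d e h u t \<and> i \<le> j \<and> j < i + d * e \<and> NP j = ND.lin i e h u j"
proof -
  define u where "u s = real (multiplicity p (cs s))" for s
  let ?F = "{s. s \<le> 4 \<and> cs s \<noteq> 0}"
  have F: "finite ?F" "0 \<in> ?F" "4 \<in> ?F" using cs_0 cs_4_nz by auto
  obtain i k where ik: "i \<in> ?F" "k \<in> ?F" "i \<le> j" "j < k"
    and supp: "\<And>x. x \<in> ?F \<Longrightarrow> chord u i k (real x) \<le> u x"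
    and tight: "\<And>x. x \<in> ?F \<Longrightarrow> chord u i k (real x) = u x \<Longrightarrow> i \<le> x \<and> x \<le> k"
    using ex_supporting_chord[OF F(1,2) _ F(3) j, of u] by blast
  define ui where "ui = multiplicity p (cs i)"
  define uk where "uk = multiplicity p (cs k)"
  have uik: "u i = real ui" "u k = real uk" by (simp_all add: u_def ui_def uk_def)
  have ik_lt: "i < k" using ik by simp
  have Ui: "newton_u p \<phi> P i = enat ui" and Uk: "newton_u p \<phi> P k = enat uk"
    using ik by (auto simp: newton_u_enat ui_def uk_def)
  have line: "newton_line p \<phi> P i k s = chord u i k (real s)" for s
    unfolding newton_line_def Ui Uk Let_def chord_def uik by simp
  have supp': "newton_line p \<phi> P i k s \<le> real v" if "s \<le> newton_len \<phi> P" "newton_u p \<phi> P s = enat v" for s v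
    using that supp[of s] unfolding line len newton_u_enat by (auto simp: u_def)
  have NPj: "NP j = newton_line p \<phi> P i k j"
    unfolding NP_def by (rule newton_polygon_on_chord[OF ik_lt _ Ui Uk supp']) (use ik len in auto)
  have u0: "u 0 = 0" by (simp add: u_def cs_0)
  have upos: "u s \<ge> 0" for s by (simp add: u_def)
  define sl where "sl = (real uk - real ui) / (real k - real i)"
  have ch: "chord u i k x = real ui + sl * (x - real i)" for x unfolding chord_def uik sl_def ..
  \<comment> \<open>The leading coefficient gives the point (0, 0) and no point lies below the axis,
    so a supporting chord cannot descend.\<close>
  have ui_le: "ui \<le> uk"
  proof (rule ccontr)
    assume "\<not> ui \<le> uk"
    then have "sl < 0" unfolding sl_def using ik_lt by (simp add: divide_neg_pos)
    have "chord u i k 0 \<le> 0" using supp[of 0] F(2) u0 by simp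
    moreover have "chord u i k (real k) = real uk" using chord_ends(2)[OF ik_lt] uik by simp
    moreover have "chord u i k 0 = chord u i k (real k) - sl * real k" unfolding ch by (simp add: algebra_simps)
    moreover have "sl * real k < 0" using \<open>sl < 0\<close> ik_lt by (simp add: mult_neg_pos)
    ultimately show False by linarith
  qed
  define d where "d = gcd (k - i) (uk - ui)"
  define e where "e = (k - i) div d"
  define h where "h = (uk - ui) div d"
  have d0: "d > 0" using ik_lt by (simp add: d_def)
  have de: "k - i = d * e" "uk - ui = d * h" unfolding e_def h_def d_def by simp_all
  have e0: "e > 0" using de(1) ik_lt by (cases e) auto
  have geh: "gcd e h = 1" unfolding e_def h_def d_def
    by (rule coprime_imp_gcd_eq_1, rule div_gcd_coprime) (use ik_lt in linarith)
  have kde: "i + d * e = k" using de(1) ik_lt by simp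
  have sl: "sl = real h / real e"
  proof -
    have "real uk - real ui = real d * real h" using de(2) ui_le by (metis of_nat_diff of_nat_mult)
    moreover have "real k - real i = real d * real e" using de(1) ik_lt by (metis less_imp_le of_nat_diff of_nat_mult)
    ultimately show ?thesis unfolding sl_def using d0 by simp
  qed
  have lin: "ND.lin i e h ui s = chord u i k (real s)" for s unfolding ND.lin_def ch sl by (simp add: mult.commute)
  have lin_pt: "chord u i k (real (i + r * e)) = real (ui + r * h)" for r
    unfolding lin[symmetric] using ND.lin_lattice[OF e0] by simp
  \<comment> \<open>Coefficients divided by the power of \<open>p\<close> that the chord prescribes.
    A point strictly above the chord leaves the residue 0, as in the definition of the residual
    polynomial.\<close>
  define t where "t r = (of_int (cs (i + r * e) div p ^ (ui + r * h)) :: algebraic_number)" for r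
  have le4: "i + r * e \<le> 4" if "r \<le> d" for r
  proof -
    have "k \<le> 4" using ik by simp
    then show ?thesis using mult_le_mono1[OF that, of e] kde by linarith
  qed
  have dvd: "p ^ (ui + r * h) dvd cs (i + r * e)" if "r \<le> d" for r
  proof (cases "cs (i + r * e) = 0")
    case False
    then have "chord u i k (real (i + r * e)) \<le> u (i + r * e)" using le4[OF that] by (intro supp) auto
    then have "ui + r * h \<le> multiplicity p (cs (i + r * e))" unfolding lin_pt u_def by linarith
    then show ?thesis by (rule multiplicity_dvd')
  qed simp
  have t_eq: "of_int (cs (i + r * e)) = of_int p ^ (ui + r * h) * t r" if "r \<le> d" for r
    unfolding t_def using dvd[OF that] by (metis dvd_mult_div_cancel of_int_mult of_int_power)
  have t_unit: "N (t r) = 1" if "r \<le> d" "cs (i + r * e) \<noteq> 0" "multiplicity p (cs (i + r * e)) = ui + r * h" for r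
  proof -
    have "\<not> p dvd cs (i + r * e) div p ^ (ui + r * h)"
      using multiplicity_decompose[OF that(2), of p] that(3) prime_p not_prime_unit by metis
    then show ?thesis unfolding t_def by (rule N_of_int_eq_1)
  qed
  have t_small: "N (t r) < 1" if "r \<le> d" "cs (i + r * e) = 0 \<or> multiplicity p (cs (i + r * e)) \<noteq> ui + r * h" for r
  proof (cases "cs (i + r * e) = 0")
    case True
    then show ?thesis by (simp add: t_def)
  next
    case False
    then have "chord u i k (real (i + r * e)) \<le> u (i + r * e)" using le4[OF that(1)] by (intro supp) auto
    then have "ui + r * h \<le> multiplicity p (cs (i + r * e))" unfolding lin_pt u_def by linarith
    then have "Suc (ui + r * h) \<le> multiplicity p (cs (i + r * e))" using that False by auto
    then have "p ^ Suc (ui + r * h) dvd cs (i + r * e)" by (rule multiplicity_dvd')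
    then have "p ^ (ui + r * h) * p dvd p ^ (ui + r * h) * (cs (i + r * e) div p ^ (ui + r * h))"
      using dvd[OF that(1)] by (simp add: mult.commute)
    then have "p dvd cs (i + r * e) div p ^ (ui + r * h)" using prime_p by simp
    then show ?thesis unfolding t_def by (simp add: N_of_int_less_1_iff)
  qed
  have sq: "RR.residually_squarefree (ND.res_poly d t)"
  proof (cases "ui < uk")
    case True
    have "principal_side p \<phi> P i k"
      unfolding principal_side_def
    proof (intro conjI allI impI)
      show "i < k" by (rule ik_lt)
      show "k \<le> newton_len \<phi> P" using ik len by auto
      show "newton_u p \<phi> P i < newton_u p \<phi> P k" "newton_u p \<phi> P k < \<infinity>" unfolding Ui Uk using True by auto
      fix s v assume s: "s \<le> newton_len \<phi> P" "newton_u p \<phi> P s = enat v"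
      show "newton_line p \<phi> P i k s \<le> real v" by (rule supp'[OF s])
      assume "newton_line p \<phi> P i k s = real v"
      then have "chord u i k (real s) = u s" "s \<in> ?F"
        using s unfolding line len newton_u_enat by (auto simp: u_def)
      then show "i \<le> s" "s \<le> k" using tight[of s] by auto
    qed
    then have "res_squarefree p \<phi> (residual_poly p \<phi> P i k)" using regular unfolding phi_regular_def by blast
    then have sqe: "RR.residually_squarefree (RR.ev_xi (residual_poly p \<phi> P i k))" by (rule RR.residually_squarefree_ev_xi)
    have res: "residual_poly p \<phi> P i k = (\<Sum>s\<le>d. monom (residual_coeff p \<phi> P i k (i + s * e)) (d - s))"
      unfolding residual_poly_def Let_def Ui Uk by (simp add: d_def[symmetric] e_def[symmetric])
    have cf: "coeff (residual_poly p \<phi> P i k) m = (if m \<le> d then residual_coeff p \<phi> P i k (i + (d - m) * e) else 0)" for m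
    proof -
      have "coeff (residual_poly p \<phi> P i k) m =
         (\<Sum>s\<le>d. if s = d - m \<and> m \<le> d then residual_coeff p \<phi> P i k (i + s * e) else 0)"
        unfolding res coeff_sum by (rule sum.cong) auto
      then show ?thesis by (cases "m \<le> d") auto
    qed
    have rc: "N (ieval (residual_coeff p \<phi> P i k (i + r * e)) (of_int c) - t r) < 1" if r: "r \<le> d" for r
    proof (cases "cs (i + r * e) = 0 \<or> multiplicity p (cs (i + r * e)) \<noteq> ui + r * h")
      case True
      have "residual_coeff p \<phi> P i k (i + r * e) = 0"
      proof (cases "cs (i + r * e) = 0")
        case True
        then have "newton_u p \<phi> P (i + r * e) = \<infinity>" by (simp add: newton_u_eq vp_def)
        then show ?thesis unfolding residual_coeff_def by simp
      next
        case False
        then have U: "newton_u p \<phi> P (i + r * e) = enat (multiplicity p (cs (i + r * e)))" by (simp add: newton_u_enat)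
        have "newton_line p \<phi> P i k (i + r * e) \<noteq> real (multiplicity p (cs (i + r * e)))"
          unfolding line lin_pt using True False by (simp only: of_nat_eq_iff) auto
        then show ?thesis unfolding residual_coeff_def U by simp
      qed
      then show ?thesis using t_small[OF r True] by simp
    next
      case False
      then have U: "newton_u p \<phi> P (i + r * e) = enat (ui + r * h)" by (simp add: newton_u_enat)
      have "newton_line p \<phi> P i k (i + r * e) = real (ui + r * h)" unfolding line lin_pt ..
      then have "residual_coeff p \<phi> P i k (i + r * e) = [:cs (i + r * e):] div [:p ^ (ui + r * h):]"
        unfolding residual_coeff_def U by (simp add: phi_dev_eq len cs_def)
      also have "\<dots> = [:cs (i + r * e) div p ^ (ui + r * h):]"
        using dvd[OF r] by (subst div_const_poly_conv_map_poly) (auto simp: poly_eq_iff coeff_map_poly coeff_pCons split: nat.split)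
      finally show ?thesis by (simp add: t_def)
    qed
    have "small (RR.ev_xi (residual_poly p \<phi> P i k) - ND.res_poly d t)"
      unfolding small_def
    proof
      fix m
      show "N (coeff (RR.ev_xi (residual_poly p \<phi> P i k) - ND.res_poly d t) m) < 1"
        using rc[of "d - m"] by (simp add: RR.coeff_ev_xi cf ND.coeff_res_poly)
    qed
    then show ?thesis by (rule RR.residually_squarefree_cong[OF sqe])
  next
    case False
    \<comment> \<open>A horizontal supporting chord has (0, 0) on or above it, so it lies on the
      axis; \<open>tight\<close> then makes it start at abscissa 0.\<close>
    then have eq: "uk = ui" using ui_le by simp
    then have sl0: "sl = 0" by (simp add: sl_def)
    have h0: "h = 0" using eq d0 de(2) by auto
    have ui0: "ui = 0" using supp[of 0] F(2) u0 unfolding ch sl0 by simp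
    have "i \<le> 0" using tight[of 0] F(2) u0 unfolding ch sl0 ui0 by simp
    then have i0: "i = 0" by simp
    have e1: "e = 1" using geh h0 by simp
    have dk: "d = k" using kde e1 i0 by simp
    have "\<not> p dvd cs k"
    proof -
      have "multiplicity p (cs k) = 0" using eq ui0 by (simp add: uk_def)
      moreover have "\<not> is_unit p" using prime_p not_prime_unit by blast
      ultimately show ?thesis using multiplicity_eq_zero_iff[of "cs k" p] ik by simp
    qed
    moreover have "p dvd cs s" if "k < s" "s \<le> 4" for s
    proof (cases "cs s = 0")
      case False
      then have "s \<in> ?F" using that by simp
      then have "u s \<noteq> 0" using tight[of s] that(1) unfolding ch sl0 ui0 by auto
      then show ?thesis unfolding u_def by (metis not_dvd_imp_multiplicity_0 of_nat_0)
    qed simp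
    ultimately have "head_squarefree k" using zero[of k] ik by auto
    then have "RR.residually_squarefree (map_poly of_int (head_poly k))" using head_residually_squarefree by simp
    moreover have "map_poly of_int (head_poly k) = ND.res_poly d t"
      by (rule poly_eqI) (simp add: coeff_map_poly coeff_head_poly ND.coeff_res_poly t_def i0 e1 h0 ui0 dk)
    ultimately show ?thesis by simp
  qed
  have "ND.good_side i d e h ui t"
    unfolding ND.good_side_def
  proof (intro conjI allI impI)
    show "0 < d" "0 < e" "gcd e h = 1" using d0 e0 geh by auto
    show "i + d * e \<le> 4" using kde ik by simp
    show "RR.residually_squarefree (ND.res_poly d t)" by (rule sq)
    fix r assume r: "r \<le> d"
    show "t r \<in> RR.Zx" unfolding t_def by simp
    show "ND.a (i + r * e) = of_int p ^ (ui + r * h) * t r" unfolding a_eq by (rule t_eq[OF r])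
  next
    show "N (t 0) = 1" using t_unit[of 0] ik ui_def by simp
    have "uk = ui + d * h" using de(2) ui_le by simp
    then show "N (t d) = 1" using t_unit[of d] ik uk_def kde by simp
  next
    fix s :: nat assume s: "s \<le> 4"
    show le: "N (ND.a s) \<le> q powr ND.lin i e h ui s"
    proof (cases "cs s = 0")
      case True
      then show ?thesis using q_powr_pos by (simp add: a_eq less_imp_le)
    next
      case False
      then have "chord u i k (real s) \<le> real (multiplicity p (cs s))" using supp[of s] s by (auto simp: u_def)
      then show ?thesis unfolding a_eq N_of_int_mult[OF False] lin by (rule q_powr_le)
    qed
    assume out: "s < i \<or> i + d * e < s"
    show "N (ND.a s) < q powr ND.lin i e h ui s"
    proof (cases "cs s = 0")
      case True
      then show ?thesis using q_powr_pos by (simp add: a_eq)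
    next
      case False
      then have sF: "s \<in> ?F" using s by simp
      have "chord u i k (real s) \<noteq> u s" using tight[OF sF] out kde by auto
      then have "chord u i k (real s) < real (multiplicity p (cs s))" using supp[OF sF] by (simp add: u_def)
      then show ?thesis unfolding a_eq N_of_int_mult[OF False] lin by (rule q_powr_less)
    qed
  qed
  moreover have "NP j = ND.lin i e h ui j" unfolding NPj line lin ..
  ultimately show ?thesis using ik kde by blast
qed

end

lemma eq_m_iff_smult: "poly_mod.eq_m p f g \<longleftrightarrow> (\<exists>r. f - g = smult p r)"
proof
  assume e: "poly_mod.eq_m p f g"
  have "f - g = smult p (map_poly (\<lambda>c. c div p) (f - g))"
  proof (rule poly_eqI)
    fix i
    have "p dvd coeff (f - g) i" by (rule eq_mD[OF e])
    then show "coeff (f - g) i = coeff (smult p (map_poly (\<lambda>c. c div p) (f - g))) i"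
      by (simp add: coeff_map_poly del: coeff_diff)
  qed
  then show "\<exists>r. f - g = smult p r" by blast
next
  assume "\<exists>r. f - g = smult p r"
  then show "poly_mod.eq_m p f g" by (auto intro!: eq_mI)
qed

lemma eq_m_pcompose: "poly_mod.eq_m p f g \<Longrightarrow> poly_mod.eq_m p (pcompose f h) (pcompose g h)"
  unfolding eq_m_iff_smult by (metis pcompose_diff pcompose_smult)

lemma eq_m_coeff_dvd: "poly_mod.eq_m p f g \<Longrightarrow> p dvd coeff f i \<longleftrightarrow> p dvd coeff g i"
  using eq_mD[of p f g i] by (metis coeff_diff dvd_diff_right_iff diff_add_cancel dvd_add_right_iff)

lemma pcompose_shift_inverse: "pcompose (pcompose f [:c, 1:]) [:- c, 1:] = (f :: int poly)"
  and pcompose_shift_inverse': "pcompose (pcompose f [:- c, 1:]) [:c, 1:] = (f :: int poly)"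
proof -
  have "pcompose [:c, 1:] [:- c, 1:] = ([:0, 1:] :: int poly)" "pcompose [:- c, 1:] [:c, 1:] = ([:0, 1:] :: int poly)"
    by (simp_all add: pcompose_pCons)
  then show "pcompose (pcompose f [:c, 1:]) [:- c, 1:] = f" "pcompose (pcompose f [:- c, 1:]) [:c, 1:] = f"
    unfolding pcompose_assoc[symmetric] by (simp_all only: pcompose_idR)
qed

lemma ieval_pcompose: "ieval (pcompose F [:c, 1:]) x = ieval F (x + of_int c)" for x :: "'b::field_char_0"
  by (simp add: ieval_def of_int_hom.map_poly_pcompose poly_pcompose hom_distribs add.commute)

context linear_lift_norm
begin

lemma N_le_imp_dvd: "N (of_int k) \<le> q ^ m \<Longrightarrow> p ^ m dvd k"
proof (cases "k = 0")
  case False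
  assume "N (of_int k) \<le> q ^ m"
  then have "real m \<le> real (multiplicity p k)"
    unfolding N_of_int_mult[OF False] q_powr_real[symmetric] q_powr_le_iff .
  then show ?thesis by (intro multiplicity_dvd') simp
qed simp

text \<open>\<open>v\<close> and the multiplicity of \<open>d\<close> are integers, so the ordinate
  of the polygon can be replaced by its integral part.\<close>

lemma dvd_of_coordinate_bound:
  assumes "N (of_int d) \<le> q ^ v * q powr (- NP j)" "NP j \<ge> 0"
  shows "p ^ v dvd d * p ^ newton_h p \<phi> P j"
proof (cases "d = 0")
  case False
  have "q powr real (multiplicity p d) \<le> q powr (real v - NP j)"
    using assms(1) unfolding N_of_int_mult[OF False] q_powr_real[symmetric] by (simp add: powr_add[symmetric])
  then have "real v - NP j \<le> real (multiplicity p d)" by (simp only: q_powr_le_iff)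
  then have "int v - int (multiplicity p d) \<le> \<lfloor>NP j\<rfloor>" by (simp add: le_floor_iff)
  then have "v \<le> multiplicity p d + newton_h p \<phi> P j" unfolding newton_h_eq using assms(2) by simp
  then have "p ^ v dvd p ^ (multiplicity p d + newton_h p \<phi> P j)" by (rule le_imp_power_dvd)
  also have "\<dots> dvd d * p ^ newton_h p \<phi> P j"
    unfolding power_add by (intro mult_dvd_mono multiplicity_dvd dvd_refl)
  finally show ?thesis .
qed simp

lemma b_eq: "ND.b j x = ieval (head_poly j) x"
  unfolding ND.b_def head_poly_def ieval_sum
  by (simp add: a_eq ieval_def poly_monom of_int_hom.map_poly_hom_monom)

lemma f_eval: "poly (map_poly of_int Pc) x = ieval P (x + of_int c)" for x :: algebraic_number
  using ieval_Pc[of x] by (simp add: ieval_def)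

lemma f_root_nz: "poly (map_poly of_int Pc) (x :: algebraic_number) = 0 \<Longrightarrow> x \<noteq> 0"
proof
  assume r: "poly (map_poly of_int Pc) x = 0" and "x = 0"
  then have "of_int (coeff Pc 0) = (0 :: algebraic_number)" by (simp add: poly_0_coeff_0 coeff_map_poly)
  then show False using cs_4_nz by (simp add: cs_def)
qed

end

context linear_lift
begin

text \<open>The horizontal side ends at the last \<open>k\<close> with \<open>cs k\<close> prime to
  \<open>p\<close>. Squarefreeness is demanded only if that side covers the interval from
  \<open>j\<close> to \<open>j + 1\<close>.\<close>

definition flat_ok :: "nat \<Rightarrow> bool" where
  "flat_ok j \<longleftrightarrow> (\<forall>k. j < k \<longrightarrow> k \<le> 4 \<longrightarrow> \<not> p dvd cs k \<longrightarrow> (\<forall>s. k < s \<longrightarrow> s \<le> 4 \<longrightarrow> p dvd cs s) \<longrightarrow> head_squarefree k)"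

abbreviation hh :: "nat \<Rightarrow> nat" where "hh j \<equiv> newton_h p \<phi> P j"

lemma ex_norm_interp: "\<exists>N. linear_lift_norm P p c \<phi> N"
proof -
  obtain N :: "algebraic_number \<Rightarrow> real" where "padic_norm N p" using ex_padic_norm[OF prime_p] by blast
  then show ?thesis using linear_lift_axioms by (auto simp: linear_lift_norm_def)
qed

lemma NP_nonneg_dvd:
  assumes "j < 4" "flat_ok j"
  shows "NP j \<ge> 0" "real (hh j) \<le> NP j" "p ^ hh j dvd cs j"
proof -
  obtain N where "linear_lift_norm P p c \<phi> N" using ex_norm_interp by blast
  then interpret linear_lift_norm P p c \<phi> N .
  obtain i d e h u t where S: "ND.good_side i d e h u t" "i \<le> j" "j < i + d * e" "NP j = ND.lin i e h u j"
    using ex_good_side[OF assms(1)] assms(2) unfolding flat_ok_def by blast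
  show nn: "NP j \<ge> 0" unfolding S(4) ND.lin_def using S(2) by simp
  show le: "real (hh j) \<le> NP j" unfolding newton_h_eq using nn by simp
  have "N (of_int (cs j)) \<le> q powr NP j"
    using ND.good_sideD(9)[OF S(1), of j] assms(1) S(4) by (simp add: a_eq)
  also have "\<dots> \<le> q ^ hh j" unfolding q_powr_real[symmetric] by (rule q_powr_le[OF le])
  finally show "p ^ hh j dvd cs j" by (rule N_le_imp_dvd)
qed

text \<open>The numerator of the \<open>j\<close>-th basis element. The basis omits the last term
  \<open>cs j\<close> of the Horner sum; as \<open>p ^ hh j\<close> divides it, the quotient changes
  by an integer only.\<close>

definition W :: "nat \<Rightarrow> int poly" where "W j = pcompose (head_poly j - [:cs j:]) [:- c, 1:]"

lemma ieval_W: "ieval (W j) x = ieval (head_poly j) (x - of_int c) - of_int (cs j)" for x :: "'b::field_char_0"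
  unfolding W_def ieval_pcompose by simp

lemma W_bound:
  assumes "padic_norm (N :: algebraic_number \<Rightarrow> real) p" "ieval P \<beta> = 0" "j < 4" "flat_ok j"
  shows "N (ieval (W j) \<beta>) \<le> N (of_int p) ^ hh j"
proof -
  interpret linear_lift_norm P p c \<phi> N
    using linear_lift_axioms assms(1) by (simp add: linear_lift_norm_def)
  obtain i d e h u t where S: "ND.good_side i d e h u t" "i \<le> j" "j < i + d * e" "NP j = ND.lin i e h u j"
    using ex_good_side[OF assms(3)] assms(4) unfolding flat_ok_def by blast
  let ?x = "\<beta> - of_int c"
  have r: "poly (map_poly of_int Pc) ?x = 0" unfolding f_eval using assms(2) by simp
  note bb = ND.b_bound_all_roots[OF S(1-3) r f_root_nz[OF r]]
  have "N (ieval (W j) \<beta>) \<le> q powr NP j"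
    unfolding ieval_W S(4) using bb by (intro N_diff_le) (simp_all add: b_eq a_eq)
  also have "\<dots> \<le> q ^ hh j" unfolding q_powr_real[symmetric] by (rule q_powr_le[OF NP_nonneg_dvd(2)[OF assms(3,4)]])
  finally show ?thesis by (simp add: q_def)
qed

lemma head_poly_monic: "degree (head_poly j) = j \<and> lead_coeff (head_poly j) = 1"
proof -
  have "degree (head_poly j) = j"
    by (intro antisym degree_le le_degree) (auto simp: coeff_head_poly cs_0)
  then show ?thesis by (simp add: coeff_head_poly cs_0)
qed

lemma head_poly_over_power_mem:
  assumes "j < 4" "flat_ok j" "(1::complex) \<in> loc_span p ws" "ieval (W j) \<alpha> / of_int p ^ hh j \<in> loc_span p ws"
  shows "ieval (head_poly j) (\<alpha> - of_int c) / of_int p ^ hh j \<in> loc_span p ws"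
proof -
  obtain m where m: "cs j = p ^ hh j * m" using NP_nonneg_dvd(3)[OF assms(1,2)] by auto
  have p0: "p \<noteq> 0" using prime_p by auto
  have "ieval (head_poly j) (\<alpha> - of_int c) / of_int p ^ hh j
      = ieval (W j) \<alpha> / of_int p ^ hh j + of_int m * 1"
    unfolding ieval_W m using p0 by (simp add: field_simps)
  then show ?thesis using assms(3,4) loc_span_add[OF prime_p] loc_span_mult[OF prime_p] by metis
qed

lemma quot_eqs:
  "quot2 p P \<phi> \<alpha> = ieval (W 2) \<alpha> / of_int p ^ hh 2"
  "quot3 p P \<phi> \<alpha> = ieval (W 3) \<alpha> / of_int p ^ hh 3"
  "eval_at \<alpha> \<phi> / of_int p ^ hh 1 = ieval (W 1) \<alpha> / of_int p ^ hh 1"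
proof -
  have hp: "ieval (head_poly 1) x = x + of_int (cs 1)"
    "ieval (head_poly 2) x = x\<^sup>2 + of_int (cs 1) * x + of_int (cs 2)"
    "ieval (head_poly 3) x = x ^ 3 + of_int (cs 1) * x\<^sup>2 + of_int (cs 2) * x + of_int (cs 3)" for x :: complex
    unfolding head_poly_def ieval_sum
    by (simp_all add: ieval_def poly_monom of_int_hom.map_poly_hom_monom cs_0 numeral_eq_Suc)
  have ph: "eval_at \<alpha> \<phi> = \<alpha> - of_int c" by (simp add: eval_at_ieval phi)
  have dv: "eval_at \<alpha> (phi_dev \<phi> P 3) = of_int (cs 1)" "eval_at \<alpha> (phi_dev \<phi> P 2) = of_int (cs 2)"
    by (simp_all add: eval_at_ieval phi_dev_eq cs_def)
  show "quot2 p P \<phi> \<alpha> = ieval (W 2) \<alpha> / of_int p ^ hh 2"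
    unfolding quot2_def Let_def ph dv ieval_W hp by simp
  show "quot3 p P \<phi> \<alpha> = ieval (W 3) \<alpha> / of_int p ^ hh 3"
    unfolding quot3_def Let_def ph dv ieval_W hp by simp
  show "eval_at \<alpha> \<phi> / of_int p ^ hh 1 = ieval (W 1) \<alpha> / of_int p ^ hh 1"
    unfolding ph ieval_W hp by simp
qed

text \<open>The Horner sums are monic of degrees 0 to 3, so \<open>G(X + c)\<close> has integral
  coordinates \<open>d j\<close>, and the coordinate bound makes \<open>d j * p ^ hh j\<close>
  divisible by \<open>p ^ v\<close>. For \<open>hh 1 = 0\<close> the element \<open>\<alpha>\<close>
  may replace \<open>\<phi>(\<alpha>)\<close>, from which it differs by an integer.\<close>

theorem linear_basis:
  assumes root: "ieval P \<alpha> = 0" and flat: "\<And>j. j < 4 \<Longrightarrow> flat_ok j"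
    and w1: "w1 = eval_at \<alpha> \<phi> / of_int p ^ hh 1 \<or> hh 1 = 0 \<and> w1 = \<alpha>"
  shows "p_integral_basis p \<alpha> [1, w1, quot2 p P \<phi> \<alpha>, quot3 p P \<phi> \<alpha>]"
proof (rule p_integral_basisI[OF root prime_p])
  let ?ws = "[1, w1, quot2 p P \<phi> \<alpha>, quot3 p P \<phi> \<alpha>]"
  show "length ?ws = 4" by simp
  have gW: "\<forall>N \<beta>. padic_norm (N :: algebraic_number \<Rightarrow> real) p \<longrightarrow> ieval P \<beta> = 0 \<longrightarrow> N (ieval (W j) \<beta>) \<le> N (of_int p) ^ hh j"
    if "j < 4" for j using W_bound[OF _ _ that flat[OF that]] by blast
  show "\<exists>G e. w = ieval G \<alpha> / of_int p ^ e \<and>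
      (\<forall>N \<beta>. padic_norm (N :: algebraic_number \<Rightarrow> real) p \<longrightarrow> ieval P \<beta> = 0 \<longrightarrow> N (ieval G \<beta>) \<le> N (of_int p) ^ e)"
    if "w \<in> set ?ws" for w
  proof -
    have "w = 1 \<or> w = w1 \<or> w = quot2 p P \<phi> \<alpha> \<or> w = quot3 p P \<phi> \<alpha>" using that by auto
    moreover have ?thesis if "w = 1"
    proof -
      have "N (ieval 1 \<beta>) \<le> N (of_int p) ^ 0" if "padic_norm N p" for N :: "algebraic_number \<Rightarrow> real" and \<beta>
        using padic_norm.N_1[OF that] by simp
      then show ?thesis using that by (intro exI[of _ 1] exI[of _ 0]) simp
    qed
    moreover have ?thesis if "w = \<alpha>"
      by (rule exI[of _ "[:0, 1:]"], rule exI[of _ 0]) (use that N_le_1_at_root in auto)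
    moreover have ?thesis if "w = ieval (W j) \<alpha> / of_int p ^ hh j" "j < 4" for j using gW[OF that(2)] that(1) by blast
    moreover have "(\<exists>j<4. w1 = ieval (W j) \<alpha> / of_int p ^ hh j) \<or> w1 = \<alpha>"
    proof (cases "w1 = \<alpha>")
      case False
      then have "w1 = ieval (W 1) \<alpha> / of_int p ^ hh 1" using w1 quot_eqs(3)[of \<alpha>] by simp
      then show ?thesis by (intro disjI1 exI[of _ 1]) simp
    qed simp
    moreover have "\<exists>j<4. quot2 p P \<phi> \<alpha> = ieval (W j) \<alpha> / of_int p ^ hh j"
      using quot_eqs(1)[of \<alpha>] by (intro exI[of _ 2]) simp
    moreover have "\<exists>j<4. quot3 p P \<phi> \<alpha> = ieval (W j) \<alpha> / of_int p ^ hh j"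
      using quot_eqs(2)[of \<alpha>] by (intro exI[of _ 3]) simp
    ultimately show ?thesis by (elim disjE exE conjE) (simp_all only:)
  qed
  fix G v assume G: "degree G < 4"
    and bound: "\<And>N \<beta>. padic_norm (N :: algebraic_number \<Rightarrow> real) p \<Longrightarrow> ieval P \<beta> = 0 \<Longrightarrow> N (ieval G \<beta>) \<le> N (of_int p) ^ v"
  let ?S = "loc_span p ?ws"
  have p0: "p \<noteq> 0" using prime_p by auto
  have one: "1 \<in> ?S" by (rule loc_span_mem[OF prime_p]) simp
  have WS: "ieval (W j) \<alpha> / of_int p ^ hh j \<in> ?S" if "j < 4" "j > 0" for j
  proof -
    have "j = 1 \<or> j = 2 \<or> j = 3" using that by auto
    moreover have "ieval (W 1) \<alpha> / of_int p ^ hh 1 \<in> ?S"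
      using w1
    proof
      assume "w1 = eval_at \<alpha> \<phi> / of_int p ^ hh 1"
      then have "ieval (W 1) \<alpha> / of_int p ^ hh 1 = w1" by (simp only: quot_eqs(3))
      then show ?thesis using loc_span_mem[OF prime_p, of w1 ?ws] by simp
    next
      assume w: "hh 1 = 0 \<and> w1 = \<alpha>"
      then have "ieval (W 1) \<alpha> / of_int p ^ hh 1 = w1 - of_int c * 1"
        unfolding quot_eqs(3)[symmetric] by (simp add: eval_at_ieval phi)
      moreover have "w1 - of_int c * 1 \<in> ?S"
        by (intro loc_span_diff[OF prime_p] loc_span_mult[OF prime_p] one loc_span_mem[OF prime_p]) simp
      ultimately show ?thesis by simp
    qed
    moreover have "ieval (W 2) \<alpha> / of_int p ^ hh 2 \<in> ?S" "ieval (W 3) \<alpha> / of_int p ^ hh 3 \<in> ?S"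
      unfolding quot_eqs[symmetric] by (intro loc_span_mem[OF prime_p], simp)+
    ultimately show ?thesis by auto
  qed
  have hS: "ieval (head_poly j) (\<alpha> - of_int c) / of_int p ^ hh j \<in> ?S" if "j < 4" for j
  proof (cases "j = 0")
    case True
    have "p ^ hh 0 dvd 1" using NP_nonneg_dvd(3)[OF _ flat, of 0] cs_0 by simp
    then have "hh 0 = 0" using prime_p not_prime_unit is_unit_power_iff by (metis power_eq_0_iff gr0I)
    moreover have "head_poly 0 = 1" by (simp add: head_poly_def cs_0 monom_0)
    ultimately show ?thesis using True one by simp
  next
    case False
    then show ?thesis using head_poly_over_power_mem[OF that flat[OF that] one WS[OF that]] by simp
  qed
  define Gc where "Gc = pcompose G [:c, 1:]"
  have Gdeg: "degree Gc < 4" using G by (simp add: Gc_def degree_pcompose)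
  obtain d where d: "Gc = (\<Sum>j<4. smult (d j) (head_poly j))"
    using monic_basis[of 4 head_poly Gc] head_poly_monic Gdeg by blast
  obtain N where "linear_lift_norm P p c \<phi> N" using ex_norm_interp by blast
  then interpret linear_lift_norm P p c \<phi> N .
  have dj: "p ^ v dvd d j * p ^ hh j" if j: "j < 4" for j
  proof (rule dvd_of_coordinate_bound[OF _ NP_nonneg_dvd(1)[OF j flat[OF j]]])
    show "N (of_int (d j)) \<le> q ^ v * q powr (- NP j)"
    proof (rule ND.coordinates_le[OF _ _ _ _ j])
      show "\<exists>i d e h u t. ND.good_side i d e h u t \<and> i \<le> j \<and> j < i + d * e \<and> NP j = ND.lin i e h u j" if "j < 4" for j
        using ex_good_side[OF that] flat[OF that] unfolding flat_ok_def by blast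
      show "of_int (d j) \<in> RR.Zx" for j by simp
      show "0 < q ^ v" using q_pos by simp
      fix x :: algebraic_number assume x: "poly (map_poly of_int Pc) x = 0"
      have "(\<Sum>j<4. of_int (d j) * ND.b j x) = ieval Gc x" unfolding d ieval_sum by (simp add: b_eq)
      also have "\<dots> = ieval G (x + of_int c)" unfolding Gc_def ieval_pcompose ..
      finally show "N (\<Sum>j<4. of_int (d j) * ND.b j x) \<le> q ^ v"
        using bound[OF padic_norm_axioms, of "x + of_int c"] x unfolding f_eval by (simp add: q_def)
    qed
  qed
  define m where "m j = d j * p ^ hh j div p ^ v" for j
  have m: "d j * p ^ hh j = p ^ v * m j" if "j < 4" for j
    unfolding m_def using dj[OF that] by simp
  have "ieval G \<alpha> = ieval Gc (\<alpha> - of_int c)" unfolding Gc_def ieval_pcompose by simp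
  also have "\<dots> = (\<Sum>j<4. of_int (d j) * ieval (head_poly j) (\<alpha> - of_int c))" unfolding d ieval_sum by simp
  finally have "ieval G \<alpha> / of_int p ^ v = (\<Sum>j<4. of_int (d j) * ieval (head_poly j) (\<alpha> - of_int c) / of_int p ^ v)"
    by (simp add: sum_divide_distrib)
  also have "\<dots> = (\<Sum>j<4. of_int (m j) * (ieval (head_poly j) (\<alpha> - of_int c) / of_int p ^ hh j))"
  proof (rule sum.cong)
    fix j :: nat assume "j \<in> {..<4}"
    then have "of_int (d j * p ^ hh j) = (of_int (p ^ v * m j) :: complex)"
      using m[of j] by simp
    then have e: "of_int (d j) * of_int p ^ hh j = of_int p ^ v * (of_int (m j) :: complex)" by simp
    have "D * E / pv = M * (E / ph)" if "D * ph = pv * M" "pv \<noteq> 0" "ph \<noteq> 0" for D E M pv ph :: complex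
    proof -
      have "D * E / pv = (D * ph) * E / (pv * ph)" using that(2,3) by simp
      then show ?thesis unfolding that(1) using that(2,3) by simp
    qed
    from this[OF e] p0 show "of_int (d j) * ieval (head_poly j) (\<alpha> - of_int c) / of_int p ^ v
        = of_int (m j) * (ieval (head_poly j) (\<alpha> - of_int c) / of_int p ^ hh j)" by simp
  qed simp
  also have "\<dots> \<in> ?S" by (intro loc_span_sum[OF prime_p] loc_span_mult[OF prime_p] hS) simp
  finally show "ieval G \<alpha> / of_int p ^ v \<in> ?S" .
qed

text \<open>The chord from (0, 0) to the point of abscissa \<open>s\<close> has height below 1 at
  abscissa 1.\<close>

lemma newton_h_1_eq_0:
  assumes "1 \<le> s" "s \<le> 4" "cs s \<noteq> 0" "multiplicity p (cs s) < s"
  shows "hh 1 = 0"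
proof -
  let ?m = "multiplicity p (cs s)"
  have pts: "(0, 0) \<in> convex hull newton_points p \<phi> P" "(real s, real ?m) \<in> convex hull newton_points p \<phi> P"
  proof -
    have "newton_u p \<phi> P 0 = enat 0" using cs_0 by (simp add: newton_u_enat)
    then have "(real 0, real 0) \<in> newton_points p \<phi> P" unfolding newton_points_def by blast
    then show "(0, 0) \<in> convex hull newton_points p \<phi> P" by (intro hull_inc) simp
    have "newton_u p \<phi> P s = enat ?m" using assms(3) by (simp add: newton_u_enat)
    then show "(real s, real ?m) \<in> convex hull newton_points p \<phi> P"
      using assms(2) len by (intro hull_inc) (auto simp: newton_points_def)
  qed
  have "(1 - 1 / real s) *\<^sub>R (0, 0) + (1 / real s) *\<^sub>R (real s, real ?m) \<in> convex hull newton_points p \<phi> P"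
    by (rule convexD[OF convex_convex_hull pts]) (use assms(1) in auto)
  then have "(real 1, real ?m / real s) \<in> convex hull newton_points p \<phi> P" using assms(1) by simp
  then have "NP 1 \<le> real ?m / real s" unfolding NP_def by (rule newton_polygon_le)
  also have "\<dots> < 1" using assms by simp
  finally show ?thesis unfolding newton_h_eq by (simp add: floor_less_iff)
qed

lemma coeff_Pc_eq_m:
  assumes "poly_mod.eq_m p P (\<phi> ^ m * P2)"
  shows "poly_mod.eq_m p Pc (monom 1 m * pcompose P2 [:c, 1:])"
proof -
  have "pcompose \<phi> [:c, 1:] = [:0, 1:]" unfolding phi by (simp add: pcompose_pCons)
  then have "pcompose (\<phi> ^ m * P2) [:c, 1:] = monom 1 m * pcompose P2 [:c, 1:]"
    by (simp add: pcompose_mult pcompose_hom.hom_power monom_altdef)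
  then show ?thesis using eq_m_pcompose[OF assms, of "[:c, 1:]"] unfolding Pc_def by simp
qed

lemma dvd_coeff_Pc:
  assumes "poly_mod.eq_m p P (\<phi> ^ m * P2)"
  shows "i < m \<Longrightarrow> p dvd coeff Pc i"
    and "p dvd coeff Pc (i + m) \<longleftrightarrow> p dvd coeff (pcompose P2 [:c, 1:]) i"
  using eq_m_coeff_dvd[OF coeff_Pc_eq_m[OF assms]] by (simp_all add: coeff_monom_mult)

lemma cofactor_not_dvd:
  assumes "\<not> poly_mod.dvdm p \<phi> P2"
  shows "\<not> p dvd coeff (pcompose P2 [:c, 1:]) 0"
proof
  let ?v = "coeff (pcompose P2 [:c, 1:]) 0"
  assume d: "p dvd ?v"
  have "?v = poly P2 c" by (simp add: poly_0_coeff_0[symmetric] poly_pcompose)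
  then have "poly (P2 - [:?v:]) c = 0" by simp
  then obtain s where "P2 - [:?v:] = [:- c, 1:] * s" using poly_eq_0_iff_dvd by (metis dvdE)
  then have "P2 - \<phi> * s = [:?v:]" unfolding phi by (simp add: algebra_simps)
  then have "poly_mod.eq_m p P2 (\<phi> * s)" using d by (intro eq_mI) (simp add: coeff_pCons split: nat.split)
  then show False using assms unfolding poly_mod.dvdm_def by blast
qed

lemma head_squarefree_1: "head_squarefree 1"
proof -
  obtain N where "linear_lift_norm P p c \<phi> N" using ex_norm_interp by blast
  then interpret linear_lift_norm P p c \<phi> N .
  show ?thesis
    unfolding head_residually_squarefree
    by (rule RR.residually_squarefree_degree_1)
       (use head_poly_monic[of 1] in
         \<open>simp_all add: poly_over_def coeff_map_poly degree_map_poly coeff_head_poly cs_0\<close>)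
qed

text \<open>After translation by \<open>c\<close> the factor \<open>\<phi>\<^sup>2\<close> becomes
  \<open>X\<^sup>2\<close>, so modulo \<open>p\<close> the sum \<open>head_poly 2\<close> is the
  translate of \<open>P2\<close>. Translation preserves squarefreeness.\<close>

lemma head_squarefree_2:
  assumes eq: "poly_mod.eq_m p P (\<phi>\<^sup>2 * P2)" and sf: "poly_mod.square_free_m p P2"
  shows "head_squarefree 2"
  unfolding head_squarefree_def
proof (intro allI impI)
  fix G H and n :: nat assume d: "\<forall>i. p dvd coeff (head_poly 2 - G * G * H) i" and n: "1 \<le> n"
  let ?P2 = "pcompose P2 [:c, 1:]"
  note E = coeff_Pc_eq_m[OF eq]
  have "poly_mod.eq_m p (head_poly 2) ?P2"
  proof (rule eq_mI)
    fix i
    have "p dvd coeff (Pc - monom 1 2 * ?P2) (i + 2)" by (rule eq_mD[OF E])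
    then have "p dvd coeff Pc (i + 2) - coeff ?P2 i" by (simp add: coeff_monom_mult)
    moreover have "coeff (head_poly 2) i = coeff Pc (i + 2)"
      using Pc_deg(1) by (auto simp: coeff_head_poly cs_def coeff_eq_0)
    ultimately show "p dvd coeff (head_poly 2 - ?P2) i" by simp
  qed
  moreover have "poly_mod.eq_m p (head_poly 2) (G * G * H)" by (rule eq_mI) (use d in blast)
  ultimately have "poly_mod.eq_m p ?P2 (G * G * H)" by simp
  from eq_m_pcompose[OF this, of "[:- c, 1:]"]
  have "poly_mod.eq_m p P2 (pcompose (G * G * H) [:- c, 1:])" unfolding pcompose_shift_inverse .
  then have "poly_mod.dvdm p (pcompose G [:- c, 1:] * pcompose G [:- c, 1:]) P2"
    unfolding poly_mod.dvdm_def pcompose_mult by blast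
  then have deg: "degree (poly_mod.Mp p (pcompose G [:- c, 1:])) = 0"
    using sf unfolding poly_mod.square_free_m_def by blast
  let ?G = "pcompose G [:- c, 1:]"
  have "poly_mod.eq_m p ?G [:coeff ?G 0:]"
  proof (rule eq_mI)
    fix i
    show "p dvd coeff (?G - [:coeff ?G 0:]) i"
    proof (cases i)
      case (Suc j)
      then have "coeff (poly_mod.Mp p ?G) i = 0" using deg by (simp add: coeff_eq_0)
      then have "coeff ?G i mod p = 0" unfolding poly_mod.Mp_coeff poly_mod.M_def .
      then show ?thesis using Suc by (simp add: mod_eq_0_iff_dvd)
    qed simp
  qed
  from eq_m_pcompose[OF this, of "[:c, 1:]"]
  have "poly_mod.eq_m p G [:coeff ?G 0:]" unfolding pcompose_shift_inverse' by simp
  from eq_mD[OF this, of n] show "p dvd coeff G n" using n by (cases n) auto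
qed

end

section \<open>Squarefree reduction\<close>

lemma N_ieval_close:
  fixes N :: "algebraic_number \<Rightarrow> real"
  assumes "padic_norm N p" "N x \<le> 1" "N y \<le> 1" "N (x - y) < 1"
  shows "N (ieval G x - ieval G y) < 1"
proof -
  interpret padic_norm N p by fact
  show ?thesis
  proof (induction G)
    case (pCons a G)
    have "ieval (pCons a G) x - ieval (pCons a G) y = x * (ieval G x - ieval G y) + (x - y) * ieval G y"
      by (simp add: algebra_simps)
    moreover have "N (x * (ieval G x - ieval G y)) < 1" by (rule N_mult_less_1[OF assms(2) pCons(2)])
    moreover have "N ((x - y) * ieval G y) < 1"
      using N_mult_less_1[OF N_ieval_le_1[OF assms(3)] assms(4), of G] by (simp add: mult.commute)
    ultimately show ?case using N_add_less by simp
  qed simp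
qed

context monic_irreducible
begin

text \<open>A polynomial of degree below 4 that is small at all roots of \<open>P\<close> is
  divisible by \<open>p\<close>: otherwise it is a unit at some root of the reduction of
  \<open>P\<close>, and a root of \<open>P\<close> lies close to that one. Repetition removes
  \<open>p ^ v\<close>.\<close>

theorem squarefree_basis:
  assumes root: "ieval P \<alpha> = 0" and p: "prime p" and sf: "poly_mod.square_free_m p P"
  shows "p_integral_basis p \<alpha> [1, \<alpha>, \<alpha>\<^sup>2, \<alpha> ^ 3]"
proof (rule p_integral_basisI[OF root p])
  let ?ws = "[1, \<alpha>, \<alpha>\<^sup>2, \<alpha> ^ 3]"
  show "length ?ws = 4" by simp
  have pw: "\<alpha> ^ i \<in> loc_span p ?ws" if "i < 4" for i
  proof -
    have "i = 0 \<or> i = 1 \<or> i = 2 \<or> i = 3" using that by auto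
    then have "\<alpha> ^ i \<in> set ?ws" by auto
    then show ?thesis by (rule loc_span_mem[OF p])
  qed
  show "\<exists>G e. w = ieval G \<alpha> / of_int p ^ e \<and>
      (\<forall>N \<beta>. padic_norm (N :: algebraic_number \<Rightarrow> real) p \<longrightarrow> ieval P \<beta> = 0 \<longrightarrow> N (ieval G \<beta>) \<le> N (of_int p) ^ e)"
    if "w \<in> set ?ws" for w
  proof -
    have "\<exists>i. w = \<alpha> ^ i" using that by (auto intro: exI[of _ 0] exI[of _ 1])
    then obtain i where "w = \<alpha> ^ i" by blast
    then have "w = ieval (monom 1 i) \<alpha> / of_int p ^ 0" by (simp add: ieval_def poly_monom of_int_hom.map_poly_hom_monom)
    moreover have "N (ieval (monom 1 i) \<beta>) \<le> N (of_int p) ^ 0"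
      if "padic_norm (N :: algebraic_number \<Rightarrow> real) p" "ieval P \<beta> = 0" for N \<beta>
    proof -
      interpret padic_norm N p by fact
      show ?thesis using N_ieval_le_1[OF N_le_1_at_root[OF that]] by simp
    qed
    ultimately show ?thesis by blast
  qed
  fix G v assume G: "degree G < 4"
    and bound: "\<And>N \<beta>. padic_norm (N :: algebraic_number \<Rightarrow> real) p \<Longrightarrow> ieval P \<beta> = 0 \<Longrightarrow> N (ieval G \<beta>) \<le> N (of_int p) ^ v"
  obtain N :: "algebraic_number \<Rightarrow> real" where N: "padic_norm N p" using ex_padic_norm[OF p] by blast
  interpret int_coeff_norm N p using N by (simp add: int_coeff_norm_def)
  let ?R = "map_poly of_int P :: algebraic_number poly"
  have Rover: "poly_over \<int> (map_poly of_int F :: algebraic_number poly)" for F by (simp add: poly_over_def coeff_map_poly)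
  have Rdeg: "degree ?R = 4" "lead_coeff ?R = 1" using deg_P monic by (simp_all add: degree_map_poly coeff_map_poly)
  have Rsq: "Int.residually_squarefree ?R"
    unfolding Int.residually_squarefree_def
  proof (intro allI impI)
    fix A B and n :: nat
    assume AB: "poly_over \<int> A" "poly_over \<int> B" and sm: "small (?R - A * A * B)" and n: "1 \<le> n"
    obtain A0 where A0: "A = map_poly of_int A0" using ints_poly_lift AB(1) by auto
    obtain B0 where B0: "B = map_poly of_int B0" using ints_poly_lift AB(2) by auto
    have "?R - A * A * B = map_poly of_int (P - A0 * A0 * B0)" unfolding A0 B0 by (simp add: hom_distribs)
    then have "\<forall>i. p dvd coeff (P - A0 * A0 * B0) i" using sm ints_small_iff by metis
    then have "poly_mod.dvdm p (A0 * A0) P" unfolding poly_mod.dvdm_def using eq_mI by blast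
    then have "degree (poly_mod.Mp p A0) = 0" using sf unfolding poly_mod.square_free_m_def by blast
    then have "coeff (poly_mod.Mp p A0) n = 0" using n by (simp add: coeff_eq_0)
    then have "p dvd coeff A0 n" unfolding poly_mod.Mp_coeff poly_mod.M_def by (simp add: mod_eq_0_iff_dvd)
    then show "N (coeff A n) < 1" unfolding A0 by (simp add: coeff_map_poly N_of_int_less_1_iff)
  qed
  have key: "\<forall>i. p dvd coeff F i" if F: "degree F < 4" "\<And>\<beta>. ieval P \<beta> = 0 \<Longrightarrow> N (ieval F \<beta>) < 1" for F
  proof (rule ccontr)
    assume "\<not> ?thesis"
    then have ns: "\<not> small (map_poly of_int F)" using ints_small_iff by blast
    obtain \<rho> where rho: "N \<rho> \<le> 1" "N (poly ?R \<rho>) < 1" "N (poly (map_poly of_int F) \<rho>) = 1"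
      by (rule Int.residually_squarefree_root[OF Rover _ Rsq Rover _ ns])
         (use Rdeg F(1) in \<open>simp_all add: degree_map_poly\<close>)
    have R0: "?R \<noteq> 0" using Rdeg by auto
    obtain B where B: "?R = (\<Prod>x\<in>#B. [:- x, 1:])"
      using alg_closed_imp_factorization[OF R0] Rdeg(2) by auto
    have pf: "poly ?R z = (\<Prod>x\<in>#B. z - x)" for z unfolding B by (induction B) (auto simp: left_diff_distrib)
    have "\<exists>x\<in>#B. N (\<rho> - x) < 1"
    proof (rule ccontr)
      assume far: "\<not> ?thesis"
      have "1 \<le> N (\<Prod>x\<in>#B'. \<rho> - x)" if "B' \<subseteq># B" for B'
        using that
      proof (induction B')
        case (add x B')
        then have "x \<in># B" "B' \<subseteq># B" by (auto dest: mset_subset_eq_insertD mset_subset_eqD)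
        then have "1 \<le> N (\<rho> - x)" "1 \<le> N (\<Prod>x\<in>#B'. \<rho> - x)" using far add.IH by force+
        then have "1 * 1 \<le> N (\<rho> - x) * N (\<Prod>x\<in>#B'. \<rho> - x)" by (intro mult_mono) auto
        then show ?case by (simp add: N_mult)
      qed simp
      from this[of B] show False using rho(2) pf by simp
    qed
    then obtain x where x: "x \<in># B" "N (\<rho> - x) < 1" by blast
    have "poly ?R x = 0" using x(1) unfolding pf by (auto simp: prod_mset_zero_iff)
    then have r: "ieval P x = 0" by (simp add: ieval_def)
    have "N (ieval F \<rho> - ieval F x) < 1" by (rule N_ieval_close[OF N rho(1) N_le_1_at_root[OF N r] x(2)])
    from N_add_less[OF this F(2)[OF r]] show False using rho(3) by (simp add: ieval_def)
  qed
  have dvd_all: "\<exists>H. F = smult (p ^ v) H" if "degree F < 4" "\<And>\<beta>. ieval P \<beta> = 0 \<Longrightarrow> N (ieval F \<beta>) \<le> q ^ v" for F v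
    using that
  proof (induction v arbitrary: F)
    case 0
    then show ?case by (intro exI[of _ F]) simp
  next
    case (Suc v)
    have lt: "q ^ Suc v < 1" using q_pos q_less_1 by (intro power_Suc_less_one) auto
    have "\<forall>i. p dvd coeff F i" by (rule key[OF Suc.prems(1)]) (use Suc.prems(2) lt in force)
    then have "poly_mod.eq_m p F 0" by (intro eq_mI) simp
    then obtain F' where F': "F = smult p F'" unfolding eq_m_iff_smult by auto
    have p0: "p \<noteq> 0" using p by auto
    have "N (ieval F' \<beta>) \<le> q ^ v" if "ieval P \<beta> = 0" for \<beta>
    proof -
      have "q * N (ieval F' \<beta>) \<le> q * q ^ v" using Suc.prems(2)[OF that] unfolding F' by (simp add: N_mult q_def)
      then show ?thesis using q_pos by simp
    qed
    moreover have "degree F' < 4" using Suc.prems(1) p0 unfolding F' by simp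
    ultimately obtain H where "F' = smult (p ^ v) H" using Suc.IH by blast
    then show ?case unfolding F' by (intro exI[of _ H]) (simp add: mult.commute)
  qed
  obtain H where H: "G = smult (p ^ v) H"
    using dvd_all[OF G, of v] bound[OF N] unfolding q_def by blast
  have p0: "p \<noteq> 0" using p by auto
  have Hdeg: "degree H < 4" using G p0 unfolding H by simp
  have "ieval G \<alpha> / of_int p ^ v = ieval H \<alpha>" unfolding H using p0 by simp
  also have "\<dots> = (\<Sum>i<4. of_int (coeff H i) * \<alpha> ^ i)"
    unfolding ieval_altdef by (rule sum.mono_neutral_left) (use Hdeg in \<open>auto simp: coeff_eq_0\<close>)
  also have "\<dots> \<in> loc_span p ?ws" by (intro loc_span_sum[OF p] loc_span_mult[OF p] pw) simp
  finally show "ieval G \<alpha> / of_int p ^ v \<in> loc_span p ?ws" .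
qed

end

section \<open>Two distinct linear factors, each squared\<close>

text \<open>Such a side ends at a nonunit coefficient. If it were horizontal, the unit
  \<open>a 2\<close> would lie below it. Hence its roots reduce to 0, which separates them from the
  roots in the other residue class.\<close>

lemma (in newton_data) slope_pos:
  assumes S: "good_side i d e h u t" and k: "2 < i + d * e" and n: "n = 4"
    and a: "N (a 2) = 1" "N (a 3) < 1" "N (a 4) < 1"
  shows "h > 0"
proof (rule ccontr)
  assume "\<not> h > 0"
  then have h: "h = 0" by simp
  note D = good_sideD[OF S]
  have "i + d * e = 3 \<or> i + d * e = 4" using k D(3) n by linarith
  then have "N (a (i + d * e)) < 1" using a by auto
  moreover have "N (a (i + d * e)) = q ^ u"
    using D(6)[of d] D(8) h by (simp add: N_mult N_p_power)
  moreover have "N (a 2) \<le> q ^ u"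
    using D(9)[of 2] n h by (simp add: lin_def q_powr_real)
  ultimately show False using a(1) by simp
qed

context monic_irreducible
begin

lemma zero_of_root:
  assumes "ieval P (x :: 'a::field_char_0) = 0" "degree F < 4" "ieval F x = 0"
  shows "F = 0"
proof (rule ccontr)
  assume "F \<noteq> 0"
  moreover have "degree F < degree P" using assms(2) deg_P by simp
  ultimately obtain U V c where c: "c \<noteq> 0" "U * P + V * F = [:c:]" by (rule irreducible_bezout[OF irr])
  have "ieval (U * P + V * F) x = 0" using assms by simp
  then show False unfolding c(2) using c(1) by simp
qed

end

context linear_lift
begin

lemma head_poly_vals:
  "ieval (head_poly 2) x = x\<^sup>2 + of_int (cs 1) * x + of_int (cs 2)"
  "ieval (head_poly 3) x = x ^ 3 + of_int (cs 1) * x\<^sup>2 + of_int (cs 2) * x + of_int (cs 3)"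
  for x :: "'b::field_char_0"
  unfolding head_poly_def ieval_sum
  by (simp_all add: ieval_def poly_monom of_int_hom.map_poly_hom_monom cs_0 numeral_eq_Suc)

text \<open>\<open>\<phi>\<close> divides \<open>P\<close> exactly twice modulo \<open>p\<close>:
  the polygon is 0 up to abscissa 2 and rises from there.\<close>

definition double_root :: bool where
  "double_root \<longleftrightarrow> \<not> p dvd cs 2 \<and> p dvd cs 3 \<and> p dvd cs 4"

lemma double_root_flat_ok: "double_root \<Longrightarrow> j \<ge> 2 \<Longrightarrow> flat_ok j"
proof -
  assume d: double_root and j: "j \<ge> 2"
  have "p dvd cs k" if "j < k" "k \<le> 4" for k
  proof -
    have "k = 3 \<or> k = 4" using that j by linarith
    then show ?thesis using d unfolding double_root_def by auto
  qed
  then show ?thesis unfolding flat_ok_def by blast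
qed

lemma NP_2: "double_root \<Longrightarrow> NP 2 = 0"
proof -
  assume d: double_root
  have "cs 2 \<noteq> 0" "multiplicity p (cs 2) = 0" using d unfolding double_root_def by (auto simp: not_dvd_imp_multiplicity_0)
  then have "newton_u p \<phi> P 2 = enat 0" by (simp add: newton_u_enat)
  then have "(real 2, real 0) \<in> newton_points p \<phi> P" unfolding newton_points_def using len by fastforce
  then have "NP 2 \<le> real 0" unfolding NP_def by (intro newton_polygon_le hull_inc)
  then show ?thesis using NP_nonneg_dvd(1)[of 2] double_root_flat_ok[OF d, of 2] by simp
qed

end

context linear_lift_norm
begin

lemma double_root_norms:
  "double_root \<Longrightarrow> N (ND.a 2) = 1" "double_root \<Longrightarrow> N (ND.a 3) < 1" "double_root \<Longrightarrow> N (ND.a 4) < 1"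
  unfolding double_root_def a_eq by (simp_all add: N_of_int_eq_1 N_of_int_less_1_iff)

text \<open>Sides beyond abscissa 2 have positive slope, so \<open>coordinates_less\<close> from
  index 2 on only involves roots that reduce to 0.\<close>

lemma double_root_coordinates_less:
  assumes dr: double_root and M: "M > 0" "N (of_int x2) \<le> M" "N (of_int x3) \<le> M * q powr (- NP 3)"
    and near: "\<And>T. poly (map_poly of_int Pc) T = 0 \<Longrightarrow> N T < 1 \<Longrightarrow>
      N (of_int x2 * ieval (head_poly 2) T + of_int x3 * ieval (head_poly 3) T) < M"
  shows "N (of_int x2) < M" "N (of_int x3) < M * q powr (- NP 3)"
proof -
  define cc :: "nat \<Rightarrow> algebraic_number" where "cc j = (if j = 2 then of_int x2 else of_int x3)" for j
  have "N (cc j) < M * q powr (- NP j)" if "2 \<le> j" "j < 4" for j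
  proof (rule ND.coordinates_less[OF _ _ _ _ _ that, where A = NP])
    show "\<exists>i d e h u t. ND.good_side i d e h u t \<and> i \<le> j \<and> j < i + d * e \<and> NP j = ND.lin i e h u j"
      if "2 \<le> j" "j < 4" for j
      using ex_good_side[OF that(2)] double_root_flat_ok[OF dr that(1)] unfolding flat_ok_def by blast
    show "cc j \<in> RR.Zx" for j by (simp add: cc_def)
    show "M > 0" by (rule M(1))
    show "N (cc j) \<le> M * q powr (- NP j)" if "2 \<le> j" "j < 4" for j
    proof -
      have "j = 2 \<or> j = 3" using that by linarith
      then show ?thesis using M NP_2[OF dr] q_pos by (auto simp: cc_def)
    qed
    fix \<beta> :: algebraic_number and i d e h u t
    assume S: "ND.good_side i d e h u t" "2 < i + d * e" "poly (map_poly of_int Pc) \<beta> = 0" "N \<beta> = q powr (real h / real e)"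
    have "h > 0" by (rule ND.slope_pos[OF S(1,2) refl double_root_norms[OF dr]])
    then have "q powr (real h / real e) < q powr 0"
      using ND.good_sideD(2)[OF S(1)] by (intro q_powr_less) simp
    then have "N \<beta> < 1" using S(4) q_pos by simp
    then show "N (\<Sum>j = 2..<4. cc j * ND.b j \<beta>) < M"
    proof -
      have "{2..<4::nat} = {2,3}" by auto
      then show ?thesis using near[OF S(3) \<open>N \<beta> < 1\<close>] by (simp add: cc_def b_eq)
    qed
  qed
  from this[of 2] this[of 3] show "N (of_int x2) < M" "N (of_int x3) < M * q powr (- NP 3)"
    using NP_2[OF dr] q_pos by (simp_all add: cc_def)
qed

text \<open>At a root of norm 1 the tail of each Horner sum is no larger than the coefficients in
  it: \<open>a 3\<close> and \<open>a 4\<close> are nonunits, and \<open>a 4\<close> is below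
  \<open>q powr NP 3\<close> because the polygon rises strictly from 3 to 4.\<close>

lemma double_root_far:
  assumes dr: double_root and T: "poly (map_poly of_int Pc) T = 0" "N T = 1"
  shows "N (ieval (head_poly 2) T) < 1" "N (ieval (head_poly 3) T) < q powr NP 3"
proof -
  have T0: "T \<noteq> 0" using T(2) by auto
  have iT: "N (inverse T) = 1" using T(2) by (simp add: N_inverse)
  have "N (\<Sum>s\<in>{2<..4}. ND.a s * inverse T ^ (s - 2)) < 1"
  proof (intro N_sum_less)
    fix s :: nat assume "s \<in> {2<..4}"
    then have "s = 3 \<or> s = 4" by auto
    then have "N (ND.a s) < 1" using double_root_norms[OF dr] by auto
    then show "N (ND.a s * inverse T ^ (s - 2)) < 1" using iT by (simp add: N_mult N_power)
  qed simp
  then show "N (ieval (head_poly 2) T) < 1" using ND.b_tail[OF T(1) T0, of 2] by (simp add: b_eq)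
  obtain i d e h u t where S: "ND.good_side i d e h u t" "i \<le> 3" "3 < i + d * e" "NP 3 = ND.lin i e h u 3"
    using ex_good_side[of 3] double_root_flat_ok[OF dr, of 3] unfolding flat_ok_def by auto
  have k: "i + d * e = 4" using S(3) ND.good_sideD(3)[OF S(1)] by simp
  have h: "h > 0" by (rule ND.slope_pos[OF S(1) _ refl double_root_norms[OF dr]]) (use k in simp)
  have "ND.lin i e h u 4 = NP 3 + real h / real e" unfolding S(4) using ND.lin_shift[of i e h u 4 3] by simp
  then have "NP 3 < ND.lin i e h u 4" using h ND.good_sideD(2)[OF S(1)] by simp
  then have "N (ND.a 4) < q powr NP 3" using ND.good_side_ends(2)[OF S(1)] unfolding k by (simp add: q_powr_less)
  moreover have "{3<..4::nat} = {4}" by auto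
  ultimately show "N (ieval (head_poly 3) T) < q powr NP 3"
    using ND.b_tail[OF T(1) T0, of 3] iT by (simp add: b_eq N_mult)
qed

end

locale two_linear_lifts = A: linear_lift P p c \<phi> + B: linear_lift P p c' \<phi>'
  for P :: "int poly" and p c :: int and \<phi> :: "int poly" and c' :: int and \<phi>' :: "int poly" +
  assumes eq_m: "poly_mod.eq_m p P (\<phi>\<^sup>2 * \<phi>'\<^sup>2)" and distinct: "\<not> p dvd c - c'"
begin

abbreviation \<delta> :: int where "\<delta> \<equiv> c - c'"

text \<open>Translation by \<open>c\<close> turns the reduction into
  \<open>X\<^sup>2 * (X + \<delta>)\<^sup>2\<close>.\<close>

lemma coeffs_mod_p:
  "p dvd A.cs 1 - 2 * \<delta>" "p dvd A.cs 2 - \<delta>\<^sup>2" "p dvd A.cs 3" "p dvd A.cs 4"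
proof -
  have e: "pcompose (\<phi>'\<^sup>2) [:c, 1:] = [:\<delta>\<^sup>2, 2 * \<delta>, 1:]"
    unfolding B.phi by (simp add: power2_eq_square pcompose_mult pcompose_pCons algebra_simps)
  have E: "poly_mod.eq_m p A.Pc (monom 1 2 * [:\<delta>\<^sup>2, 2 * \<delta>, 1:])"
    using A.coeff_Pc_eq_m[OF eq_m] unfolding e .
  have "p dvd coeff A.Pc i - coeff (monom 1 2 * [:\<delta>\<^sup>2, 2 * \<delta>, 1:]) i" for i
    using eq_mD[OF E, of i] by simp
  from this[of 3] this[of 2] this[of 1] this[of 0]
  show "p dvd A.cs 1 - 2 * \<delta>" "p dvd A.cs 2 - \<delta>\<^sup>2" "p dvd A.cs 3" "p dvd A.cs 4"
    by (simp_all add: A.cs_def coeff_monom_mult numeral_eq_Suc coeff_pCons)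
qed

lemma double_root: "A.double_root"
  unfolding A.double_root_def
proof (intro conjI)
  show "p dvd A.cs 3" "p dvd A.cs 4" by (rule coeffs_mod_p)+
  show "\<not> p dvd A.cs 2"
  proof
    assume "p dvd A.cs 2"
    then have "p dvd A.cs 2 - (A.cs 2 - \<delta>\<^sup>2)" using coeffs_mod_p(2) by (rule dvd_diff)
    then have "p dvd \<delta>\<^sup>2" by simp
    then show False using distinct A.prime_p prime_dvd_power by blast
  qed
qed

lemma near_other:
  fixes N :: "algebraic_number \<Rightarrow> real"
  assumes N: "padic_norm N p" and T: "ieval A.Pc T = 0" "N T < 1"
  shows "ieval B.Pc (T + of_int \<delta>) = 0" "N (T + of_int \<delta>) = 1"
proof -
  interpret padic_norm N p by fact
  show "ieval B.Pc (T + of_int \<delta>) = 0" using T(1) unfolding A.ieval_Pc B.ieval_Pc by (simp add: algebra_simps)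
  have "N (of_int \<delta>) = 1" by (rule N_of_int_eq_1[OF distinct])
  then show "N (T + of_int \<delta>) = 1" using N_add_eq[of T "of_int \<delta>"] T(2) by simp
qed

end

sublocale two_linear_lifts \<subseteq> swap: two_linear_lifts P p c' \<phi>' c \<phi>
proof unfold_locales
  show "poly_mod.eq_m p P (\<phi>'\<^sup>2 * \<phi>\<^sup>2)" using eq_m by (simp add: mult.commute)
  show "\<not> p dvd c' - c" using distinct by (simp add: dvd_diff_commute)
qed

context two_linear_lifts
begin

text \<open>Near \<open>c\<close> the two elements attached to \<open>c'\<close> are small, and vice versa, so the local estimates
  at the two places decouple.\<close>

lemma coordinates_dvd:
  assumes N: "padic_norm (N :: algebraic_number \<Rightarrow> real) p"
    and bound: "\<And>\<beta>. ieval P \<beta> = 0 \<Longrightarrow> N (ieval G \<beta>) \<le> N (of_int p) ^ v"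
    and rep: "\<And>x :: algebraic_number. of_int k * ieval G x =
      of_int d2 * ieval (A.head_poly 2) (x - of_int c) + of_int d3 * ieval (A.head_poly 3) (x - of_int c) +
      (of_int e2 * ieval (B.head_poly 2) (x - of_int c') + of_int e3 * ieval (B.head_poly 3) (x - of_int c'))"
  shows "p ^ v dvd d2" "p ^ v dvd d3 * p ^ A.hh 3" "p ^ v dvd e2" "p ^ v dvd e3 * p ^ B.hh 3"
proof -
  interpret padic_norm N p by fact
  interpret NA: linear_lift_norm P p c \<phi> N by unfold_locales
  interpret NB: linear_lift_norm P p c' \<phi>' N by unfold_locales
  \<comment> \<open>The largest weighted coordinate over both classes. If it exceeded
    \<open>q ^ v\<close>, then near each class the terms of the other one would be below
    \<open>M\<close>, and all four weighted coordinates would fall below their maximum.\<close>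
  define M where "M = Max {N (of_int d2), N (of_int d3) * q powr A.NP 3, N (of_int e2), N (of_int e3) * q powr B.NP 3}"
  have ge: "N (of_int d2) \<le> M" "N (of_int d3) * q powr A.NP 3 \<le> M" "N (of_int e2) \<le> M" "N (of_int e3) * q powr B.NP 3 \<le> M"
    unfolding M_def by (intro Max_ge; simp)+
  have shift: "x \<le> M * q powr (- y)" if "x * q powr y \<le> M" for x y
  proof -
    have "x = x * q powr y * q powr (- y)" using q_pos by (simp add: mult.assoc flip: powr_add)
    also have "\<dots> \<le> M * q powr (- y)" using that q_pos by (intro mult_right_mono) auto
    finally show ?thesis .
  qed
  have unshift: "x * q powr y < M" if "x < M * q powr (- y)" for x y
  proof -
    have "x * q powr y < M * q powr (- y) * q powr y" using that q_pos by (intro mult_strict_right_mono) auto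
    also have "\<dots> = M" using q_pos by (simp add: mult.assoc flip: powr_add)
    finally show ?thesis .
  qed
  have MC: "M \<le> q ^ v"
  proof (rule ccontr)
    assume "\<not> M \<le> q ^ v"
    then have lt: "q ^ v < M" by simp
    then have M0: "M > 0" using q_pos by (meson less_trans zero_less_power)
    have main: "N (of_int k * ieval G x) < M" if "ieval P x = 0" for x
    proof -
      have "N (of_int k * ieval G x) \<le> 1 * N (ieval G x)"
        unfolding N_mult using N_of_int_le_1 N_nonneg by (intro mult_right_mono) auto
      then show ?thesis using bound[OF that] lt unfolding q_def by simp
    qed
    have far: "N (of_int x2 * y2 + of_int x3 * y3) < M"
      if "N (of_int x2) \<le> M" "N (of_int x3) * q powr z \<le> M" "N y2 < 1" "N y3 < q powr z" for x2 x3 y2 y3 z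
    proof (rule N_add_less)
      have "N (of_int x2) * N y2 \<le> M * N y2" using that(1) N_nonneg by (intro mult_right_mono) auto
      also have "\<dots> < M * 1" using that(3) M0 by (intro mult_strict_left_mono) auto
      finally show "N (of_int x2 * y2) < M" unfolding N_mult by simp
      have "N (of_int x3) * N y3 \<le> M * q powr (- z) * N y3" using shift[OF that(2)] N_nonneg by (intro mult_right_mono) auto
      also have "\<dots> < M * q powr (- z) * q powr z" using that(4) M0 q_pos by (intro mult_strict_left_mono) auto
      also have "\<dots> = M" using q_pos by (simp add: mult.assoc flip: powr_add)
      finally show "N (of_int x3 * y3) < M" unfolding N_mult .
    qed
    have cancel: "N x < M" if "N (x + y) < M" "N y < M" for x y
      using N_diff_less[OF that] by simp
    have cancel': "N y < M" if "N (x + y) < M" "N x < M" for x y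
      using N_diff_less[OF that] by simp
    have nearA: "N (of_int d2 * ieval (A.head_poly 2) T + of_int d3 * ieval (A.head_poly 3) T) < M"
      if T: "poly (map_poly of_int A.Pc) T = 0" "N T < 1" for T
    proof -
      let ?x = "T + of_int c"
      have r: "ieval A.Pc T = 0" using T(1) by (simp add: ieval_def)
      note o = near_other[OF N r T(2)]
      have x: "?x - of_int c' = T + of_int \<delta>" by simp
      have "N (of_int e2 * ieval (B.head_poly 2) (T + of_int \<delta>) + of_int e3 * ieval (B.head_poly 3) (T + of_int \<delta>)) < M"
        using NB.double_root_far[OF swap.double_root, of "T + of_int \<delta>"] o ge(3,4)
        by (intro far) (simp_all add: ieval_def)
      moreover have "N (of_int k * ieval G ?x) < M" using r A.ieval_Pc[of T] by (intro main) simp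
      ultimately show ?thesis
        unfolding rep[of ?x] x add_diff_cancel_right' by (rule cancel[rotated])
    qed
    have nearB: "N (of_int e2 * ieval (B.head_poly 2) T + of_int e3 * ieval (B.head_poly 3) T) < M"
      if T: "poly (map_poly of_int B.Pc) T = 0" "N T < 1" for T
    proof -
      let ?x = "T + of_int c'"
      have r: "ieval B.Pc T = 0" using T(1) by (simp add: ieval_def)
      note o = swap.near_other[OF N r T(2)]
      have x: "?x - of_int c = T + of_int (c' - c)" by simp
      have "N (of_int d2 * ieval (A.head_poly 2) (T + of_int (c' - c)) + of_int d3 * ieval (A.head_poly 3) (T + of_int (c' - c))) < M"
        using NA.double_root_far[OF double_root, of "T + of_int (c' - c)"] o ge(1,2)
        by (intro far) (simp_all add: ieval_def)
      moreover have "N (of_int k * ieval G ?x) < M" using r B.ieval_Pc[of T] by (intro main) simp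
      ultimately show ?thesis
        unfolding rep[of ?x] x add_diff_cancel_right' by (rule cancel'[rotated])
    qed
    have "N (of_int d2) < M \<and> N (of_int d3) < M * q powr (- A.NP 3)"
      by (intro conjI NA.double_root_coordinates_less[OF double_root M0 ge(1) shift[OF ge(2)]] nearA)
    moreover have "N (of_int e2) < M \<and> N (of_int e3) < M * q powr (- B.NP 3)"
      by (intro conjI NB.double_root_coordinates_less[OF swap.double_root M0 ge(3) shift[OF ge(4)]] nearB)
    ultimately have "Max {N (of_int d2), N (of_int d3) * q powr A.NP 3, N (of_int e2), N (of_int e3) * q powr B.NP 3} < M"
      using unshift by simp
    then show False unfolding M_def by simp
  qed
  have nn: "A.NP 3 \<ge> 0" "B.NP 3 \<ge> 0"
    using A.NP_nonneg_dvd(1)[OF _ A.double_root_flat_ok[OF double_root]]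
      B.NP_nonneg_dvd(1)[OF _ B.double_root_flat_ok[OF swap.double_root]] by simp_all
  show "p ^ v dvd d2" "p ^ v dvd e2" using ge(1,3) MC by (auto intro: NA.N_le_imp_dvd)
  have "N (of_int d3) \<le> q ^ v * q powr (- A.NP 3)"
    using shift[OF ge(2)] mult_right_mono[OF MC, of "q powr (- A.NP 3)"] by simp
  then show "p ^ v dvd d3 * p ^ A.hh 3" by (rule NA.dvd_of_coordinate_bound[OF _ nn(1)])
  have "N (of_int e3) \<le> q ^ v * q powr (- B.NP 3)"
    using shift[OF ge(4)] mult_right_mono[OF MC, of "q powr (- B.NP 3)"] by simp
  then show "p ^ v dvd e3 * p ^ B.hh 3" by (rule NB.dvd_of_coordinate_bound[OF _ nn(2)])
qed

text \<open>Translating a monic quartic by \<open>z\<close> adds \<open>4 * z\<close> to its cubic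
  coefficient. The relation is exact and not only modulo \<open>p\<close>.\<close>

lemma cs_1_eq: "B.cs 1 = A.cs 1 - 4 * \<delta>"
proof -
  obtain p0 p1 p2 p3 where P: "P = [:p0, p1, p2, p3, 1:]"
  proof -
    have "P = [:coeff P 0, coeff P 1, coeff P 2, coeff P 3, 1:]"
    proof (rule poly_eqI)
      fix i :: nat
      have "i = 0 \<or> i = 1 \<or> i = 2 \<or> i = 3 \<or> i = 4 \<or> i > 4" by linarith
      then show "coeff P i = coeff [:coeff P 0, coeff P 1, coeff P 2, coeff P 3, 1:] i"
        using A.monic A.deg_P by (auto simp: numeral_eq_Suc coeff_eq_0 coeff_pCons split: nat.splits)
    qed
    then show thesis by (rule that)
  qed
  have "coeff (pcompose P [:z, 1:]) 3 = p3 + 4 * z" for z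
    unfolding P by (simp add: pcompose_pCons numeral_eq_Suc algebra_simps)
  then show ?thesis by (simp add: A.cs_def B.cs_def A.Pc_def B.Pc_def)
qed

text \<open>Modulo \<open>p\<close> the four Horner sums are \<open>\<phi>'\<^sup>2\<close>,
  \<open>\<phi> * \<phi>'\<^sup>2\<close>, \<open>\<phi>\<^sup>2\<close> and
  \<open>\<phi>' * \<phi>\<^sup>2\<close>, a basis modulo \<open>P\<close> since
  \<open>\<phi>\<close> and \<open>\<phi>'\<close> are coprime. Explicitly, cancelling cubes and
  squares leaves two linear forms in \<open>\<theta>\<close> whose determinant \<open>D\<close> is
  congruent to \<open>\<delta> ^ 5\<close>.\<close>

lemma powers_in_local_span:
  fixes \<alpha> :: complex
  defines "\<theta> \<equiv> \<alpha> - of_int c" and "\<theta>' \<equiv> \<alpha> - of_int c'"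
  assumes S: "ieval (A.head_poly 2) \<theta> \<in> loc_span p ws" "ieval (A.head_poly 3) \<theta> \<in> loc_span p ws"
    "ieval (B.head_poly 2) \<theta>' \<in> loc_span p ws" "ieval (B.head_poly 3) \<theta>' \<in> loc_span p ws"
  shows "1 \<in> loc_span p ws" "\<theta> \<in> loc_span p ws" "\<theta>\<^sup>2 \<in> loc_span p ws" "\<theta> ^ 3 \<in> loc_span p ws"
proof -
  note ls = loc_span_diff[OF A.prime_p] loc_span_mult[OF A.prime_p]
  obtain r1 r2 r3 where r: "A.cs 1 = 2 * \<delta> + p * r1" "A.cs 2 = \<delta>\<^sup>2 + p * r2" "A.cs 3 = p * r3"
    using coeffs_mod_p by (metis dvdE diff_eq_eq add.commute)
  obtain s2 s3 where s: "B.cs 2 = \<delta>\<^sup>2 + p * s2" "B.cs 3 = p * s3"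
    using swap.coeffs_mod_p(2,3) by (metis dvdE diff_eq_eq add.commute power2_commute)
  define a1 where "a1 = A.cs 1"
  define a2 where "a2 = A.cs 2"
  define a3 where "a3 = A.cs 3"
  define b1 where "b1 = B.cs 1"
  define b2 where "b2 = B.cs 2"
  define b3 where "b3 = B.cs 3"
  define dl where "dl = \<delta>"
  have b1: "b1 = a1 - 4 * dl" unfolding b1_def a1_def dl_def by (rule cs_1_eq)
  \<comment> \<open>The difference \<open>?E\<close> of the two cubic sums is
    \<open>dl * \<theta>\<^sup>2 + e1 * \<theta> + e0\<close>. Cancelling its square against each of
    the two quadratic sums leaves the linear forms with coefficients \<open>g11, g12\<close> and
    \<open>g21, g22\<close>.\<close>
  define e1 where "e1 = a2 - 3 * dl\<^sup>2 - 2 * dl * b1 - b2"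
  define e0 where "e0 = a3 - dl ^ 3 - b1 * dl\<^sup>2 - b2 * dl - b3"
  define g11 where "g11 = dl * a1 - e1"
  define g12 where "g12 = dl * a2 - e0"
  define g21 where "g21 = dl * (2 * dl + b1) - e1"
  define g22 where "g22 = dl * (dl\<^sup>2 + b1 * dl + b2) - e0"
  define D where "D = g11 * g22 - g12 * g21"
  have rr: "a1 = 2 * dl + p * r1" "a2 = dl\<^sup>2 + p * r2" "a3 = p * r3" "b2 = dl\<^sup>2 + p * s2" "b3 = p * s3"
    using r s unfolding a1_def a2_def a3_def b2_def b3_def dl_def by simp_all
  define k1 where "k1 = dl * r1 - (r2 - 2 * dl * r1 - s2)"
  define kk where "kk = r3 - dl\<^sup>2 * r1 - s2 * dl - s3"
  define k2 where "k2 = dl * r2 - kk"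
  define k3 where "k3 = dl * r1 - (r2 - 2 * dl * r1 - s2)"
  define k4 where "k4 = dl * (dl * r1 + s2) - kk"
  have g: "g11 = dl\<^sup>2 + p * k1" "g12 = dl ^ 3 + p * k2" "g21 = - (dl\<^sup>2) + p * k3" "g22 = p * k4"
    unfolding g11_def g12_def g21_def g22_def e1_def e0_def b1 rr k1_def k2_def k3_def k4_def kk_def
    by (simp_all add: algebra_simps power2_eq_square power3_eq_cube)
  have D_eq: "D = dl ^ 5 + p * ((dl\<^sup>2 + p * k1) * k4 - (dl ^ 3 + p * k2) * k3 + k2 * dl\<^sup>2)"
    unfolding D_def g by (simp add: algebra_simps numeral_eq_Suc)
  have D: "\<not> p dvd D"
  proof
    assume "p dvd D"
    then have "p dvd dl ^ 5" unfolding D_eq by (simp add: dvd_add_left_iff)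
    then show False using distinct A.prime_p prime_dvd_power unfolding dl_def by blast
  qed
  have th: "\<theta>' = \<theta> + of_int dl" unfolding \<theta>_def \<theta>'_def dl_def by simp
  let ?E = "ieval (A.head_poly 3) \<theta> - ieval (B.head_poly 3) \<theta>'"
  have G1: "of_int dl * ieval (A.head_poly 2) \<theta> - ?E = of_int g11 * \<theta> + of_int g12"
    unfolding A.head_poly_vals B.head_poly_vals th a1_def[symmetric] a2_def[symmetric] a3_def[symmetric]
      b1_def[symmetric] b2_def[symmetric] b3_def[symmetric] g11_def g12_def e1_def e0_def b1
    by (simp add: algebra_simps power2_eq_square power3_eq_cube)
  have G2: "of_int dl * ieval (B.head_poly 2) \<theta>' - ?E = of_int g21 * \<theta> + of_int g22"
    unfolding A.head_poly_vals B.head_poly_vals th a1_def[symmetric] a2_def[symmetric] a3_def[symmetric]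
      b1_def[symmetric] b2_def[symmetric] b3_def[symmetric] g21_def g22_def e1_def e0_def b1
    by (simp add: algebra_simps power2_eq_square power3_eq_cube)
  have GS: "of_int g11 * \<theta> + of_int g12 \<in> loc_span p ws" "of_int g21 * \<theta> + of_int g22 \<in> loc_span p ws"
    unfolding G1[symmetric] G2[symmetric] by (intro ls S)+
  have "of_int g11 * (of_int g21 * \<theta> + of_int g22) - of_int g21 * (of_int g11 * \<theta> + of_int g12) = of_int D * 1"
    unfolding D_def by (simp add: algebra_simps)
  then have "of_int D * 1 \<in> loc_span p ws" using ls GS by metis
  then show one: "1 \<in> loc_span p ws" by (rule loc_span_cancel[OF A.prime_p _ D])
  have "of_int g22 * (of_int g11 * \<theta> + of_int g12) - of_int g12 * (of_int g21 * \<theta> + of_int g22) = of_int D * \<theta>"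
    unfolding D_def by (simp add: algebra_simps)
  then have "of_int D * \<theta> \<in> loc_span p ws" using ls GS by metis
  then show t1: "\<theta> \<in> loc_span p ws" by (rule loc_span_cancel[OF A.prime_p _ D])
  have "\<theta>\<^sup>2 = ieval (A.head_poly 2) \<theta> - of_int a1 * \<theta> - of_int a2 * 1"
    unfolding A.head_poly_vals a1_def a2_def by simp
  also have "\<dots> \<in> loc_span p ws" by (intro ls S one t1)
  finally show t2: "\<theta>\<^sup>2 \<in> loc_span p ws" .
  have "\<theta> ^ 3 = ieval (A.head_poly 3) \<theta> - of_int a1 * \<theta>\<^sup>2 - of_int a2 * \<theta> - of_int a3 * 1"
    unfolding A.head_poly_vals a1_def a2_def a3_def by simp
  also have "\<dots> \<in> loc_span p ws" by (intro ls S one t1 t2)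
  finally show "\<theta> ^ 3 \<in> loc_span p ws" .
qed

text \<open>The four sums form a basis only after localisation, whence the multiplier
  \<open>k\<close>. The resulting identity at \<open>\<alpha>\<close> is one between polynomials of
  degree below 4, so it holds at all algebraic numbers, where \<open>coordinates_dvd\<close> can be
  applied.\<close>

lemma double_span:
  assumes root: "ieval P \<alpha> = 0" and G: "degree G < 4"
    and bound: "\<And>N \<beta>. padic_norm (N :: algebraic_number \<Rightarrow> real) p \<Longrightarrow> ieval P \<beta> = 0 \<Longrightarrow> N (ieval G \<beta>) \<le> N (of_int p) ^ v"
    and mem: "ieval (A.head_poly 2) (\<alpha> - of_int c) \<in> loc_span p ws" "ieval (B.head_poly 2) (\<alpha> - of_int c') \<in> loc_span p ws"
      "ieval (A.head_poly 3) (\<alpha> - of_int c) / of_int p ^ A.hh 3 \<in> loc_span p ws"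
      "ieval (B.head_poly 3) (\<alpha> - of_int c') / of_int p ^ B.hh 3 \<in> loc_span p ws"
  shows "ieval G \<alpha> / of_int p ^ v \<in> loc_span p ws"
proof -
  note pr = A.prime_p
  have p0: "p \<noteq> 0" using pr by auto
  let ?t = "\<alpha> - of_int c" and ?t' = "\<alpha> - of_int c'"
  let ?L = "[ieval (A.head_poly 2) ?t, ieval (A.head_poly 3) ?t, ieval (B.head_poly 2) ?t', ieval (B.head_poly 3) ?t']"
  have "w \<in> loc_span p ?L" if "w \<in> set ?L" for w by (rule loc_span_mem[OF pr that])
  then have pw: "1 \<in> loc_span p ?L" "?t \<in> loc_span p ?L" "?t\<^sup>2 \<in> loc_span p ?L" "?t ^ 3 \<in> loc_span p ?L"
    using powers_in_local_span[of \<alpha> ?L] by simp_all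
  have pw': "?t ^ i \<in> loc_span p ?L" if "i < 4" for i
  proof -
    have "i = 0 \<or> i = 1 \<or> i = 2 \<or> i = 3" using that by auto
    then show ?thesis using pw by auto
  qed
  define Gc where "Gc = pcompose G [:c, 1:]"
  have Gdeg: "degree Gc < 4" using G by (simp add: Gc_def degree_pcompose)
  have "ieval G \<alpha> = ieval Gc ?t" unfolding Gc_def ieval_pcompose by simp
  also have "\<dots> = (\<Sum>i<4. of_int (coeff Gc i) * ?t ^ i)"
    unfolding ieval_altdef by (rule sum.mono_neutral_left) (use Gdeg in \<open>auto simp: coeff_eq_0\<close>)
  also have "\<dots> \<in> loc_span p ?L" by (intro loc_span_sum[OF pr] loc_span_mult[OF pr] pw') simp
  finally obtain k where k: "\<not> p dvd k" "of_int k * ieval G \<alpha> \<in> int_span ?L" unfolding loc_span_def by blast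
  then obtain d where "of_int k * ieval G \<alpha> = (\<Sum>i<length ?L. of_int (d i) * ?L ! i)" unfolding int_span_def by blast
  then have d: "of_int k * ieval G \<alpha> = of_int (d 0) * ieval (A.head_poly 2) ?t + of_int (d 1) * ieval (A.head_poly 3) ?t
     + (of_int (d 2) * ieval (B.head_poly 2) ?t' + of_int (d 3) * ieval (B.head_poly 3) ?t')"
    by (simp add: numeral_eq_Suc)
  define HA where "HA j = pcompose (A.head_poly j) [:- c, 1:]" for j
  define HB where "HB j = pcompose (B.head_poly j) [:- c', 1:]" for j
  have HA: "ieval (HA j) x = ieval (A.head_poly j) (x - of_int c)" for j and x :: "'b::field_char_0"
    unfolding HA_def ieval_pcompose by simp
  have HB: "ieval (HB j) x = ieval (B.head_poly j) (x - of_int c')" for j and x :: "'b::field_char_0"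
    unfolding HB_def ieval_pcompose by simp
  have Hdeg: "degree (HA j) = j" "degree (HB j) = j" for j
    using A.head_poly_monic[of j] B.head_poly_monic[of j] by (simp_all add: HA_def HB_def degree_pcompose)
  define F where "F = smult k G - (smult (d 0) (HA 2) + smult (d 1) (HA 3) + (smult (d 2) (HB 2) + smult (d 3) (HB 3)))"
  have "degree F < 4"
    unfolding F_def using G Hdeg
    by (intro degree_diff_less degree_add_less le_less_trans[OF degree_smult_le]) simp_all
  moreover have "ieval F \<alpha> = 0" unfolding F_def using d by (simp add: HA HB)
  ultimately have "F = 0" using A.zero_of_root[OF root] by blast
  then have F0: "ieval F x = 0" for x :: algebraic_number by simp
  have rep: "of_int k * ieval G x = of_int (d 0) * ieval (A.head_poly 2) (x - of_int c) + of_int (d 1) * ieval (A.head_poly 3) (x - of_int c)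
     + (of_int (d 2) * ieval (B.head_poly 2) (x - of_int c') + of_int (d 3) * ieval (B.head_poly 3) (x - of_int c'))"
    for x :: algebraic_number
    using F0[of x] unfolding F_def by (simp add: HA HB)
  obtain N :: "algebraic_number \<Rightarrow> real" where N: "padic_norm N p" using ex_padic_norm[OF pr] by blast
  obtain m0 m1 m2 m3 where m: "d 0 = p ^ v * m0" "d 1 * p ^ A.hh 3 = p ^ v * m1" "d 2 = p ^ v * m2" "d 3 * p ^ B.hh 3 = p ^ v * m3"
  proof -
    have "p ^ v dvd d 0" by (rule coordinates_dvd(1)[OF N bound[OF N] rep])
    moreover have "p ^ v dvd d 1 * p ^ A.hh 3" by (rule coordinates_dvd(2)[OF N bound[OF N] rep])
    moreover have "p ^ v dvd d 2" by (rule coordinates_dvd(3)[OF N bound[OF N] rep])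
    moreover have "p ^ v dvd d 3 * p ^ B.hh 3" by (rule coordinates_dvd(4)[OF N bound[OF N] rep])
    ultimately show thesis using that by (elim dvdE) blast
  qed
  have m': "of_int (d 1) / of_int p ^ v = (of_int m1 / of_int p ^ A.hh 3 :: complex)"
    "of_int (d 3) / of_int p ^ v = (of_int m3 / of_int p ^ B.hh 3 :: complex)"
    using arg_cong[OF m(2), of "of_int :: int \<Rightarrow> complex"] arg_cong[OF m(4), of "of_int :: int \<Rightarrow> complex"] p0
    by (simp_all add: frac_eq_eq mult.commute)
  have "of_int k * (ieval G \<alpha> / of_int p ^ v) = of_int k * ieval G \<alpha> / of_int p ^ v" by simp
  also have "\<dots> = of_int m0 * ieval (A.head_poly 2) ?t + of_int (d 1) / of_int p ^ v * ieval (A.head_poly 3) ?t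
     + (of_int m2 * ieval (B.head_poly 2) ?t' + of_int (d 3) / of_int p ^ v * ieval (B.head_poly 3) ?t')"
    unfolding d m(1,3) using p0 by (simp add: add_divide_distrib)
  also have "\<dots> = of_int m0 * ieval (A.head_poly 2) ?t + of_int m1 * (ieval (A.head_poly 3) ?t / of_int p ^ A.hh 3)
     + (of_int m2 * ieval (B.head_poly 2) ?t' + of_int m3 * (ieval (B.head_poly 3) ?t' / of_int p ^ B.hh 3))"
    unfolding m' by simp
  also have "\<dots> \<in> loc_span p ws" by (intro loc_span_add[OF pr] loc_span_mult[OF pr] mem)
  finally show ?thesis by (rule loc_span_cancel[OF pr _ k(1)])
qed

text \<open>If \<open>A.hh 3 = 0\<close>, the first cubic sum differs from the second by an integral
  polynomial of degree at most 2. Otherwise the numerators of \<open>wA\<close> and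
  \<open>wB\<close> differ by a quadratic polynomial with leading coefficient \<open>c - c'\<close>,
  prime to \<open>p\<close>, so the square of \<open>\<alpha>\<close> is recovered locally.\<close>

theorem double_basis:
  assumes root: "ieval P \<alpha> = 0" and le: "A.hh 3 \<le> B.hh 3"
  defines "wA \<equiv> quot3 p P \<phi> \<alpha>" and "wB \<equiv> quot3 p P \<phi>' \<alpha>"
  shows "A.hh 3 = 0 \<Longrightarrow> p_integral_basis p \<alpha> [1, \<alpha>, \<alpha>\<^sup>2, wB]"
    and "A.hh 3 \<ge> 1 \<Longrightarrow> p_integral_basis p \<alpha> [1, \<alpha>, wA - of_int p ^ (B.hh 3 - A.hh 3) * wB, wB]"
proof -
  note pr = A.prime_p
  have p0: "p \<noteq> 0" using pr by auto
  let ?t = "\<alpha> - of_int c" and ?t' = "\<alpha> - of_int c'"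
  have fA: "A.flat_ok 3" and fB: "B.flat_ok 3"
    using A.double_root_flat_ok[OF double_root, of 3] B.double_root_flat_ok[OF swap.double_root, of 3] by simp_all
  have wA: "wA = ieval (A.W 3) \<alpha> / of_int p ^ A.hh 3" unfolding wA_def by (rule A.quot_eqs)
  have wB: "wB = ieval (B.W 3) \<alpha> / of_int p ^ B.hh 3" unfolding wB_def by (rule B.quot_eqs)
  have WA: "N (ieval (A.W 3) \<beta>) \<le> N (of_int p) ^ A.hh 3"
    and WB: "N (ieval (B.W 3) \<beta>) \<le> N (of_int p) ^ B.hh 3"
    if "padic_norm (N :: algebraic_number \<Rightarrow> real) p" "ieval P \<beta> = 0" for N \<beta>
    using A.W_bound[OF that _ fA] B.W_bound[OF that _ fB] by simp_all
  have genpow: "\<exists>G e. \<alpha> ^ i = ieval G \<alpha> / of_int p ^ e \<and>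
      (\<forall>N \<beta>. padic_norm (N :: algebraic_number \<Rightarrow> real) p \<longrightarrow> ieval P \<beta> = 0 \<longrightarrow> N (ieval G \<beta>) \<le> N (of_int p) ^ e)" for i
  proof -
    have "\<alpha> ^ i = ieval (monom 1 i) \<alpha> / of_int p ^ 0" by (simp add: ieval_def poly_monom of_int_hom.map_poly_hom_monom)
    moreover have "N (ieval (monom 1 i) \<beta>) \<le> N (of_int p) ^ 0"
      if "padic_norm (N :: algebraic_number \<Rightarrow> real) p" "ieval P \<beta> = 0" for N \<beta>
    proof -
      interpret padic_norm N p by fact
      show ?thesis using N_ieval_le_1[OF A.N_le_1_at_root[OF that]] by simp
    qed
    ultimately show ?thesis by blast
  qed
  have genB: "\<exists>G e. wB = ieval G \<alpha> / of_int p ^ e \<and>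
      (\<forall>N \<beta>. padic_norm (N :: algebraic_number \<Rightarrow> real) p \<longrightarrow> ieval P \<beta> = 0 \<longrightarrow> N (ieval G \<beta>) \<le> N (of_int p) ^ e)"
    using wB WB by blast
  have mems: "ieval (A.head_poly 2) ?t \<in> loc_span p ws" "ieval (B.head_poly 2) ?t' \<in> loc_span p ws"
      "ieval (B.head_poly 3) ?t' / of_int p ^ B.hh 3 \<in> loc_span p ws"
    if "1 \<in> loc_span p ws" "\<alpha> \<in> loc_span p ws" "\<alpha>\<^sup>2 \<in> loc_span p ws" "wB \<in> loc_span p ws" for ws
  proof -
    note ls = loc_span_add[OF pr] loc_span_diff[OF pr] loc_span_mult[OF pr]
    have "ieval (A.head_poly 2) ?t = \<alpha>\<^sup>2 + of_int (A.cs 1 - 2 * c) * \<alpha> + of_int (c\<^sup>2 - A.cs 1 * c + A.cs 2) * 1"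
      unfolding A.head_poly_vals by (simp add: algebra_simps power2_eq_square)
    also have "\<dots> \<in> loc_span p ws" by (intro ls that)
    finally show "ieval (A.head_poly 2) ?t \<in> loc_span p ws" .
    have "ieval (B.head_poly 2) ?t' = \<alpha>\<^sup>2 + of_int (B.cs 1 - 2 * c') * \<alpha> + of_int (c'\<^sup>2 - B.cs 1 * c' + B.cs 2) * 1"
      unfolding B.head_poly_vals by (simp add: algebra_simps power2_eq_square)
    also have "\<dots> \<in> loc_span p ws" by (intro ls that)
    finally show "ieval (B.head_poly 2) ?t' \<in> loc_span p ws" .
    show "ieval (B.head_poly 3) ?t' / of_int p ^ B.hh 3 \<in> loc_span p ws"
      using B.head_poly_over_power_mem[OF _ fB that(1), of \<alpha>] that(4) unfolding wB by simp
  qed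
  have in_set: "w \<in> loc_span p ws" if "w \<in> set ws" for w ws by (rule loc_span_mem[OF pr that])
  show "p_integral_basis p \<alpha> [1, \<alpha>, \<alpha>\<^sup>2, wB]" if h0: "A.hh 3 = 0"
  proof (rule A.p_integral_basisI[OF root pr])
    let ?ws = "[1, \<alpha>, \<alpha>\<^sup>2, wB]"
    show "length ?ws = 4" by simp
    show "\<exists>G e. w = ieval G \<alpha> / of_int p ^ e \<and>
      (\<forall>N \<beta>. padic_norm (N :: algebraic_number \<Rightarrow> real) p \<longrightarrow> ieval P \<beta> = 0 \<longrightarrow> N (ieval G \<beta>) \<le> N (of_int p) ^ e)"
      if "w \<in> set ?ws" for w
    proof -
      have "w = \<alpha> ^ 0 \<or> w = \<alpha> ^ 1 \<or> w = \<alpha> ^ 2 \<or> w = wB" using that by auto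
      then show ?thesis using genpow[of 0] genpow[of 1] genpow[of 2] genB by (elim disjE) (simp_all only:)
    qed
    fix G v assume G: "degree G < 4"
      "\<And>N \<beta>. padic_norm (N :: algebraic_number \<Rightarrow> real) p \<Longrightarrow> ieval P \<beta> = 0 \<Longrightarrow> N (ieval G \<beta>) \<le> N (of_int p) ^ v"
    note ls = loc_span_add[OF pr] loc_span_diff[OF pr] loc_span_mult[OF pr]
    have base: "1 \<in> loc_span p ?ws" "\<alpha> \<in> loc_span p ?ws" "\<alpha>\<^sup>2 \<in> loc_span p ?ws" "wB \<in> loc_span p ?ws"
      by (rule in_set, simp)+
    note ms = mems[OF base]
    have "of_int p ^ B.hh 3 * (ieval (B.head_poly 3) ?t' / of_int p ^ B.hh 3) = ieval (B.head_poly 3) ?t'"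
      using p0 by simp
    then have B3: "ieval (B.head_poly 3) ?t' \<in> loc_span p ?ws"
      using loc_span_mult[OF pr ms(3), of "p ^ B.hh 3"] by simp
    have "ieval (A.head_poly 3) ?t = ieval (B.head_poly 3) ?t' +
      (of_int (A.cs 1 - 3 * c - B.cs 1 + 3 * c') * \<alpha>\<^sup>2
       + of_int (3 * c\<^sup>2 - 2 * A.cs 1 * c + A.cs 2 - 3 * c'\<^sup>2 + 2 * B.cs 1 * c' - B.cs 2) * \<alpha>
       + of_int (- (c ^ 3) + A.cs 1 * c\<^sup>2 - A.cs 2 * c + A.cs 3 + c' ^ 3 - B.cs 1 * c'\<^sup>2 + B.cs 2 * c' - B.cs 3) * 1)"
      unfolding A.head_poly_vals B.head_poly_vals by (simp add: algebra_simps power2_eq_square power3_eq_cube)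
    also have "\<dots> \<in> loc_span p ?ws" by (intro ls B3 base)
    finally have "ieval (A.head_poly 3) ?t / of_int p ^ A.hh 3 \<in> loc_span p ?ws" unfolding h0 by simp
    from double_span[OF root G ms(1,2) this ms(3)]
    show "ieval G \<alpha> / of_int p ^ v \<in> loc_span p ?ws" .
  qed
  show "p_integral_basis p \<alpha> [1, \<alpha>, wA - of_int p ^ (B.hh 3 - A.hh 3) * wB, wB]" if h1: "A.hh 3 \<ge> 1"
  proof (rule A.p_integral_basisI[OF root pr])
    let ?W = "wA - of_int p ^ (B.hh 3 - A.hh 3) * wB"
    let ?ws = "[1, \<alpha>, ?W, wB]"
    have W: "?W = ieval (A.W 3 - B.W 3) \<alpha> / of_int p ^ A.hh 3"
    proof -
      have "of_int p ^ B.hh 3 = of_int p ^ (B.hh 3 - A.hh 3) * (of_int p ^ A.hh 3 :: complex)"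
        using le by (simp flip: power_add)
      then have "of_int p ^ (B.hh 3 - A.hh 3) * wB = ieval (B.W 3) \<alpha> / of_int p ^ A.hh 3"
        unfolding wB using p0 by simp
      then show ?thesis unfolding wA by (simp add: diff_divide_distrib)
    qed
    show "length ?ws = 4" by simp
    have genW: "\<exists>G e. ?W = ieval G \<alpha> / of_int p ^ e \<and>
      (\<forall>N \<beta>. padic_norm (N :: algebraic_number \<Rightarrow> real) p \<longrightarrow> ieval P \<beta> = 0 \<longrightarrow> N (ieval G \<beta>) \<le> N (of_int p) ^ e)"
    proof -
      have "N (ieval (A.W 3 - B.W 3) \<beta>) \<le> N (of_int p) ^ A.hh 3"
        if "padic_norm (N :: algebraic_number \<Rightarrow> real) p" "ieval P \<beta> = 0" for N \<beta>
      proof -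
        interpret padic_norm N p by fact
        have "N (of_int p) ^ B.hh 3 \<le> N (of_int p) ^ A.hh 3"
          using le N_nonneg N_p_less_1 by (intro power_decreasing) auto
        then show ?thesis using WA[OF that] WB[OF that] by (simp add: N_diff_le)
      qed
      then show ?thesis using W by blast
    qed
    show "\<exists>G e. w = ieval G \<alpha> / of_int p ^ e \<and>
      (\<forall>N \<beta>. padic_norm (N :: algebraic_number \<Rightarrow> real) p \<longrightarrow> ieval P \<beta> = 0 \<longrightarrow> N (ieval G \<beta>) \<le> N (of_int p) ^ e)"
      if "w \<in> set ?ws" for w
    proof -
      have "w = \<alpha> ^ 0 \<or> w = \<alpha> ^ 1 \<or> w = ?W \<or> w = wB" using that by auto
      then show ?thesis using genpow[of 0] genpow[of 1] genW genB by (elim disjE) (simp_all only:)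
    qed
    fix G v assume G: "degree G < 4"
      "\<And>N \<beta>. padic_norm (N :: algebraic_number \<Rightarrow> real) p \<Longrightarrow> ieval P \<beta> = 0 \<Longrightarrow> N (ieval G \<beta>) \<le> N (of_int p) ^ v"
    note ls = loc_span_add[OF pr] loc_span_diff[OF pr] loc_span_mult[OF pr]
    have base: "1 \<in> loc_span p ?ws" "\<alpha> \<in> loc_span p ?ws" "?W \<in> loc_span p ?ws" "wB \<in> loc_span p ?ws"
      by (rule in_set, simp)+
    have "of_int (p ^ A.hh 3) * ?W = ieval (A.W 3) \<alpha> - ieval (B.W 3) \<alpha>" unfolding W using p0 by simp
    also have "\<dots> = of_int (c - c') * \<alpha>\<^sup>2
       + of_int (3 * c\<^sup>2 - 2 * A.cs 1 * c + A.cs 2 - 3 * c'\<^sup>2 + 2 * B.cs 1 * c' - B.cs 2) * \<alpha>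
       + of_int (- (c ^ 3) + A.cs 1 * c\<^sup>2 - A.cs 2 * c + c' ^ 3 - B.cs 1 * c'\<^sup>2 + B.cs 2 * c') * 1"
      unfolding A.ieval_W B.ieval_W A.head_poly_vals B.head_poly_vals cs_1_eq
      by (simp add: algebra_simps power2_eq_square power3_eq_cube)
    finally have eqn: "of_int (p ^ A.hh 3) * ?W = of_int (c - c') * \<alpha>\<^sup>2
       + of_int (3 * c\<^sup>2 - 2 * A.cs 1 * c + A.cs 2 - 3 * c'\<^sup>2 + 2 * B.cs 1 * c' - B.cs 2) * \<alpha>
       + of_int (- (c ^ 3) + A.cs 1 * c\<^sup>2 - A.cs 2 * c + c' ^ 3 - B.cs 1 * c'\<^sup>2 + B.cs 2 * c') * 1" .
    have gen: "x = a + b + e \<Longrightarrow> a = x - b - e" for x a b e :: complex by simp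
    have "of_int (c - c') * \<alpha>\<^sup>2 = of_int (p ^ A.hh 3) * ?W
       - of_int (3 * c\<^sup>2 - 2 * A.cs 1 * c + A.cs 2 - 3 * c'\<^sup>2 + 2 * B.cs 1 * c' - B.cs 2) * \<alpha>
       - of_int (- (c ^ 3) + A.cs 1 * c\<^sup>2 - A.cs 2 * c + c' ^ 3 - B.cs 1 * c'\<^sup>2 + B.cs 2 * c') * 1"
      by (rule gen[OF eqn])
    also have "\<dots> \<in> loc_span p ?ws" by (intro ls base)
    finally have sq: "\<alpha>\<^sup>2 \<in> loc_span p ?ws" by (rule loc_span_cancel[OF pr _ distinct])
    note ms = mems[OF base(1,2) sq base(4)]
    have "wA = ?W + of_int (p ^ (B.hh 3 - A.hh 3)) * wB" by simp
    also have "\<dots> \<in> loc_span p ?ws" by (intro ls base)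
    finally have "ieval (A.W 3) \<alpha> / of_int p ^ A.hh 3 \<in> loc_span p ?ws" unfolding wA .
    then have "ieval (A.head_poly 3) ?t / of_int p ^ A.hh 3 \<in> loc_span p ?ws"
      using A.head_poly_over_power_mem[OF _ fA base(1), of \<alpha>] by simp
    from double_span[OF root G ms(1,2) this ms(3)]
    show "ieval G \<alpha> / of_int p ^ v \<in> loc_span p ?ws" .
  qed
qed

end

section \<open>Quadratic phi: contents, separability, and the development\<close>

lemma vp_poly_decompose:
  assumes p: "prime p" and C: "C \<noteq> 0"
  obtains v C' where "vp_poly p C = enat v" "C = smult (p ^ v) C'" "\<not> (\<forall>i. p dvd coeff C' i)"
proof -
  obtain i where i: "coeff C i \<noteq> 0" using C by (auto simp: poly_eq_iff)
  have "vp_poly p C \<le> vp p (coeff C i)" unfolding vp_poly_def by (rule INF_lower) simp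
  then obtain v where v: "vp_poly p C = enat v" using i by (cases "vp_poly p C") (auto simp: vp_def)
  let ?S = "range (\<lambda>i. vp p (coeff C i))"
  have "Inf ?S \<in> ?S" by (rule wellorder_InfI[of "vp p (coeff C 0)"]) simp
  then obtain i0 where i0: "vp p (coeff C i0) = enat v" using v unfolding vp_poly_def by auto
  then have i0': "coeff C i0 \<noteq> 0" "multiplicity p (coeff C i0) = v" by (auto simp: vp_def split: if_splits)
  have dvd: "p ^ v dvd coeff C i" for i
  proof (cases "coeff C i = 0")
    case False
    have "enat v \<le> vp p (coeff C i)" unfolding v[symmetric] vp_poly_def by (rule INF_lower) simp
    then have "v \<le> multiplicity p (coeff C i)" using False by (simp add: vp_def)
    then show ?thesis by (rule multiplicity_dvd')
  qed simp
  define C' where "C' = map_poly (\<lambda>c. c div p ^ v) C"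
  have cf: "coeff C' i = coeff C i div p ^ v" for i by (simp add: C'_def coeff_map_poly)
  have "C = smult (p ^ v) C'" using dvd by (auto simp: poly_eq_iff cf)
  moreover have "\<not> p dvd coeff C i0 div p ^ v"
    using multiplicity_decompose[OF i0'(1), of p] i0'(2) p not_prime_unit by metis
  then have "\<not> (\<forall>i. p dvd coeff C' i)" using cf by metis
  ultimately show thesis using v that by blast
qed

lemma poly_degree_less_2: "degree C < 2 \<Longrightarrow> C = [:coeff C 0, coeff C 1:]"
proof (rule poly_eqI)
  fix i
  assume "degree C < 2"
  then show "coeff C i = coeff [:coeff C 0, coeff C 1:] i"
    by (cases i) (auto simp: coeff_pCons coeff_eq_0 split: nat.split)
qed

context coeff_ring
begin

text \<open>Scaling by the residual inverse \<open>w\<close> of \<open>\<delta>\<close> undoes the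
  substitution up to small terms and carries a square factor back to \<open>F\<close>.\<close>

lemma residually_squarefree_scale:
  assumes F: "poly_over Z F" "residually_squarefree F" and d: "\<delta> \<in> Z" "N \<delta> = 1"
  shows "residually_squarefree (pcompose F [:0, \<delta>:])"
  unfolding residually_squarefree_def
proof (intro allI impI)
  fix G H and n :: nat
  assume G: "poly_over Z G" and H: "poly_over Z H" and sm: "small (pcompose F [:0, \<delta>:] - G * G * H)" and n: "1 \<le> n"
  obtain w where w: "w \<in> Z" "N (\<delta> * w - 1) < 1" using Z_inverse[OF d] by blast
  have Nw: "N w = 1"
  proof -
    have "N (\<delta> * w) = 1" using N_add_eq[of "\<delta> * w - 1" 1] w(2) by simp
    then show ?thesis using d(2) by (simp add: N_mult)
  qed
  have over: "poly_over Z (pcompose K [:0, w:])" if "poly_over Z K" for K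
    using that w(1) by (auto simp: poly_over_def coeff_pcompose_linear intro!: Z_closed unital_subring_power[OF Z_subring])
  have "small (pcompose (pcompose F [:0, \<delta>:] - G * G * H) [:0, w:])"
    using sm Nw by (simp add: small_def coeff_pcompose_linear N_mult N_power)
  then have 1: "small (pcompose (pcompose F [:0, \<delta>:]) [:0, w:] - pcompose G [:0, w:] * pcompose G [:0, w:] * pcompose H [:0, w:])"
    by (simp add: pcompose_diff pcompose_mult)
  have "small (F - pcompose (pcompose F [:0, \<delta>:]) [:0, w:])"
    unfolding small_def
  proof
    fix i
    have "coeff (F - pcompose (pcompose F [:0, \<delta>:]) [:0, w:]) i = coeff F i * (1 ^ i - (\<delta> * w) ^ i)"
      by (simp add: coeff_pcompose_linear power_mult_distrib algebra_simps)
    moreover have "N (1 ^ i - (\<delta> * w) ^ i) < 1"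
    proof (cases "i > 0")
      case True
      have "N (\<delta> * w) = 1" using d Nw by (simp add: N_mult)
      moreover have "N (1 - \<delta> * w) < 1" using w(2) N_minus[of "\<delta> * w - 1"] by simp
      ultimately show ?thesis using N_power_diff[of 1 1 "\<delta> * w" i] True by simp
    qed simp
    ultimately show "N (coeff (F - pcompose (pcompose F [:0, \<delta>:]) [:0, w:]) i) < 1"
      using N_mult_less_1[OF coeff_le_1[OF F(1)]] by simp
  qed
  from small_trans[OF this 1] have "N (coeff (pcompose G [:0, w:]) n) < 1"
    using F(2) over[OF G] over[OF H] n unfolding residually_squarefree_def by blast
  then show "N (coeff G n) < 1" using Nw by (simp add: coeff_pcompose_linear N_mult N_power)
qed

end

context residue_root
begin

text \<open>Otherwise \<open>\<phi>\<close> would divide \<open>C\<close> modulo \<open>p\<close>.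
  Subtracting a suitable multiple of \<open>p\<close> leaves a multiple of \<open>\<phi>\<close> of
  too small a degree, so \<open>C\<close> itself would be divisible by \<open>p\<close>.\<close>

lemma N_ieval_unit:
  assumes "degree C < degree \<phi>" "\<not> (\<forall>i. p dvd coeff C i)"
  shows "N (ieval C \<xi>) = 1"
proof (rule ccontr)
  assume "N (ieval C \<xi>) \<noteq> 1"
  then have "N (ieval C \<xi>) < 1" using N_ieval_le_1[OF N_xi, of C] by simp
  then obtain h where h: "poly_mod.eq_m p C (\<phi> * h)" using dvdm_of_N_ieval_less_1 by (auto simp: poly_mod.dvdm_def)
  define r where "r = map_poly (\<lambda>c. c div p) (C - \<phi> * h)"
  have r: "C - \<phi> * h = smult p r"
    using eq_mD[OF h] by (auto simp: poly_eq_iff r_def coeff_map_poly)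
  obtain s r' where s: "r = \<phi> * s + r'" "degree r' < degree \<phi>" by (rule monic_divmod[OF phi_monic phi_deg])
  have e: "C - smult p r' = \<phi> * (h + smult p s)" using r s(1) by (simp add: algebra_simps smult_add_right)
  have "degree (C - smult p r') < degree \<phi>"
    using assms(1) s(2) by (intro degree_diff_less le_less_trans[OF degree_smult_le])
  moreover have "\<phi> \<noteq> 0" using phi_monic by auto
  ultimately have "h + smult p s = 0"
    using degree_mult_eq[of \<phi> "h + smult p s"] phi_deg unfolding e by (cases "h + smult p s = 0") auto
  then have "C = smult p r'" using e by simp
  then show False using assms(2) by simp
qed

lemma N_ieval_content:
  "degree C < degree \<phi> \<Longrightarrow> \<not> (\<forall>i. p dvd coeff C i) \<Longrightarrow> N (ieval (smult (p ^ v) C) \<xi>) = q ^ v"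
  using N_ieval_unit[of C] by (simp add: N_mult N_p_power)

text \<open>Below the degree of \<open>\<phi>\<close> the norm at \<open>\<xi>\<close> is that of
  the content, so a single value controls all coefficients.\<close>

lemma N_coeff_le:
  assumes "degree C < degree \<phi>" shows "N (of_int (coeff C i)) \<le> N (ieval C \<xi>)"
proof (cases "C = 0")
  case False
  obtain v C' where C: "vp_poly p C = enat v" "C = smult (p ^ v) C'" "\<not> (\<forall>i. p dvd coeff C' i)"
    by (rule vp_poly_decompose[OF prime_p False])
  have "degree C' < degree \<phi>" using assms C(2) prime_p by (simp add: prime_gt_0_int)
  then have "N (ieval C \<xi>) = q ^ v" using N_ieval_content C by simp
  moreover have "N (of_int (coeff C i)) = q ^ v * N (of_int (coeff C' i))" unfolding C(2) by (simp add: N_mult N_p_power)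
  ultimately show ?thesis using N_of_int_le_1[of "coeff C' i"] q_pos by (simp add: mult_left_le)
qed simp

lemma N_ieval_le_powr:
  assumes "degree C < degree \<phi>" "N (ieval C \<xi>) \<le> q powr x" "\<And>w. x \<le> real w \<Longrightarrow> v \<le> w + k"
  shows "\<exists>C'. smult (p ^ k) C = smult (p ^ v) C'"
proof (cases "C = 0")
  case False
  obtain w C' where C: "vp_poly p C = enat w" "C = smult (p ^ w) C'" "\<not> (\<forall>i. p dvd coeff C' i)"
    by (rule vp_poly_decompose[OF prime_p False])
  have "degree C' < degree \<phi>" using assms(1) C(2) prime_p by (simp add: prime_gt_0_int)
  then have "q powr real w \<le> q powr x" using N_ieval_content[of C' w] C assms(2) by (simp add: q_powr_real)
  then have "v \<le> w + k" using assms(3) q_powr_le_iff by blast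
  then have "w + k = v + (w + k - v)" by simp
  then have "smult (p ^ k) C = smult (p ^ v) (smult (p ^ (w + k - v)) C')"
    unfolding C(2) by (simp add: power_add[symmetric] add.commute)
  then show ?thesis by blast
qed (auto intro: exI[of _ 0])

text \<open>\<open>\<phi>\<close> is separable modulo \<open>p\<close>.\<close>

lemma N_deriv:
  assumes phi: "\<phi> = [:f0, f1, 1:]"
  shows "N (2 * \<xi> + of_int f1) = 1"
proof (rule ccontr)
  assume ne: "N (2 * \<xi> + of_int f1) \<noteq> 1"
  have e: "2 * \<xi> + of_int f1 = ieval [:f1, 2:] \<xi>" by (simp add: mult.commute)
  have d: "\<forall>i. p dvd coeff [:f1, 2:] i" using ne N_ieval_unit[of "[:f1, 2:]"] phi unfolding e by auto
  have "p dvd 2" using d[rule_format, of 1] by simp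
  then have p2: "p = 2" using prime_p primes_dvd_imp_eq[of p 2] by simp
  have f1: "p dvd f1" using d[rule_format, of 0] by simp
  \<comment> \<open>In characteristic 2 with vanishing linear coefficient, \<open>\<phi>\<close> is
    the square of \<open>X + f0\<close>, because \<open>f0\<close> is congruent to its own
    square.\<close>
  have sq: "poly_mod.eq_m p \<phi> ([:f0, 1:] * [:f0, 1:])"
  proof (rule eq_mI)
    fix i
    have "\<phi> - [:f0, 1:] * [:f0, 1:] = [:f0 - f0 * f0, f1 - 2 * f0:]" unfolding phi by (simp add: algebra_simps)
    moreover have "p dvd f0 - f0 * f0" "p dvd f1 - 2 * f0" using f1 unfolding p2 by simp_all
    ultimately show "p dvd coeff (\<phi> - [:f0, 1:] * [:f0, 1:]) i" by (simp add: coeff_pCons split: nat.split)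
  qed
  then have "poly_mod.dvdm p [:f0, 1:] 1" using phi_irr unfolding poly_mod.irreducible_m_def by blast
  then obtain h where h: "poly_mod.eq_m p 1 ([:f0, 1:] * h)" by (auto simp: poly_mod.dvdm_def)
  have "N (ieval [:f0, 1:] \<xi>) < 1"
  proof (rule ccontr)
    assume "\<not> ?thesis"
    then have "N (ieval [:f0, 1:] \<xi>) = 1" using N_ieval_le_1[OF N_xi, of "[:f0, 1:]"] by linarith
    then have "N (ieval \<phi> \<xi> - ieval ([:f0, 1:] * [:f0, 1:]) \<xi>) = 1"
      unfolding phi_root ieval_simps(5) by (simp only: diff_0 N_minus N_mult)
    then show False using N_ieval_eq_m[OF sq N_xi] by simp
  qed
  then have "N (ieval h \<xi> * ieval [:f0, 1:] \<xi>) < 1" by (intro N_mult_less_1 N_ieval_le_1 N_xi)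
  then have "N (ieval ([:f0, 1:] * h) \<xi>) < 1" by (simp only: ieval_simps(5) mult.commute)
  from N_add_less[OF N_ieval_eq_m[OF h N_xi] this] show False by simp
qed

end

locale quadratic_lift = monic_irreducible P
  for P :: "int poly" +
  fixes p :: int and \<phi> :: "int poly"
  assumes prime_p: "prime p" and phi_monic: "lead_coeff \<phi> = 1" and phi_deg: "degree \<phi> = 2"
    and phi_irr: "poly_mod.irreducible_m p \<phi>" and regular: "phi_regular p \<phi> P"
    and eq_m: "poly_mod.eq_m p P (\<phi>\<^sup>2)"
begin

definition A where "A = phi_dev \<phi> P 1"
definition B where "B = phi_dev \<phi> P 0"
definition f0 where "f0 = coeff \<phi> 0"
definition f1 where "f1 = coeff \<phi> 1"

lemma phi: "\<phi> = [:f0, f1, 1:]"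
proof (rule poly_eqI)
  fix i :: nat
  have "i = 0 \<or> i = 1 \<or> i = 2 \<or> i > 2" by linarith
  then show "coeff \<phi> i = coeff [:f0, f1, 1:] i"
    using phi_monic phi_deg by (auto simp: f0_def f1_def numeral_2_eq_2 coeff_eq_0 coeff_pCons split: nat.splits)
qed

lemma development:
  "degree A < 2" "degree B < 2" "P = \<phi>\<^sup>2 + A * \<phi> + B" "phi_dev \<phi> P 2 = 1"
proof -
  have "is_phi_dev \<phi> P (phi_dev \<phi> P)"
    unfolding phi_dev_def by (rule theI'[OF is_phi_dev_unique[OF phi_monic]]) (simp add: phi_deg)
  then have D0: "\<forall>i. degree (phi_dev \<phi> P i) < degree \<phi>"
    "P = (\<Sum>i\<le>degree P div degree \<phi>. phi_dev \<phi> P i * \<phi> ^ i)"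
    unfolding is_phi_dev_def by blast+
  have dd: "degree P div degree \<phi> = 2" using phi_deg deg_P by simp
  have D: "degree (phi_dev \<phi> P i) < 2" for i using D0(1) phi_deg by simp
  note D2 = D0(2)[unfolded dd]
  show "degree A < 2" "degree B < 2" using D by (simp_all add: A_def B_def)
  define C where "C = phi_dev \<phi> P 2"
  have "{..2::nat} = {0, 1, 2}" by auto
  then have "(\<Sum>i\<le>2. phi_dev \<phi> P i * \<phi> ^ i) = C * \<phi>\<^sup>2 + A * \<phi> + B"
    by (simp add: A_def B_def C_def)
  then have P: "P = C * \<phi>\<^sup>2 + A * \<phi> + B" by (rule trans[OF D2])
  have R: "degree (A * \<phi> + B) < 4"
    using D[of 0] D[of 1] phi_deg unfolding A_def B_def
    by (intro degree_add_less le_less_trans[OF degree_mult_le]) simp_all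
  have "x = a + b + d \<Longrightarrow> a = x - (b + d)" for x a b d :: "int poly" by simp
  from this[OF P] have CP: "C * \<phi>\<^sup>2 = P - (A * \<phi> + B)" .
  have "coeff (A * \<phi> + B) 4 = 0" by (rule coeff_eq_0[OF R])
  then have c4: "coeff (C * \<phi>\<^sup>2) 4 = 1" unfolding CP coeff_diff using deg_P monic by simp
  then have C0: "C \<noteq> 0" by auto
  have "\<phi> \<noteq> 0" using phi_monic by auto
  then have dm: "degree (C * \<phi>\<^sup>2) = degree C + 4"
    using C0 phi_deg by (simp add: degree_mult_eq degree_power_eq)
  have "degree (C * \<phi>\<^sup>2) \<le> 4" unfolding CP using R deg_P by (intro degree_diff_le) simp_all
  then have dC: "degree C = 0" using dm by simp
  then have "lead_coeff (C * \<phi>\<^sup>2) = 1" using c4 dm by simp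
  then have "lead_coeff C = 1" using phi_monic by (simp add: lead_coeff_mult lead_coeff_power)
  then have "C = 1" using dC by (metis degree_0_id one_poly_eq_simps(1))
  then show "phi_dev \<phi> P 2 = 1" by (simp add: C_def)
  have "C * \<phi>\<^sup>2 = \<phi>\<^sup>2" using \<open>C = 1\<close> by simp
  from trans[OF P arg_cong[OF this, of "\<lambda>x. x + A * \<phi> + B"]] show "P = \<phi>\<^sup>2 + A * \<phi> + B" .
qed

text \<open>\<open>A * \<phi> + B\<close> vanishes modulo \<open>p\<close>, and its coefficients
  determine those of \<open>A\<close> and \<open>B\<close> from the top down.\<close>

lemma dvd_development: "p dvd coeff A i" "p dvd coeff B i"
proof -
  obtain x1 y1 where A: "A = [:x1, y1:]" using poly_degree_less_2[OF development(1)] by blast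
  obtain x0 y0 where B: "B = [:x0, y0:]" using poly_degree_less_2[OF development(2)] by blast
  obtain g0 g1 where phi': "\<phi> = [:g0, g1, 1:]" using phi by blast
  have "x = a + b + d \<Longrightarrow> x - a = b + d" for x a b d :: "int poly" by simp
  from this[OF development(3)] have "P - \<phi>\<^sup>2 = A * \<phi> + B" .
  also have "\<dots> = [:x1, y1:] * [:g0, g1, 1:] + [:x0, y0:]"
    by (rule arg_cong2[where f = "(+)"], rule arg_cong2[where f = "(*)"]) (rule A phi' B)+
  also have "\<dots> = [:x1 * g0 + x0, x1 * g1 + y1 * g0 + y0, x1 + y1 * g1, y1:]" by (simp add: algebra_simps)
  finally have e: "P - \<phi>\<^sup>2 = [:x1 * g0 + x0, x1 * g1 + y1 * g0 + y0, x1 + y1 * g1, y1:]" .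
  note d = eq_mD[OF eq_m, unfolded e]
  have 1: "p dvd y1" using d[of 3] by (simp add: numeral_3_eq_3)
  have 2: "p dvd x1" using d[of 2] 1 by (simp add: numeral_2_eq_2 dvd_add_left_iff)
  have 3: "p dvd y0" using d[of 1] 1 2 by (simp add: dvd_add_right_iff)
  have 4: "p dvd x0" using d[of 0] 2 by (simp add: dvd_add_right_iff)
  show "p dvd coeff A i" "p dvd coeff B i"
    unfolding A B using 1 2 3 4 by (simp_all add: coeff_pCons split: nat.split)
qed

lemma B_nz: "B \<noteq> 0"
proof
  assume "B = 0"
  have "x = a\<^sup>2 + b * a + d \<Longrightarrow> d = 0 \<Longrightarrow> x = a * (a + b)" for x a b d :: "int poly"
    by (simp add: power2_eq_square algebra_simps)
  from this[OF development(3) \<open>B = 0\<close>] have e: "P = \<phi> * (\<phi> + A)" .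
  have da: "degree (\<phi> + A) = 2" using development(1) phi_deg by (subst degree_add_eq_left) simp_all
  have "is_unit \<phi> \<or> is_unit (\<phi> + A)" using irr e irreducibleD by blast
  then show False using dvd_imp_degree_le[of _ "1 :: int poly"] phi_deg da by fastforce
qed

definition uB where "uB = the_enat (vp_poly p B)"
definition B' where "B' = (SOME C. B = smult (p ^ uB) C \<and> \<not> (\<forall>i. p dvd coeff C i))"
text \<open>For \<open>A = 0\<close> the value \<open>uB\<close> has the effect of an infinite
  valuation: the minimum with half of \<open>uB\<close> is not attained by it, and
  \<open>2 * uA = uB\<close> fails since \<open>uB\<close> is positive.\<close>

definition uA where "uA = (if A = 0 then uB else the_enat (vp_poly p A))"
definition A' where "A' = (if A = 0 then 0 else (SOME C. A = smult (p ^ uA) C \<and> \<not> (\<forall>i. p dvd coeff C i)))"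

lemma B_eq: "vp_poly p B = enat uB" "B = smult (p ^ uB) B'" "\<not> (\<forall>i. p dvd coeff B' i)"
proof -
  obtain v C where C: "vp_poly p B = enat v" "B = smult (p ^ v) C" "\<not> (\<forall>i. p dvd coeff C i)"
    by (rule vp_poly_decompose[OF prime_p B_nz])
  then have v: "v = uB" by (simp add: uB_def)
  show "vp_poly p B = enat uB" using C(1) v by simp
  have "\<exists>C. B = smult (p ^ uB) C \<and> \<not> (\<forall>i. p dvd coeff C i)" using C v by blast
  from someI_ex[OF this] show "B = smult (p ^ uB) B'" "\<not> (\<forall>i. p dvd coeff B' i)" unfolding B'_def by blast+
qed

lemma A_eq: "A = smult (p ^ uA) A'"
  "A = 0 \<and> uA = uB \<and> vp_poly p A = \<infinity> \<or> A \<noteq> 0 \<and> vp_poly p A = enat uA \<and> \<not> (\<forall>i. p dvd coeff A' i)"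
proof -
  have "A = smult (p ^ uA) A' \<and> (A = 0 \<and> uA = uB \<and> vp_poly p A = \<infinity> \<or> A \<noteq> 0 \<and> vp_poly p A = enat uA \<and> \<not> (\<forall>i. p dvd coeff A' i))"
  proof (cases "A = 0")
    case True
    then show ?thesis by (simp add: uA_def A'_def vp_poly_def vp_def)
  next
    case False
    obtain v C where C: "vp_poly p A = enat v" "A = smult (p ^ v) C" "\<not> (\<forall>i. p dvd coeff C i)"
      by (rule vp_poly_decompose[OF prime_p False])
    have v: "v = uA" using False C(1) by (simp add: uA_def)
    have "\<exists>C. A = smult (p ^ uA) C \<and> \<not> (\<forall>i. p dvd coeff C i)" using C v by blast
    from someI_ex[OF this] False C(1) v show ?thesis unfolding A'_def by auto
  qed
  then show "A = smult (p ^ uA) A'"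
    "A = 0 \<and> uA = uB \<and> vp_poly p A = \<infinity> \<or> A \<noteq> 0 \<and> vp_poly p A = enat uA \<and> \<not> (\<forall>i. p dvd coeff A' i)" by blast+
qed

lemma uB_pos: "uB > 0"
  using B_eq dvd_development(2) by (cases uB) auto

lemma uA_pos: "uA > 0"
  using A_eq uB_pos dvd_development(1) by (cases uA) auto

lemma deg_A': "degree A' < 2" using development(1) A_eq(1) prime_p by (simp add: prime_gt_0_int)
lemma deg_B': "degree B' < 2" using development(2) B_eq(2) prime_p by (simp add: prime_gt_0_int)

lemma len: "newton_len \<phi> P = 2" using deg_P phi_deg by (simp add: newton_len_def)

lemma newton_u_vals: "newton_u p \<phi> P 0 = enat 0" "newton_u p \<phi> P 1 = vp_poly p A" "newton_u p \<phi> P 2 = enat uB"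
proof -
  have "vp_poly p 1 = vp p 1" using vp_poly_const[of p 1] by simp
  then show "newton_u p \<phi> P 0 = enat 0" by (simp add: newton_u_def len development(4) vp_def)
  show "newton_u p \<phi> P 1 = vp_poly p A" "newton_u p \<phi> P 2 = enat uB"
    using B_eq(1) by (simp_all add: newton_u_def len A_def B_def)
qed

definition h where "h = min uA (uB div 2)"

lemma quad_h_eq: "quad_h p (phi_dev \<phi> P 1) (phi_dev \<phi> P 0) = h"
proof -
  have "quad_h p A B = h"
    using A_eq(2) unfolding quad_h_def B_eq(1) h_def by auto
  then show ?thesis by (simp add: A_def B_def)
qed

text \<open>The ordinate at abscissa 1 of the \<open>\<phi>\<close>-polygon, whose points are (0,
  0), (1, \<open>uA\<close>) if \<open>A\<close> is nonzero, and (2, \<open>uB\<close>). Its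
  integral part is \<open>h\<close>.\<close>

definition nn :: real where "nn = min (real uA) (real uB / 2)"

lemma nn_pos: "nn > 0" using uA_pos uB_pos by (simp add: nn_def)

text \<open>The middle coefficient of the residual polynomial of the side from \<open>(0, 0)\<close> to \<open>(2, uB)\<close>.\<close>

definition rc where "rc = (if 2 * uA = uB then A' else 0)"

text \<open>The one case in which the residual polynomial is not linear: for odd \<open>uB\<close>
  the single side has \<open>d = 1\<close>, and for \<open>uB > 2 * uA\<close> there are two sides
  of length 1.\<close>

lemma residual_even:
  assumes le: "uB \<le> 2 * uA" and ev: "even uB"
  shows "res_squarefree p \<phi> [:B', rc, 1:]"
proof -
  have line: "newton_line p \<phi> P 0 2 j = real uB / 2 * real j" for j
    by (simp add: newton_line_def newton_u_vals)
  have cases: "j = 0 \<or> j = 1 \<or> j = 2" if "j \<le> (2::nat)" for j using that by linarith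
  have "principal_side p \<phi> P 0 2"
    unfolding principal_side_def len line newton_u_vals
  proof (intro conjI allI impI)
    fix j v assume j: "j \<le> (2::nat)" "newton_u p \<phi> P j = enat v"
    show "real uB / 2 * real j \<le> real v"
      using cases[OF j(1)]
    proof (elim disjE)
      assume "j = 1"
      then have "v = uA" using j(2) newton_u_vals(2) A_eq(2) by auto
      then show ?thesis using le \<open>j = 1\<close> by simp
    qed (use j(2) newton_u_vals in auto)
    show "0 \<le> j" "j \<le> 2" using j by auto
  qed (use uB_pos in auto)
  then have sq: "res_squarefree p \<phi> (residual_poly p \<phi> P 0 2)" using regular unfolding phi_regular_def by blast
  have divc: "smult (p ^ v) C div [:p ^ v:] = C" for v C
  proof -
    have "smult (p ^ v) C = [:p ^ v:] * C" by simp
    moreover have "[:p ^ v:] \<noteq> 0" using prime_p by auto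
    ultimately show ?thesis by (metis nonzero_mult_div_cancel_left)
  qed
  have c0: "residual_coeff p \<phi> P 0 2 0 = 1"
    unfolding residual_coeff_def line newton_u_vals len using development(4) divc[of 0 1] by simp
  have c1: "residual_coeff p \<phi> P 0 2 1 = rc"
  proof (cases "A = 0")
    case True
    then have "rc = 0" "vp_poly p A = \<infinity>" using A_eq(2) uB_pos by (auto simp: rc_def)
    then show ?thesis unfolding residual_coeff_def newton_u_vals by simp
  next
    case False
    then have v: "vp_poly p A = enat uA" using A_eq(2) by blast
    have "real uB / 2 * real 1 = real uA \<longleftrightarrow> 2 * uA = uB" by auto
    moreover have "phi_dev \<phi> P (2 - 1) div [:p ^ uA:] = A'"
      using divc[of uA A'] A_eq(1) by (simp add: A_def)
    ultimately show ?thesis unfolding residual_coeff_def newton_u_vals v line len rc_def by simp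
  qed
  have c2: "residual_coeff p \<phi> P 0 2 2 = B'"
  proof -
    have "phi_dev \<phi> P (2 - 2) div [:p ^ uB:] = B'" using divc[of uB B'] B_eq(2) by (simp add: B_def)
    then show ?thesis unfolding residual_coeff_def newton_u_vals line len by simp
  qed
  have g: "gcd 2 uB = 2" using ev by (simp add: gcd_nat.absorb1)
  have "residual_poly p \<phi> P 0 2 = (\<Sum>s\<le>2. monom (residual_coeff p \<phi> P 0 2 s) (2 - s))"
    unfolding residual_poly_def Let_def newton_u_vals using g by simp
  also have "{..2::nat} = {0, 1, 2}" by auto
  also have "(\<Sum>s\<in>{0, 1, 2}. monom (residual_coeff p \<phi> P 0 2 s) (2 - s)) = [:B', rc, 1:]"
    by (simp add: c0 c1[unfolded One_nat_def] c2 monom_altdef power2_eq_square)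
  finally show ?thesis using sq by simp
qed

end

section \<open>Quadratic phi: expansion of P at a root xi of phi\<close>

locale quadratic_lift_norm = quadratic_lift P p \<phi> + padic_norm N p
  for P :: "int poly" and p :: int and \<phi> :: "int poly" and N :: "algebraic_number \<Rightarrow> real" +
  fixes \<xi> :: algebraic_number
  assumes xi_root: "ieval \<phi> \<xi> = 0"
begin

sublocale RR: residue_root N p \<phi> \<xi>
  by unfold_locales (use phi_monic phi_irr xi_root phi_deg in simp_all)

text \<open>The derivative of \<open>\<phi>\<close> at \<open>\<xi>\<close>. With
  \<open>X = \<xi> + T\<close>, \<open>\<phi>\<close> becomes
  \<open>T\<^sup>2 + \<delta> * T\<close>, so near \<open>T = 0\<close> a development in
  \<open>\<phi>\<close> is one in \<open>T\<close> with \<open>Y\<close> rescaled by the unit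
  \<open>\<delta>\<close>. The polygon of \<open>Pxi\<close> is 0 up to abscissa 2 and then repeats
  the \<open>\<phi>\<close>-polygon.\<close>

definition \<delta> where "\<delta> = 2 * \<xi> + of_int f1"
definition k1 where "k1 = 2 * \<delta> + of_int (coeff A 1)"
definition k2 where "k2 = \<delta>\<^sup>2 + (ieval A \<xi> + of_int (coeff A 1) * \<delta>)"
definition k3 where "k3 = ieval A \<xi> * \<delta> + of_int (coeff B 1)"
definition k4 where "k4 = ieval B \<xi>"
definition Pxi where "Pxi = [:k4, k3, k2, k1, 1:]"

lemma ieval_linear: "degree C < 2 \<Longrightarrow> ieval C (\<xi> + T) = ieval C \<xi> + of_int (coeff C 1) * T"
proof -
  assume d: "degree C < 2"
  obtain x y where "C = [:x, y:]" using poly_degree_less_2[OF d] by blast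
  then show ?thesis by (simp add: algebra_simps)
qed

lemma ieval_phi: "ieval \<phi> (\<xi> + T) = T\<^sup>2 + \<delta> * T"
proof -
  define g0 g1 where g: "g0 = f0" "g1 = f1"
  have phi': "\<phi> = [:g0, g1, 1:]" unfolding g by (rule phi)
  have "ieval [:g0, g1, 1:] (\<xi> + T) = ieval [:g0, g1, 1:] \<xi> + (T\<^sup>2 + (2 * \<xi> + of_int g1) * T)"
    by (simp add: power2_eq_square algebra_simps)
  then have "ieval \<phi> (\<xi> + T) = ieval \<phi> \<xi> + (T\<^sup>2 + (2 * \<xi> + of_int g1) * T)"
    unfolding phi'[symmetric] .
  then have "ieval \<phi> (\<xi> + T) = ieval \<phi> \<xi> + (T\<^sup>2 + \<delta> * T)"
    unfolding \<delta>_def g(2) .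
  then show ?thesis using xi_root by simp
qed

lemma ieval_P: "ieval P (\<xi> + T) = poly Pxi T"
proof -
  have "ieval P (\<xi> + T) = (T\<^sup>2 + \<delta> * T)\<^sup>2 + (ieval A \<xi> + of_int (coeff A 1) * T) * (T\<^sup>2 + \<delta> * T)
     + (ieval B \<xi> + of_int (coeff B 1) * T)"
    by (subst development(3)) (simp only: ieval_simps ieval_phi ieval_linear development(1,2))
  then show ?thesis
    by (simp add: Pxi_def k1_def k2_def k3_def k4_def power2_eq_square algebra_simps)
qed

lemma Zx_vals: "\<delta> \<in> RR.Zx" "k1 \<in> RR.Zx" "k2 \<in> RR.Zx" "k3 \<in> RR.Zx" "k4 \<in> RR.Zx"
proof -
  have d: "\<delta> = ieval [:f1, 2:] \<xi>" by (simp add: \<delta>_def mult.commute)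
  have "k1 = ieval (smult 2 [:f1, 2:] + [:coeff A 1:]) \<xi>" unfolding k1_def d by simp
  then show "k1 \<in> RR.Zx" by (simp only: RR.Zx_mem)
  have "k2 = ieval ([:f1, 2:]\<^sup>2 + (A + smult (coeff A 1) [:f1, 2:])) \<xi>"
    unfolding k2_def d by (simp only: ieval_simps)
  then show "k2 \<in> RR.Zx" by (simp only: RR.Zx_mem)
  have "k3 = ieval (A * [:f1, 2:] + [:coeff B 1:]) \<xi>"
    unfolding k3_def d ieval_simps(3,5) by simp
  then show "k3 \<in> RR.Zx" by (simp only: RR.Zx_mem)
  show "\<delta> \<in> RR.Zx" unfolding d by (rule RR.Zx_mem)
  show "k4 \<in> RR.Zx" by (simp add: k4_def)
qed

sublocale ND: newton_data N p RR.Zx Pxi 4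
proof
  show "poly_over RR.Zx Pxi"
    using Zx_vals RR.Z_closed by (auto simp: poly_over_def Pxi_def coeff_pCons split: nat.split)
qed (simp_all add: Pxi_def)

lemma a_vals: "ND.a 0 = 1" "ND.a 1 = k1" "ND.a 2 = k2" "ND.a 3 = k3" "ND.a 4 = k4"
  unfolding ND.a_def by (simp_all add: Pxi_def numeral_eq_Suc)

lemma a_vals_Suc: "ND.a (Suc (Suc 0)) = k2" "ND.a (Suc (Suc (Suc 0))) = k3" "ND.a (Suc (Suc (Suc (Suc 0)))) = k4"
  unfolding ND.a_def by (simp_all add: Pxi_def numeral_eq_Suc)

lemma N_delta: "N \<delta> = 1" unfolding \<delta>_def by (rule RR.N_deriv[OF phi])

lemma N_A: "N (ieval A \<xi>) \<le> q ^ uA" "A \<noteq> 0 \<Longrightarrow> N (ieval A \<xi>) = q ^ uA"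
proof -
  show 1: "N (ieval A \<xi>) = q ^ uA" if "A \<noteq> 0"
    by (subst A_eq(1), rule RR.N_ieval_content) (use deg_A' phi_deg A_eq(2) that in auto)
  show "N (ieval A \<xi>) \<le> q ^ uA" using 1 q_pos by (cases "A = 0") auto
qed

lemma N_B: "N k4 = q ^ uB"
  unfolding k4_def by (subst B_eq(2), rule RR.N_ieval_content) (use deg_B' phi_deg B_eq(3) in auto)

lemma N_A1: "N (of_int (coeff A 1)) \<le> q ^ uA" "N (of_int (coeff B 1)) \<le> q ^ uB"
  using RR.N_coeff_le[of A 1] RR.N_coeff_le[of B 1] development(1,2) phi_deg N_A(1) N_B
  by (auto simp: k4_def)

lemma q_power_less_1: "k > 0 \<Longrightarrow> q ^ k < 1"
proof -
  assume "k > 0"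
  then have "Suc (k - 1) = k" by simp
  then show "q ^ k < 1" using power_Suc_less_one[OF q_pos q_less_1, of "k - 1"] by (simp only:)
qed

lemma N_k1: "N k1 \<le> 1" by (rule RR.Z_le_1[OF Zx_vals(2)])

lemma N_k2: "N k2 = 1"
proof -
  have "N (ieval A \<xi>) < 1" using N_A(1) q_power_less_1[OF uA_pos] by linarith
  moreover have "N (of_int (coeff A 1) * \<delta>) < 1"
    using N_A1(1) q_power_less_1[OF uA_pos] by (simp add: N_mult N_delta)
  ultimately have "N (ieval A \<xi> + of_int (coeff A 1) * \<delta>) < 1" by (rule N_add_less)
  moreover have "N (\<delta>\<^sup>2) = 1" by (simp add: N_power N_delta)
  ultimately show ?thesis unfolding k2_def using N_add_eq[of "ieval A \<xi> + of_int (coeff A 1) * \<delta>" "\<delta>\<^sup>2"]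
    by (simp add: add.commute)
qed

lemma N_k3: "N k3 \<le> q powr nn"
  unfolding k3_def
proof (rule N_add_le)
  have "q ^ uA \<le> q powr nn" unfolding q_powr_real[symmetric] by (intro q_powr_le) (simp add: nn_def)
  then show "N (ieval A \<xi> * \<delta>) \<le> q powr nn" using N_A(1) by (simp add: N_mult N_delta)
  have "q ^ uB \<le> q powr nn" unfolding q_powr_real[symmetric] by (intro q_powr_le) (simp add: nn_def)
  then show "N (of_int (coeff B 1)) \<le> q powr nn" using N_A1(2) by linarith
qed

lemma q_nn_less_1: "q powr nn < 1" using q_powr_less[OF nn_pos] q_pos by simp

lemma N_k4: "N k4 \<le> (q powr nn)\<^sup>2"
proof -
  have "(q powr nn)\<^sup>2 = q powr (nn * 2)" using q_powr_power[of nn 2] by simp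
  moreover have "q ^ uB \<le> q powr (nn * 2)" unfolding q_powr_real[symmetric] by (intro q_powr_le) (simp add: nn_def)
  ultimately show ?thesis by (simp add: N_B)
qed

lemma q_less_powr: "x < 0 \<Longrightarrow> 1 < q powr x" using q_powr_less[of x 0] q_pos by simp

lemma s_cases: "s \<le> 4 \<Longrightarrow> s = 0 \<or> s = 1 \<or> s = 2 \<or> s = 3 \<or> s = (4::nat)" by linarith

text \<open>The polygon has a vertex at (3, \<open>uA\<close>). Both sides beyond abscissa 2 have
  length 1, and linear residual polynomials are squarefree.\<close>

lemma good_sides:
  assumes "2 * uA < uB"
  shows "\<exists>t. ND.good_side 2 1 1 uA 0 t" "\<exists>t. ND.good_side 3 1 1 (uB - uA) uA t"
proof -
  have A0: "A \<noteq> 0" using A_eq(2) assms by auto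
  have lt: "q ^ uB < q ^ uA" "q ^ uB < q powr (2 * real uA)"
    unfolding q_powr_real[symmetric] using assms by (auto intro!: q_powr_less)
  have k3: "N k3 = q ^ uA"
  proof -
    have "N (of_int (coeff B 1)) < N (ieval A \<xi> * \<delta>)" using N_A1(2) lt(1) N_A(2)[OF A0] by (simp add: N_mult N_delta)
    from N_add_eq[OF this] show ?thesis unfolding k3_def using N_A(2)[OF A0] by (simp add: N_mult N_delta add.commute)
  qed
  obtain t1 where t1: "t1 \<in> RR.Zx" "k3 = of_int p ^ uA * t1"
    using RR.Z_divide_power[OF Zx_vals(4), of uA] k3 by auto
  obtain t2 where t2: "t2 \<in> RR.Zx" "k4 = of_int p ^ uB * t2"
    using RR.Z_divide_power[OF Zx_vals(5), of uB] N_B by auto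
  have u1: "N t1 = 1" using k3 t1(2) q_pos by (simp add: N_mult N_p_power)
  have u2: "N t2 = 1" using N_B t2(2) q_pos by (simp add: N_mult N_p_power)
  have sq: "RR.residually_squarefree (ND.res_poly 1 t)" if "t 0 \<in> RR.Zx" "t 1 \<in> RR.Zx" "N (t 0) = 1" for t
  proof -
    have e: "ND.res_poly 1 t = [:t 1, t 0:]" by (simp add: ND.res_poly_def monom_altdef)
    have "t 0 \<noteq> 0" using that(3) by auto
    then show ?thesis
      unfolding e using that RR.Z_closed
      by (intro RR.residually_squarefree_degree_1) (auto simp: poly_over_def coeff_pCons split: nat.split)
  qed
  have lin1: "ND.lin 2 1 uA 0 s = (real s - 2) * real uA" for s by (simp add: ND.lin_def)
  have lin2: "ND.lin 3 1 (uB - uA) uA s = real uA + (real s - 3) * (real uB - real uA)" for s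
    using assms by (simp add: ND.lin_def)
  have r2: "r \<le> 1 \<Longrightarrow> r = 0 \<or> r = (1::nat)" for r by linarith
  have up: "real uA > 0" "2 * real uA < real uB" using uA_pos assms by simp_all
  let ?t = "\<lambda>r. if r = (0::nat) then k2 else t1" and ?t' = "\<lambda>r. if r = (0::nat) then t1 else t2"
  have "ND.good_side 2 1 1 uA 0 ?t"
    unfolding ND.good_side_def
  proof (intro conjI allI impI)
    fix r :: nat assume "r \<le> 1"
    then have r: "r = 0 \<or> r = 1" by linarith
    then show "?t r \<in> RR.Zx" using Zx_vals(3) t1 by auto
    have "2 + 1 * 1 = (3::nat)" by simp
    then show "ND.a (2 + r * 1) = of_int p ^ (0 + r * uA) * ?t r" using r a_vals a_vals_Suc t1 by auto
  next
    fix s :: nat assume "s \<le> 4"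
    then have s: "s = 0 \<or> s = 1 \<or> s = 2 \<or> s = 3 \<or> s = 4" by (rule s_cases)
    have v: "N (ND.a 0) < q powr ((real 0 - 2) * real uA)" "N (ND.a 1) < q powr ((real 1 - 2) * real uA)"
      "N (ND.a 2) \<le> q powr ((real 2 - 2) * real uA)" "N (ND.a 3) \<le> q powr ((real 3 - 2) * real uA)"
      "N (ND.a 4) < q powr ((real 4 - 2) * real uA)"
      unfolding a_vals using q_less_powr[of "- 2 * real uA"] q_less_powr[of "- real uA"] up N_k1 N_k2 k3 N_B lt q_pos
      by (simp_all add: q_powr_real)
    show "N (ND.a s) \<le> q powr ND.lin 2 1 uA 0 s" unfolding lin1 using s v by (auto intro: less_imp_le)
    show "N (ND.a s) < q powr ND.lin 2 1 uA 0 s" if "s < 2 \<or> 2 + 1 * 1 < s"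
    proof -
      have "s = 0 \<or> s = 1 \<or> s = 4" using s that by linarith
      then show ?thesis unfolding lin1 using v by auto
    qed
  qed (use N_k2 u1 sq Zx_vals t1 in auto)
  then show "\<exists>t. ND.good_side 2 1 1 uA 0 t" by blast
  have "ND.good_side 3 1 1 (uB - uA) uA ?t'"
    unfolding ND.good_side_def
  proof (intro conjI allI impI)
    fix r :: nat assume "r \<le> 1"
    then have r: "r = 0 \<or> r = 1" by linarith
    then show "?t' r \<in> RR.Zx" using t2 t1 by auto
    have "uA + (uB - uA) = uB" using assms by simp
    then show "ND.a (3 + r * 1) = of_int p ^ (uA + r * (uB - uA)) * ?t' r" using r a_vals a_vals_Suc t1 t2 by auto
  next
    fix s :: nat assume "s \<le> 4"
    then have s: "s = 0 \<or> s = 1 \<or> s = 2 \<or> s = 3 \<or> s = 4" by (rule s_cases)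
    have v: "N (ND.a 0) < q powr (real uA + (real 0 - 3) * (real uB - real uA))"
      "N (ND.a 1) < q powr (real uA + (real 1 - 3) * (real uB - real uA))"
      "N (ND.a 2) < q powr (real uA + (real 2 - 3) * (real uB - real uA))"
      "N (ND.a 3) \<le> q powr (real uA + (real 3 - 3) * (real uB - real uA))"
      "N (ND.a 4) \<le> q powr (real uA + (real 4 - 3) * (real uB - real uA))"
    proof -
      have "1 < q powr (real uA + (real k - 3) * (real uB - real uA))" if "k \<le> 2" for k
      proof (rule q_less_powr)
        have "(real k - 3) * (real uB - real uA) \<le> (- 1) * (real uB - real uA)"
          using that up by (intro mult_right_mono) auto
        from order.trans[OF this] have *: "(real k - 3) * (real uB - real uA) \<le> real uA - real uB" by simp
        show "real uA + (real k - 3) * (real uB - real uA) < 0"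
          by (rule le_less_trans[OF add_left_mono[OF *]]) (use up in linarith)
      qed
      from this[of 0] this[of 1] this[of 2]
      show "N (ND.a 0) < q powr (real uA + (real 0 - 3) * (real uB - real uA))"
        "N (ND.a 1) < q powr (real uA + (real 1 - 3) * (real uB - real uA))"
        "N (ND.a 2) < q powr (real uA + (real 2 - 3) * (real uB - real uA))"
        unfolding a_vals using N_k1 N_k2 by simp_all
      show "N (ND.a 3) \<le> q powr (real uA + (real 3 - 3) * (real uB - real uA))"
        "N (ND.a 4) \<le> q powr (real uA + (real 4 - 3) * (real uB - real uA))"
        unfolding a_vals k3 N_B by (simp_all add: q_powr_real)
    qed
    show "N (ND.a s) \<le> q powr ND.lin 3 1 (uB - uA) uA s" unfolding lin2 using s v by (auto intro: less_imp_le)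
    show "N (ND.a s) < q powr ND.lin 3 1 (uB - uA) uA s" if "s < 3 \<or> 3 + 1 * 1 < s"
    proof -
      have "s = 0 \<or> s = 1 \<or> s = 2" using s that by linarith
      then show ?thesis unfolding lin2 using v by auto
    qed
  qed (use u1 u2 sq t2 t1 in auto)
  then show "\<exists>t. ND.good_side 3 1 1 (uB - uA) uA t" by blast
qed

text \<open>A single side joins (2, 0) to (4, \<open>uB\<close>). Its residual polynomial is linear
  for odd \<open>uB\<close>; for even \<open>uB\<close> it is the one of the
  \<open>\<phi>\<close>-polygon, taken at \<open>\<delta> * Y\<close>.\<close>

lemma good_side_double:
  assumes le: "uB \<le> 2 * uA"
  shows "\<exists>d e h t. ND.good_side 2 d e h 0 t \<and> d * e = 2 \<and> real h / real e = real uB / 2"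
proof -
  have nn: "nn = real uB / 2" using le by (simp add: nn_def)
  obtain t2 where t2: "t2 \<in> RR.Zx" "k4 = of_int p ^ uB * t2"
    using RR.Z_divide_power[OF Zx_vals(5), of uB] N_B by auto
  have u2: "N t2 = 1" using N_B t2(2) q_pos by (simp add: N_mult N_p_power)
  have v: "N (ND.a s) \<le> q powr ((real s - 2) * (real uB / 2))"
    "s < 2 \<Longrightarrow> N (ND.a s) < q powr ((real s - 2) * (real uB / 2))" if "s \<le> 4" for s
  proof -
    have s: "s = 0 \<or> s = 1 \<or> s = 2 \<or> s = 3 \<or> s = 4" using that by (rule s_cases)
    have v: "N (ND.a 0) < q powr ((real 0 - 2) * (real uB / 2))" "N (ND.a 1) < q powr ((real 1 - 2) * (real uB / 2))"
      "N (ND.a 2) \<le> q powr ((real 2 - 2) * (real uB / 2))" "N (ND.a 3) \<le> q powr ((real 3 - 2) * (real uB / 2))"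
      "N (ND.a 4) \<le> q powr ((real 4 - 2) * (real uB / 2))"
      unfolding a_vals using q_less_powr[of "- real uB"] q_less_powr[of "- (real uB / 2)"] uB_pos N_k1 N_k2 N_k3 nn N_B q_pos
      by (simp_all add: q_powr_real)
    show "N (ND.a s) \<le> q powr ((real s - 2) * (real uB / 2))" using s v by (auto intro: less_imp_le)
    assume "s < 2"
    then have "s = 0 \<or> s = 1" by linarith
    then show "N (ND.a s) < q powr ((real s - 2) * (real uB / 2))" using v by auto
  qed
  show ?thesis
  proof (cases "even uB")
    case False
    let ?t = "\<lambda>r. if r = (0::nat) then k2 else t2"
    have lin: "ND.lin 2 2 uB 0 s = (real s - 2) * (real uB / 2)" for s by (simp add: ND.lin_def)
    have "ND.good_side 2 1 2 uB 0 ?t"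
      unfolding ND.good_side_def
    proof (intro conjI allI impI)
      fix r :: nat assume "r \<le> 1"
      then have r: "r = 0 \<or> r = 1" by linarith
      then show "?t r \<in> RR.Zx" using Zx_vals(3) t2 by auto
      show "ND.a (2 + r * 2) = of_int p ^ (0 + r * uB) * ?t r" using r a_vals a_vals_Suc t2 by auto
    next
      fix s :: nat assume s: "s \<le> 4"
      show "N (ND.a s) \<le> q powr ND.lin 2 2 uB 0 s" unfolding lin using v(1)[OF s] .
      show "N (ND.a s) < q powr ND.lin 2 2 uB 0 s" if "s < 2 \<or> 2 + 1 * 2 < s"
        unfolding lin using v(2)[OF s] that s by auto
    next
      have "\<not> 2 dvd uB" using False .
      then have "coprime 2 uB" using prime_imp_coprime[OF two_is_prime_nat] by simp
      then show "gcd 2 uB = 1" by simp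
      have e: "ND.res_poly 1 ?t = [:t2, k2:]" by (simp add: ND.res_poly_def monom_altdef)
      have "k2 \<noteq> 0" using N_k2 by auto
      then show "RR.residually_squarefree (ND.res_poly 1 ?t)"
        unfolding e using N_k2 t2 Zx_vals RR.Z_closed
        by (intro RR.residually_squarefree_degree_1) (auto simp: poly_over_def coeff_pCons split: nat.split)
    qed (use N_k2 u2 in auto)
    then show ?thesis by (intro exI[of _ 1] exI[of _ 2] exI[of _ uB]) auto
  next
    case True
    then obtain m where m: "uB = 2 * m" by blast
    have "N k3 \<le> q ^ m" using N_k3 nn m by (simp add: q_powr_real)
    then obtain t1 where t1: "t1 \<in> RR.Zx" "k3 = of_int p ^ m * t1"
      using RR.Z_divide_power[OF Zx_vals(4), of m] by auto
    let ?t = "\<lambda>r. if r = (0::nat) then k2 else if r = 1 then t1 else t2"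
    have lin: "ND.lin 2 1 m 0 s = (real s - 2) * (real uB / 2)" for s by (simp add: ND.lin_def m)
    define Rc where "Rc = ieval rc \<xi>"
    have B'x: "t2 = ieval B' \<xi>"
    proof -
      have "of_int p ^ uB * t2 = k4" by (rule t2(2)[symmetric])
      also have "k4 = ieval (smult (p ^ uB) B') \<xi>"
        unfolding k4_def by (rule arg_cong[OF B_eq(2), of "\<lambda>C. ieval C \<xi>"])
      also have "\<dots> = of_int p ^ uB * ieval B' \<xi>" by simp
      finally have "of_int p ^ uB * t2 = of_int p ^ uB * ieval B' \<xi>" .
      then show ?thesis using prime_p by simp
    qed
    \<comment> \<open>\<open>k3\<close> is the value of \<open>A\<close> at \<open>\<xi>\<close>
      times \<open>\<delta>\<close>, up to a coefficient of \<open>B\<close>. That coefficient has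
      norm at most \<open>q ^ uB\<close>, too small to reach the side at abscissa 3.\<close>
    have t1_close: "N (t1 - \<delta> * Rc) < 1"
    proof -
      have "of_int p ^ m * (t1 - \<delta> * Rc) = \<delta> * (ieval A \<xi> - of_int p ^ m * Rc) + of_int (coeff B 1)"
        using t1(2) unfolding k3_def by (simp add: algebra_simps)
      moreover have "N (\<delta> * (ieval A \<xi> - of_int p ^ m * Rc)) < q ^ m"
      proof (cases "uA = m")
        case True
        then have "ieval A \<xi> - of_int p ^ m * Rc = 0"
          using arg_cong[OF A_eq(1), of "\<lambda>C. ieval C \<xi>"] by (simp add: Rc_def rc_def m)
        then show ?thesis using q_pos by simp
      next
        case False
        then have "Rc = 0" "m < uA" using le by (auto simp: Rc_def rc_def m)
        have "q ^ uA < q ^ m" unfolding q_powr_real[symmetric] using \<open>m < uA\<close> by (intro q_powr_less) simp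
        then show ?thesis using N_A(1) \<open>Rc = 0\<close> by (simp add: N_mult N_delta)
      qed
      moreover have "N (of_int (coeff B 1)) < q ^ m"
      proof -
        have "q ^ uB < q ^ m" unfolding q_powr_real[symmetric] using uB_pos m by (intro q_powr_less) simp
        then show ?thesis using N_A1(2) by linarith
      qed
      ultimately have "N (of_int p ^ m * (t1 - \<delta> * Rc)) < q ^ m" using N_add_less by simp
      then show ?thesis using q_pos by (simp add: N_mult N_p_power)
    qed
    have sq: "RR.residually_squarefree (ND.res_poly 2 ?t)"
    proof (rule RR.residually_squarefree_cong)
      have "RR.residually_squarefree (RR.ev_xi [:B', rc, 1:])"
        by (rule RR.residually_squarefree_ev_xi[OF residual_even[OF le True]])
      then show "RR.residually_squarefree (pcompose (RR.ev_xi [:B', rc, 1:]) [:0, \<delta>:])"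
        by (rule RR.residually_squarefree_scale[OF RR.ev_xi_over _ Zx_vals(1) N_delta])
      have e1: "pcompose (RR.ev_xi [:B', rc, 1:]) [:0, \<delta>:] = [:t2, \<delta> * Rc, \<delta> * \<delta>:]"
        unfolding B'x Rc_def by (simp add: RR.ev_xi_def pcompose_pCons map_poly_pCons algebra_simps)
      have "{..2::nat} = {0, 1, 2}" by auto
      then have e2: "ND.res_poly 2 ?t = [:t2, t1, k2:]"
        by (simp add: ND.res_poly_def monom_altdef) (simp add: power2_eq_square)
      have "N (\<delta> * \<delta> - k2) < 1"
      proof -
        have "N (ieval A \<xi> + of_int (coeff A 1) * \<delta>) < 1"
        proof (rule N_add_less)
          show "N (ieval A \<xi>) < 1" using N_A(1) q_power_less_1[OF uA_pos] by linarith
          show "N (of_int (coeff A 1) * \<delta>) < 1"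
            using N_A1(1) q_power_less_1[OF uA_pos] by (simp add: N_mult N_delta)
        qed
        moreover have "\<delta> * \<delta> - k2 = - (ieval A \<xi> + of_int (coeff A 1) * \<delta>)" by (simp add: k2_def power2_eq_square)
        ultimately show ?thesis by (simp only: N_minus)
      qed
      moreover have "N (\<delta> * Rc - t1) < 1" using t1_close N_minus[of "t1 - \<delta> * Rc"] by simp
      ultimately show "small (pcompose (RR.ev_xi [:B', rc, 1:]) [:0, \<delta>:] - ND.res_poly 2 ?t)"
        unfolding e1 e2 by (auto simp: small_def coeff_pCons split: nat.split)
    qed
    have "ND.good_side 2 2 1 m 0 ?t"
      unfolding ND.good_side_def
    proof (intro conjI allI impI)
      fix r :: nat assume "r \<le> 2"
      then have r: "r = 0 \<or> r = 1 \<or> r = 2" by linarith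
      then show "?t r \<in> RR.Zx" using Zx_vals(3) t2 t1 by auto
      have "2 + 1 * 1 = (3::nat)" "2 + 2 * 1 = (4::nat)" by simp_all
      then show "ND.a (2 + r * 1) = of_int p ^ (0 + r * m) * ?t r" using r a_vals a_vals_Suc t2 t1 m by auto
    next
      fix s :: nat assume s: "s \<le> 4"
      show "N (ND.a s) \<le> q powr ND.lin 2 1 m 0 s" unfolding lin using v(1)[OF s] .
      show "N (ND.a s) < q powr ND.lin 2 1 m 0 s" if "s < 2 \<or> 2 + 2 * 1 < s"
        unfolding lin using v(2)[OF s] that s by auto
    qed (use N_k2 u2 sq in auto)
    then show ?thesis by (intro exI[of _ 2] exI[of _ 1] exI[of _ m]) (auto simp: m)
  qed
qed

definition AA :: "nat \<Rightarrow> real" where "AA j = (if j = 2 then 0 else nn)"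

lemma covered:
  assumes "2 \<le> j" "j < 4"
  shows "\<exists>i d e h u t. ND.good_side i d e h u t \<and> i \<le> j \<and> j < i + d * e \<and> AA j = ND.lin i e h u j"
proof -
  have j: "j = 2 \<or> j = 3" using assms by linarith
  show ?thesis
  proof (cases "2 * uA < uB")
    case True
    obtain t t' where g: "ND.good_side 2 1 1 uA 0 t" "ND.good_side 3 1 1 (uB - uA) uA t'" using good_sides[OF True] by blast
    have "AA 2 = ND.lin 2 1 uA 0 2" "AA 3 = ND.lin 3 1 (uB - uA) uA 3"
      using True by (simp_all add: AA_def ND.lin_def nn_def)
    then have "ND.good_side 2 1 1 uA 0 t \<and> 2 \<le> (2::nat) \<and> (2::nat) < 2 + 1 * 1 \<and> AA 2 = ND.lin 2 1 uA 0 2"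
      "ND.good_side 3 1 1 (uB - uA) uA t' \<and> 3 \<le> (3::nat) \<and> (3::nat) < 3 + 1 * 1 \<and> AA 3 = ND.lin 3 1 (uB - uA) uA 3"
      using g by simp_all
    then show ?thesis using j by blast
  next
    case False
    then have le: "uB \<le> 2 * uA" by simp
    obtain d e h t where g: "ND.good_side 2 d e h 0 t" "d * e = 2" "real h / real e = real uB / 2"
      using good_side_double[OF le] by blast
    have "AA j = ND.lin 2 e h 0 j" using j le g(3) by (auto simp: AA_def ND.lin_def nn_def)
    then have "ND.good_side 2 d e h 0 t \<and> 2 \<le> j \<and> j < 2 + d * e \<and> AA j = ND.lin 2 e h 0 j" using g assms by simp
    then show ?thesis by blast
  qed
qed

end

context padic_norm
begin

text \<open>If \<open>N z\<close> exceeded \<open>r\<close>, the quadratic term would strictly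
  dominate.\<close>

lemma N_quadratic_le:
  assumes e: "z\<^sup>2 * u = - (a * z + b)" and u: "N u = 1" and a: "N a \<le> r" and b: "N b \<le> r\<^sup>2"
  shows "N z \<le> r"
proof (rule ccontr)
  assume "\<not> N z \<le> r"
  then have z: "r < N z" by simp
  have r0: "0 \<le> r" using a N_nonneg[of a] by linarith
  have "N a * N z < N z * N z" using a z r0 by (intro mult_strict_right_mono) auto
  then have 1: "N (a * z) < N z * N z" by (simp only: N_mult)
  have "r * r < N z * N z" using z r0 by (intro mult_strict_mono) auto
  then have 2: "N b < N z * N z" using b by (simp add: power2_eq_square)
  have "N (z\<^sup>2 * u) = N z * N z" by (simp add: N_mult u power2_eq_square)
  moreover have "N (z\<^sup>2 * u) = N (a * z + b)" unfolding e by (rule N_minus)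
  ultimately show False using N_add_less[OF 1 2] by simp
qed

lemma N_mult_less:
  assumes "N x \<le> M" "N y < 1" "0 < M" shows "N (x * y) < M"
proof -
  have "N x * N y \<le> M * N y" using assms(1) N_nonneg by (intro mult_right_mono) auto
  also have "\<dots> < M * 1" using assms by (intro mult_strict_left_mono) auto
  finally show ?thesis by (simp add: N_mult)
qed

end

context quadratic_lift_norm
begin

lemma N_root_le: "poly Pxi T = 0 \<Longrightarrow> N T < 1 \<Longrightarrow> N T \<le> q powr nn"
proof (rule N_quadratic_le[OF _ _ N_k3 N_k4])
  assume r: "poly Pxi T = 0" and T: "N T < 1"
  have "poly Pxi T = T\<^sup>2 * (T * (T + k1) + k2) + (k3 * T + k4)"
    by (simp add: Pxi_def power2_eq_square algebra_simps)
  then have "T\<^sup>2 * (T * (T + k1) + k2) + (k3 * T + k4) = 0" using r by (simp only:)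
  then show "T\<^sup>2 * (T * (T + k1) + k2) = - (k3 * T + k4)" by (simp only: eq_neg_iff_add_eq_0)
  have "N (T + k1) \<le> 1" using T N_k1 by (intro N_add_le) simp_all
  from N_mult_less_1[OF this T] have "N (T * (T + k1)) < 1" by (simp only: mult.commute)
  then show "N (T * (T + k1) + k2) = 1" using N_add_eq[of "T * (T + k1)" k2] N_k2 by simp
qed

lemma b_vals:
  "ND.b 2 T = T\<^sup>2 + k1 * T + k2" "ND.b 3 T = T ^ 3 + k1 * T\<^sup>2 + k2 * T + k3"
proof -
  have "ND.b 2 T = (\<Sum>s\<in>{0, 1, 2}. ND.a s * T ^ (2 - s))"
    unfolding ND.b_def by (rule sum.cong) auto
  also have "\<dots> = ND.a 0 * T ^ (2 - 0) + (ND.a 1 * T ^ (2 - 1) + (ND.a 2 * T ^ (2 - 2)))" by simp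
  finally show "ND.b 2 T = T\<^sup>2 + k1 * T + k2" unfolding a_vals by simp
  have "ND.b 3 T = (\<Sum>s\<in>{0, 1, 2, 3}. ND.a s * T ^ (3 - s))"
    unfolding ND.b_def by (rule sum.cong) auto
  also have "\<dots> = ND.a 0 * T ^ (3 - 0) + (ND.a 1 * T ^ (3 - 1) + (ND.a 2 * T ^ (3 - 2) + (ND.a 3 * T ^ (3 - 3))))" by simp
  finally show "ND.b 3 T = T ^ 3 + k1 * T\<^sup>2 + k2 * T + k3" unfolding a_vals by simp
qed

text \<open>Roots near \<open>\<xi>\<close> suffice, since the values of \<open>C\<close> and
  \<open>D\<close> there already determine their contents. For such a root the given value is close
  to \<open>x + y * \<delta> * T\<close>, while \<open>b 2\<close> and \<open>b 3\<close> are close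
  to \<open>k2\<close> and \<open>k2 * T + k3\<close>; so it can be rewritten in Horner sums and
  \<open>coordinates_less\<close> applies from index 2 on.\<close>

lemma coordinates_bound:
  assumes C: "degree C < 2" and D: "degree D < 2"
    and bound: "\<And>\<beta>. ieval P \<beta> = 0 \<Longrightarrow> N (ieval C \<beta> + ieval D \<beta> * ieval \<phi> \<beta>) \<le> q ^ v"
  shows "N (ieval C \<xi>) \<le> q ^ v" "N (ieval D \<xi>) \<le> q powr (real v - nn)"
proof -
  define x where "x = ieval C \<xi>"
  define y where "y = ieval D \<xi>"
  define r where "r = q powr nn"
  have r: "0 < r" "r < 1" using q_powr_pos q_nn_less_1 by (simp_all add: r_def)
  have rinv: "s * r * q powr (- nn) = s" for s
    unfolding r_def using q_pos by (simp add: mult.assoc flip: powr_add)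
  define M where "M = max (N x) (N y * r)"
  have Mx: "N x \<le> M" "N y * r \<le> M" by (simp_all add: M_def)
  have k3r: "N k3 \<le> r" unfolding r_def by (rule N_k3)
  have MC: "M \<le> q ^ v"
  proof (rule ccontr)
    assume "\<not> M \<le> q ^ v"
    then have lt: "q ^ v < M" by simp
    then have M0: "M > 0" using q_pos by (meson less_trans zero_less_power)
    obtain w where w: "w \<in> RR.Zx" "N (k2 * w - 1) < 1" using RR.Z_inverse[OF Zx_vals(3) N_k2] by blast
    have Nw: "N w = 1"
    proof -
      have "N (k2 * w) = 1" using N_add_eq[of "k2 * w - 1" 1] w(2) by simp
      then show ?thesis by (simp add: N_mult N_k2)
    qed
    \<comment> \<open>\<open>d2\<close> and \<open>d3\<close> solve
      \<open>d2 * k2 + d3 * (k2 * T + k3) = x + y * \<delta> * T\<close> up to small terms, with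
      \<open>w\<close> in place of the inverse of \<open>k2\<close>.\<close>
    define d3 where "d3 = y * \<delta> * w"
    define z where "z = x - d3 * k3"
    define d2 where "d2 = w * z"
    have Nd3: "N d3 = N y" by (simp add: d3_def N_mult N_delta Nw)
    have Nd3k3': "N (d3 * k3) \<le> N y * r"
      unfolding N_mult Nd3 using k3r N_nonneg by (intro mult_left_mono) auto
    have Nz: "N z \<le> M" unfolding z_def by (rule N_diff_le[OF Mx(1) order.trans[OF Nd3k3' Mx(2)]])
    have Nd2: "N d2 = N z" by (simp add: d2_def N_mult Nw)
    define cc where "cc j = (if j = 2 then d2 else d3)" for j :: nat
    have Ny: "N y \<le> M * q powr (- nn)"
    proof -
      have "N y * r * q powr (- nn) \<le> M * q powr (- nn)" using Mx(2) q_powr_pos by (intro mult_right_mono) auto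
      then show ?thesis unfolding rinv .
    qed
    have xy: "x \<in> RR.Zx" "y \<in> RR.Zx" by (simp_all add: x_def y_def)
    have d3Z: "d3 \<in> RR.Zx" unfolding d3_def by (intro RR.Z_closed xy Zx_vals w(1))
    have d2Z: "d2 \<in> RR.Zx" unfolding d2_def z_def by (intro RR.Z_closed xy Zx_vals w(1) d3Z)
    have AA: "AA 2 = 0" "AA 3 = nn" by (simp_all add: AA_def)
    have near: "N (\<Sum>j\<in>{2..<4}. cc j * ND.b j T) < M"
      if S: "ND.good_side i d e h u t" "2 < i + d * e" "poly Pxi T = 0" "N T = q powr (real h / real e)" for T i d e h u t
    proof -
      have "N k3 < 1" using k3r r(2) by linarith
      moreover have "N k4 < 1" unfolding N_B by (rule q_power_less_1[OF uB_pos])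
      ultimately have "h > 0" using N_k2 by (intro ND.slope_pos[OF S(1,2) refl]) (simp_all only: a_vals)
      then have "q powr (real h / real e) < q powr 0"
        using ND.good_sideD(2)[OF S(1)] by (intro q_powr_less) simp
      then have T: "N T < 1" using S(4) q_pos by simp
      have Tr: "N T \<le> r" unfolding r_def by (rule N_root_le[OF S(3) T])
      define g where "g = (x + of_int (coeff C 1) * T) + (y + of_int (coeff D 1) * T) * (T\<^sup>2 + \<delta> * T)"
      have "ieval P (\<xi> + T) = 0" unfolding ieval_P by (rule S(3))
      from bound[OF this] have "N g \<le> q ^ v"
        unfolding ieval_linear[OF C] ieval_linear[OF D] ieval_phi g_def x_def y_def .
      then have g: "N g < M" using lt by linarith
      have "{2..<4::nat} = {2, 3}" by auto
      then have "(\<Sum>j\<in>{2..<4}. cc j * ND.b j T) = d2 * (T\<^sup>2 + k1 * T + k2) + d3 * (T ^ 3 + k1 * T\<^sup>2 + k2 * T + k3)"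
        by (simp add: cc_def b_vals)
      also have "\<dots> = (z * (k2 * w - 1) + d2 * (T * (T + k1)) + (y * T) * (\<delta> * (k2 * w - 1)) + (d3 * T) * (T * (T + k1))
          - of_int (coeff C 1) * T - (y * T) * T - (of_int (coeff D 1) * T) * (T * (T + \<delta>))) + g"
        by (simp add: d2_def d3_def z_def g_def power2_eq_square power3_eq_cube algebra_simps)
      also have "N \<dots> < M"
      proof (intro N_add_less N_diff_less g)
        have yT: "N (y * T) \<le> M"
        proof -
          have "N y * N T \<le> N y * r" using Tr N_nonneg by (intro mult_left_mono) auto
          then show ?thesis using Mx(2) by (simp add: N_mult)
        qed
        have Tk: "N (T * (T + s)) < 1" if "N s \<le> 1" for s
        proof -
          have "N (T + s) \<le> 1" using T that by (intro N_add_le) simp_all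
          from N_mult_less_1[OF this T] show ?thesis by (simp only: mult.commute)
        qed
        show "N (z * (k2 * w - 1)) < M" by (rule N_mult_less[OF Nz w(2) M0])
        show "N (d2 * (T * (T + k1))) < M" by (rule N_mult_less[OF _ Tk[OF N_k1] M0]) (simp add: Nd2 Nz)
        show "N (y * T * (\<delta> * (k2 * w - 1))) < M"
          by (rule N_mult_less[OF yT _ M0]) (use w(2) in \<open>simp add: N_mult N_delta\<close>)
        show "N (d3 * T * (T * (T + k1))) < M"
          by (rule N_mult_less[OF _ Tk[OF N_k1] M0]) (use yT in \<open>simp add: N_mult Nd3\<close>)
        have "N (of_int (coeff C 1)) \<le> N x" unfolding x_def using RR.N_coeff_le[of C 1] C phi_deg by simp
        then have "N (of_int (coeff C 1)) \<le> M" using Mx(1) by linarith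
        then show "N (of_int (coeff C 1) * T) < M" by (rule N_mult_less[OF _ T M0])
        show "N (y * T * T) < M" by (rule N_mult_less[OF yT T M0])
        have "N (of_int (coeff D 1)) \<le> N y" unfolding y_def using RR.N_coeff_le[of D 1] D phi_deg by simp
        then have "N (of_int (coeff D 1)) * N T \<le> N y * N T" using N_nonneg by (intro mult_right_mono) auto
        then have "N (of_int (coeff D 1) * T) \<le> M" using yT by (simp add: N_mult)
        moreover have "N \<delta> \<le> 1" by (simp add: N_delta)
        ultimately show "N (of_int (coeff D 1) * T * (T * (T + \<delta>))) < M" by (intro N_mult_less[OF _ Tk M0])
      qed
      finally show ?thesis .
    qed
    have less: "N (cc j) < M * q powr (- AA j)" if j: "2 \<le> j" "j < 4" for j
    proof (rule ND.coordinates_less[where ?j1.0 = 2 and A = AA and c = cc and M = M])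
      show "\<exists>i d e h u t. ND.good_side i d e h u t \<and> i \<le> j \<and> j < i + d * e \<and> AA j = ND.lin i e h u j"
        if "2 \<le> j" "j < 4" for j using that by (rule covered)
      show "cc j \<in> RR.Zx" for j using d2Z d3Z by (simp add: cc_def)
      show "N (cc j) \<le> M * q powr (- AA j)" if "2 \<le> j" "j < 4" for j
      proof -
        have "j = 2 \<or> j = 3" using that by linarith
        then show ?thesis using Ny Nz Nd2 Nd3 AA q_pos by (auto simp: cc_def)
      qed
      show "N (\<Sum>j = 2..<4. cc j * ND.b j \<beta>) < M"
        if "ND.good_side i d e h u t" "2 < i + d * e" "poly Pxi \<beta> = 0" "N \<beta> = q powr (real h / real e)"
        for \<beta> i d e h u t using that by (rule near)
    qed (use M0 j in simp_all)
    have l2: "N z < M" using less[of 2] AA Nd2 q_pos by (simp add: cc_def)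
    have "N y < M * q powr (- nn)" using less[of 3] AA Nd3 by (simp add: cc_def)
    then have "N y * r < M * q powr (- nn) * r" using r by (intro mult_strict_right_mono)
    moreover have "M * q powr (- nn) * r = M" using rinv[of M] by (simp add: mult_ac)
    ultimately have l3: "N y * r < M" by simp
    have "N (z + d3 * k3) < M" by (intro N_add_less l2 le_less_trans[OF Nd3k3' l3])
    then have "N x < M" by (simp add: z_def)
    then show False using l3 unfolding M_def by auto
  qed
  show "N (ieval C \<xi>) \<le> q ^ v" using Mx(1) MC by (simp add: x_def)
  have "N y * r * q powr (- nn) \<le> q ^ v * q powr (- nn)"
    using Mx(2) MC q_powr_pos by (intro mult_right_mono) auto
  then have "N y \<le> q ^ v * q powr (- nn)" unfolding rinv .
  also have "\<dots> = q powr (real v - nn)" unfolding q_powr_real[symmetric] by (simp flip: powr_add)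
  finally show "N (ieval D \<xi>) \<le> q powr (real v - nn)" by (simp add: y_def)
qed

end

context quadratic_lift
begin

lemma nn_floor:
  assumes "real v - nn \<le> real w" shows "v \<le> w + h"
proof -
  have "nn \<le> real uA" "nn \<le> real uB / 2" by (simp_all add: nn_def)
  then have "real v \<le> real w + real uA" "2 * real v \<le> 2 * real w + real uB" using assms by linarith+
  then have "v \<le> w + uA" "2 * v \<le> 2 * w + uB" by linarith+
  moreover from this(2) have "v \<le> w + uB div 2" by linarith
  ultimately show ?thesis by (simp add: h_def)
qed

text \<open>\<open>\<phi>(\<beta>)\<close> is a root of a monic quadratic with coefficients
  \<open>A(\<beta>)\<close> and \<open>B(\<beta>)\<close>, divisible by \<open>p ^ h\<close> and
  \<open>p ^ (2 * h)\<close>.\<close>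

lemma N_phi_le:
  fixes \<beta> :: algebraic_number
  assumes N: "padic_norm N p" and r: "ieval P \<beta> = 0"
  shows "N (ieval \<phi> \<beta>) \<le> N (of_int p) ^ h"
proof -
  interpret padic_norm N p by fact
  have b: "N \<beta> \<le> 1" by (rule N_le_1_at_root[OF N r])
  have qh: "q ^ uA \<le> q ^ h" "q ^ uB \<le> (q ^ h)\<^sup>2"
  proof -
    have "h \<le> uA" "h * 2 \<le> uB" by (simp_all add: h_def)
    then show "q ^ uA \<le> q ^ h" "q ^ uB \<le> (q ^ h)\<^sup>2"
      unfolding power_mult[symmetric] using q_pos q_less_1 by (auto intro: power_decreasing)
  qed
  have cont: "N (ieval (smult (p ^ k) E) \<beta>) \<le> q ^ k" for k E
    using N_ieval_le_1[OF b, of E] q_pos by (simp add: N_mult N_p_power mult_left_le)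
  have "N (ieval A \<beta>) \<le> q ^ uA" by (subst A_eq(1)) (rule cont)
  then have NA: "N (ieval A \<beta>) \<le> q ^ h" using qh(1) by linarith
  have "N (ieval B \<beta>) \<le> q ^ uB" by (subst B_eq(2)) (rule cont)
  then have NB: "N (ieval B \<beta>) \<le> (q ^ h)\<^sup>2" using qh(2) by linarith
  have "ieval P \<beta> = (ieval \<phi> \<beta>)\<^sup>2 + ieval A \<beta> * ieval \<phi> \<beta> + ieval B \<beta>"
    using arg_cong[OF development(3), of "\<lambda>f. ieval f \<beta>"] unfolding ieval_simps .
  then have "(ieval \<phi> \<beta>)\<^sup>2 + ieval A \<beta> * ieval \<phi> \<beta> + ieval B \<beta> = 0" using r by (simp only:)
  then have "(ieval \<phi> \<beta>)\<^sup>2 * 1 = - (ieval A \<beta> * ieval \<phi> \<beta> + ieval B \<beta>)"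
    by (simp only: eq_neg_iff_add_eq_0 mult_1_right add.assoc)
  from N_quadratic_le[OF this N_1 NA NB] show ?thesis unfolding q_def .
qed

text \<open>The coordinates of \<open>G\<close> are the remainder \<open>C\<close> and the quotient
  \<open>D\<close> of its division by \<open>\<phi>\<close>; the bounds make \<open>C\<close> and
  \<open>p ^ h * D\<close> divisible by \<open>p ^ v\<close>.\<close>

theorem quadratic_basis:
  assumes root: "ieval P \<alpha> = 0"
  shows "p_integral_basis p \<alpha> [1, \<alpha>, ieval \<phi> \<alpha> / of_int p ^ h, \<alpha> * ieval \<phi> \<alpha> / of_int p ^ h]"
proof (rule p_integral_basisI[OF root prime_p])
  let ?z = "ieval \<phi> \<alpha>"
  let ?ws = "[1, \<alpha>, ?z / of_int p ^ h, \<alpha> * ?z / of_int p ^ h]"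
  show "length ?ws = 4" by simp
  have p0: "p \<noteq> 0" using prime_p by auto
  show "\<exists>G e. w = ieval G \<alpha> / of_int p ^ e \<and>
      (\<forall>N \<beta>. padic_norm (N :: algebraic_number \<Rightarrow> real) p \<longrightarrow> ieval P \<beta> = 0 \<longrightarrow> N (ieval G \<beta>) \<le> N (of_int p) ^ e)"
    if "w \<in> set ?ws" for w
  proof -
    have g1: "N (ieval 1 \<beta>) \<le> N (of_int p) ^ 0" if "padic_norm N p" for N and \<beta> :: algebraic_number
      using padic_norm.N_1[OF that] by simp
    have g2: "N (ieval [:0, 1:] \<beta>) \<le> N (of_int p) ^ 0"
      if "padic_norm N p" "ieval P \<beta> = 0" for N and \<beta> :: algebraic_number
      using N_le_1_at_root[OF that] by simp
    have g4: "N (ieval ([:0, 1:] * \<phi>) \<beta>) \<le> N (of_int p) ^ h"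
      if n: "padic_norm N p" "ieval P \<beta> = 0" for N and \<beta> :: algebraic_number
    proof -
      interpret padic_norm N p by fact
      have "N \<beta> * N (ieval \<phi> \<beta>) \<le> 1 * N (ieval \<phi> \<beta>)"
        using N_le_1_at_root[OF n] N_nonneg by (intro mult_right_mono) auto
      then show ?thesis using N_phi_le[OF n] by (simp add: N_mult)
    qed
    have "w = ieval 1 \<alpha> / of_int p ^ 0 \<or> w = ieval [:0, 1:] \<alpha> / of_int p ^ 0 \<or> w = ieval \<phi> \<alpha> / of_int p ^ h
      \<or> w = ieval ([:0, 1:] * \<phi>) \<alpha> / of_int p ^ h" using that by auto
    then show ?thesis
    proof (elim disjE)
      assume "w = ieval 1 \<alpha> / of_int p ^ 0"
      then show ?thesis using g1 by blast
    next
      assume "w = ieval [:0, 1:] \<alpha> / of_int p ^ 0"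
      then show ?thesis using g2 by blast
    next
      assume "w = ieval \<phi> \<alpha> / of_int p ^ h"
      then show ?thesis using N_phi_le by blast
    next
      assume "w = ieval ([:0, 1:] * \<phi>) \<alpha> / of_int p ^ h"
      then show ?thesis using g4 by blast
    qed
  qed
  fix G v assume G: "degree G < 4"
    and bound: "\<And>N \<beta>. padic_norm (N :: algebraic_number \<Rightarrow> real) p \<Longrightarrow> ieval P \<beta> = 0 \<Longrightarrow> N (ieval G \<beta>) \<le> N (of_int p) ^ v"
  have phi0: "degree \<phi> > 0" using phi_deg by simp
  obtain D C where DC: "G = \<phi> * D + C" "degree C < degree \<phi>" by (rule monic_divmod[OF phi_monic phi0])
  have C: "degree C < 2" using DC(2) phi_deg by simp
  have D: "degree D < 2"
  proof (cases "D = 0")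
    case False
    have "\<phi> \<noteq> 0" using phi_deg by auto
    then have "degree (\<phi> * D) = 2 + degree D" using False phi_deg by (simp add: degree_mult_eq)
    moreover have "\<phi> * D = G - C" using DC(1) by simp
    moreover have "degree (G - C) < 4" using G C by (intro degree_diff_less) simp_all
    ultimately show ?thesis by simp
  qed simp
  obtain N :: "algebraic_number \<Rightarrow> real" where N: "padic_norm N p" using ex_padic_norm[OF prime_p] by blast
  interpret N: padic_norm N p by (rule N)
  have "\<exists>\<xi>. poly (map_poly of_int \<phi>) \<xi> = (0 :: algebraic_number)"
    by (rule alg_closed_imp_poly_has_root) (simp add: degree_map_poly phi_deg)
  then obtain \<xi> :: algebraic_number where xi: "ieval \<phi> \<xi> = 0" unfolding ieval_def by blast
  interpret Q: quadratic_lift_norm P p \<phi> N \<xi> by unfold_locales (rule xi)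
  have "N (ieval C \<beta> + ieval D \<beta> * ieval \<phi> \<beta>) \<le> N.q ^ v" if "ieval P \<beta> = 0" for \<beta>
    using bound[OF N that] unfolding DC(1) N.q_def by (simp add: add.commute mult.commute)
  note cb = Q.coordinates_bound[OF C D this]
  have "\<exists>C'. smult (p ^ 0) C = smult (p ^ v) C'"
    by (rule Q.RR.N_ieval_le_powr[where x = "real v"]) (use DC(2) cb(1) N.q_powr_real in simp_all)
  then obtain C' where C': "C = smult (p ^ v) C'" by auto
  have "\<exists>D'. smult (p ^ h) D = smult (p ^ v) D'"
    by (rule Q.RR.N_ieval_le_powr[where x = "real v - nn"]) (use D phi_deg cb(2) nn_floor in simp_all)
  then obtain D' where D': "smult (p ^ h) D = smult (p ^ v) D'" by blast
  have "degree C' < 2" using C p0 unfolding C' by simp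
  then obtain c0 c1 where c: "C' = [:c0, c1:]" using poly_degree_less_2 by blast
  have "degree (smult (p ^ v) D') < 2" using D p0 unfolding D'[symmetric] by simp
  then have "degree D' < 2" using p0 by simp
  then obtain d0 d1 where d: "D' = [:d0, d1:]" using poly_degree_less_2 by blast
  have "of_int p ^ h * ieval D \<alpha> = of_int p ^ v * ieval D' \<alpha>"
    using arg_cong[OF D', of "\<lambda>f. ieval f \<alpha>"] by simp
  then have "ieval D \<alpha> / of_int p ^ v = ieval D' \<alpha> / of_int p ^ h"
    using p0 by (simp add: frac_eq_eq mult.commute)
  moreover have "ieval G \<alpha> / of_int p ^ v = ieval C' \<alpha> + ieval D \<alpha> / of_int p ^ v * ?z"
    unfolding DC(1) C' using p0 by (simp add: add_divide_distrib mult.commute)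
  ultimately have "ieval G \<alpha> / of_int p ^ v = ieval C' \<alpha> + ieval D' \<alpha> / of_int p ^ h * ?z" by simp
  also have "\<dots> = of_int c0 * 1 + of_int c1 * \<alpha> + (of_int d0 * (?z / of_int p ^ h) + of_int d1 * (\<alpha> * ?z / of_int p ^ h))"
    unfolding c d by (simp add: add_divide_distrib algebra_simps)
  also have "\<dots> \<in> loc_span p ?ws"
    by (intro loc_span_add[OF prime_p] loc_span_mult[OF prime_p] loc_span_mem[OF prime_p]) simp_all
  finally show "ieval G \<alpha> / of_int p ^ v \<in> loc_span p ?ws" .
qed

end

section \<open>Assembly of the cases\<close>

context linear_lift
begin

text \<open>The exact power \<open>\<phi> ^ m\<close> puts the end of the horizontal side at
  abscissa \<open>4 - m\<close>, where \<open>head\<close> applies. That side contains abscissa 1,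
  hence \<open>hh 1 = 0\<close>.\<close>

lemma power_basis:
  assumes root: "ieval P \<alpha> = 0" and eq: "poly_mod.eq_m p P (\<phi> ^ m * P2)" and nd: "\<not> poly_mod.dvdm p \<phi> P2"
    and m: "m \<le> 3" and head: "head_squarefree (4 - m)"
  shows "p_integral_basis p \<alpha> [1, \<alpha>, quot2 p P \<phi> \<alpha>, quot3 p P \<phi> \<alpha>]"
proof (rule linear_basis[OF root])
  have "4 - (4 - m) = m" using m by simp
  then have "cs (4 - m) = coeff Pc (0 + m)" by (simp add: cs_def)
  then have unit: "\<not> p dvd cs (4 - m)" using dvd_coeff_Pc(2)[OF eq, of 0] cofactor_not_dvd[OF nd] by simp
  have above: "p dvd cs k" if "4 - m < k" "k \<le> 4" for k
    unfolding cs_def by (rule dvd_coeff_Pc(1)[OF eq]) (use that m in linarith)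
  show "flat_ok j" if "j < 4" for j
    unfolding flat_ok_def
  proof (intro allI impI)
    fix k assume k: "j < k" "k \<le> 4" "\<not> p dvd cs k" "\<forall>s. k < s \<longrightarrow> s \<le> 4 \<longrightarrow> p dvd cs s"
    have "\<not> 4 - m < k" using above k by blast
    moreover have "\<not> k < 4 - m" using k(4) unit by (meson diff_le_self)
    ultimately have "k = 4 - m" by linarith
    then show "head_squarefree k" using head by simp
  qed
  have "cs (4 - m) \<noteq> 0" using unit by auto
  moreover have "multiplicity p (cs (4 - m)) < 4 - m" using unit m by (simp add: not_dvd_imp_multiplicity_0)
  ultimately have "hh 1 = 0" using m by (intro newton_h_1_eq_0[of "4 - m"]) simp_all
  then show "\<alpha> = eval_at \<alpha> \<phi> / of_int p ^ hh 1 \<or> hh 1 = 0 \<and> \<alpha> = \<alpha>" by simp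
qed

text \<open>All coefficients after the leading one are divisible by \<open>p\<close>, so there is no
  horizontal side.\<close>

lemma totally_ramified_flat_ok:
  assumes eq: "poly_mod.eq_m p P (\<phi> ^ 4)"
  shows "flat_ok j"
proof -
  have eq': "poly_mod.eq_m p P (\<phi> ^ 4 * 1)" using eq by simp
  have "p dvd cs k" if "j < k" "k \<le> 4" for k
    unfolding cs_def by (rule dvd_coeff_Pc(1)[OF eq']) (use that in linarith)
  then show ?thesis unfolding flat_ok_def by blast
qed

text \<open>The condition puts one point of the \<open>\<phi>\<close>-polygon strictly below the
  line of slope 1 through the origin. For \<open>(X - 1) ^ 4 + 81\<close> with \<open>p = 3\<close>
  and \<open>\<phi> = X - 1\<close> both finite points lie on that line and
  \<open>hh 1 = 1\<close>.\<close>

lemma newton_h_1_eq_0_of_vp: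
  assumes "vp_poly p (phi_dev \<phi> P 3) = 0 \<or> vp_poly p (phi_dev \<phi> P 2) \<le> 1 \<or>
     vp_poly p (phi_dev \<phi> P 1) \<le> 2 \<or> vp_poly p (phi_dev \<phi> P 0) \<le> 3"
  shows "hh 1 = 0"
proof -
  have c: "vp_poly p (phi_dev \<phi> P 3) = vp p (cs 1)" "vp_poly p (phi_dev \<phi> P 2) = vp p (cs 2)"
    "vp_poly p (phi_dev \<phi> P 1) = vp p (cs 3)" "vp_poly p (phi_dev \<phi> P 0) = vp p (cs 4)"
    by (simp_all add: phi_dev_eq vp_poly_const cs_def)
  have vd: "x \<noteq> 0 \<and> multiplicity p x < Suc n" if "vp p x \<le> enat n" for x n
    using that by (auto simp: vp_def split: if_splits)
  have e: "(0::enat) = enat 0" "(1::enat) = enat 1" "(2::enat) = enat 2" "(3::enat) = enat 3"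
    by (simp_all add: zero_enat_def one_enat_def numeral_eq_enat)
  have "vp p (cs 1) \<le> enat 0 \<or> vp p (cs 2) \<le> enat 1 \<or> vp p (cs 3) \<le> enat 2 \<or> vp p (cs 4) \<le> enat 3"
    using assms unfolding c e by (metis order_refl)
  then consider "cs 1 \<noteq> 0 \<and> multiplicity p (cs 1) < Suc 0" | "cs 2 \<noteq> 0 \<and> multiplicity p (cs 2) < Suc 1"
    | "cs 3 \<noteq> 0 \<and> multiplicity p (cs 3) < Suc 2" | "cs 4 \<noteq> 0 \<and> multiplicity p (cs 4) < Suc 3"
    using vd by blast
  then show ?thesis
  proof cases
    case 1
    then show ?thesis by (intro newton_h_1_eq_0[of 1]) auto
  next
    case 2
    then show ?thesis by (intro newton_h_1_eq_0[of 2]) auto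
  next
    case 3
    then show ?thesis by (intro newton_h_1_eq_0[of 3]) auto
  next
    case 4
    then show ?thesis by (intro newton_h_1_eq_0[of 4]) auto
  qed
qed

end

lemma dvdm_of_close:
  assumes "p dvd c - c'"
  shows "poly_mod.dvdm p [:- c, 1:] [:- c', 1:]" "poly_mod.dvdm p [:- c', 1:] [:- c, 1:]"
proof -
  have "poly_mod.eq_m p [:- a, 1:] ([:- b, 1:] * 1)" if "p dvd b - a" for a b
    by (rule eq_mI) (use that in \<open>simp add: coeff_pCons split: nat.split\<close>)
  moreover have "p dvd c' - c" using assms by (simp add: dvd_diff_commute)
  ultimately show "poly_mod.dvdm p [:- c, 1:] [:- c', 1:]" "poly_mod.dvdm p [:- c', 1:] [:- c, 1:]"
    using assms unfolding poly_mod.dvdm_def by blast+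
qed

theorem theorem1p2:
  fixes m n a b p :: int and P :: "int poly" and \<alpha> :: complex and \<Phi> :: "int poly set"
  assumes P: "P = [:b, a, n, m, 1:]"
    and irreducible: "irreducible P"
    and normalised: "\<forall>q::int. prime q \<longrightarrow>
          vp q m = 0 \<or> vp q n \<le> 1 \<or> vp q a \<le> 2 \<or> vp q b \<le> 3"
    and root: "eval_at \<alpha> P = 0"
    and prime: "prime p"
    and regular: "p_regular_wrt p P \<Phi>"
  shows
    "(poly_mod.square_free_m p P \<longrightarrow> p_integral_basis p \<alpha> [1, \<alpha>, \<alpha>\<^sup>2, \<alpha> ^ 3]) \<and>

     (\<forall>\<phi>\<in>\<Phi>. degree \<phi> = 1 \<and> poly_mod.eq_m p P (\<phi> ^ 4) \<longrightarrow>
        ((vp_poly p (phi_dev \<phi> P 3) = 0 \<or> vp_poly p (phi_dev \<phi> P 2) \<le> 1 \<or>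
          vp_poly p (phi_dev \<phi> P 1) \<le> 2 \<or> vp_poly p (phi_dev \<phi> P 0) \<le> 3) \<longrightarrow>
           p_integral_basis p \<alpha> [1, \<alpha>, quot2 p P \<phi> \<alpha>, quot3 p P \<phi> \<alpha>]) \<and>
        p_integral_basis p \<alpha>
          [1, eval_at \<alpha> \<phi> / of_int p ^ newton_h p \<phi> P 1, quot2 p P \<phi> \<alpha>, quot3 p P \<phi> \<alpha>]) \<and>

     (\<forall>\<phi>\<in>\<Phi>. \<forall>P2. degree \<phi> = 1 \<and> poly_mod.eq_m p P (\<phi> ^ 3 * P2) \<and>
          \<not> poly_mod.dvdm p \<phi> P2 \<longrightarrow>
        p_integral_basis p \<alpha> [1, \<alpha>, quot2 p P \<phi> \<alpha>, quot3 p P \<phi> \<alpha>]) \<and>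

     (\<forall>\<phi>\<in>\<Phi>. \<forall>P2. degree \<phi> = 1 \<and> poly_mod.eq_m p P (\<phi>\<^sup>2 * P2) \<and>
          \<not> poly_mod.dvdm p \<phi> P2 \<and> poly_mod.square_free_m p P2 \<longrightarrow>
        p_integral_basis p \<alpha> [1, \<alpha>, quot2 p P \<phi> \<alpha>, quot3 p P \<phi> \<alpha>]) \<and>

     (\<forall>\<phi> :: nat \<Rightarrow> int poly. \<forall>i j.
        \<phi> 1 \<in> \<Phi> \<and> \<phi> 2 \<in> \<Phi> \<and> degree (\<phi> 1) = 1 \<and> degree (\<phi> 2) = 1 \<and>
        poly_mod.eq_m p P ((\<phi> 1)\<^sup>2 * (\<phi> 2)\<^sup>2) \<and> \<not> poly_mod.dvdm p (\<phi> 1) (\<phi> 2) \<and>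
        {i, j} = {1, 2} \<and> newton_h p (\<phi> i) P 3 \<le> newton_h p (\<phi> j) P 3 \<longrightarrow>
        (let w = (\<lambda>k. quot3 p P (\<phi> k) \<alpha>); h = (\<lambda>k. newton_h p (\<phi> k) P 3) in
          (h i = 0 \<longrightarrow> p_integral_basis p \<alpha> [1, \<alpha>, \<alpha>\<^sup>2, w j]) \<and>
          (h i \<ge> 1 \<longrightarrow>
             p_integral_basis p \<alpha> [1, \<alpha>, w i - of_int p ^ (h j - h i) * w j, w j]))) \<and>

     (\<forall>\<phi>\<in>\<Phi>. degree \<phi> = 2 \<and> poly_mod.irreducible_m p \<phi> \<and> poly_mod.eq_m p P (\<phi>\<^sup>2) \<longrightarrow>
        (let h = quad_h p (phi_dev \<phi> P 1) (phi_dev \<phi> P 0) in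
          p_integral_basis p \<alpha>
            [1, \<alpha>, eval_at \<alpha> \<phi> / of_int p ^ h, \<alpha> * eval_at \<alpha> \<phi> / of_int p ^ h]))"
proof -
  interpret monic_irreducible P
    by unfold_locales (use irreducible in \<open>simp_all add: P\<close>)
  have rt: "ieval P \<alpha> = 0" using root by (simp only: eval_at_ieval)
  have Phi: "lead_coeff \<phi> = 1" "poly_mod.irreducible_m p \<phi>" "phi_regular p \<phi> P" if "\<phi> \<in> \<Phi>" for \<phi>
    using regular that unfolding p_regular_wrt_def by blast+
  \<comment> \<open>The root \<open>c\<close> of a monic linear polynomial is minus its constant
    coefficient; the double sign is the shape that \<open>linear_lift\<close> expects.\<close>
  have form: "\<phi> = [:- (- coeff \<phi> 0), 1:]" if phi: "\<phi> \<in> \<Phi>" "degree \<phi> = 1" for \<phi>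
  proof -
    have "degree \<phi> < 2" using phi(2) by simp
    note e = poly_degree_less_2[OF this]
    have c1: "coeff \<phi> 1 = 1" using Phi(1)[OF phi(1)] phi(2) by simp
    show ?thesis unfolding minus_minus by (rule e[unfolded c1])
  qed
  have lin: "linear_lift P p (- coeff \<phi> 0) \<phi>" if phi: "\<phi> \<in> \<Phi>" "degree \<phi> = 1" for \<phi>
    by (intro linear_lift.intro linear_lift_axioms.intro monic_irreducible_axioms prime form[OF phi] Phi(2,3)[OF phi(1)])
  show ?thesis
  proof (intro conjI ballI allI impI)
    assume "poly_mod.square_free_m p P"
    then show "p_integral_basis p \<alpha> [1, \<alpha>, \<alpha>\<^sup>2, \<alpha> ^ 3]" by (rule squarefree_basis[OF rt prime])
  next
    fix \<phi> assume phi: "\<phi> \<in> \<Phi>" and a: "degree \<phi> = 1 \<and> poly_mod.eq_m p P (\<phi> ^ 4)"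
    interpret linear_lift P p "- coeff \<phi> 0" \<phi> using phi a by (intro lin) blast+
    have fl: "flat_ok j" for j using a by (intro totally_ramified_flat_ok) blast
    show "p_integral_basis p \<alpha>
          [1, eval_at \<alpha> \<phi> / of_int p ^ newton_h p \<phi> P 1, quot2 p P \<phi> \<alpha>, quot3 p P \<phi> \<alpha>]"
      by (rule linear_basis[OF rt fl]) simp
    assume "vp_poly p (phi_dev \<phi> P 3) = 0 \<or> vp_poly p (phi_dev \<phi> P 2) \<le> 1 \<or>
          vp_poly p (phi_dev \<phi> P 1) \<le> 2 \<or> vp_poly p (phi_dev \<phi> P 0) \<le> 3"
    from newton_h_1_eq_0_of_vp[OF this]
    show "p_integral_basis p \<alpha> [1, \<alpha>, quot2 p P \<phi> \<alpha>, quot3 p P \<phi> \<alpha>]"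
      by (intro linear_basis[OF rt fl]) simp
  next
    fix \<phi> P2 assume phi: "\<phi> \<in> \<Phi>"
      and a: "degree \<phi> = 1 \<and> poly_mod.eq_m p P (\<phi> ^ 3 * P2) \<and> \<not> poly_mod.dvdm p \<phi> P2"
    interpret linear_lift P p "- coeff \<phi> 0" \<phi> using phi a by (intro lin) blast+
    show "p_integral_basis p \<alpha> [1, \<alpha>, quot2 p P \<phi> \<alpha>, quot3 p P \<phi> \<alpha>]"
      by (rule power_basis[OF rt, of 3 P2]) (use a head_squarefree_1 in simp_all)
  next
    fix \<phi> P2 assume phi: "\<phi> \<in> \<Phi>"
      and a: "degree \<phi> = 1 \<and> poly_mod.eq_m p P (\<phi>\<^sup>2 * P2) \<and> \<not> poly_mod.dvdm p \<phi> P2 \<and> poly_mod.square_free_m p P2"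
    interpret linear_lift P p "- coeff \<phi> 0" \<phi> using phi a by (intro lin) blast+
    have "head_squarefree 2" by (rule head_squarefree_2[of P2]) (use a in blast)+
    then show "p_integral_basis p \<alpha> [1, \<alpha>, quot2 p P \<phi> \<alpha>, quot3 p P \<phi> \<alpha>]"
      using a by (intro power_basis[OF rt, of 2 P2]) simp_all
  next
    fix \<phi> :: "nat \<Rightarrow> int poly" and i j :: nat
    assume a: "\<phi> 1 \<in> \<Phi> \<and> \<phi> 2 \<in> \<Phi> \<and> degree (\<phi> 1) = 1 \<and> degree (\<phi> 2) = 1 \<and>
        poly_mod.eq_m p P ((\<phi> 1)\<^sup>2 * (\<phi> 2)\<^sup>2) \<and> \<not> poly_mod.dvdm p (\<phi> 1) (\<phi> 2) \<and>
        {i, j} = {1, 2} \<and> newton_h p (\<phi> i) P 3 \<le> newton_h p (\<phi> j) P 3"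
    then have ij: "i = 1 \<and> j = 2 \<or> i = 2 \<and> j = 1" by (simp add: doubleton_eq_iff)
    have mem: "\<phi> i \<in> \<Phi>" "degree (\<phi> i) = 1" "\<phi> j \<in> \<Phi>" "degree (\<phi> j) = 1" using a ij by blast+
    have "poly_mod.eq_m p P ((\<phi> i)\<^sup>2 * (\<phi> j)\<^sup>2)" using a ij by (metis mult.commute)
    moreover have "\<not> p dvd - coeff (\<phi> i) 0 - - coeff (\<phi> j) 0"
    proof
      assume "p dvd - coeff (\<phi> i) 0 - - coeff (\<phi> j) 0"
      from dvdm_of_close[OF this] have "poly_mod.dvdm p (\<phi> i) (\<phi> j)" "poly_mod.dvdm p (\<phi> j) (\<phi> i)"
        unfolding form[OF mem(1,2), symmetric] form[OF mem(3,4), symmetric] .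
      then show False using a ij by blast
    qed
    ultimately interpret L: two_linear_lifts P p "- coeff (\<phi> i) 0" "\<phi> i" "- coeff (\<phi> j) 0" "\<phi> j"
      using lin[OF mem(1,2)] lin[OF mem(3,4)] unfolding two_linear_lifts_def two_linear_lifts_axioms_def by blast
    have le: "newton_h p (\<phi> i) P 3 \<le> newton_h p (\<phi> j) P 3" using a by blast
    show "let w = (\<lambda>k. quot3 p P (\<phi> k) \<alpha>); h = (\<lambda>k. newton_h p (\<phi> k) P 3) in
          (h i = 0 \<longrightarrow> p_integral_basis p \<alpha> [1, \<alpha>, \<alpha>\<^sup>2, w j]) \<and>
          (h i \<ge> 1 \<longrightarrow>
             p_integral_basis p \<alpha> [1, \<alpha>, w i - of_int p ^ (h j - h i) * w j, w j])"
      unfolding Let_def using L.double_basis[OF rt le] by blast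
  next
    fix \<phi> assume phi: "\<phi> \<in> \<Phi>" and a: "degree \<phi> = 2 \<and> poly_mod.irreducible_m p \<phi> \<and> poly_mod.eq_m p P (\<phi>\<^sup>2)"
    interpret quadratic_lift P p \<phi>
      using a prime Phi[OF phi] monic_irreducible_axioms
      unfolding quadratic_lift_def quadratic_lift_axioms_def by blast
    show "let h = quad_h p (phi_dev \<phi> P 1) (phi_dev \<phi> P 0) in
          p_integral_basis p \<alpha>
            [1, \<alpha>, eval_at \<alpha> \<phi> / of_int p ^ h, \<alpha> * eval_at \<alpha> \<phi> / of_int p ^ h]"
      unfolding Let_def quad_h_eq eval_at_ieval by (rule quadratic_basis[OF rt])
  qed
qed

end
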